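(* Let $\mathcal{M}$ be a gridding matrix each of whose entries is either a monotone class ($\mathrm{Av}(21)$ or $\mathrm{Av}(12)$), or a permutation class that is not monotone griddable and contains only finitely many simple permutations, or the empty class. Then the permutation class $\mathrm{Grid}(\mathcal{M})$ is partially well-ordered if and only if the graph $G_\mathcal{M}$ is a forest and every connected component of $G_\mathcal{M}$ contains at most one cell whose entry is not a monotone class.
   Context: A permutation $\pi$ of length $n$ is identified with its plot $\{(i,\pi(i))\}$. A permutation $\alpha$ is contained in $\pi$ ($\alpha\le\pi$) if $\pi$ has a subsequence order isomorphic to $\alpha$. A permutation class is a set of permutations closed downward under $\le$; $\mathrm{Av}(B)$ is the class of permutations containing no element of $B$. The monotone classes are $\mathrm{Av}(21)$ (increasing permutations) and $\mathrm{Av}(12)$ (decreasing permutations). A set of permutations is partially well-ordered if it contains no infinite antichain (infinite set of pairwise incomparable elements). An interval of $\pi$ is a set of contiguous positions whose set of values is also contiguous; $\pi$ is simple if its only intervals are the empty set, singletons and the whole of $\pi$. Matrices are indexed from the bottom-left with column index first: an $m\times n$ matrix has $m$ columns and $n$ rows, and entry $\mathcal{M}_{ij}$ lies in column $i$, row $j$. A gridding matrix is a matrix each of whose entries is a permutation class (an infinite class or the empty class). An $m\times n$ gridding of a permutation $\pi$ is a choice of $m-1$ vertical and $n-1$ horizontal lines (avoiding the points) dividing the plot of $\pi$ into $mn$ cells; $\pi^{ij}$ denotes the set of points in cell $ij$. For an $m\times n$ gridding matrix $\mathcal{M}$, an $\mathcal{M}$-gridding of $\pi$ is an $m\times n$ gridding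 in which, for every $i,j$, $\pi^{ij}$ is order isomorphic to a permutation in $\mathcal{M}_{ij}$. $\mathrm{Grid}(\mathcal{M})$ is the class of all permutations possessing an $\mathcal{M}$-gridding. A permutation class $\mathcal{C}$ is monotone griddable if there is a gridding matrix $\mathcal{N}$ all of whose entries are $\mathrm{Av}(21)$, $\mathrm{Av}(12)$ or empty such that every permutation in $\mathcal{C}$ has an $\mathcal{N}$-gridding. The graph $G_\mathcal{M}$ has as vertices the non-empty cells of $\mathcal{M}$, two being adjacent if they lie in the same row or the same column and every cell strictly between them is empty. *)

theory Defs
  imports Complex_Main "HOL-Library.Sublist" "HOL-Combinatorics.Multiset_Permutations"
begin

section \<open>Permutations and containment\<close>

text \<open>
  A permutation of length \<open>n\<close> is the list of its values, with both positions and values counted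
  from \<open>0\<close>, so that \<open>[1,0]\<close> is the permutation usually written \<open>21\<close>.  The empty permutation is
  included.
\<close>

definition perms :: "nat list set" where
  "perms = (\<Union>n. permutations_of_set {..<n})"

definition plot :: "nat list \<Rightarrow> (nat \<times> nat) set" where
  "plot s = {(i, s ! i) | i. i < length s}"

definition order_isomorphic :: "(nat \<times> nat) set \<Rightarrow> (nat \<times> nat) set \<Rightarrow> bool" where
  "order_isomorphic S T \<longleftrightarrow>
     (\<exists>f. bij_betw f S T \<and>
       (\<forall>p\<in>S. \<forall>q\<in>S. (fst p < fst q \<longleftrightarrow> fst (f p) < fst (f q)) \<and>
                        (snd p < snd q \<longleftrightarrow> snd (f p) < snd (f q))))"

definition contained :: "nat list \<Rightarrow> nat list \<Rightarrow> bool" where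
  "contained \<alpha> \<pi> \<longleftrightarrow> (\<exists>s. subseq s \<pi> \<and> order_isomorphic (plot s) (plot \<alpha>))"

definition perm_class :: "nat list set \<Rightarrow> bool" where
  "perm_class C \<longleftrightarrow>
     C \<subseteq> perms \<and> (\<forall>\<pi>\<in>C. \<forall>\<alpha>\<in>perms. contained \<alpha> \<pi> \<longrightarrow> \<alpha> \<in> C)"

definition Av :: "nat list set \<Rightarrow> nat list set" where
  "Av B = {\<pi> \<in> perms. \<forall>\<beta>\<in>B. \<not> contained \<beta> \<pi>}"

definition monotone_class :: "nat list set \<Rightarrow> bool" where
  "monotone_class C \<longleftrightarrow> C = Av {[1,0]} \<or> C = Av {[0,1]}"

definition partially_well_ordered :: "nat list set \<Rightarrow> bool" where
  "partially_well_ordered A \<longleftrightarrow>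
     \<not> (\<exists>S\<subseteq>A. infinite S \<and> (\<forall>\<alpha>\<in>S. \<forall>\<beta>\<in>S. \<alpha> \<noteq> \<beta> \<longrightarrow> \<not> contained \<alpha> \<beta>))"

section \<open>Simple permutations\<close>

definition contiguous :: "nat set \<Rightarrow> bool" where
  "contiguous I \<longleftrightarrow> (\<exists>a b. I = {a..<b})"

definition perm_interval :: "nat list \<Rightarrow> nat set \<Rightarrow> bool" where
  "perm_interval \<pi> I \<longleftrightarrow>
     I \<subseteq> {..<length \<pi>} \<and> contiguous I \<and> contiguous ((!) \<pi> ` I)"

definition simple_perm :: "nat list \<Rightarrow> bool" where
  "simple_perm \<pi> \<longleftrightarrow> \<pi> \<in> perms \<and>
     (\<forall>I. perm_interval \<pi> I \<longrightarrow> I = {} \<or> (\<exists>i. I = {i}) \<or> I = {..<length \<pi>})"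

section \<open>Griddings and grid classes\<close>

text \<open>
  An \<open>m \<times> n\<close> matrix is a function used on \<open>{1..m} \<times> {1..n}\<close> only; \<open>M i j\<close> lies in column \<open>i\<close>
  (counted from the left) and row \<open>j\<close> (counted from the bottom).  The empty class is \<open>{}\<close>.
\<close>

definition gridding_matrix :: "nat \<Rightarrow> nat \<Rightarrow> (nat \<Rightarrow> nat \<Rightarrow> nat list set) \<Rightarrow> bool" where
  "gridding_matrix m n M \<longleftrightarrow> 1 \<le> m \<and> 1 \<le> n \<and>
     (\<forall>i\<in>{1..m}. \<forall>j\<in>{1..n}. perm_class (M i j) \<and> (infinite (M i j) \<or> M i j = {}))"

text \<open>
  The vertical lines are \<open>x = v 1, \<dots>, x = v (m - 1)\<close> and the horizontal lines are
  \<open>y = h 1, \<dots>, y = h (n - 1)\<close>.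
\<close>

definition gridding :: "nat \<Rightarrow> nat \<Rightarrow> (nat \<Rightarrow> real) \<Rightarrow> (nat \<Rightarrow> real) \<Rightarrow> nat list \<Rightarrow> bool" where
  "gridding m n v h \<pi> \<longleftrightarrow>
     strict_mono_on {1..<m} v \<and> strict_mono_on {1..<n} h \<and>
     (\<forall>(x, y)\<in>plot \<pi>. (\<forall>i\<in>{1..<m}. real x \<noteq> v i) \<and> (\<forall>j\<in>{1..<n}. real y \<noteq> h j))"

definition cell_points ::
  "nat \<Rightarrow> nat \<Rightarrow> (nat \<Rightarrow> real) \<Rightarrow> (nat \<Rightarrow> real) \<Rightarrow> nat list \<Rightarrow> nat \<Rightarrow> nat \<Rightarrow> (nat \<times> nat) set" where
  "cell_points m n v h \<pi> i j = {(x, y) \<in> plot \<pi>.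
     (1 < i \<longrightarrow> v (i - 1) < real x) \<and> (i < m \<longrightarrow> real x < v i) \<and>
     (1 < j \<longrightarrow> h (j - 1) < real y) \<and> (j < n \<longrightarrow> real y < h j)}"

text \<open>
  A cell containing no points meets the requirement for every class, including the empty one:
  an entry \<open>{}\<close> forces its cell to contain no points, and does not make the grid class empty.
\<close>

definition has_gridding ::
  "nat \<Rightarrow> nat \<Rightarrow> (nat \<Rightarrow> nat \<Rightarrow> nat list set) \<Rightarrow> nat list \<Rightarrow> bool" where
  "has_gridding m n M \<pi> \<longleftrightarrow>
     (\<exists>v h. gridding m n v h \<pi> \<and>
       (\<forall>i\<in>{1..m}. \<forall>j\<in>{1..n}. cell_points m n v h \<pi> i j = {} \<or>
          (\<exists>\<alpha>\<in>M i j. order_isomorphic (cell_points m n v h \<pi> i j) (plot \<alpha>))))"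

definition Grid :: "nat \<Rightarrow> nat \<Rightarrow> (nat \<Rightarrow> nat \<Rightarrow> nat list set) \<Rightarrow> nat list set" where
  "Grid m n M = {\<pi> \<in> perms. has_gridding m n M \<pi>}"

definition monotone_griddable :: "nat list set \<Rightarrow> bool" where
  "monotone_griddable C \<longleftrightarrow>
     (\<exists>m n N. gridding_matrix m n N \<and>
       (\<forall>i\<in>{1..m}. \<forall>j\<in>{1..n}. monotone_class (N i j) \<or> N i j = {}) \<and>
       (\<forall>\<pi>\<in>C. has_gridding m n N \<pi>))"

section \<open>The graph of a gridding matrix\<close>

text \<open>
  Graphs are undirected and simple: edges are two-element sets of vertices.  The predicate
  \<open>forest\<close> of the AFP entry Graph Theory is not suitable, since in the symmetric digraph of an
  undirected graph every edge gives a directed cycle of length two.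
\<close>

definition graph_cycle :: "'a set set \<Rightarrow> 'a list \<Rightarrow> bool" where
  "graph_cycle E c \<longleftrightarrow> 3 \<le> length c \<and> distinct c \<and>
     (\<forall>k<length c. {c ! k, c ! (Suc k mod length c)} \<in> E)"

definition forest :: "'a set set \<Rightarrow> bool" where
  "forest E \<longleftrightarrow> \<not> (\<exists>c. graph_cycle E c)"

definition components :: "'a set \<Rightarrow> 'a set set \<Rightarrow> 'a set set" where
  "components V E = (\<lambda>a. {(b, c). {b, c} \<in> E}\<^sup>* `` {a}) ` V"

definition cell_vertices :: "nat \<Rightarrow> nat \<Rightarrow> (nat \<Rightarrow> nat \<Rightarrow> nat list set) \<Rightarrow> (nat \<times> nat) set" where
  "cell_vertices m n M = {(i, j). i \<in> {1..m} \<and> j \<in> {1..n} \<and> M i j \<noteq> {}}"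

definition cell_edges :: "nat \<Rightarrow> nat \<Rightarrow> (nat \<Rightarrow> nat \<Rightarrow> nat list set) \<Rightarrow> (nat \<times> nat) set set" where
  "cell_edges m n M =
     {{(i, j), (i, j')} | i j j'. j < j' \<and>
        (i, j) \<in> cell_vertices m n M \<and> (i, j') \<in> cell_vertices m n M \<and>
        (\<forall>k\<in>{j<..<j'}. M i k = {})} \<union>
     {{(i, j), (i', j)} | i i' j. i < i' \<and>
        (i, j) \<in> cell_vertices m n M \<and> (i', j) \<in> cell_vertices m n M \<and>
        (\<forall>k\<in>{i<..<i'}. M k j = {})}"

end

theory Submission
  imports Defs "HOL-Library.Ramsey"
begin

text \<open>
  A closed walk through the cells of \<open>M\<close> that turns at every step (between rows and columns) carries
  long zigzags of points, each point sharing a row or a column with the next.  Unrolled around the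
  walk for different lengths and with both end points doubled, these zigzags form an infinite
  antichain: an embedding must shift or reflect some long stretch rigidly, this determines it
  everywhere, and the doubled points force equal lengths.  A walk may also pause once in a cell whose class
  contains all sums of 21 or all skew sums of 12, and an entry that is not monotone griddable has
  this property.  A cycle of the graph gives such a walk directly, and two entries that are not
  monotone griddable in one component give a walk going to and fro between them.

  Conversely, let a component be a tree whose cells are monotone except for a root cell.  Its rows
  and columns fall into two sides such that only the root cell meets both, and on each side all
  orders along rows and columns come from a single linear order.  By Nash-Williams' minimal bad
  sequence argument such structures are well-quasi-ordered: either an extreme point of one of the
  two linear orders lies off the root cell and can be removed, or the substitution decomposition of
  the points in the root cell, with one of finitely many simple permutations, extends to the whole
  structure.
\<close>

section \<open>Patterns of point sets and coloured griddings\<close>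

text \<open>Three obstacles shape the proof. A containment between gridded permutations need not
  respect the griddings, so the rigidity of the zigzags may use only the two linear orders; which
  line carries the image of a point has to be recovered from monotonicity and pigeonhole. Next, a
  closed walk may return with reversed orientation, since every decreasing cell on it flips the
  direction of growth. The zigzag therefore has two rounds of the walk as its period, and strands of
  opposite orientation in the same row or column are kept apart as separate lines; this separation
  also keeps every cell monotone apart from the inversions of consecutive points. Finally, in the
  converse direction the orders along rows and columns can be merged only across monotone cells,
  with some of the lines reversed. The signs of these reversals depend on the matrix alone, so an
  embedding of merged structures restores the original orders. The embeddings found this way even
  respect cells, which is more than containment asks for; points on different lines are then ordered
  by their cells, and this allows the components to be treated separately.\<close>

lemma subseq_index:
  "subseq s t \<longleftrightarrow>
    (\<exists>f. (\<forall>i j. i < j \<and> j < length s \<longrightarrow> f i < f j) \<and> (\<forall>i<length s. f i < length t \<and> s ! i = t ! f i))"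
  (is "_ \<longleftrightarrow> (\<exists>f. ?P s t f)")
proof
  assume "subseq s t"
  then obtain N where "s = nths t N" by (auto simp: subseq_conv_nths)
  then have s: "s = map ((!) t) (nths [0..<length t] N)" by (metis map_nth nths_map)
  let ?l = "nths [0..<length t] N"
  have "sorted ?l" "distinct ?l" by (simp_all add: sorted_nths distinct_nthsI)
  then have "sorted_wrt (<) ?l" by (simp add: strict_sorted_iff)
  moreover have "set ?l \<subseteq> {..<length t}" using set_nths_subset[of "[0..<length t]" N] by auto
  then have "\<forall>i<length ?l. ?l ! i < length t" using nth_mem by blast
  ultimately have "?P s t ((!) ?l)" unfolding s by (auto simp: sorted_wrt_nth_less)
  then show "\<exists>f. ?P s t f" by blast
next
  assume "\<exists>f. ?P s t f"
  then obtain f where "?P s t f" by blast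
  then show "subseq s t"
  proof (induction s arbitrary: t rule: rev_induct)
    case (snoc x s)
    define k where "k = f (length s)"
    have k: "k < length t" "t ! k = x" using snoc.prems by (auto simp: k_def)
    have "f i < k" if "i < length s" for i using snoc.prems that by (simp add: k_def)
    then have "?P s (take k t) f" using snoc.prems by (auto simp: nth_append split: if_splits)
    then have "subseq s (take k t)" by (rule snoc.IH)
    then have "subseq (s @ [x]) (take k t @ t ! k # drop (Suc k) t)"
      using k by (intro list_emb_append_mono) auto
    then show ?case using id_take_nth_drop[OF k(1)] by simp
  qed simp
qed

lemma perms_iff: "\<pi> \<in> perms \<longleftrightarrow> distinct \<pi> \<and> set \<pi> = {..<length \<pi>}"
proof -
  have "length \<pi> = n" if "distinct \<pi>" "set \<pi> = {..<n}" for n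
    using distinct_card[OF that(1)] that(2) by simp
  then show ?thesis by (auto simp: perms_def permutations_of_set_def)
qed

lemma perms_bij: "\<pi> \<in> perms \<Longrightarrow> bij_betw ((!) \<pi>) {..<length \<pi>} {..<length \<pi>}"
  by (auto simp: perms_iff bij_betw_nth)

lemma perms_inj: "\<pi> \<in> perms \<Longrightarrow> inj_on ((!) \<pi>) {..<length \<pi>}"
  using perms_bij bij_betw_def by blast

text \<open>Points are indices with two keys in arbitrary linear orders, which allows positions,
  integers and reals to be mixed. Injectivity of \<open>f\<close> is implied: distinct values of a
  key stay distinct, so one key that is injective on \<open>I\<close> is enough.\<close>

definition emb :: "'a set \<Rightarrow> ('a \<Rightarrow> 'k::linorder) \<Rightarrow> ('a \<Rightarrow> 'l::linorder) \<Rightarrow>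
    'b set \<Rightarrow> ('b \<Rightarrow> 'm::linorder) \<Rightarrow> ('b \<Rightarrow> 'n::linorder) \<Rightarrow> ('a \<Rightarrow> 'b) \<Rightarrow> bool" where
  "emb I X Y J X' Y' f \<longleftrightarrow> (\<forall>p\<in>I. f p \<in> J) \<and>
     (\<forall>p\<in>I. \<forall>q\<in>I. (X p < X q \<longleftrightarrow> X' (f p) < X' (f q)) \<and> (Y p < Y q \<longleftrightarrow> Y' (f p) < Y' (f q)))"

abbreviation lemb :: "nat list \<Rightarrow> nat list \<Rightarrow> (nat \<Rightarrow> nat) \<Rightarrow> bool" where
  "lemb \<alpha> \<pi> f \<equiv> emb {..<length \<alpha>} (\<lambda>i. i) ((!) \<alpha>) {..<length \<pi>} (\<lambda>i. i) ((!) \<pi>) f"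

definition is_pattern :: "'a set \<Rightarrow> ('a \<Rightarrow> 'k::linorder) \<Rightarrow> ('a \<Rightarrow> 'l::linorder) \<Rightarrow> nat list \<Rightarrow> bool" where
  "is_pattern I X Y \<alpha> \<longleftrightarrow>
     (\<exists>f. bij_betw f I {..<length \<alpha>} \<and> emb I X Y {..<length \<alpha>} (\<lambda>i. i) ((!) \<alpha>) f)"

definition in_class :: "nat list set \<Rightarrow> 'a set \<Rightarrow> ('a \<Rightarrow> 'k::linorder) \<Rightarrow> ('a \<Rightarrow> 'l::linorder) \<Rightarrow> bool" where
  "in_class C I X Y \<longleftrightarrow> (\<exists>\<alpha>\<in>C. is_pattern I X Y \<alpha>)"

lemma emb_comp: "emb I X Y J X' Y' f \<Longrightarrow> emb J X' Y' K X'' Y'' g \<Longrightarrow> emb I X Y K X'' Y'' (g \<circ> f)"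
  by (simp add: emb_def)

lemma emb_inv:
  assumes "bij_betw f I J" "emb I X Y J X' Y' f"
  shows "emb J X' Y' I X Y (inv_into I f)"
proof -
  have i: "inv_into I f p \<in> I \<and> f (inv_into I f p) = p" if "p \<in> J" for p
    using assms(1) that by (auto simp: bij_betw_def inv_into_into f_inv_into_f)
  show ?thesis
    unfolding emb_def
  proof (intro conjI ballI)
    fix p q assume pq: "p \<in> J" "q \<in> J"
    show "inv_into I f p \<in> I" using i pq by blast
    have "X (inv_into I f p) < X (inv_into I f q) \<longleftrightarrow> X' (f (inv_into I f p)) < X' (f (inv_into I f q))"
      "Y (inv_into I f p) < Y (inv_into I f q) \<longleftrightarrow> Y' (f (inv_into I f p)) < Y' (f (inv_into I f q))"
      using assms(2) i[OF pq(1)] i[OF pq(2)] unfolding emb_def by blast+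
    then show "X' p < X' q \<longleftrightarrow> X (inv_into I f p) < X (inv_into I f q)"
      "Y' p < Y' q \<longleftrightarrow> Y (inv_into I f p) < Y (inv_into I f q)" using i pq by simp_all
  qed
qed

text \<open>Subsequence and order isomorphism become a single map on positions, which is easy to
  compose and to invert.\<close>

lemma contained_lemb:
  assumes "\<pi> \<in> perms"
  shows "contained \<alpha> \<pi> \<longleftrightarrow> (\<exists>f. lemb \<alpha> \<pi> f)"
proof
  assume "contained \<alpha> \<pi>"
  then obtain s g where s: "subseq s \<pi>" and g: "bij_betw g (plot s) (plot \<alpha>)"
    "\<forall>p\<in>plot s. \<forall>q\<in>plot s. (fst p < fst q \<longleftrightarrow> fst (g p) < fst (g q)) \<and> (snd p < snd q \<longleftrightarrow> snd (g p) < snd (g q))"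
    by (auto simp: contained_def order_isomorphic_def)
  obtain h where h: "\<And>i j. i < j \<Longrightarrow> j < length s \<Longrightarrow> h i < h j"
    "\<And>i. i < length s \<Longrightarrow> h i < length \<pi> \<and> s ! i = \<pi> ! h i"
    using s by (auto simp: subseq_index)
  let ?g' = "inv_into (plot s) g"
  define f where "f i = h (fst (?g' (i, \<alpha> ! i)))" for i
  have pt: "(i, \<alpha> ! i) \<in> plot \<alpha>" if "i < length \<alpha>" for i using that by (auto simp: plot_def)
  have g': "?g' (i, \<alpha> ! i) \<in> plot s" "g (?g' (i, \<alpha> ! i)) = (i, \<alpha> ! i)" if "i < length \<alpha>" for i
    using bij_betwE[OF bij_betw_inv_into[OF g(1)]] bij_betw_inv_into_right[OF g(1)] pt[OF that] by auto
  have pl: "fst p < length s \<and> snd p = s ! fst p" if "p \<in> plot s" for p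
    using that by (auto simp: plot_def)
  have hlt: "h i < h j \<longleftrightarrow> i < j" if "i < length s" "j < length s" for i j
    using h(1) that by (metis less_asym linorder_neqE_nat less_irrefl)
  have "lemb \<alpha> \<pi> f"
    unfolding emb_def
  proof (intro conjI ballI)
    fix i assume i: "i \<in> {..<length \<alpha>}"
    then show "f i \<in> {..<length \<pi>}" using g'(1)[of i] pl h(2) by (auto simp: f_def)
    fix j assume j: "j \<in> {..<length \<alpha>}"
    have "fst (?g' (i, \<alpha> ! i)) < fst (?g' (j, \<alpha> ! j)) \<longleftrightarrow> i < j"
      "snd (?g' (i, \<alpha> ! i)) < snd (?g' (j, \<alpha> ! j)) \<longleftrightarrow> \<alpha> ! i < \<alpha> ! j"
      using g(2) g'[of i] g'[of j] i j by auto
    then show "i < j \<longleftrightarrow> f i < f j" "\<alpha> ! i < \<alpha> ! j \<longleftrightarrow> \<pi> ! f i < \<pi> ! f j"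
      using g'(1)[of i] g'(1)[of j] i j pl h(2) hlt by (auto simp: f_def)
  qed
  then show "\<exists>f. lemb \<alpha> \<pi> f" by blast
next
  assume "\<exists>f. lemb \<alpha> \<pi> f"
  then obtain f where f: "lemb \<alpha> \<pi> f" by blast
  define s where "s = map (\<lambda>i. \<pi> ! f i) [0..<length \<alpha>]"
  have "subseq s \<pi>" unfolding subseq_index
    using f by (intro exI[of _ f]) (auto simp: emb_def s_def)
  moreover have "order_isomorphic (plot s) (plot \<alpha>)"
    unfolding order_isomorphic_def
  proof (intro exI[of _ "\<lambda>p. (fst p, \<alpha> ! fst p)"] conjI ballI)
    show "bij_betw (\<lambda>p. (fst p, \<alpha> ! fst p)) (plot s) (plot \<alpha>)"
      by (rule bij_betwI[where g = "\<lambda>p. (fst p, s ! fst p)"]) (auto simp: plot_def s_def)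
  qed (use f in \<open>auto simp: plot_def s_def emb_def\<close>)
  ultimately show "contained \<alpha> \<pi>" by (auto simp: contained_def)
qed

lemma lemb_refl: "lemb \<alpha> \<alpha> (\<lambda>i. i)"
  by (simp add: emb_def)

lemma finite_perms_le: "finite {\<pi> \<in> perms. length \<pi> < n}"
proof -
  show ?thesis
  proof (rule finite_subset)
    show "finite {xs. set xs \<subseteq> {..<n} \<and> length xs \<le> n}" by (rule finite_lists_length_le) simp
    show "{\<pi> \<in> perms. length \<pi> < n} \<subseteq> {xs. set xs \<subseteq> {..<n} \<and> length xs \<le> n}"
    proof
      fix \<pi> assume "\<pi> \<in> {\<pi> \<in> perms. length \<pi> < n}"
      then have "set \<pi> = {..<length \<pi>}" "length \<pi> < n" by (simp_all add: perms_iff)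
      moreover from this have "{..<length \<pi>} \<subseteq> {..<n}" by simp
      ultimately show "\<pi> \<in> {xs. set xs \<subseteq> {..<n} \<and> length xs \<le> n}" by simp
    qed
  qed
qed

lemma rank_bij:
  fixes X :: "'a \<Rightarrow> 'k::linorder"
  assumes fin: "finite I" and inj: "inj_on X I"
  defines "r \<equiv> \<lambda>p. card {q \<in> I. X q < X p}"
  shows "bij_betw r I {..<card I}" "\<And>p q. p \<in> I \<Longrightarrow> q \<in> I \<Longrightarrow> X p < X q \<longleftrightarrow> r p < r q"
proof -
  have lt: "r p < r q" if "p \<in> I" "q \<in> I" "X p < X q" for p q
    unfolding r_def using that fin by (intro psubset_card_mono) auto
  show iff: "X p < X q \<longleftrightarrow> r p < r q" if "p \<in> I" "q \<in> I" for p q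
    using lt[OF that] lt[OF that(2,1)] by (metis not_less_iff_gr_or_eq that inj inj_onD)
  have ir: "inj_on r I"
    using lt inj by (metis inj_onI inj_onD less_irrefl linorder_neqE)
  have "r ` I \<subseteq> {..<card I}"
    unfolding r_def using fin by (auto intro!: psubset_card_mono)
  then have "r ` I = {..<card I}"
    using card_image[OF ir] by (intro card_subset_eq) auto
  then show "bij_betw r I {..<card I}" using ir by (simp add: bij_betw_def)
qed

text \<open>Standardisation: points are numbered by their rank in \<open>X\<close>, and the
  permutation lists their ranks in \<open>Y\<close>.\<close>

lemma pattern_exists:
  assumes fin: "finite I" and inj: "inj_on X I" "inj_on Y I"
  obtains \<alpha> where "\<alpha> \<in> perms" "is_pattern I X Y \<alpha>" "length \<alpha> = card I"
proof -
  define r where "r p = card {q \<in> I. X q < X p}" for p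
  define t where "t p = card {q \<in> I. Y q < Y p}" for p
  note r = rank_bij[OF fin inj(1), folded r_def]
  note t = rank_bij[OF fin inj(2), folded t_def]
  define g where "g = inv_into I r"
  have g: "bij_betw g {..<card I} I" unfolding g_def by (rule bij_betw_inv_into[OF r(1)])
  have gr: "g (r p) = p" if "p \<in> I" for p
    unfolding g_def using that r(1) by (simp add: bij_betw_inv_into_left)
  define \<alpha> where "\<alpha> = map (\<lambda>i. t (g i)) [0..<card I]"
  have b: "bij_betw (\<lambda>i. t (g i)) {..<card I} {..<card I}"
    using bij_betw_trans[OF g t(1)] by (simp add: comp_def)
  have "\<alpha> \<in> perms"
    using b by (auto simp: perms_iff \<alpha>_def distinct_map bij_betw_def lessThan_atLeast0)
  moreover have rl: "r p < card I" if "p \<in> I" for p using r(1) that by (auto simp: bij_betw_def)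
  have "is_pattern I X Y \<alpha>"
    unfolding is_pattern_def emb_def using r t gr rl
    by (intro exI[of _ r]) (auto simp: \<alpha>_def)
  ultimately show ?thesis by (intro that) (auto simp: \<alpha>_def)
qed

lemma is_pattern_self: "is_pattern {..<length \<alpha>} (\<lambda>i. i) ((!) \<alpha>) \<alpha>"
  unfolding is_pattern_def by (rule exI[of _ id]) (auto simp: emb_def)

text \<open>Containment of permutations may thus be tested on any point sets that represent
  them.\<close>

lemma pattern_lemb:
  assumes "is_pattern I X Y \<alpha>" "is_pattern J X' Y' \<beta>"
  shows "(\<exists>f. emb I X Y J X' Y' f) \<longleftrightarrow> (\<exists>f. lemb \<alpha> \<beta> f)"
proof -
  obtain g where g: "bij_betw g I {..<length \<alpha>}" "emb I X Y {..<length \<alpha>} (\<lambda>i. i) ((!) \<alpha>) g"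
    using assms(1) by (auto simp: is_pattern_def)
  obtain h where h: "bij_betw h J {..<length \<beta>}" "emb J X' Y' {..<length \<beta>} (\<lambda>i. i) ((!) \<beta>) h"
    using assms(2) by (auto simp: is_pattern_def)
  note g' = emb_inv[OF g] and h' = emb_inv[OF h]
  show ?thesis
  proof
    assume "\<exists>f. emb I X Y J X' Y' f"
    then obtain f where f: "emb I X Y J X' Y' f" by blast
    from emb_comp[OF emb_comp[OF g' f] h(2)] show "\<exists>f. lemb \<alpha> \<beta> f" by blast
  next
    assume "\<exists>f. lemb \<alpha> \<beta> f"
    then obtain f where f: "lemb \<alpha> \<beta> f" by blast
    from emb_comp[OF emb_comp[OF g(2) f] h'] show "\<exists>f. emb I X Y J X' Y' f" by blast
  qed
qed

text \<open>Downward closure of the class, carried over from permutations to point sets by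
  standardising the smaller set.\<close>

lemma in_class_mono:
  assumes C: "perm_class C" and IC: "in_class C I X Y" and f: "emb J X' Y' I X Y f"
    and J: "finite J" "inj_on X' J" "inj_on Y' J"
  shows "in_class C J X' Y'"
proof -
  obtain \<alpha> where \<alpha>: "\<alpha> \<in> C" "is_pattern I X Y \<alpha>" using IC by (auto simp: in_class_def)
  obtain \<beta> where \<beta>: "\<beta> \<in> perms" "is_pattern J X' Y' \<beta>" by (rule pattern_exists[OF J])
  have "\<alpha> \<in> perms" using \<alpha> C by (auto simp: perm_class_def)
  then have "contained \<beta> \<alpha>" using pattern_lemb[OF \<beta>(2) \<alpha>(2)] f contained_lemb by blast
  then have "\<beta> \<in> C" using C \<alpha> \<beta> by (auto simp: perm_class_def)
  then show ?thesis using \<beta> by (auto simp: in_class_def)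
qed

lemma in_class_self: "\<alpha> \<in> C \<Longrightarrow> in_class C {..<length \<alpha>} (\<lambda>i. i) ((!) \<alpha>)"
  using is_pattern_self by (auto simp: in_class_def)

lemma in_class_pattern:
  assumes "perm_class C" "in_class C I X Y" "is_pattern I X Y \<alpha>" "\<alpha> \<in> perms"
  shows "\<alpha> \<in> C"
proof -
  obtain \<beta> where \<beta>: "\<beta> \<in> C" "is_pattern I X Y \<beta>" using assms by (auto simp: in_class_def)
  have "emb I X Y I X Y (\<lambda>x. x)" by (simp add: emb_def)
  then have "\<exists>f. lemb \<alpha> \<beta> f" using pattern_lemb[OF assms(3) \<beta>(2)] by blast
  then show ?thesis using assms \<beta> contained_lemb[of \<beta> \<alpha>] by (auto simp: perm_class_def)
qed

lemma order_isomorphic_pattern: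
  assumes "S \<subseteq> {..<length \<pi>}"
  shows "order_isomorphic {(x, \<pi> ! x) | x. x \<in> S} (plot \<alpha>) \<longleftrightarrow> is_pattern S (\<lambda>i. i) ((!) \<pi>) \<alpha>"
proof
  assume "order_isomorphic {(x, \<pi> ! x) | x. x \<in> S} (plot \<alpha>)"
  then obtain g where g: "bij_betw g {(x, \<pi> ! x) | x. x \<in> S} (plot \<alpha>)"
    and gl: "\<And>x y. x \<in> S \<Longrightarrow> y \<in> S \<Longrightarrow> (x < y \<longleftrightarrow> fst (g (x, \<pi> ! x)) < fst (g (y, \<pi> ! y)))
      \<and> (\<pi> ! x < \<pi> ! y \<longleftrightarrow> snd (g (x, \<pi> ! x)) < snd (g (y, \<pi> ! y)))"
    by (auto simp: order_isomorphic_def)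
  define f where "f x = fst (g (x, \<pi> ! x))" for x
  have b1: "bij_betw (\<lambda>x. (x, \<pi> ! x)) S {(x, \<pi> ! x) | x. x \<in> S}"
    by (rule bij_betwI[where g = fst]) auto
  have b2: "bij_betw fst (plot \<alpha>) {..<length \<alpha>}"
    by (rule bij_betwI[where g = "\<lambda>i. (i, \<alpha> ! i)"]) (auto simp: plot_def)
  have "bij_betw f S {..<length \<alpha>}"
    using bij_betw_trans[OF bij_betw_trans[OF b1 g] b2] by (simp add: f_def[abs_def] comp_def)
  moreover have "g (x, \<pi> ! x) \<in> plot \<alpha>" if "x \<in> S" for x using bij_betwE[OF g] that by auto
  then have "f x < length \<alpha>" "snd (g (x, \<pi> ! x)) = \<alpha> ! f x" if "x \<in> S" for x
    using that by (fastforce simp: plot_def f_def)+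
  ultimately show "is_pattern S (\<lambda>i. i) ((!) \<pi>) \<alpha>"
    unfolding is_pattern_def emb_def using gl by (intro exI[of _ f]) (auto simp: f_def)
next
  assume "is_pattern S (\<lambda>i. i) ((!) \<pi>) \<alpha>"
  then obtain f where f: "bij_betw f S {..<length \<alpha>}" "emb S (\<lambda>i. i) ((!) \<pi>) {..<length \<alpha>} (\<lambda>i. i) ((!) \<alpha>) f"
    by (auto simp: is_pattern_def)
  have b1: "bij_betw fst {(x, \<pi> ! x) | x. x \<in> S} S"
    by (rule bij_betwI[where g = "\<lambda>x. (x, \<pi> ! x)"]) auto
  have b2: "bij_betw (\<lambda>i. (i, \<alpha> ! i)) {..<length \<alpha>} (plot \<alpha>)"
    by (rule bij_betwI[where g = fst]) (auto simp: plot_def)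
  have "bij_betw ((\<lambda>i. (i, \<alpha> ! i)) \<circ> (f \<circ> fst)) {(x, \<pi> ! x) | x. x \<in> S} (plot \<alpha>)"
    by (rule bij_betw_trans[OF bij_betw_trans[OF b1 f(1)] b2])
  then show "order_isomorphic {(x, \<pi> ! x) | x. x \<in> S} (plot \<alpha>)"
    unfolding order_isomorphic_def using f(2)
    by (intro exI[of _ "(\<lambda>i. (i, \<alpha> ! i)) \<circ> (f \<circ> fst)"]) (auto simp: emb_def)
qed

subsection \<open>Griddings as monotone colourings\<close>

lemma initial_segment:
  fixes K :: "nat set"
  assumes "K \<subseteq> {1..<m}" "\<And>i k. k \<in> K \<Longrightarrow> 1 \<le> i \<Longrightarrow> i < k \<Longrightarrow> i \<in> K"
  shows "K = {1..card K}"
proof (cases "K = {}")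
  case False
  have fin: "finite K" using assms(1) finite_subset by blast
  have "K = {1..Max K}"
    using assms(2)[OF Max_in[OF fin False]] Max_ge[OF fin] Max_in[OF fin False] assms(1)
    by (auto simp: le_less subset_iff Suc_le_eq)
  then show ?thesis by (metis card_atLeastAtMost diff_Suc_1)
qed simp

text \<open>As \<open>v\<close> increases, the lines below \<open>t\<close> are an initial segment
  of the indices, and its length decides all the inequalities at once.\<close>

lemma line_index:
  fixes v :: "nat \<Rightarrow> real"
  assumes v: "strict_mono_on {1..<m} v" "\<forall>i\<in>{1..<m}. t \<noteq> v i" and i: "1 \<le> i" "i \<le> m"
  shows "(1 < i \<longrightarrow> v (i - 1) < t) \<and> (i < m \<longrightarrow> t < v i) \<longleftrightarrow> card {k\<in>{1..<m}. v k < t} + 1 = i"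
proof -
  define K where "K = {k\<in>{1..<m}. v k < t}"
  have K: "K = {1..card K}"
  proof (rule initial_segment[of K m])
    fix i k assume "k \<in> K" "1 \<le> i" "i < k"
    then have k: "i \<in> {1..<m}" "k \<in> {1..<m}" "v k < t" by (auto simp: K_def)
    then have "v i < v k" using strict_mono_onD[OF v(1)] \<open>i < k\<close> by blast
    then show "i \<in> K" using k by (simp add: K_def)
  qed (auto simp: K_def)
  have mem: "k \<in> K \<longleftrightarrow> 1 \<le> k \<and> k \<le> card K" for k by (subst K) auto
  have "card K < m"
  proof (rule ccontr)
    assume "\<not> card K < m"
    then have "m \<in> K" using mem i by auto
    then show False by (simp add: K_def)
  qed
  have "(1 < i \<longrightarrow> v (i - 1) < t) \<longleftrightarrow> i - 1 \<le> card K"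
  proof (cases "1 < i")
    case True
    then have "v (i - 1) < t \<longleftrightarrow> i - 1 \<in> K" using i by (auto simp: K_def)
    then show ?thesis using True mem[of "i - 1"] by auto
  qed (use i in simp)
  moreover have "(i < m \<longrightarrow> t < v i) \<longleftrightarrow> card K < i"
  proof (cases "i < m")
    case True
    then have "i \<in> {1..<m}" "t \<noteq> v i" using i v(2) by auto
    then have "t < v i \<longleftrightarrow> i \<notin> K" by (auto simp: K_def)
    then show ?thesis using True mem[of i] i by auto
  next
    case False
    then show ?thesis using i \<open>card K < m\<close> by auto
  qed
  ultimately have "(1 < i \<longrightarrow> v (i - 1) < t) \<and> (i < m \<longrightarrow> t < v i) \<longleftrightarrow> card K + 1 = i"
    using i by auto
  then show ?thesis by (simp add: K_def)
qed

lemma lines_exist: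
  fixes c :: "nat \<Rightarrow> nat"
  assumes mono: "\<And>x y. x \<le> y \<Longrightarrow> y < L \<Longrightarrow> c x \<le> c y" and c: "\<And>x. x < L \<Longrightarrow> c x \<in> {1..m}"
  obtains v :: "nat \<Rightarrow> real" where "strict_mono_on {1..<m} v"
    "\<And>x i. x < L \<Longrightarrow> i \<in> {1..<m} \<Longrightarrow> real x \<noteq> v i"
    "\<And>x i. x < L \<Longrightarrow> i \<in> {1..m} \<Longrightarrow>
      (1 < i \<longrightarrow> v (i - 1) < real x) \<and> (i < m \<longrightarrow> real x < v i) \<longleftrightarrow> c x = i"
proof -
  define n where "n i = card {x. x < L \<and> c x \<le> i}" for i
  \<comment> \<open>Line \<open>i\<close> lies just before \<open>n i\<close>, the number of points
    of colour at most \<open>i\<close>. The last term stays below 1/2, so the line passes no point,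
    and it separates the lines around empty columns, where \<open>n\<close> repeats.\<close>
  define v where "v i = real (n i) - 1/2 + real i / (4 * real m)" for i
  have seg: "x < n i \<longleftrightarrow> c x \<le> i" if "x < L" for x i
  proof
    assume "c x \<le> i"
    then have "{..x} \<subseteq> {x. x < L \<and> c x \<le> i}" using mono[OF _ that] that by force
    then have "card {..x} \<le> n i" unfolding n_def by (intro card_mono) auto
    then show "x < n i" by simp
  next
    assume x: "x < n i"
    show "c x \<le> i"
    proof (rule ccontr)
      assume "\<not> c x \<le> i"
      then have "{x. x < L \<and> c x \<le> i} \<subseteq> {..<x}" using mono[of x] by (force simp: not_le[symmetric])
      then have "n i \<le> card {..<x}" unfolding n_def by (intro card_mono) auto
      then show False using x by simp
    qed
  qed
  have off: "0 < real i / (4 * real m) \<and> real i / (4 * real m) < 1/2" if "i \<in> {1..<m}" for i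
  proof -
    have "real i < real m" "0 < real m" "0 < real i" using that by auto
    then show ?thesis by (simp add: field_simps)
  qed
  have nm: "n i \<le> n j" if "i \<le> j" for i j
    unfolding n_def using that by (intro card_mono) auto
  have lt: "(real x < v i) = (c x \<le> i)" "(v i < real x) = (\<not> c x \<le> i)" if x: "x < L" "i \<in> {1..<m}" for x i
  proof -
    have "x < n i \<Longrightarrow> real x \<le> real (n i) - 1" by (simp add: of_nat_diff)
    moreover have "\<not> x < n i \<Longrightarrow> real (n i) \<le> real x" by simp
    ultimately show "(real x < v i) = (c x \<le> i)" "(v i < real x) = (\<not> c x \<le> i)"
      using off[OF x(2)] seg[OF x(1), of i] unfolding v_def by fastforce+
  qed
  show ?thesis
  proof
    show "strict_mono_on {1..<m} v"
    proof (rule strict_mono_onI)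
      fix i j assume ij: "i \<in> {1..<m}" "j \<in> {1..<m}" "i < j"
      then have "real i / (4 * real m) < real j / (4 * real m)" by (intro divide_strict_right_mono) auto
      moreover have "real (n i) \<le> real (n j)" using nm[of i j] ij by simp
      ultimately show "v i < v j" by (simp add: v_def)
    qed
    fix x i assume x: "x < L"
    { assume i: "i \<in> {1..<m}" show "real x \<noteq> v i" using lt[OF x i] by fastforce }
    assume i: "i \<in> {1..m}"
    have "v (i - 1) < real x \<longleftrightarrow> \<not> c x \<le> i - 1" if "1 < i"
      using that i by (intro lt(2)[OF x]) auto
    then have "(1 < i \<longrightarrow> v (i - 1) < real x) \<longleftrightarrow> i \<le> c x" using c[OF x] i by (cases "1 < i") auto
    moreover have "real x < v i \<longleftrightarrow> c x \<le> i" if "i < m" using that i by (intro lt(1)[OF x]) auto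
    then have "(i < m \<longrightarrow> real x < v i) \<longleftrightarrow> c x \<le> i" using c[OF x] i by (cases "i < m") auto
    ultimately show "(1 < i \<longrightarrow> v (i - 1) < real x) \<and> (i < m \<longrightarrow> real x < v i) \<longleftrightarrow> c x = i"
      by auto
  qed
qed

text \<open>Real grid lines are replaced by the column and the row of each point, both given as
  functions of its position: \<open>c\<close> is monotone in the position and \<open>r\<close> in
  the value.\<close>

definition coloured ::
  "nat \<Rightarrow> nat \<Rightarrow> (nat \<Rightarrow> nat \<Rightarrow> nat list set) \<Rightarrow> nat list \<Rightarrow> (nat \<Rightarrow> nat) \<Rightarrow> (nat \<Rightarrow> nat) \<Rightarrow> bool" where
  "coloured m n M \<pi> c r \<longleftrightarrow>
     (\<forall>x<length \<pi>. c x \<in> {1..m} \<and> r x \<in> {1..n}) \<and>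
     (\<forall>x<length \<pi>. \<forall>y<length \<pi>. (x \<le> y \<longrightarrow> c x \<le> c y) \<and> (\<pi> ! x \<le> \<pi> ! y \<longrightarrow> r x \<le> r y)) \<and>
     (\<forall>i\<in>{1..m}. \<forall>j\<in>{1..n}. {x. x < length \<pi> \<and> c x = i \<and> r x = j} = {} \<or>
        in_class (M i j) {x. x < length \<pi> \<and> c x = i \<and> r x = j} (\<lambda>x. x) ((!) \<pi>))"

lemma cell_points_colour:
  assumes "\<And>x. x < length \<pi> \<Longrightarrow> (1 < i \<longrightarrow> v (i - 1) < real x) \<and> (i < m \<longrightarrow> real x < v i) \<longleftrightarrow> c x = i"
    and "\<And>x. x < length \<pi> \<Longrightarrow>
      (1 < j \<longrightarrow> h (j - 1) < real (\<pi> ! x)) \<and> (j < n \<longrightarrow> real (\<pi> ! x) < h j) \<longleftrightarrow> r x = j"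
  shows "cell_points m n v h \<pi> i j = {(x, \<pi> ! x) | x. x \<in> {x. x < length \<pi> \<and> c x = i \<and> r x = j}}"
  unfolding cell_points_def plot_def using assms by fastforce

lemma gridding_iff_coloured:
  assumes \<pi>: "\<pi> \<in> perms" and mn: "1 \<le> m" "1 \<le> n"
  shows "has_gridding m n M \<pi> \<longleftrightarrow> (\<exists>c r. coloured m n M \<pi> c r)"
proof
  assume "has_gridding m n M \<pi>"
  then obtain v h where vh: "gridding m n v h \<pi>"
    and cells: "\<And>i j. i\<in>{1..m} \<Longrightarrow> j\<in>{1..n} \<Longrightarrow> cell_points m n v h \<pi> i j = {} \<or>
          (\<exists>\<alpha>\<in>M i j. order_isomorphic (cell_points m n v h \<pi> i j) (plot \<alpha>))"
    by (auto simp: has_gridding_def)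
  have v: "strict_mono_on {1..<m} v" "strict_mono_on {1..<n} h"
    "\<And>x. x < length \<pi> \<Longrightarrow> \<forall>i\<in>{1..<m}. real x \<noteq> v i"
    "\<And>x. x < length \<pi> \<Longrightarrow> \<forall>j\<in>{1..<n}. real (\<pi> ! x) \<noteq> h j"
    using vh by (auto simp: gridding_def plot_def)
  define c where "c x = card {k\<in>{1..<m}. v k < real x} + 1" for x
  define r where "r x = card {k\<in>{1..<n}. h k < real (\<pi> ! x)} + 1" for x
  have card_le: "card {k\<in>{1..<m}. P k} + 1 \<in> {1..m}" if "1 \<le> m" for P and m :: nat
  proof -
    have "card {k\<in>{1..<m}. P k} \<le> card {1..<m}" by (intro card_mono) auto
    then show ?thesis using that by auto
  qed
  have "coloured m n M \<pi> c r"
    unfolding coloured_def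
  proof (intro conjI allI impI ballI)
    fix x assume "x < length \<pi>"
    show "c x \<in> {1..m}" "r x \<in> {1..n}" unfolding c_def r_def by (rule card_le; fact)+
    fix y
    show "c x \<le> c y" if "x \<le> y" unfolding c_def using that
      by (intro add_right_mono card_mono) auto
    show "r x \<le> r y" if "\<pi> ! x \<le> \<pi> ! y" unfolding r_def using that
      by (intro add_right_mono card_mono) auto
  next
    fix i j assume ij: "i \<in> {1..m}" "j \<in> {1..n}"
    let ?S = "{x. x < length \<pi> \<and> c x = i \<and> r x = j}"
    have cp: "cell_points m n v h \<pi> i j = {(x, \<pi> ! x) | x. x \<in> ?S}"
      using line_index[OF v(1) v(3)] line_index[OF v(2) v(4)] ij
      by (intro cell_points_colour) (auto simp: c_def r_def)
    show "?S = {} \<or> in_class (M i j) ?S (\<lambda>x. x) ((!) \<pi>)"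
    proof (cases "?S = {}")
      case False
      then have "cell_points m n v h \<pi> i j \<noteq> {}" unfolding cp by blast
      then obtain \<alpha> where "\<alpha> \<in> M i j" "order_isomorphic (cell_points m n v h \<pi> i j) (plot \<alpha>)"
        using cells[OF ij] by blast
      then have "is_pattern ?S (\<lambda>i. i) ((!) \<pi>) \<alpha>"
        unfolding cp using order_isomorphic_pattern[of ?S \<pi> \<alpha>] by blast
      then show ?thesis using \<open>\<alpha> \<in> M i j\<close> by (auto simp: in_class_def)
    qed simp
  qed
  then show "\<exists>c r. coloured m n M \<pi> c r" by blast
next
  assume "\<exists>c r. coloured m n M \<pi> c r"
  then obtain c r where cr: "coloured m n M \<pi> c r" by blast
  let ?L = "length \<pi>"
  \<comment> \<open>\<open>lines_exist\<close> wants the row as a function of the value, so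
    \<open>r\<close> is transported along the inverse of the permutation.\<close>
  define r' where "r' y = r (inv_into {..<?L} ((!) \<pi>) y)" for y
  have r': "r' (\<pi> ! x) = r x" if "x < ?L" for x
    using inv_into_f_f[OF perms_inj[OF \<pi>]] that by (simp add: r'_def)
  have ex: "\<exists>x<?L. y = \<pi> ! x" if "y < ?L" for y
    using perms_bij[OF \<pi>] that unfolding bij_betw_def by (metis imageE lessThan_iff)
  have val: "\<pi> ! x < ?L" if "x < ?L" for x using bij_betwE[OF perms_bij[OF \<pi>]] that by auto
  have cm: "c x \<le> c y" if "x \<le> y" "y < ?L" for x y using cr that by (simp add: coloured_def)
  have cc: "c x \<in> {1..m}" if "x < ?L" for x using cr that unfolding coloured_def by blast
  have rm: "r' x \<le> r' y" if xy: "x \<le> y" "y < ?L" for x y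
  proof -
    obtain x' y' where "x' < ?L" "x = \<pi> ! x'" "y' < ?L" "y = \<pi> ! y'"
      using ex[of x] ex[of y] xy by auto
    then show ?thesis using xy cr r' by (simp add: coloured_def)
  qed
  have rc: "r' x \<in> {1..n}" if x: "x < ?L" for x
  proof -
    obtain x' where "x' < ?L" "x = \<pi> ! x'" using ex[OF x] by blast
    then show ?thesis using cr r' unfolding coloured_def by metis
  qed
  obtain v :: "nat \<Rightarrow> real" where v: "strict_mono_on {1..<m} v"
    "\<And>x i. x < ?L \<Longrightarrow> i \<in> {1..<m} \<Longrightarrow> real x \<noteq> v i"
    "\<And>x i. x < ?L \<Longrightarrow> i \<in> {1..m} \<Longrightarrow>
      (1 < i \<longrightarrow> v (i - 1) < real x) \<and> (i < m \<longrightarrow> real x < v i) \<longleftrightarrow> c x = i"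
    by (rule lines_exist[OF cm cc], assumption+, rule that)
  obtain h :: "nat \<Rightarrow> real" where h: "strict_mono_on {1..<n} h"
    "\<And>x i. x < ?L \<Longrightarrow> i \<in> {1..<n} \<Longrightarrow> real x \<noteq> h i"
    "\<And>x i. x < ?L \<Longrightarrow> i \<in> {1..n} \<Longrightarrow>
      (1 < i \<longrightarrow> h (i - 1) < real x) \<and> (i < n \<longrightarrow> real x < h i) \<longleftrightarrow> r' x = i"
    by (rule lines_exist[OF rm rc], assumption+, rule that)
  have "gridding m n v h \<pi>"
    using v h val by (auto simp: gridding_def plot_def)
  moreover have "cell_points m n v h \<pi> i j = {} \<or>
          (\<exists>\<alpha>\<in>M i j. order_isomorphic (cell_points m n v h \<pi> i j) (plot \<alpha>))"
    if ij: "i \<in> {1..m}" "j \<in> {1..n}" for i j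
  proof -
    let ?S = "{x. x < length \<pi> \<and> c x = i \<and> r x = j}"
    have cp: "cell_points m n v h \<pi> i j = {(x, \<pi> ! x) | x. x \<in> ?S}"
      using v(3) h(3) val r' ij by (intro cell_points_colour) auto
    have "?S = {} \<or> in_class (M i j) ?S (\<lambda>x. x) ((!) \<pi>)" using cr ij by (simp add: coloured_def)
    then show ?thesis
      unfolding cp in_class_def using order_isomorphic_pattern[of ?S \<pi>] by auto
  qed
  ultimately show "has_gridding m n M \<pi>" unfolding has_gridding_def by blast
qed

section \<open>Rigidity of zigzags\<close>

text \<open>
  The point \<open>(s, 0)\<close> of a zigzag lies on the links \<open>s\<close> and \<open>s + 1\<close>, one in each of the two directions
  (\<open>True\<close> for even links).  On a link \<open>t\<close> the key of the point \<open>t\<close> lies just below that of the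
  point \<open>t - 1\<close>; this inversion of consecutive points is what an embedding has to respect.  The
  points \<open>(s, 1)\<close> are the doubles of the two end points.
\<close>

definition link :: "bool \<Rightarrow> int \<Rightarrow> int" where
  "link a s = (if even s = a then s else s + 1)"

definition tkey :: "bool \<Rightarrow> int \<Rightarrow> int" where
  "tkey a s = (if even s = a then s else s + 2)"

text \<open>The factor 2 leaves room for the double of a point directly above it, with no other key
  in between.\<close>

definition pkey :: "bool \<Rightarrow> int \<times> int \<Rightarrow> int" where
  "pkey a p = 2 * tkey a (fst p) + snd p"

definition sgv :: "int \<Rightarrow> int" where
  "sgv v = (if odd v then 1 else - 1)"

definition opts :: "int \<Rightarrow> (int \<times> int) set" where
  "opts N = {(s, 0) | s. 0 \<le> s \<and> s < N} \<union> {(0, 1), (N - 1, 1)}"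

lemma double_plus_bit:
  fixes x y b c :: int
  assumes "2 * x + b = 2 * y + c" "b = 0 \<or> b = 1" "c = 0 \<or> c = 1"
  shows "x = y \<and> b = c"
  using assms by presburger

lemma tkey_inj: "tkey a s = tkey a t \<Longrightarrow> s = t"
  unfolding tkey_def by (cases a) (simp_all split: if_splits, presburger+)

lemma pkey_inj:
  assumes "snd p = 0 \<or> snd p = 1" "snd q = 0 \<or> snd q = 1" "pkey a p = pkey a q"
  shows "p = q"
  using double_plus_bit[OF assms(3)[unfolded pkey_def] assms(1,2)] tkey_inj[of a "fst p" "fst q"]
  by (simp add: prod_eq_iff)

lemma finite_opts: "finite (opts N)"
proof -
  have "opts N \<subseteq> {0..<N} \<times> {0} \<union> {(0, 1), (N - 1, 1)}"
    by (auto simp: opts_def)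
  then show ?thesis by (rule finite_subset) auto
qed

lemma opts_snd: "p \<in> opts N \<Longrightarrow> snd p = 0 \<or> snd p = 1"
  by (auto simp: opts_def)

lemma opts_fst: "p \<in> opts N \<Longrightarrow> 1 \<le> N \<Longrightarrow> 0 \<le> fst p \<and> fst p < N"
  by (auto simp: opts_def)

section \<open>Steady stretches of integer sequences\<close>

text \<open>If each of \<open>c + 1\<close> consecutive blocks of length \<open>w\<close> brought a
  strict increase, the total increase would exceed \<open>c\<close>.\<close>

lemma steady_window:
  fixes F :: "nat \<Rightarrow> int"
  assumes mono: "\<And>i. i < J \<Longrightarrow> F i \<le> F (Suc i)"
    and bd: "F J - F 0 \<le> int c" and J: "w * (c + 1) \<le> J"
  shows "\<exists>j. j + w \<le> J \<and> F (j + w) = F j"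
proof (rule ccontr)
  assume neg: "\<not> ?thesis"
  have le: "i \<le> j \<Longrightarrow> j \<le> J \<Longrightarrow> F i \<le> F j" for i j
  proof (induction j)
    case (Suc j)
    then show ?case using mono[of j] by (cases "i = Suc j") auto
  qed simp
  have lt: "j + w \<le> J \<Longrightarrow> F j < F (j + w)" for j
    using neg le[of j "j + w"] by force
  have "k \<le> c + 1 \<Longrightarrow> F 0 + int k \<le> F (w * k)" for k
  proof (induction k)
    case (Suc k)
    have "w * Suc k \<le> w * (c + 1)" using Suc.prems by (intro mult_le_mono) auto
    then have "w * k + w \<le> J" using J by (metis add.commute le_trans mult_Suc_right)
    from lt[OF this] Suc show ?case by (simp add: add.commute)
  qed simp
  from this[of "c + 1"] have "F 0 + int (c + 1) \<le> F (w * (c + 1))" by simp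
  also have "\<dots> \<le> F J" using le[OF J order_refl] .
  finally show False using bd by simp
qed

text \<open>The deficit of \<open>h\<close> against slope 1, sampled once per period, never
  decreases. Injectivity bounds its total by \<open>2 * P\<close>: the distinct values of
  \<open>h\<close> all lie between its first and its last value, up to an error of \<open>P\<close>
  at either end. A steady stretch of the deficit is then a run of slope exactly 1.\<close>

lemma long_run:
  fixes h :: "int \<Rightarrow> int" and P :: int and s0 :: int and L :: nat
  assumes P: "0 < P"
    and step: "\<And>s. s0 \<le> s \<Longrightarrow> s < s1 \<Longrightarrow> h (s + 1) \<le> h s + 1"
    and per: "\<And>s. s0 \<le> s \<Longrightarrow> s + P \<le> s1 \<Longrightarrow> h s < h (s + P)"
    and inj: "inj_on h {s0..s1}"
    and len: "s0 + P * (int L * (2 * P + 1)) \<le> s1"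
  shows "\<exists>A. s0 \<le> A \<and> A + P * int L \<le> s1 \<and> (\<forall>s. A \<le> s \<and> s \<le> A + P * int L \<longrightarrow> h s = h A + (s - A))"
proof -
  define J where "J = L * nat (2 * P + 1)"
  define F where "F j = P * int j - h (s0 + P * int j) " for j :: nat
  have J: "s0 + P * int J \<le> s1" using len P by (simp add: J_def)
  have up: "s0 \<le> s \<Longrightarrow> s \<le> t \<Longrightarrow> t \<le> s1 \<Longrightarrow> h t \<le> h s + (t - s)" for s t
  proof (induction "nat (t - s)" arbitrary: t)
    case (Suc n)
    have "h (t - 1) \<le> h s + (t - 1 - s)" using Suc.prems Suc.hyps(2) by (intro Suc.hyps) auto
    moreover have "h t \<le> h (t - 1) + 1" using step[of "t - 1"] Suc.prems Suc.hyps(2) by simp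
    ultimately show ?case by simp
  qed auto
  have per': "s0 \<le> s \<Longrightarrow> s + P * int i \<le> s1 \<Longrightarrow> h s \<le> h (s + P * int i)" for s i
  proof (induction i)
    case (Suc i)
    have "0 \<le> P * int i" using P by simp
    then have "h (s + P * int i) < h (s + P * int i + P)" using Suc.prems
      by (intro per) (auto simp: algebra_simps)
    moreover have "h s \<le> h (s + P * int i)" using Suc P by (intro Suc.IH) (auto simp: algebra_simps)
    ultimately show ?case by (simp add: algebra_simps)
  qed simp
  have mono: "F i \<le> F (Suc i)" if "i < J" for i
  proof -
    have "P * int (Suc i) \<le> P * int J" using that P by (intro mult_left_mono) auto
    then have "h (s0 + P * int i + P) \<le> h (s0 + P * int i) + P"
      using up[of "s0 + P * int i" "s0 + P * int i + P"] J P by (auto simp: algebra_simps)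
    then show ?thesis by (simp add: F_def algebra_simps)
  qed
  have bd: "F J - F 0 \<le> int (nat (2 * P))"
  proof (cases "J = 0")
    case True then show ?thesis by (simp add: P less_imp_le)
  next
    case False
    let ?e = "s0 + P * int J"
    have eP: "s0 + P \<le> ?e" using False P by (cases J) (simp_all add: distrib_left)
    have lo: "h s0 - P < h t" if t: "s0 \<le> t" "t \<le> ?e" for t
    proof -
      define r where "r = (t - s0) mod P"
      define i where "i = nat ((t - s0) div P)"
      have "int i = (t - s0) div P" using P t by (simp add: i_def pos_imp_zdiv_nonneg_iff)
      then have r: "0 \<le> r" "r < P" "t = s0 + r + P * int i"
        using P mult_div_mod_eq[of P "t - s0"] by (simp_all add: r_def)
      have "h (s0 + P) \<le> h (s0 + r) + (P - r)" using up[of "s0 + r" "s0 + P"] r eP J by auto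
      moreover have "h s0 < h (s0 + P)" using per[of s0] eP J by auto
      moreover have "h (s0 + r) \<le> h t" using per'[of "s0 + r" i] r t J by auto
      ultimately show ?thesis using r by auto
    qed
    have hi: "h t < h ?e + P" if t: "s0 \<le> t" "t \<le> ?e" for t
    proof -
      define r where "r = (?e - t) mod P"
      define i where "i = nat ((?e - t) div P)"
      have "int i = (?e - t) div P" using P t by (simp add: i_def pos_imp_zdiv_nonneg_iff)
      then have r: "0 \<le> r" "r < P" "?e = t + r + P * int i"
        using P mult_div_mod_eq[of P "?e - t"] by (simp_all add: r_def)
      have "h t \<le> h (t + P * int i)" using per'[of t i] r t J by auto
      also have "t + P * int i = ?e - r" using r by simp
      also have "h (?e - r) \<le> h (?e - P) + (P - r)"
        using up[of "?e - P" "?e - r"] r eP J by auto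
      also have "h (?e - P) < h ?e" using per[of "?e - P"] eP J by auto
      finally show ?thesis using r by auto
    qed
    have "h ` {s0..?e} \<subseteq> {h s0 - P<..<h ?e + P}" using lo hi by auto
    then have "card (h ` {s0..?e}) \<le> card {h s0 - P<..<h ?e + P}" by (intro card_mono) auto
    moreover have "card (h ` {s0..?e}) = card {s0..?e}"
      by (rule card_image, rule inj_on_subset[OF inj]) (use J in auto)
    moreover have "0 \<le> P * int J" using P by simp
    ultimately have "P * int J \<le> h ?e - h s0 + 2 * P" by (simp add: nat_le_eq_zle)
    then show ?thesis using P by (simp add: F_def)
  qed
  have "\<exists>j. j + L \<le> J \<and> F (j + L) = F j"
  proof (rule steady_window[OF mono bd])
    show "L * (nat (2 * P) + 1) \<le> J" using P by (simp add: J_def nat_add_distrib)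
  qed
  then obtain j where j: "j + L \<le> J" "F (j + L) = F j" by blast
  let ?A = "s0 + P * int j"
  have e: "?A + P * int L \<le> s1"
  proof -
    have "P * int (j + L) \<le> P * int J" using j(1) P by (intro mult_left_mono) auto
    then show ?thesis using J by (simp add: algebra_simps)
  qed
  have eq: "h (?A + P * int L) = h ?A + P * int L" using j(2) by (simp add: F_def algebra_simps)
  have Pj: "0 \<le> P * int j" using P by simp
  \<comment> \<open>Each step gains at most one and the whole stretch gains its full length, which
    leaves no slack at any time in between.\<close>
  have "h s = h ?A + (s - ?A)" if "?A \<le> s" "s \<le> ?A + P * int L" for s
    using up[of ?A s] up[of s "?A + P * int L"] that e eq Pj by auto
  moreover have "s0 \<le> ?A" using Pj by simp
  ultimately show ?thesis using e by blast
qed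

section \<open>Betweenness within a zigzag\<close>

text \<open>
  \<open>cid t\<close> is the line (a row or a column of the matrix) carrying the link \<open>t\<close>; its parity \<open>sgv\<close> says
  whether keys increase or decrease along the line.
\<close>

locale osc =
  fixes P :: int and cid :: "int \<Rightarrow> int"
  assumes evenP: "even P" and P2: "2 \<le> P" and periodic: "cid (t + P) = cid t"
begin

definition line :: "bool \<Rightarrow> int \<times> int \<Rightarrow> int" where
  "line a p = cid (link a (fst p))"

definition lt :: "bool \<Rightarrow> int \<times> int \<Rightarrow> int \<times> int \<Rightarrow> bool" where
  "lt a p q \<longleftrightarrow> line a p < line a q \<or>
     line a p = line a q \<and> sgv (line a p) * pkey a p < sgv (line a p) * pkey a q"

definition betw :: "bool \<Rightarrow> int \<times> int \<Rightarrow> int \<times> int \<Rightarrow> int \<times> int \<Rightarrow> bool" where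
  "betw a p r q \<longleftrightarrow> lt a p r \<and> lt a r q \<or> lt a q r \<and> lt a r p"

lemma cid_plus [simp]: "cid (t + P) = cid t"
  by (rule periodic)

lemma cid_minus [simp]: "cid (t - P) = cid t"
  by (metis periodic diff_add_cancel)

lemma lt_same:
  assumes "line a p = line a q"
  shows "lt a p q \<longleftrightarrow> (if odd (line a p) then pkey a p < pkey a q else pkey a q < pkey a p)"
  using assms by (simp add: lt_def sgv_def)

lemma lt_diff: "line a p \<noteq> line a q \<Longrightarrow> lt a p q \<longleftrightarrow> line a p < line a q"
  by (auto simp: lt_def)

lemma lt_line: "lt a p q \<Longrightarrow> line a p \<le> line a q"
  by (auto simp: lt_def)

lemma betw_sameI:
  assumes "line a p = v" "line a q = v" "line a r = v"
    and "pkey a p < pkey a r" "pkey a r < pkey a q"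
  shows "betw a p r q"
  using assms by (simp add: betw_def lt_same)

lemma betw_same:
  assumes "line a p = v" "line a q = v" "betw a p r q" "pkey a p < pkey a q"
  shows "line a r = v" "pkey a p < pkey a r" "pkey a r < pkey a q"
proof -
  show v: "line a r = v"
    using assms(1-3) lt_line[of a p r] lt_line[of a r q] lt_line[of a q r] lt_line[of a r p]
    unfolding betw_def by linarith
  have "pkey a p < pkey a r \<and> pkey a r < pkey a q"
    using assms v by (cases "odd v") (auto simp: betw_def lt_same)
  then show "pkey a p < pkey a r" "pkey a r < pkey a q" by auto
qed

text \<open>A line is an interval of the order \<open>lt\<close>, so on the way from
  \<open>p\<close> to a point outside the line one of the two key neighbours is passed.\<close>

lemma betw_outI:
  assumes "line a p = v" "line a r1 = v" "line a r2 = v" "line a q \<noteq> v"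
    and "pkey a r1 < pkey a p" "pkey a p < pkey a r2"
  shows "betw a p r1 q \<or> betw a p r2 q"
  using assms linorder_less_linear[of v "line a q"]
  by (cases "odd v") (auto simp: betw_def lt_same lt_diff)

lemma betw_sym: "betw a p r q = betw a q r p"
  by (auto simp: betw_def)

text \<open>On the line of link \<open>s\<close> the key of the point \<open>s - 1\<close> is just
  above that of \<open>s\<close>, and the key of \<open>s - P\<close> is below it. A later point on
  the same line has its key above \<open>s - 1\<close>; a point on another line is cut off from
  \<open>s\<close> by one of the two.\<close>

lemma sep_low:
  assumes s: "P \<le> s" "s < s'" "s' < N" and b: "b = 0 \<or> b = 1" "b' = 0 \<or> b' = 1"
  shows "\<exists>r a. 0 \<le> r \<and> r < N \<and> betw a (s, b) (r, 0) (s', b')"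
proof -
  define a where "a = even s"
  have l: "line a (s, b) = cid s" "line a (s - 1, 0) = cid s" "line a (s - P, 0) = cid s"
    and k: "pkey a (s, b) = 2 * s + b" "pkey a (s - 1, 0) = 2 * s + 2" "pkey a (s - P, 0) = 2 * s - 2 * P"
    using evenP by (auto simp: line_def link_def a_def pkey_def tkey_def)
  show ?thesis
  proof (cases "line a (s', b') = cid s")
    case True
    have "2 * s + 2 < pkey a (s', b')"
      using s b by (auto simp: pkey_def tkey_def a_def; presburger)
    then have "betw a (s, b) (s - 1, 0) (s', b')"
      using l k True b by (intro betw_sameI[where v = "cid s"]) auto
    then show ?thesis using s P2 by (intro exI[of _ "s - 1"] exI[of _ a]) auto
  next
    case False
    have "betw a (s, b) (s - P, 0) (s', b') \<or> betw a (s, b) (s - 1, 0) (s', b')"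
      using l k False b P2 by (intro betw_outI[where v = "cid s"]) auto
    moreover have "0 \<le> s - P" "s - P < N" "0 \<le> s - 1" "s - 1 < N" using s P2 by auto
    ultimately show ?thesis by metis
  qed
qed

text \<open>Mirror image of \<open>sep_low\<close>, for use near the start of the zigzag: the
  separating points \<open>s' + 1\<close> and \<open>s' + P\<close> come later than both.\<close>

lemma sep_high:
  assumes s: "0 \<le> s" "s < s'" "s' + P < N" and b: "b = 0 \<or> b = 1" "b' = 0 \<or> b' = 1"
  shows "\<exists>r a. 0 \<le> r \<and> r < N \<and> betw a (s, b) (r, 0) (s', b')"
proof -
  define a where "a = odd s'"
  have l: "line a (s', b') = cid (s' + 1)" "line a (s' + 1, 0) = cid (s' + 1)"
    "line a (s' + P, 0) = cid (s' + 1)"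
    using evenP periodic[of "s' + 1"] by (auto simp: line_def link_def a_def algebra_simps)
  have k: "pkey a (s', b') = 2 * s' + 4 + b'" "pkey a (s' + 1, 0) = 2 * s' + 2"
    "pkey a (s' + P, 0) = 2 * s' + 4 + 2 * P"
    using evenP by (auto simp: a_def pkey_def tkey_def)
  show ?thesis
  proof (cases "line a (s, b) = cid (s' + 1)")
    case True
    have "pkey a (s, b) < 2 * s' + 2"
      using s b by (auto simp: pkey_def tkey_def a_def; presburger)
    then have "betw a (s, b) (s' + 1, 0) (s', b')"
      using l k True b by (intro betw_sameI[where v = "cid (s' + 1)"]) auto
    then show ?thesis using s P2 by (intro exI[of _ "s' + 1"] exI[of _ a]) auto
  next
    case False
    have "betw a (s', b') (s' + 1, 0) (s, b) \<or> betw a (s', b') (s' + P, 0) (s, b)"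
      using l k False b P2 by (intro betw_outI[where v = "cid (s' + 1)"]) auto
    moreover have "0 \<le> s' + P" "s' + P < N" "0 \<le> s' + 1" "s' + 1 < N" using s P2 by auto
    ultimately show ?thesis unfolding betw_sym[of a "(s', b')"] by metis
  qed
qed

text \<open>The keys of a point and its double differ by one, so nothing fits between them. Together
  with \<open>sep_low\<close> and \<open>sep_high\<close> this makes image times distinct.\<close>

lemma not_betw_twin:
  assumes "snd p = 0 \<or> snd p = 1" "snd q = 0 \<or> snd q = 1" "snd r = 0 \<or> snd r = 1" "fst p = fst q"
  shows "\<not> betw a p r q"
proof
  assume bt: "betw a p r q"
  have pq: "line a p = line a q" using assms by (simp add: line_def)
  have ne: "pkey a p \<noteq> pkey a q" using bt lt_same[of a p r] lt_same[of a r q] lt_same[of a q r] lt_same[of a r p] 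
     lt_line[of a p r] lt_line[of a r q] lt_line[of a q r] lt_line[of a r p] pq
    unfolding betw_def by (smt (verit))
  have "pkey a p < pkey a r \<and> pkey a r < pkey a q \<or> pkey a q < pkey a r \<and> pkey a r < pkey a p"
    using betw_same[OF pq refl bt] betw_same[OF refl pq bt[unfolded betw_sym[of a p]]] ne pq by linarith
  then show False using assms by (auto simp: pkey_def)
qed

lemma lt_total: "p \<in> opts N \<Longrightarrow> q \<in> opts N' \<Longrightarrow> p \<noteq> q \<Longrightarrow> lt a p q \<or> lt a q p"
  using pkey_inj[of p q a] opts_snd[of p N] opts_snd[of q N'] linorder_less_linear[of "pkey a p" "pkey a q"]
  by (cases "line a p = line a q") (auto simp: lt_same lt_diff)

lemma lt_irrefl: "\<not> lt a p p" by (auto simp: lt_def)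

end

context osc begin

lemma cid_shift: "cid (t + P * int k) = cid t"
proof (induction k)
  case (Suc k)
  have "t + P * int (Suc k) = (t + P * int k) + P" by (simp add: algebra_simps)
  then show ?case using Suc periodic[of "t + P * int k"] by metis
qed simp

lemma cid_mod: "cid (t mod P) = cid t"
proof (cases "0 \<le> t div P")
  case True
  then have "t = t mod P + P * int (nat (t div P))" by simp
  then show ?thesis by (metis cid_shift)
next
  case False
  then have "t mod P = t + P * int (nat (- (t div P)))"
    by (simp add: minus_mult_div_eq_mod[symmetric])
  then show ?thesis by (metis cid_shift)
qed

lemma cid_bound: "\<exists>M::nat. \<forall>t. \<bar>cid t\<bar> \<le> int M"
proof -
  have "finite ((\<lambda>t. \<bar>cid t\<bar>) ` {0..<P})" by simp
  then obtain M where M: "\<forall>x\<in>(\<lambda>t. \<bar>cid t\<bar>) ` {0..<P}. x \<le> M"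
    by (meson Max_ge)
  have "\<bar>cid t\<bar> \<le> int (nat M)" for t
  proof -
    have "t mod P \<in> {0..<P}" using P2 by simp
    then have "\<bar>cid (t mod P)\<bar> \<le> M" using M by blast
    then show ?thesis unfolding cid_mod by linarith
  qed
  then show ?thesis by blast
qed

end

lemma sgv_cases: "sgv v = 1 \<or> sgv v = - 1"
  by (simp add: sgv_def)

lemma tkey_both_less:
  "tkey True u < tkey True v \<Longrightarrow> tkey False u < tkey False v \<Longrightarrow> u < v"
  unfolding tkey_def by (simp split: if_splits; presburger)

text \<open>The two keys of a time \<open>u\<close> are \<open>u\<close> and \<open>u + 2\<close> in
  some order, so across a gap of two or more both keys follow the order of the times.\<close>

lemma tkey_opposite:
  "tkey a u < tkey a v \<Longrightarrow> tkey (\<not> a) v < tkey (\<not> a) u \<Longrightarrow> \<bar>u - v\<bar> = 1"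
  unfolding tkey_def by (cases a) (simp_all split: if_splits; presburger)+

lemma tkey_le: "tkey a u < tkey a v \<Longrightarrow> u \<le> v + 1"
  unfolding tkey_def by (cases a) (simp_all split: if_splits)

section \<open>Embeddings between zigzags\<close>

text \<open>Both zigzags run over the same lines \<open>cid\<close> and differ only in length.
  Nothing is assumed about how \<open>f\<close> moves points between lines.\<close>

locale osc_emb = osc +
  fixes N N' :: int and f :: "int \<times> int \<Rightarrow> int \<times> int"
  assumes N2: "2 \<le> N" and N2': "2 \<le> N'"
    and fmap: "p \<in> opts N \<Longrightarrow> f p \<in> opts N'"
    and fpres: "p \<in> opts N \<Longrightarrow> q \<in> opts N \<Longrightarrow> lt a (f p) (f q) \<longleftrightarrow> lt a p q"
begin

definition g :: "int \<Rightarrow> int" where "g s = fst (f (s, 0))"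

definition C :: "bool \<Rightarrow> int \<Rightarrow> int" where "C a s = line a (f (s, 0))"

definition tt :: "bool \<Rightarrow> int \<Rightarrow> int" where "tt a s = cid (link a s)"

text \<open>Among points of one line whose images share a line, \<open>1\<close> means that
  \<open>f\<close> keeps the order of keys and \<open>- 1\<close> that it reverses it.\<close>

definition ee :: "bool \<Rightarrow> int \<Rightarrow> int" where "ee a s = sgv (C a s) * sgv (tt a s)"

lemma optsI [intro]: "0 \<le> s \<Longrightarrow> s < N \<Longrightarrow> (s, 0) \<in> opts N"
  by (simp add: opts_def)

lemma f_inj: "p \<in> opts N \<Longrightarrow> q \<in> opts N \<Longrightarrow> p \<noteq> q \<Longrightarrow> f p \<noteq> f q"
  using lt_total[of p N q N True] fpres[of p q True] fpres[of q p True] lt_irrefl by metis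

lemma betw_pres:
  "betw a p r q \<Longrightarrow> p \<in> opts N \<Longrightarrow> q \<in> opts N \<Longrightarrow> r \<in> opts N \<Longrightarrow> betw a (f p) (f r) (f q)"
  using fpres by (auto simp: betw_def)

text \<open>Betweenness survives \<open>f\<close>, whereas nothing lies between two points of equal
  time. The condition \<open>far\<close> ensures that the separating points of
  \<open>sep_low\<close> or \<open>sep_high\<close> belong to the zigzag.\<close>

lemma time_inj:
  assumes p: "p \<in> opts N" "q \<in> opts N" "fst p < fst q" and far: "P \<le> fst p \<or> fst q + P < N"
  shows "fst (f p) \<noteq> fst (f q)"
proof
  assume eq: "fst (f p) = fst (f q)"
  have "\<exists>r a. 0 \<le> r \<and> r < N \<and> betw a (fst p, snd p) (r, 0) (fst q, snd q)"
    using sep_low[of "fst p" "fst q" N "snd p" "snd q"] sep_high[of "fst p" "fst q" N "snd p" "snd q"]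
      p far opts_fst[of p N] opts_fst[of q N] opts_snd[of p N] opts_snd[of q N] N2 by auto
  then obtain r a where r: "(r, 0) \<in> opts N" "betw a p (r, 0) q" by auto
  have "betw a (f p) (f (r, 0)) (f q)" using betw_pres[OF r(2)] r p by blast
  moreover have "\<not> betw a (f p) (f (r, 0)) (f q)"
    using eq fmap r p opts_snd by (intro not_betw_twin) blast+
  ultimately show False by blast
qed

lemma g_inj: "0 \<le> s \<Longrightarrow> s < t \<Longrightarrow> t < N \<Longrightarrow> P \<le> s \<or> t + P < N \<Longrightarrow> g s \<noteq> g t"
  using time_inj[of "(s, 0)" "(t, 0)"] optsI[of s] optsI[of t] by (auto simp: g_def)

lemma line_tt: "line a (s, b) = tt a s"
  by (simp add: line_def tt_def)

lemma tt_P [simp]: "tt a (s + P) = tt a s"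
proof -
  have "link a (s + P) = link a s + P" using evenP by (simp add: link_def)
  then show ?thesis by (simp add: tt_def)
qed

lemma tkey_P [simp]: "tkey a (s + P) = tkey a s + P"
  using evenP by (simp add: tkey_def)

text \<open>Since \<open>lt\<close> compares lines first, moving upwards within one line can move
  the images only to the same or higher lines.\<close>

lemma C_tkey_mono:
  assumes "0 \<le> s" "s < N" "0 \<le> t" "t < N" "tt a s = tt a t" "tkey a s < tkey a t"
  shows "sgv (tt a s) * C a s \<le> sgv (tt a s) * C a t"
proof -
  have "pkey a (s, 0) < pkey a (t, 0)" using assms by (simp add: pkey_def)
  then have "if odd (tt a s) then lt a (s, 0) (t, 0) else lt a (t, 0) (s, 0)"
    using assms by (simp add: lt_same line_tt)
  then have "if odd (tt a s) then lt a (f (s, 0)) (f (t, 0)) else lt a (f (t, 0)) (f (s, 0))"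
    using assms by (simp add: fpres optsI split: if_splits)
  then show ?thesis using lt_line by (auto simp: C_def sgv_def split: if_splits)
qed

text \<open>The signed line numbers of the images, summed over all residues and both directions,
  form a bounded potential that is monotone along the periods. It is constant over some window of
  \<open>w\<close> periods, and then so is each summand.\<close>

lemma window:
  fixes w :: nat
  assumes M: "\<And>t. \<bar>cid t\<bar> \<le> int M"
    and len: "P * (int w * (4 * int M * P + 1) + 3) \<le> N"
  shows "\<exists>s0. P \<le> s0 \<and> s0 + P * int w + P \<le> N \<and>
    (\<forall>a s. s0 \<le> s \<and> s + P \<le> s0 + P * int w \<longrightarrow> C a (s + P) = C a s)"
proof -
  \<comment> \<open>There are \<open>2 * P\<close> summands, and each varies by at most
    \<open>2 * int M\<close>.\<close>
  define c where "c = 4 * M * nat P"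
  define J where "J = w * (c + 1)"
  define I where "I = (UNIV :: bool set) \<times> {0..<P}"
  define T where "T j x = sgv (tt (fst x) (snd x)) * C (fst x) (P + snd x + P * int j)" for j :: nat and x
  define F where "F j = (\<Sum>x\<in>I. T j x)" for j
  have fin: "finite I" by (simp add: I_def)
  have ic: "int c = 4 * int M * P" using P2 by (simp add: c_def)
  have J: "P * (int J + 3) \<le> N" using len by (simp add: J_def ic distrib_left)
  have ttk: "tt a (P + r + P * int j) = tt a r" for a r j
  proof -
    have "link a (P + r + P * int j) = link a r + P * int (Suc j)"
      using evenP by (simp add: link_def algebra_simps)
    then show ?thesis using cid_shift[of "link a r" "Suc j"] by (simp add: tt_def)
  qed
  have Tm: "T j x \<le> T (Suc j) x" if "j < J" "x \<in> I" for j x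
  proof -
    obtain a r where x: "x = (a, r)" "0 \<le> r" "r < P" using that(1) \<open>x \<in> I\<close>[unfolded I_def] by (metis SigmaE atLeastLessThan_iff)
    have "P * int (Suc j) \<le> P * int J" using that P2 by (intro mult_left_mono) auto
    define y where "y = P + r + P * int j"
    have "y + P < N" "0 \<le> y" using \<open>P * int (Suc j) \<le> P * int J\<close> J x P2
      by (auto simp: y_def algebra_simps)
    then have "sgv (tt a y) * C a y \<le> sgv (tt a y) * C a (y + P)"
      using P2 by (intro C_tkey_mono) auto
    moreover have "y + P = P + r + P * int (Suc j)" by (simp add: y_def algebra_simps)
    moreover have "tt a y = tt a r" by (simp add: y_def ttk)
    ultimately show ?thesis unfolding T_def x fst_conv snd_conv by (metis y_def)
  qed
  have Tle: "T i x \<le> T j x" if "i \<le> j" "j \<le> J" "x \<in> I" for i j x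
    using that by (induction j) (auto simp: le_Suc_eq intro: order_trans[OF _ Tm])
  have "F j \<le> F (Suc j)" if "j < J" for j
    unfolding F_def by (rule sum_mono) (rule Tm[OF that])
  moreover have "F J - F 0 \<le> int c"
  proof -
    have "\<bar>T j x\<bar> \<le> int M" for j x
      using M sgv_cases[of "tt (fst x) (snd x)"] by (auto simp: T_def abs_mult C_def line_def)
    then have b: "T J x - T 0 x \<le> 2 * int M" for x by (smt (verit))
    have "F J - F 0 = (\<Sum>x\<in>I. T J x - T 0 x)" by (simp add: F_def sum_subtractf)
    also have "\<dots> \<le> (\<Sum>x\<in>I. 2 * int M)" by (rule sum_mono) (rule b)
    also have "\<dots> = int c" using P2 by (simp add: I_def ic)
    finally show ?thesis .
  qed
  ultimately obtain j where j: "j + w \<le> J" "F (j + w) = F j"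
    using steady_window[of J F c w] by (auto simp: J_def)
  have Teq: "T (j + w) x = T j x" if "x \<in> I" for x
    using sum_mono_inv[of "T j" I "T (j + w)" x] j Tle fin that by (auto simp: F_def)
  define s0 where "s0 = P + P * int j"
  have "C a (s + P) = C a s" if s: "s0 \<le> s" "s + P \<le> s0 + P * int w" for a s
  proof -
    define r where "r = (s - s0) mod P"
    define i where "i = nat ((s - s0) div P)"
    have "int i = (s - s0) div P" using P2 s by (simp add: i_def pos_imp_zdiv_nonneg_iff)
    then have r: "0 \<le> r" "r < P" "s = s0 + r + P * int i"
      using P2 mult_div_mod_eq[of P "s - s0"] by (simp_all add: r_def)
    have "P * (int i + 1) \<le> P * int w" using s r by (simp add: algebra_simps)
    then have iw: "Suc i \<le> w" using P2 by simp
    have x: "(a, r) \<in> I" using r by (simp add: I_def)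
    have "T (j + i) (a, r) = T j (a, r)" "T (j + Suc i) (a, r) = T j (a, r)"
      using Tle[of j "j + i" "(a, r)"] Tle[of "j + i" "j + w" "(a, r)"]
        Tle[of j "j + Suc i" "(a, r)"] Tle[of "j + Suc i" "j + w" "(a, r)"] Teq[OF x] x iw j
      by auto
    then have "T (j + i) (a, r) = T (j + Suc i) (a, r)" by simp
    then have "C a (P + r + P * int (j + i)) = C a (P + r + P * int (j + Suc i))"
      using sgv_cases[of "tt a r"] by (auto simp: T_def)
    moreover have "P + r + P * int (j + i) = s" "P + r + P * int (j + Suc i) = s + P"
      by (simp_all add: r s0_def algebra_simps)
    ultimately show ?thesis by metis
  qed
  moreover have "s0 + P * int w + P \<le> N"
  proof -
    have "P * int (j + w) \<le> P * int J" using j P2 by (intro mult_left_mono) auto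
    then show ?thesis using J P2 by (simp add: s0_def algebra_simps)
  qed
  moreover have "P \<le> s0" using P2 by (simp add: s0_def)
  ultimately show ?thesis by blast
qed

end

context osc_emb begin

text \<open>On link \<open>B + 1\<close> the new point lies between \<open>B - P\<close> and
  \<open>B\<close>, so its image lies between theirs. All but one of the times available there are
  already taken, and \<open>time_inj\<close> forbids using them again. The condition on
  \<open>eps\<close> and \<open>D\<close> singles out the shifts and reflections that map links to
  links of the same direction: a shift must be even, and a reflection must have an odd sum.\<close>

lemma propagate_up:
  assumes eps: "eps = 1 \<and> even D \<or> eps = - 1 \<and> odd D"
    and A: "P \<le> A" "A + P \<le> B" "B < N"
    and st: "\<And>s. A \<le> s \<Longrightarrow> s \<le> B \<Longrightarrow> g s = eps * s + D"
    and q: "q \<in> opts N" "fst q = B + 1"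
  shows "fst (f q) = eps * (B + 1) + D"
proof -
  define a where "a = odd B"
  define u where "u = fst (f q)"
  have gB: "g B = eps * B + D" and gBP: "g (B - P) = eps * (B - P) + D" using st A P2 by auto
  have q01: "snd q = 0 \<or> snd q = 1" using q opts_snd by blast
  have mem: "(B, 0) \<in> opts N" "(B - P, 0) \<in> opts N" using A P2 by auto
  have "betw a (B - P, 0) q (B, 0)"
  proof (rule betw_sameI)
    show "line a (B - P, 0) = cid (B + 1)" "line a (B, 0) = cid (B + 1)" "line a q = cid (B + 1)"
      using evenP q cid_minus[of "B + 1"] by (auto simp: line_def link_def a_def algebra_simps)
    show "pkey a (B - P, 0) < pkey a q" "pkey a q < pkey a (B, 0)"
      using evenP q q01 P2 by (auto simp: pkey_def tkey_def a_def)
  qed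
  then have bt: "betw a (f (B - P, 0)) (f q) (f (B, 0))" by (rule betw_pres) (use mem q in auto)
  have f2: "snd (f (B - P, 0)) = 0 \<or> snd (f (B - P, 0)) = 1" "snd (f (B, 0)) = 0 \<or> snd (f (B, 0)) = 1"
    "snd (f q) = 0 \<or> snd (f q) = 1" using fmap mem q opts_snd by blast+
  have unused: "u \<noteq> g s" if "B - P \<le> s" "s \<le> B" for s
    using time_inj[of "(s, 0)" q] q that A P2 optsI[of s] by (auto simp: u_def g_def)
  have line1: "line a (f (B - P, 0)) = line a (f (B, 0))"
  proof -
    have "link a (g (B - P)) = link a (g B) - eps * P"
      using eps evenP unfolding gB gBP by (auto simp: link_def algebra_simps)
    then show ?thesis using eps by (auto simp: line_def g_def)
  qed
  have "g (B - P) = g B - eps * P" unfolding gB gBP by (simp add: algebra_simps)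
  then have gP: "tkey a (g (B - P)) = tkey a (g B) - eps * P"
    using eps evenP by (auto simp: tkey_def)
  show ?thesis
  proof (cases "eps = 1")
    case True
    then have D: "even D" using eps by simp
    have "pkey a (f (B - P, 0)) < pkey a (f (B, 0))"
      using gP f2 P2 True by (auto simp: pkey_def g_def)
    from betw_same[OF line1 refl bt this] have "tkey a (g B) - P \<le> tkey a u" "tkey a u \<le> tkey a (g B)"
      using f2 gP True by (auto simp: pkey_def g_def u_def)
    moreover have "even (g B) \<longleftrightarrow> even B" using gB True D by simp
    ultimately have "g B - P \<le> u \<and> u \<le> g B + 1"
      using evenP by (auto simp: tkey_def a_def split: if_splits) presburger+
    moreover have "u \<noteq> g (u - D)" if "g B - P \<le> u" "u \<le> g B"
      using unused[of "u - D"] that gB True by auto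
    moreover have "g (u - D) = u" if "g B - P \<le> u" "u \<le> g B"
      using st[of "u - D"] that gB True A by auto
    ultimately have "u = g B + 1" by (smt (verit))
    then show ?thesis using gB True by (simp add: u_def)
  next
    case False
    then have e: "eps = - 1" and D: "odd D" using eps by auto
    have "pkey a (f (B, 0)) < pkey a (f (B - P, 0))"
      using gP f2 P2 e by (auto simp: pkey_def g_def)
    from betw_same[OF line1[symmetric] refl bt[unfolded betw_sym[of a "f (B - P, 0)"]] this]
    have "tkey a (g B) \<le> tkey a u" "tkey a u \<le> tkey a (g B) + P"
      using f2 gP e by (auto simp: pkey_def g_def u_def)
    moreover have "even (g B) \<longleftrightarrow> odd B" using gB e D by simp
    ultimately have "g B - 1 \<le> u \<and> u \<le> g B + P"
      using evenP by (auto simp: tkey_def a_def split: if_splits) presburger+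
    moreover have "u \<noteq> g (D - u)" if "g B \<le> u" "u \<le> g B + P"
      using unused[of "D - u"] that gB e by auto
    moreover have "g (D - u) = u" if "g B \<le> u" "u \<le> g B + P"
      using st[of "D - u"] that gB e A by auto
    ultimately have "u = g B - 1" by (smt (verit))
    then show ?thesis using gB e by (simp add: u_def)
  qed
qed

text \<open>The same argument on link \<open>A\<close>, where the point \<open>A - 1\<close> lies
  between \<open>A\<close> and \<open>A + P\<close>.\<close>

lemma propagate_down:
  assumes eps: "eps = 1 \<and> even D \<or> eps = - 1 \<and> odd D"
    and A: "1 \<le> A" "A + P \<le> B" "B < N" "A + 2 * P < N"
    and st: "\<And>s. A \<le> s \<Longrightarrow> s \<le> B \<Longrightarrow> g s = eps * s + D"
    and q: "q \<in> opts N" "fst q = A - 1"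
  shows "fst (f q) = eps * (A - 1) + D"
proof -
  define a where "a = even A"
  define u where "u = fst (f q)"
  have gA: "g A = eps * A + D" and gAP: "g (A + P) = eps * (A + P) + D" using st A P2 by auto
  have q01: "snd q = 0 \<or> snd q = 1" using q opts_snd by blast
  have mem: "(A, 0) \<in> opts N" "(A + P, 0) \<in> opts N" using A P2 by auto
  have "betw a (A, 0) q (A + P, 0)"
  proof (rule betw_sameI)
    show "line a (A, 0) = cid A" "line a (A + P, 0) = cid A" "line a q = cid A"
      using evenP q by (auto simp: line_def link_def a_def)
    show "pkey a (A, 0) < pkey a q" "pkey a q < pkey a (A + P, 0)"
      using evenP q q01 P2 by (auto simp: pkey_def tkey_def a_def)
  qed
  then have bt: "betw a (f (A, 0)) (f q) (f (A + P, 0))" by (rule betw_pres) (use mem q in auto)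
  have f2: "snd (f (A + P, 0)) = 0 \<or> snd (f (A + P, 0)) = 1" "snd (f (A, 0)) = 0 \<or> snd (f (A, 0)) = 1"
    "snd (f q) = 0 \<or> snd (f q) = 1" using fmap mem q opts_snd by blast+
  have unused: "u \<noteq> g s" if "A \<le> s" "s \<le> A + P" for s
    using time_inj[of q "(s, 0)"] q that A optsI[of s] by (auto simp: u_def g_def)
  have line1: "line a (f (A, 0)) = line a (f (A + P, 0))"
  proof -
    have "link a (g (A + P)) = link a (g A) + eps * P"
      using eps evenP unfolding gA gAP by (auto simp: link_def algebra_simps)
    then show ?thesis using eps by (auto simp: line_def g_def)
  qed
  have "g (A + P) = g A + eps * P" unfolding gA gAP by (simp add: algebra_simps)
  then have gP: "tkey a (g (A + P)) = tkey a (g A) + eps * P"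
    using eps evenP by (auto simp: tkey_def)
  show ?thesis
  proof (cases "eps = 1")
    case True
    then have D: "even D" using eps by simp
    have "pkey a (f (A, 0)) < pkey a (f (A + P, 0))"
      using gP f2 P2 True by (auto simp: pkey_def g_def)
    from betw_same[OF line1 refl bt this] have "tkey a (g A) \<le> tkey a u" "tkey a u \<le> tkey a (g A) + P"
      using f2 gP True by (auto simp: pkey_def g_def u_def)
    moreover have "even (g A) \<longleftrightarrow> even A" using gA True D by simp
    ultimately have "g A - 1 \<le> u \<and> u \<le> g A + P"
      using evenP by (auto simp: tkey_def a_def split: if_splits) presburger+
    moreover have "u \<noteq> g (u - D)" if "g A \<le> u" "u \<le> g A + P"
      using unused[of "u - D"] that gA True by auto
    moreover have "g (u - D) = u" if "g A \<le> u" "u \<le> g A + P"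
      using st[of "u - D"] that gA True A by auto
    ultimately have "u = g A - 1" by (smt (verit))
    then show ?thesis using gA True by (simp add: u_def)
  next
    case False
    then have e: "eps = - 1" and D: "odd D" using eps by auto
    have "pkey a (f (A + P, 0)) < pkey a (f (A, 0))"
      using gP f2 P2 e by (auto simp: pkey_def g_def)
    from betw_same[OF line1[symmetric] refl bt[unfolded betw_sym[of a "f (A, 0)"]] this]
    have "tkey a (g A) - P \<le> tkey a u" "tkey a u \<le> tkey a (g A)"
      using f2 gP e by (auto simp: pkey_def g_def u_def)
    moreover have "even (g A) \<longleftrightarrow> odd A" using gA e D by simp
    ultimately have "g A - P \<le> u \<and> u \<le> g A + 1"
      using evenP by (auto simp: tkey_def a_def split: if_splits) presburger+
    moreover have "u \<noteq> g (D - u)" if "g A - P \<le> u" "u \<le> g A"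
      using unused[of "D - u"] that gA e by auto
    moreover have "g (D - u) = u" if "g A - P \<le> u" "u \<le> g A"
      using st[of "D - u"] that gA e A by auto
    ultimately have "u = g A + 1" by (smt (verit))
    then show ?thesis using gA e by (simp add: u_def)
  qed
qed

text \<open>The affine form reaches both ends and covers the doubles there. Two points with a common
  image time force this time to be an end of the target, as only ends are doubled; matching both
  ends leaves only equal lengths.\<close>

lemma propagate:
  assumes eps: "eps = 1 \<and> even D \<or> eps = - 1 \<and> odd D"
    and A: "P \<le> A" "A + P \<le> B" "B < N - 1" "A + 2 * P < N"
    and st: "\<And>s. A \<le> s \<Longrightarrow> s \<le> B \<Longrightarrow> g s = eps * s + D"
  shows "N = N'"
proof -
  have up: "\<forall>s. A \<le> s \<and> s \<le> B + int k \<longrightarrow> g s = eps * s + D" if "B + int k < N" for k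
    using that
  proof (induction k)
    case 0 then show ?case using st by simp
  next
    case (Suc k)
    have IH: "\<forall>s. A \<le> s \<and> s \<le> B + int k \<longrightarrow> g s = eps * s + D" using Suc by simp
    have "g (B + int k + 1) = eps * (B + int k + 1) + D"
      unfolding g_def using eps A IH Suc.prems P2
      by (intro propagate_up[where A = A and B = "B + int k"]) auto
    moreover have "s \<le> B + int k \<or> s = B + int k + 1" if "s \<le> B + int (Suc k)" for s
      using that by auto
    ultimately show ?case using IH by blast
  qed
  have st1: "g s = eps * s + D" if "A \<le> s" "s \<le> N - 1" for s
    using up[of "nat (N - 1 - B)"] that A by auto
  have top: "fst (f q) = eps * (N - 1) + D" if "q \<in> opts N" "fst q = N - 1" for q
    using propagate_up[of eps D A "N - 2" q] eps A st1 that by auto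
  have down: "\<forall>s. A - int k \<le> s \<and> s \<le> N - 1 \<longrightarrow> g s = eps * s + D" if "int k \<le> A" for k
    using that
  proof (induction k)
    case 0 then show ?case using st1 by simp
  next
    case (Suc k)
    have IH: "\<forall>s. A - int k \<le> s \<and> s \<le> N - 1 \<longrightarrow> g s = eps * s + D" using Suc by simp
    have "g (A - int k - 1) = eps * (A - int k - 1) + D"
      unfolding g_def using eps A IH Suc.prems P2
      by (intro propagate_down[where A = "A - int k" and B = "N - 1"]) auto
    moreover have "A - int k \<le> s \<or> s = A - int k - 1" if "A - int (Suc k) \<le> s" for s
      using that by auto
    ultimately show ?case using IH by blast
  qed
  have st2: "g s = eps * s + D" if "1 \<le> s" "s \<le> N - 1" for s
    using down[of "nat (A - 1)"] that A P2 by auto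
  have bot: "fst (f q) = D" if "q \<in> opts N" "fst q = 0" for q
    using propagate_down[of eps D 1 "N - 1" q] eps A P2 st2 that by auto
  have m: "(0, 0) \<in> opts N" "(0, 1) \<in> opts N" "(N - 1, 0) \<in> opts N" "(N - 1, 1) \<in> opts N"
    using N2 by (auto simp: opts_def)
  have twin: "x = 0 \<or> x = N' - 1" "0 \<le> x \<and> x < N'"
    if "p \<in> opts N" "q \<in> opts N" "p \<noteq> q" "fst (f p) = x" "fst (f q) = x" for p q x
  proof -
    have ne: "f p \<noteq> f q" using f_inj that by blast
    have "snd (f p) = 1 \<or> snd (f q) = 1"
      using opts_snd[OF fmap[OF that(1)]] opts_snd[OF fmap[OF that(2)]] ne that by (auto simp: prod_eq_iff)
    then show "x = 0 \<or> x = N' - 1"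
      using fmap[OF that(1)] fmap[OF that(2)] that by (auto simp: opts_def)
    show "0 \<le> x \<and> x < N'" using opts_fst[OF fmap[OF that(1)]] N2' that by auto
  qed
  have "D = 0 \<or> D = N' - 1"
    using m bot by (intro twin(1)[of "(0, 0)" "(0, 1)"]) auto
  moreover have "eps * (N - 1) + D = 0 \<or> eps * (N - 1) + D = N' - 1"
    "0 \<le> eps * (N - 1) + D \<and> eps * (N - 1) + D < N'"
    using m top twin[of "(N - 1, 0)" "(N - 1, 1)" "eps * (N - 1) + D"] by auto
  ultimately show ?thesis using eps N2 N2' by auto
qed

lemma key_pres:
  assumes s: "0 \<le> s" "s < N" "0 \<le> t" "t < N" "tt a s = tt a t" "C a s = C a t" "g s \<noteq> g t"
  shows "tkey a s < tkey a t \<longleftrightarrow>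
    (if ee a s = 1 then tkey a (g s) < tkey a (g t) else tkey a (g t) < tkey a (g s))"
proof -
  have m: "(s, 0) \<in> opts N" "(t, 0) \<in> opts N" using s by auto
  have b: "snd (f (s, 0)) = 0 \<or> snd (f (s, 0)) = 1" "snd (f (t, 0)) = 0 \<or> snd (f (t, 0)) = 1"
    using opts_snd fmap m by blast+
  have kn: "tkey a (g s) \<noteq> tkey a (g t)" using s tkey_inj by blast
  then have k: "pkey a (f (s, 0)) < pkey a (f (t, 0)) \<longleftrightarrow> tkey a (g s) < tkey a (g t)"
    "pkey a (f (t, 0)) < pkey a (f (s, 0)) \<longleftrightarrow> tkey a (g t) < tkey a (g s)"
    using b by (auto simp: pkey_def g_def)
  have "lt a (f (s, 0)) (f (t, 0)) \<longleftrightarrow> lt a (s, 0) (t, 0)" using fpres m by blast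
  moreover have "lt a (s, 0) (t, 0) \<longleftrightarrow> (if odd (tt a s) then tkey a s < tkey a t else tkey a t < tkey a s)"
    using s by (simp add: lt_same line_tt pkey_def)
  moreover have "lt a (f (s, 0)) (f (t, 0)) \<longleftrightarrow>
    (if odd (C a s) then tkey a (g s) < tkey a (g t) else tkey a (g t) < tkey a (g s))"
    using s k by (simp add: lt_same C_def)
  moreover have "tkey a s < tkey a t \<or> tkey a t < tkey a s"
    using tkey_inj[of a s t] s by fastforce
  ultimately show ?thesis using kn
    by (simp add: ee_def sgv_def split: if_splits) linarith+
qed

text \<open>
  By pigeonhole, points of one line have their images on one line throughout some long window of
  times.  This forces the induced map of times to be a shift or a reflection on a long run, and
  betweenness propagates it to both ends of the zigzag, where the doubled points sit.
\<close>

theorem rigid: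
  fixes M :: nat
  assumes M: "\<And>t. \<bar>cid t\<bar> \<le> int M"
    and len: "P * ((6 * P + 20) * (4 * int M * P + 1) + 3) \<le> N"
  shows "N = N'"
proof -
  \<comment> \<open>\<open>long_run\<close> with \<open>L = 3\<close> consumes
    \<open>3 * (2 * P + 1)\<close> periods, and the cut from \<open>s1\<close> to \<open>s2\<close>
    takes three more; the rest is slack.\<close>
  define w where "w = nat (6 * P + 20)"
  have w: "int w = 6 * P + 20" using P2 by (simp add: w_def)
  obtain s0 where s0: "P \<le> s0" "s0 + P * int w + P \<le> N"
    and Cw: "\<And>a s. s0 \<le> s \<Longrightarrow> s + P \<le> s0 + P * int w \<Longrightarrow> C a (s + P) = C a s"
    using window[OF M, of w] len w by auto
  define s1 where "s1 = s0 + P * int w"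
  have s1N: "s1 + P \<le> N" using s0 by (simp add: s1_def)
  have C_shift: "C a (s + P * int i) = C a s" if "s0 \<le> s" "s + P * int i \<le> s1" for a s i
    using that
  proof (induction i)
    case (Suc i)
    have "0 \<le> P * int i" using P2 by simp
    then have "C a (s + P * int i + P) = C a (s + P * int i)"
      using Suc.prems by (intro Cw) (auto simp: s1_def algebra_simps)
    moreover have "C a (s + P * int i) = C a s" using Suc P2 by (intro Suc.IH) (auto simp: algebra_simps)
    ultimately show ?case by (simp add: algebra_simps)
  qed simp
  have tt_shift: "tt a (s + P * int i) = tt a s" for a s i
  proof (induction i)
    case (Suc i) then show ?case using tt_P[of a "s + P * int i"] by (simp add: algebra_simps)
  qed simp
  have ginj: "g s \<noteq> g t" if "s0 \<le> s" "s \<le> s1" "s0 \<le> t" "t \<le> s1" "s \<noteq> t" for s t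
    using that s0 s1N P2 g_inj[of s t] g_inj[of t s] by (cases s t rule: linorder_cases) auto
  \<comment> \<open>The point \<open>y\<close> represents the residue class of \<open>t\<close> and
    is sandwiched on the line between \<open>x\<close> and \<open>z\<close>, both from the class of
    \<open>s\<close>. Monotonicity and equality at \<open>x\<close> and \<open>z\<close> force
    equality at \<open>y\<close>.\<close>
  have same: "C a s = C a t" if w5: "s0 \<le> s" "s \<le> s1" "s0 \<le> t" "t \<le> s1" "tt a s = tt a t" for a s t
  proof -
    have ex: "\<exists>r i. 0 \<le> r \<and> r < P \<and> x = s0 + r + P * int i" if "s0 \<le> x" for x
    proof -
      have "int (nat ((x - s0) div P)) = (x - s0) div P" using P2 that by (simp add: pos_imp_zdiv_nonneg_iff)
      then have "0 \<le> (x - s0) mod P \<and> (x - s0) mod P < P \<and>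
          x = s0 + (x - s0) mod P + P * int (nat ((x - s0) div P))"
        using P2 mult_div_mod_eq[of P "x - s0"] by simp
      then show ?thesis by blast
    qed
    obtain r i where r: "0 \<le> r" "r < P" "s = s0 + r + P * int i" using ex[OF w5(1)] by blast
    obtain r' i' where r': "0 \<le> r'" "r' < P" "t = s0 + r' + P * int i'" using ex[OF w5(3)] by blast
    define x y z where "x = s0 + r" and "y = s0 + r' + P * int 2" and "z = s0 + r + P * int 4"
    have "P * 6 \<le> P * int w" using w P2 by (intro mult_left_mono) auto
    then have big: "s0 + 6 * P \<le> s1" by (simp add: s1_def)
    have Px: "0 \<le> P * int i" "0 \<le> P * int i'" using P2 by auto
    have Cx: "C a s = C a x" "C a z = C a x"
      using C_shift[of "s0 + r" i a] C_shift[of "s0 + r" 4 a] r big that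
      by (auto simp: x_def z_def)
    have Cy: "C a t = C a (s0 + r')" "C a y = C a (s0 + r')"
      using C_shift[of "s0 + r'" i' a] C_shift[of "s0 + r'" 2 a] r' big that
      by (auto simp: y_def)
    have tx: "tt a x = tt a s" "tt a z = tt a s" "tt a y = tt a t"
      using tt_shift[of a "s0 + r" i] tt_shift[of a "s0 + r" 4] tt_shift[of a "s0 + r'" i']
        tt_shift[of a "s0 + r'" 2] r r' by (auto simp: x_def y_def z_def)
    have k: "tkey a x < tkey a y" "tkey a y < tkey a z"
      using r r' P2 by (auto simp: tkey_def x_def y_def z_def)
    have rng: "0 \<le> x" "x < N" "0 \<le> y" "y < N" "0 \<le> z" "z < N"
      using r r' s0 s1N big P2 by (auto simp: x_def y_def z_def)
    have "sgv (tt a x) * C a x \<le> sgv (tt a x) * C a y" "sgv (tt a y) * C a y \<le> sgv (tt a y) * C a z"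
      using rng k tx that by (intro C_tkey_mono; simp)+
    then have "C a y = C a x" using Cx tx that sgv_cases[of "tt a s"] by auto
    then show ?thesis using Cx Cy by simp
  qed
  \<comment> \<open>If the order of keys is kept in one direction and reversed in the other,
    \<open>tkey_opposite\<close> makes image times adjacent; but three different times cannot all be
    adjacent to \<open>g s\<close>.\<close>
  have axes: "ee True s = ee False s" if s: "s0 \<le> s" "s + 3 * P \<le> s1" for s
  proof (rule ccontr)
    assume ne: "ee True s \<noteq> ee False s"
    have e1: "ee a s = 1 \<or> ee a s = - 1" for a
      using sgv_cases[of "C a s"] sgv_cases[of "tt a s"] by (auto simp: ee_def)
    have d: "\<bar>g s - g (s + P * int i)\<bar> = 1" if i: "i = 1 \<or> i = 2 \<or> i = 3" for i
    proof -
      have b: "P * int i \<le> 3 * P" "0 < P * int i" using i P2 by auto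
      have gn: "g s \<noteq> g (s + P * int i)" by (intro ginj) (use s b P2 in linarith)+
      have tk: "tkey a s < tkey a (s + P * int i)" for a
        using b i evenP by (auto simp: tkey_def)
      have kp: "if ee a s = 1 then tkey a (g s) < tkey a (g (s + P * int i))
           else tkey a (g (s + P * int i)) < tkey a (g s)" for a
        using key_pres[of s "s + P * int i" a] tk[of a] tt_shift[of a s i] C_shift[of s i a] gn s b s0 s1N P2
        by (simp split: if_splits)
      show ?thesis
      proof (cases "ee True s = 1")
        case True
        then have "ee False s \<noteq> 1" using ne by simp
        then show ?thesis using kp[of True] kp[of False] True tkey_opposite[of True "g s" "g (s + P * int i)"]
          by simp
      next
        case False
        then have "ee False s = 1" using ne e1 by metis
        then show ?thesis using kp[of True] kp[of False] False tkey_opposite[of False "g s" "g (s + P * int i)"]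
          by simp
      qed
    qed
    have "g (s + P * int 1) \<noteq> g (s + P * int 2)" "g (s + P * int 1) \<noteq> g (s + P * int 3)"
      "g (s + P * int 2) \<noteq> g (s + P * int 3)"
      using s P2 by (intro ginj; simp)+
    moreover have "\<bar>g s - g (s + P * int 1)\<bar> = 1" "\<bar>g s - g (s + P * int 2)\<bar> = 1"
      "\<bar>g s - g (s + P * int 3)\<bar> = 1" by (rule d; simp)+
    ultimately show False by linarith
  qed
  define E where "E s = ee True s" for s
  \<comment> \<open>Consecutive points share a link, hence a line and a line of images, and this
    passes the orientation on.\<close>
  have Estep: "E (s + 1) = E s" if s: "s0 \<le> s" "s + 1 + 3 * P \<le> s1" for s
  proof -
    define a where "a = odd s"
    have t: "tt a s = tt a (s + 1)" by (simp add: tt_def link_def a_def)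
    then have "C a s = C a (s + 1)" using s P2 by (intro same) auto
    then have "ee a s = ee a (s + 1)" using t by (simp add: ee_def)
    then show ?thesis using axes[of s] axes[of "s + 1"] s unfolding E_def by (cases a) auto
  qed
  define s2 where "s2 = s1 - 3 * P"
  define eps where "eps = E s0"
  have Econst: "E s = eps" if "s0 \<le> s" "s \<le> s2" for s
    using that
  proof (induction "nat (s - s0)" arbitrary: s)
    case (Suc n)
    then have "E (s - 1) = eps" by auto
    moreover have "E (s - 1 + 1) = E (s - 1)" using Suc.prems Suc.hyps(2) by (intro Estep) (auto simp: s2_def)
    ultimately show ?case by simp
  qed (auto simp: eps_def)
  have eE: "ee a s = eps" if "s0 \<le> s" "s \<le> s2" for a s
    using Econst[OF that] axes[of s] that by (cases a) (auto simp: E_def s2_def)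
  have eps: "eps = 1 \<or> eps = - 1"
    using sgv_cases[of "C True s0"] sgv_cases[of "tt True s0"] by (auto simp: eps_def E_def ee_def)
  have kp: "tkey a s < tkey a t \<longleftrightarrow>
    (if eps = 1 then tkey a (g s) < tkey a (g t) else tkey a (g t) < tkey a (g s))"
    if "s0 \<le> s" "s \<le> s2" "s0 \<le> t" "t \<le> s2" "tt a s = tt a t" "s \<noteq> t" for a s t
    using key_pres[of s t a] same[of s t a] ginj[of s t] eE[of s a] that s0 s1N P2 by (auto simp: s2_def)
  define h where "h s = eps * g s" for s
  have lk: "tkey (odd s) (s + 1) < tkey (odd s) s" "tt (odd s) (s + 1) = tt (odd s) s" for s
    by (simp_all add: tkey_def tt_def link_def)
  \<comment> \<open>The two points are inverted on their common link, and \<open>tkey_le\<close>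
    turns an order of keys into a bound on times.\<close>
  have h1: "h (s + 1) \<le> h s + 1" if "s0 \<le> s" "s < s2" for s
    using kp[of "s + 1" s "odd s"] lk[of s] that eps tkey_le[of "odd s" "g (s + 1)" "g s"]
      tkey_le[of "odd s" "g s" "g (s + 1)"] by (auto simp: h_def)
  have h2: "h s < h (s + P)" if "s0 \<le> s" "s + P \<le> s2" for s
    using kp[of s "s + P" True] kp[of s "s + P" False] that eps P2
      tkey_both_less[of "g s" "g (s + P)"] tkey_both_less[of "g (s + P)" "g s"] by (auto simp: h_def)
  have h3: "inj_on h {s0..s2}"
  proof (rule inj_onI)
    fix s t assume st: "s \<in> {s0..s2}" "t \<in> {s0..s2}" "h s = h t"
    then have "g s = g t" using eps by (auto simp: h_def)
    then show "s = t" using ginj[of s t] st P2 by (auto simp: s2_def)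
  qed
  have h4: "s0 + P * (int 3 * (2 * P + 1)) \<le> s2"
  proof -
    have "P * (6 * P + 6) \<le> P * int w" using w P2 by (intro mult_left_mono) auto
    then show ?thesis by (simp add: s2_def s1_def algebra_simps)
  qed
  obtain A where A: "s0 \<le> A" "A + P * int 3 \<le> s2"
    and run: "\<And>s. A \<le> s \<Longrightarrow> s \<le> A + P * int 3 \<Longrightarrow> h s = h A + (s - A)"
    using long_run[OF _ h1 h2 h3 h4] P2 by auto
  define D where "D = g A - eps * A"
  have gD: "g s = eps * s + D" if "A \<le> s" "s \<le> A + 3 * P" for s
    using run[of s] that eps by (auto simp: h_def D_def)
  \<comment> \<open>The images of \<open>A\<close> and \<open>A + 1\<close> have adjacent times, and
    adjacent times are inverted only in the direction of the link they share. This direction has to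
    be the original one, which fixes the parity of \<open>D\<close>.\<close>
  have par: "eps = 1 \<and> even D \<or> eps = - 1 \<and> odd D"
  proof -
    have "g (A + 1) = g A + eps" using gD[of A] gD[of "A + 1"] P2 by (simp add: algebra_simps)
    moreover have "if eps = 1 then tkey (odd A) (g (A + 1)) < tkey (odd A) (g A)
       else tkey (odd A) (g A) < tkey (odd A) (g (A + 1))"
      using kp[of "A + 1" A "odd A"] lk[of A] A P2 by (simp split: if_splits)
    ultimately show ?thesis using eps D_def
      by (elim disjE) (auto simp: tkey_def split: if_splits)
  qed
  show ?thesis
    using par A s0 s1N P2 gD by (intro propagate[where A = A and B = "A + P"]) (auto simp: s2_def)
qed

end

section \<open>Acyclic sets of cells\<close>

definition coord :: "bool \<Rightarrow> nat \<times> nat \<Rightarrow> nat" where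
  "coord d x = (if d then fst x else snd x)"

lemma coord_eqI: "coord d x = coord d y \<Longrightarrow> coord (\<not> d) x = coord (\<not> d) y \<Longrightarrow> x = y"
  by (cases d) (auto simp: coord_def prod_eq_iff)

definition lone :: "(nat \<times> nat) set \<Rightarrow> bool \<Rightarrow> nat \<times> nat \<Rightarrow> bool" where
  "lone X d x \<longleftrightarrow> (\<forall>z\<in>X. coord d z = coord d x \<longrightarrow> z = x)"

text \<open>Acyclicity of the bipartite graph joining the column and the row of each cell, as leaf removal.\<close>

definition acyc :: "(nat \<times> nat) set \<Rightarrow> bool" where
  "acyc X \<longleftrightarrow> (\<forall>Y\<subseteq>X. Y \<noteq> {} \<longrightarrow> (\<exists>y\<in>Y. \<exists>d. lone Y d y))"

definition adj :: "(nat \<times> nat) set \<Rightarrow> bool \<Rightarrow> nat \<times> nat \<Rightarrow> nat \<times> nat \<Rightarrow> bool" where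
  "adj X d x y \<longleftrightarrow> x \<in> X \<and> y \<in> X \<and> coord d x = coord d y \<and> coord (\<not> d) x < coord (\<not> d) y \<and>
     (\<forall>z\<in>X. coord d z = coord d x \<longrightarrow> coord (\<not> d) z \<le> coord (\<not> d) x \<or> coord (\<not> d) y \<le> coord (\<not> d) z)"

definition edges :: "(nat \<times> nat) set \<Rightarrow> (nat \<times> nat) set set" where
  "edges X = {{x, y} | x y. \<exists>d. adj X d x y}"

lemma cell_edges_eq: "cell_edges m n M = edges (cell_vertices m n M)"
proof -
  let ?V = "cell_vertices m n M"
  have 1: "(\<forall>k\<in>{j<..<j'}. M i k = {}) \<longleftrightarrow> (\<forall>k. j < k \<and> k < j' \<longrightarrow> (i, k) \<notin> ?V)"
    if "(i, j) \<in> ?V" "(i, j') \<in> ?V" for i j j'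
    using that by (auto simp: cell_vertices_def)
  have 2: "(\<forall>k\<in>{i<..<i'}. M k j = {}) \<longleftrightarrow> (\<forall>k. i < k \<and> k < i' \<longrightarrow> (k, j) \<notin> ?V)"
    if "(i, j) \<in> ?V" "(i', j) \<in> ?V" for i j i'
    using that by (auto simp: cell_vertices_def)
  have q1: "(\<forall>z\<in>V. fst z = i \<longrightarrow> snd z \<le> j \<or> j' \<le> snd z) \<longleftrightarrow> (\<forall>k. j < k \<and> k < j' \<longrightarrow> (i, k) \<notin> V)"
    and q2: "(\<forall>z\<in>V. snd z = i \<longrightarrow> fst z \<le> j \<or> j' \<le> fst z) \<longleftrightarrow> (\<forall>k. j < k \<and> k < j' \<longrightarrow> (k, i) \<notin> V)"
    for V :: "(nat \<times> nat) set" and i j j'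
    by (force simp: not_le[symmetric])+
  have a1: "adj ?V True x y \<longleftrightarrow> (\<exists>i j j'. x = (i, j) \<and> y = (i, j') \<and> j < j' \<and> (i, j) \<in> ?V \<and> (i, j') \<in> ?V \<and>
        (\<forall>k\<in>{j<..<j'}. M i k = {}))" for x y
  proof -
    obtain i j i' j' where "x = (i, j)" "y = (i', j')" by (cases x, cases y)
    then show ?thesis using 1[of i j j'] q1[of ?V i j j'] by (auto simp: adj_def coord_def)
  qed
  have a2: "adj ?V False x y \<longleftrightarrow> (\<exists>i i' j. x = (i, j) \<and> y = (i', j) \<and> i < i' \<and> (i, j) \<in> ?V \<and> (i', j) \<in> ?V \<and>
        (\<forall>k\<in>{i<..<i'}. M k j = {}))" for x y
  proof -
    obtain i j i' j' where "x = (i, j)" "y = (i', j')" by (cases x, cases y)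
    then show ?thesis using 2[of i j i'] q2[of ?V j i i'] by (auto simp: adj_def coord_def)
  qed
  have "edges ?V = {{x, y} | x y. adj ?V True x y} \<union> {{x, y} | x y. adj ?V False x y}"
    unfolding edges_def ex_bool_eq by blast
  also have "\<dots> = cell_edges m n M"
  proof -
    have s1: "{{x, y} | x y. \<exists>i j j'. x = (i, j) \<and> y = (i, j') \<and> Q i j j'} = {{(i, j), (i, j')} | i j j'. Q i j j'}"
      and s2: "{{x, y} | x y. \<exists>i i' j. x = (i, j) \<and> y = (i', j) \<and> Q i i' j} = {{(i, j), (i', j)} | i i' j. Q i i' j}"
      for Q :: "nat \<Rightarrow> nat \<Rightarrow> nat \<Rightarrow> bool" by blast+
    show ?thesis unfolding cell_edges_def a1 a2 s1 s2 ..
  qed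
  finally show ?thesis ..
qed

lemma finite_cell_vertices: "finite (cell_vertices m n M)"
  by (rule finite_subset[of _ "{1..m} \<times> {1..n}"]) (auto simp: cell_vertices_def)

lemma graph_cycle_iff:
  assumes "3 \<le> length c"
  shows "graph_cycle E c \<longleftrightarrow> distinct c \<and> (\<forall>k. Suc k < length c \<longrightarrow> {c ! k, c ! Suc k} \<in> E) \<and>
    {c ! (length c - 1), c ! 0} \<in> E"
proof -
  have "(\<forall>k<length c. {c ! k, c ! (Suc k mod length c)} \<in> E) \<longleftrightarrow>
    (\<forall>k. Suc k < length c \<longrightarrow> {c ! k, c ! Suc k} \<in> E) \<and> {c ! (length c - 1), c ! 0} \<in> E" (is "?l \<longleftrightarrow> ?r")
  proof
    assume l: ?l
    show ?r
    proof (intro conjI allI impI)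
      fix k assume "Suc k < length c"
      then show "{c ! k, c ! Suc k} \<in> E" using l[rule_format, of k] by simp
    next
      have "Suc (length c - 1) = length c" using assms by simp
      then show "{c ! (length c - 1), c ! 0} \<in> E" using l[rule_format, of "length c - 1"] assms by simp
    qed
  next
    assume r: ?r
    show ?l
    proof (intro allI impI)
      fix k assume k: "k < length c"
      show "{c ! k, c ! (Suc k mod length c)} \<in> E"
      proof (cases "Suc k = length c")
        case True
        then have "k = length c - 1" by simp
        then show ?thesis using r True by simp
      next
        case False
        then show ?thesis using r k by simp
      qed
    qed
  qed
  then show ?thesis using assms by (auto simp: graph_cycle_def)
qed

lemma graph_cycle_rotate:
  assumes "graph_cycle E c"
  shows "graph_cycle E (rotate k c)"
proof -
  have L: "0 < length c" using assms by (auto simp: graph_cycle_def)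
  have "{rotate k c ! i, rotate k c ! (Suc i mod length c)} \<in> E" if "i < length c" for i
  proof -
    let ?j = "(k + i) mod length c"
    have "(k + Suc i mod length c) mod length c = Suc ?j mod length c"
      by (simp add: mod_simps)
    then have "rotate k c ! (Suc i mod length c) = c ! (Suc ?j mod length c)"
      using L by (simp add: nth_rotate)
    moreover have "rotate k c ! i = c ! ?j" using that by (simp add: nth_rotate)
    moreover have "?j < length c" using L by simp
    ultimately show ?thesis using assms by (simp add: graph_cycle_def)
  qed
  then show ?thesis using assms by (simp add: graph_cycle_def)
qed

text \<open>All neighbours of the first vertex of a longest path lie on the path; one of them is not
  the second vertex and closes a cycle.\<close>

lemma cycle_of_min_degree_2:
  assumes fin: "finite X" and ne: "X \<noteq> {}"
    and deg: "\<And>x. x \<in> X \<Longrightarrow> \<exists>u w. u \<in> X \<and> w \<in> X \<and> u \<noteq> w \<and> x \<noteq> u \<and> x \<noteq> w \<and> {x, u} \<in> E \<and> {x, w} \<in> E"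
  shows "\<exists>c. graph_cycle E c"
proof -
  define path where "path c \<longleftrightarrow> distinct c \<and> set c \<subseteq> X \<and> (\<forall>k. Suc k < length c \<longrightarrow> {c ! k, c ! Suc k} \<in> E)" for c
  obtain x where x: "x \<in> X" using ne by blast
  have "length c \<le> card X" if "path c" for c
    using that card_mono[OF fin, of "set c"] distinct_card[of c] by (simp add: path_def)
  moreover have "path [x]" using x by (simp add: path_def)
  ultimately have "\<exists>c. path c \<and> (\<forall>c'. path c' \<longrightarrow> length c' \<le> length c)"
    using ex_has_greatest_nat[of path "[x]" length "Suc (card X)"] by (simp add: less_Suc_eq_le)
  then obtain c where c: "path c" and mx: "\<And>c'. path c' \<Longrightarrow> length c' \<le> length c" by blast
  have cne: "c \<noteq> []" using mx[of "[x]"] \<open>path [x]\<close> by auto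
  then have hX: "c ! 0 \<in> X" using c by (auto simp: path_def)
  have nb: "u \<in> set c" if u: "u \<in> X" "{c ! 0, u} \<in> E" for u
  proof (rule ccontr)
    assume "u \<notin> set c"
    moreover have "{(u # c) ! k, (u # c) ! Suc k} \<in> E" if "Suc k < length (u # c)" for k
      using that u c by (cases k) (auto simp: path_def insert_commute)
    ultimately have "path (u # c)" using u c by (auto simp: path_def)
    then show False using mx[of "u # c"] by simp
  qed
  obtain u w where uw: "u \<in> X" "w \<in> X" "u \<noteq> w" "c ! 0 \<noteq> u" "c ! 0 \<noteq> w" "{c ! 0, u} \<in> E" "{c ! 0, w} \<in> E"
    using deg[OF hX] by blast
  have "\<exists>k\<ge>2. k < length c \<and> {c ! 0, c ! k} \<in> E"
  proof -
    obtain i j where ij: "i < length c" "j < length c" "c ! i = u" "c ! j = w"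
      using nb uw by (metis in_set_conv_nth)
    then have "i \<noteq> 0" "j \<noteq> 0" "i \<noteq> j" using uw by metis+
    then have "2 \<le> i \<or> 2 \<le> j" by linarith
    then show ?thesis using ij uw by blast
  qed
  then obtain k where k: "2 \<le> k" "k < length c" "{c ! 0, c ! k} \<in> E" by blast
  define b where "b = take (Suc k) c"
  have lb: "length b = Suc k" using k by (simp add: b_def)
  have "graph_cycle E b"
  proof (subst graph_cycle_iff)
    show "3 \<le> length b" using k lb by simp
    have "{b ! i, b ! Suc i} \<in> E" if "Suc i < length b" for i
      using that k c lb by (simp add: b_def path_def)
    moreover have "{b ! (length b - 1), b ! 0} \<in> E" using k lb by (simp add: b_def insert_commute)
    moreover have "distinct b" using c by (simp add: b_def path_def)
    ultimately show "distinct b \<and> (\<forall>k. Suc k < length b \<longrightarrow> {b ! k, b ! Suc k} \<in> E) \<and> {b ! (length b - 1), b ! 0} \<in> E"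
      by blast
  qed
  then show ?thesis by blast
qed

lemma next_on_line:
  assumes "finite X" "x \<in> X" "z \<in> X" "coord d z = coord d x" "coord (\<not> d) x < coord (\<not> d) z"
  shows "\<exists>u. adj X d x u"
proof -
  let ?S = "{u\<in>X. coord d u = coord d x \<and> coord (\<not> d) x < coord (\<not> d) u}"
  have "z \<in> ?S" "finite ?S" using assms by simp_all
  then have "finite (coord (\<not> d) ` ?S)" "coord (\<not> d) ` ?S \<noteq> {}" by blast+
  note mn = Min_in[OF this] Min_le[OF this(1)]
  obtain u where u: "u \<in> ?S" "coord (\<not> d) u = Min (coord (\<not> d) ` ?S)" using mn(1) by force
  then have "coord (\<not> d) u \<le> coord (\<not> d) v" if "v \<in> ?S" for v using mn(2) that by simp
  then have "coord (\<not> d) z \<le> coord (\<not> d) x \<or> coord (\<not> d) u \<le> coord (\<not> d) z"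
    if "z \<in> X" "coord d z = coord d x" for z
    using that by (cases "coord (\<not> d) x < coord (\<not> d) z") auto
  then have "adj X d x u" using assms(2) u(1) by (auto simp: adj_def)
  then show ?thesis by blast
qed

lemma prev_on_line:
  assumes "finite X" "x \<in> X" "z \<in> X" "coord d z = coord d x" "coord (\<not> d) z < coord (\<not> d) x"
  shows "\<exists>u. adj X d u x"
proof -
  let ?S = "{u\<in>X. coord d u = coord d x \<and> coord (\<not> d) u < coord (\<not> d) x}"
  have "z \<in> ?S" "finite ?S" using assms by simp_all
  then have "finite (coord (\<not> d) ` ?S)" "coord (\<not> d) ` ?S \<noteq> {}" by blast+
  note mx = Max_in[OF this] Max_ge[OF this(1)]
  obtain u where u: "u \<in> ?S" "coord (\<not> d) u = Max (coord (\<not> d) ` ?S)" using mx(1) by force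
  then have "coord (\<not> d) v \<le> coord (\<not> d) u" if "v \<in> ?S" for v using mx(2) that by simp
  then have "coord (\<not> d) z \<le> coord (\<not> d) u \<or> coord (\<not> d) x \<le> coord (\<not> d) z"
    if "z \<in> X" "coord d z = coord d x" for z
    using that by (cases "coord (\<not> d) z < coord (\<not> d) x") auto
  then have "adj X d u x" using assms(2) u(1) by (auto simp: adj_def)
  then show ?thesis by blast
qed

text \<open>Deleting a cell creates a new adjacency only along a line on which the cell has
  neighbours on both sides. In direction \<open>d\<close> it has no neighbours at all, and
  \<open>ext\<close> handles the other direction.\<close>

lemma edges_remove:
  assumes l: "lone X d x" and ext: "\<And>u w. adj X (\<not> d) u x \<Longrightarrow> adj X (\<not> d) x w \<Longrightarrow> False"
    and fin: "finite X" "x \<in> X"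
  shows "edges (X - {x}) \<subseteq> edges X"
proof -
  have "adj X e y z" if a: "adj (X - {x}) e y z" for e y z
  proof (rule ccontr)
    assume n: "\<not> adj X e y z"
    have yz: "y \<in> X" "z \<in> X" "y \<noteq> x" "z \<noteq> x" "coord e y = coord e z" using a by (auto simp: adj_def)
    have b: "coord e x = coord e y" "coord (\<not> e) y < coord (\<not> e) x" "coord (\<not> e) x < coord (\<not> e) z"
      using a n by (auto simp: adj_def not_le)
    have "e \<noteq> d"
    proof
      assume "e = d"
      then have "y = x" using l yz b(1) by (simp add: lone_def)
      then show False using yz by simp
    qed
    then have e: "e = (\<not> d)" by blast
    obtain u where "adj X e u x" using prev_on_line[of X x y e] fin yz b by auto
    moreover obtain w where "adj X e x w" using next_on_line[of X x z e] fin yz b by auto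
    ultimately show False using ext e by blast
  qed
  then show ?thesis unfolding edges_def by blast
qed

section \<open>Forests and leaf removal\<close>

text \<open>A forest has a cell with at most one neighbour. Such a cell is alone in its row or in
  its column, and deleting it adds no edge, so the induction applies.\<close>

lemma forest_imp_acyc:
  assumes "finite X" "forest (edges X)"
  shows "acyc X"
  using assms
proof (induction "card X" arbitrary: X)
  case 0 then show ?case by (simp add: acyc_def)
next
  case (Suc n)
  have fin: "finite X" and ne: "X \<noteq> {}" using Suc by auto
  have "\<not> (\<forall>x\<in>X. \<exists>u w. u \<in> X \<and> w \<in> X \<and> u \<noteq> w \<and> x \<noteq> u \<and> x \<noteq> w \<and> {x, u} \<in> edges X \<and> {x, w} \<in> edges X)"
    using cycle_of_min_degree_2[OF fin ne, of "edges X"] Suc.prems(2) unfolding forest_def by blast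
  then obtain x where x: "x \<in> X"
    "\<And>u w. u \<in> X \<Longrightarrow> w \<in> X \<Longrightarrow> x \<noteq> u \<Longrightarrow> x \<noteq> w \<Longrightarrow> {x, u} \<in> edges X \<Longrightarrow> {x, w} \<in> edges X \<Longrightarrow> u = w"
    by blast
  have nbr: "u \<in> X \<and> x \<noteq> u \<and> {x, u} \<in> edges X" if "adj X d x u \<or> adj X d u x" for d u
  proof -
    have "u \<in> X" "x \<noteq> u" using that by (auto simp: adj_def)
    moreover have "{x, u} \<in> edges X \<or> {u, x} \<in> edges X" using that unfolding edges_def by blast
    ultimately show ?thesis by (simp add: insert_commute)
  qed
  have uniq: "u = w" if "adj X d x u \<or> adj X d u x" "adj X e x w \<or> adj X e w x" for d e u w
    using x(2) nbr[OF that(1)] nbr[OF that(2)] by blast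
  have updn: False if "adj X d u x" "adj X d x w" for d u w
  proof -
    have "u = w" using uniq that by blast
    then show False using that by (auto simp: adj_def)
  qed
  have cross: False if "adj X d x u \<or> adj X d u x" "adj X (\<not> d) x w \<or> adj X (\<not> d) w x" for d u w
  proof -
    have "u = w" using uniq that by blast
    then have "u = x" using that by (intro coord_eqI[of d]) (auto simp: adj_def)
    then show False using nbr[OF that(1)] by blast
  qed
  have lone: "lone X d x" if "\<And>u. \<not> adj X d x u" "\<And>u. \<not> adj X d u x" for d
    unfolding lone_def
  proof (intro ballI impI)
    fix z assume z: "z \<in> X" "coord d z = coord d x"
    have "\<not> coord (\<not> d) x < coord (\<not> d) z" "\<not> coord (\<not> d) z < coord (\<not> d) x"
      using next_on_line[OF fin x(1) z] prev_on_line[OF fin x(1) z] that by blast+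
    then show "z = x" using z by (intro coord_eqI[of d]) auto
  qed
  obtain d where d: "lone X d x" using lone[of True] lone[of False] cross[of True] by fastforce
  have "edges (X - {x}) \<subseteq> edges X" by (rule edges_remove[OF d _ fin x(1)]) (rule updn)
  then have "forest (edges (X - {x}))" using Suc.prems(2) unfolding forest_def graph_cycle_def by blast
  then have IH: "acyc (X - {x})" using Suc.hyps(1)[of "X - {x}"] Suc.hyps(2) fin x(1) by simp
  show ?case
    unfolding acyc_def
  proof (intro allI impI)
    fix Y assume Y: "Y \<subseteq> X" "Y \<noteq> {}"
    show "\<exists>y\<in>Y. \<exists>d. lone Y d y"
    proof (cases "x \<in> Y")
      case True
      have "lone Y d x" using d Y unfolding lone_def by blast
      then show ?thesis using True by blast
    next
      case False
      then have "Y \<subseteq> X - {x}" using Y by blast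
      then show ?thesis using IH Y unfolding acyc_def by blast
    qed
  qed
qed

lemma acyc_sub: "acyc X \<Longrightarrow> Y \<subseteq> X \<Longrightarrow> acyc Y"
  unfolding acyc_def by (meson order_trans)

text \<open>A lone cell has its neighbours on one line, at most one on each side, and a cycle
  through it uses both. Deleting the cell makes them adjacent and shortens the cycle; a triangle is
  excluded, as the two are not adjacent while the cell lies between them.\<close>

lemma acyc_imp_forest:
  assumes "finite X" "acyc X"
  shows "forest (edges X)"
  using assms
proof (induction "card X" arbitrary: X)
  case 0
  then have "edges X = {}" by (auto simp: edges_def adj_def)
  then show ?case unfolding forest_def graph_cycle_def by fastforce
next
  case (Suc n)
  have fin: "finite X" and ne: "X \<noteq> {}" using Suc by auto
  obtain x d where x: "x \<in> X" "lone X d x" using Suc.prems(2) ne unfolding acyc_def by blast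
  have IH: "forest (edges (X - {x}))"
    using Suc.hyps(1)[of "X - {x}"] Suc.hyps(2) fin x(1) acyc_sub[OF Suc.prems(2)] by auto
  have keep: "{y, z} \<in> edges (X - {x})" if yz: "{y, z} \<in> edges X" "y \<noteq> x" "z \<noteq> x" for y z
  proof -
    obtain u w e where uw: "{y, z} = {u, w}" "adj X e u w" using yz(1) unfolding edges_def by blast
    then have "u \<noteq> x" "w \<noteq> x" using yz by (auto simp: doubleton_eq_iff)
    then have "adj (X - {x}) e u w" using uw(2) by (auto simp: adj_def)
    then show ?thesis unfolding uw(1) edges_def by blast
  qed
  show ?case
    unfolding forest_def
  proof
    assume "\<exists>c. graph_cycle (edges X) c"
    then obtain c where c: "graph_cycle (edges X) c" by blast
    have Lc: "3 \<le> length c" using c by (simp add: graph_cycle_def)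
    show False
    proof (cases "x \<in> set c")
      case False
      then have "c ! k \<noteq> x" if "k < length c" for k using that nth_mem by blast
      moreover have "Suc k mod length c < length c" for k using Lc by (intro mod_less_divisor) linarith
      ultimately have "\<forall>k<length c. {c ! k, c ! (Suc k mod length c)} \<in> edges (X - {x})"
        using c keep unfolding graph_cycle_def by blast
      then have "graph_cycle (edges (X - {x})) c" using c unfolding graph_cycle_def by blast
      then show False using IH unfolding forest_def by blast
    next
      case True
      then obtain k where k: "k < length c" "c ! k = x" by (auto simp: in_set_conv_nth)
      define b where "b = rotate k c"
      have b: "graph_cycle (edges X) b" "length b = length c" "b ! 0 = x"
      proof -
        have "0 < length c" using Lc by linarith
        then show "b ! 0 = x" using nth_rotate[of 0 c k] k by (simp add: b_def)
      qed (simp_all add: b_def graph_cycle_rotate[OF c])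
      have cne: "c \<noteq> []" using Lc by auto
      define L where "L = length c"
      have bi: "distinct b" "\<And>i. Suc i < L \<Longrightarrow> {b ! i, b ! Suc i} \<in> edges X" "{b ! (L - 1), b ! 0} \<in> edges X"
        using b Lc by (auto simp: graph_cycle_iff L_def)
      define l r where "l = b ! 1" and "r = b ! (L - 1)"
      have xl: "x = b ! 0" using b(3) by simp
      have lr: "l \<noteq> r" "l \<noteq> x" "r \<noteq> x"
        using nth_eq_iff_index_eq[OF bi(1), of 1 "L - 1"] nth_eq_iff_index_eq[OF bi(1), of 1 0]
          nth_eq_iff_index_eq[OF bi(1), of "L - 1" 0] Lc cne b(2) unfolding l_def r_def L_def xl by auto
      define e where "e = (\<not> d)"
      have side: "adj X e x u \<or> adj X e u x" if u: "{x, u} \<in> edges X" for u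
      proof -
        obtain f where f: "adj X f x u \<or> adj X f u x"
          using u unfolding edges_def by (auto simp: doubleton_eq_iff)
        moreover have "f = e"
        proof (rule ccontr)
          assume "f \<noteq> e"
          then have "f = d" by (auto simp: e_def)
          then have "u = x" using f x(2) by (auto simp: adj_def lone_def)
          then show False using f by (auto simp: adj_def)
        qed
        ultimately show ?thesis by blast
      qed
      have up1: "u = w" if "adj X e x u" "adj X e x w" for u w
      proof -
        have "coord (\<not> e) u = coord (\<not> e) w" using that unfolding adj_def by (metis le_antisym linorder_not_le)
        then show ?thesis using that by (intro coord_eqI[of e]) (auto simp: adj_def)
      qed
      have dn1: "u = w" if "adj X e u x" "adj X e w x" for u w
      proof -
        have "coord (\<not> e) u = coord (\<not> e) w" using that unfolding adj_def by (metis le_antisym linorder_not_le)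
        then show ?thesis using that by (intro coord_eqI[of e]) (auto simp: adj_def)
      qed
      have through: "{u, w} \<notin> edges X" "{u, w} \<in> edges (X - {x})"
        if uw: "adj X e u x" "adj X e x w" for u w
      proof -
        have co: "coord e u = coord e x" "coord e w = coord e x" "coord (\<not> e) u < coord (\<not> e) x"
          "coord (\<not> e) x < coord (\<not> e) w" using uw by (auto simp: adj_def)
        show "{u, w} \<notin> edges X"
        proof
          assume "{u, w} \<in> edges X"
          then obtain f where f: "adj X f u w \<or> adj X f w u" unfolding edges_def by (auto simp: doubleton_eq_iff)
          have "f = e"
          proof (rule ccontr)
            assume "f \<noteq> e"
            then have "coord (\<not> e) u = coord (\<not> e) w" using f by (cases e; cases f) (auto simp: adj_def)
            then show False using co by simp
          qed
          have "\<not> adj X e w u" using co by (simp add: adj_def)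
          then have a: "adj X e u w" using f \<open>f = e\<close> by blast
          then have "coord (\<not> e) x \<le> coord (\<not> e) u \<or> coord (\<not> e) w \<le> coord (\<not> e) x"
            using x(1) co(1) unfolding adj_def by metis
          then show False using co by linarith
        qed
        have "adj (X - {x}) e u w"
          unfolding adj_def
        proof (intro conjI ballI impI)
          show "u \<in> X - {x}" "w \<in> X - {x}" using uw co by (auto simp: adj_def)
          show "coord e u = coord e w" "coord (\<not> e) u < coord (\<not> e) w" using co by auto
          fix z assume z: "z \<in> X - {x}" "coord e z = coord e u"
          then have "coord (\<not> e) z \<noteq> coord (\<not> e) x" using co coord_eqI[of e z x] by auto
          moreover have "coord (\<not> e) z \<le> coord (\<not> e) u \<or> coord (\<not> e) x \<le> coord (\<not> e) z"
            "coord (\<not> e) z \<le> coord (\<not> e) x \<or> coord (\<not> e) w \<le> coord (\<not> e) z"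
            using uw z co by (auto simp: adj_def)
          ultimately show "coord (\<not> e) z \<le> coord (\<not> e) u \<or> coord (\<not> e) w \<le> coord (\<not> e) z" by linarith
        qed
        then show "{u, w} \<in> edges (X - {x})" unfolding edges_def by blast
      qed
      have xlr: "{x, l} \<in> edges X" "{x, r} \<in> edges X"
        using bi(2)[of 0] bi(3) Lc cne b by (auto simp: l_def r_def L_def insert_commute)
      have lre: "{l, r} \<notin> edges X \<and> {l, r} \<in> edges (X - {x})"
      proof -
        consider "adj X e x l" "adj X e x r" | "adj X e l x" "adj X e r x"
          | "adj X e l x" "adj X e x r" | "adj X e r x" "adj X e x l"
          using side[OF xlr(1)] side[OF xlr(2)] by blast
        then show ?thesis
        proof cases
          case 1 then show ?thesis using up1 lr by blast
        next
          case 2 then show ?thesis using dn1 lr by blast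
        next
          case 3 then show ?thesis using through by blast
        next
          case 4 then show ?thesis using through[of r l] by (simp add: insert_commute)
        qed
      qed
      show False
      proof (cases "L = 3")
        case True
        then have "{b ! 1, b ! 2} \<in> edges X" using bi(2)[of 1] by (simp add: numeral_2_eq_2)
        then show False using lre True by (simp add: l_def r_def numeral_2_eq_2)
      next
        case False
        define c' where "c' = tl b"
        have L: "length c' = L - 1" "3 \<le> L - 1" using False Lc b(2) by (auto simp: c'_def L_def)
        have c'i: "c' ! i = b ! Suc i" if "i < L - 1" for i using that L by (simp add: c'_def nth_tl)
        have nx: "b ! Suc i \<noteq> x" if "Suc i < L" for i
          using that b bi(1) nth_eq_iff_index_eq[OF bi(1), of "Suc i" 0] cne by (auto simp: L_def)
        have "graph_cycle (edges (X - {x})) c'"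
        proof (subst graph_cycle_iff)
          show "3 \<le> length c'" using L by simp
          have "distinct c'" using bi(1) by (simp add: c'_def distinct_tl)
          moreover have "{c' ! i, c' ! Suc i} \<in> edges (X - {x})" if i: "Suc i < length c'" for i
          proof -
            have i': "Suc (Suc i) < L" using i L by linarith
            then have "{b ! Suc i, b ! Suc (Suc i)} \<in> edges (X - {x})"
              using bi(2)[OF i'] nx[of i] nx[OF i'] by (intro keep) simp_all
            then show ?thesis using i L c'i[of i] c'i[of "Suc i"] by simp
          qed
          moreover have "{c' ! (length c' - 1), c' ! 0} \<in> edges (X - {x})"
          proof -
            have "Suc (L - 2) = L - 1" using L by simp
            then have "c' ! (length c' - 1) = r" "c' ! 0 = l"
              using L c'i[of "L - 2"] c'i[of 0] by (auto simp: l_def r_def numeral_2_eq_2)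
            then show ?thesis using lre by (simp add: insert_commute)
          qed
          ultimately show "distinct c' \<and> (\<forall>k. Suc k < length c' \<longrightarrow> {c' ! k, c' ! Suc k} \<in> edges (X - {x})) \<and>
            {c' ! (length c' - 1), c' ! 0} \<in> edges (X - {x})" by blast
        qed
        then show False using IH unfolding forest_def by blast
      qed
    qed
  qed
qed

text \<open>The colour of a row or column is the side to which it belongs. Leaf removal works
  because the line on which a cell is lone is constrained by this cell only.\<close>

lemma acyc_colouring:
  assumes "finite X" "acyc X" "r \<in> X"
  shows "\<exists>g :: bool \<Rightarrow> nat \<Rightarrow> bool. g True (fst r) \<noteq> g False (snd r) \<and>
    (\<forall>x\<in>X - {r}. g True (fst x) = g False (snd x))"
proof -
  have "\<exists>g :: bool \<Rightarrow> nat \<Rightarrow> bool. (\<forall>d. g d (coord d r) \<noteq> g (\<not> d) (coord (\<not> d) r)) \<and>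
    (\<forall>x\<in>X - {r}. \<forall>d. g d (coord d x) = g (\<not> d) (coord (\<not> d) x))"
    using assms
  proof (induction "card X" arbitrary: X)
    case 0 then show ?case by simp
  next
    case (Suc n)
    obtain x d where x: "x \<in> X" "lone X d x" using Suc.prems unfolding acyc_def by blast
    show ?case
    proof (cases "x = r")
      case True
      \<comment> \<open>No other cell meets the lone line of \<open>r\<close>, so giving this line a
        colour of its own separates the two lines of \<open>r\<close> and affects no other
        cell.\<close>
      define g where "g e i \<longleftrightarrow> \<not> (e = d \<and> i = coord d r)" for e i
      have "coord d y \<noteq> coord d r" if "y \<in> X - {r}" for y using that x True by (auto simp: lone_def)
      then have "g e (coord e y) = g (\<not> e) (coord (\<not> e) y)" if "y \<in> X - {r}" for y e
        using that by (cases "e = d") (auto simp: g_def)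
      moreover have "g e (coord e r) \<noteq> g (\<not> e) (coord (\<not> e) r)" for e
        by (cases "e = d") (auto simp: g_def)
      ultimately show ?thesis by (intro exI[of _ g]) blast
    next
      case False
      have "\<exists>g :: bool \<Rightarrow> nat \<Rightarrow> bool. (\<forall>d. g d (coord d r) \<noteq> g (\<not> d) (coord (\<not> d) r)) \<and>
        (\<forall>y\<in>X - {x} - {r}. \<forall>d. g d (coord d y) = g (\<not> d) (coord (\<not> d) y))"
        using Suc.hyps(1)[of "X - {x}"] Suc.hyps(2) Suc.prems x False acyc_sub by auto
      then obtain g :: "bool \<Rightarrow> nat \<Rightarrow> bool" where g: "\<forall>d. g d (coord d r) \<noteq> g (\<not> d) (coord (\<not> d) r)"
        "\<forall>y\<in>X - {x} - {r}. \<forall>d. g d (coord d y) = g (\<not> d) (coord (\<not> d) y)" by (elim exE conjE)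
      \<comment> \<open>The lone line of \<open>x\<close> is free and copies the colour of the other
        line of \<open>x\<close>.\<close>
      define g' where "g' e i = (if e = d \<and> i = coord d x then g (\<not> d) (coord (\<not> d) x) else g e i)" for e i
      have off: "coord d y \<noteq> coord d x" if "y \<in> X" "y \<noteq> x" for y using that x by (auto simp: lone_def)
      have g'y: "g' e (coord e y) = g e (coord e y)" if "y \<in> X" "y \<noteq> x" for e y
        using off[OF that] by (auto simp: g'_def)
      have "g' e (coord e y) = g' (\<not> e) (coord (\<not> e) y)" if "y \<in> X - {r}" for y e
      proof (cases "y = x")
        case True
        then show ?thesis by (cases "e = d") (auto simp: g'_def)
      next
        case False
        have "g e (coord e y) = g (\<not> e) (coord (\<not> e) y)" using g(2) that False by blast
        moreover have "y \<in> X" using that by blast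
        ultimately show ?thesis using g'y[of y e] g'y[of y "\<not> e"] False by metis
      qed
      moreover have "g' e (coord e r) \<noteq> g' (\<not> e) (coord (\<not> e) r)" for e
      proof -
        have "r \<in> X" "r \<noteq> x" using Suc.prems(3) False by auto
        then show ?thesis unfolding g'y[OF \<open>r \<in> X\<close> \<open>r \<noteq> x\<close>] using g(1) by blast
      qed
      ultimately show ?thesis by (intro exI[of _ g']) blast
    qed
  qed
  then obtain g :: "bool \<Rightarrow> nat \<Rightarrow> bool" where g: "\<forall>d. g d (coord d r) \<noteq> g (\<not> d) (coord (\<not> d) r)"
    "\<forall>x\<in>X - {r}. \<forall>d. g d (coord d x) = g (\<not> d) (coord (\<not> d) x)" by (elim exE conjE)
  have "g True (fst r) \<noteq> g False (snd r)" using g(1)[rule_format, of True] by (simp add: coord_def)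
  moreover have "g True (fst x) = g False (snd x)" if "x \<in> X - {r}" for x
    using g(2)[rule_format, of x True] that by (simp add: coord_def)
  ultimately show ?thesis by blast
qed

subsection \<open>Common linear extensions\<close>

lemma gap:
  fixes D U F :: "real set"
  assumes fin: "finite D" "finite U" "finite F" and lt: "\<And>d u. d \<in> D \<Longrightarrow> u \<in> U \<Longrightarrow> d < u"
  shows "\<exists>z. (\<forall>d\<in>D. d < z) \<and> (\<forall>u\<in>U. z < u) \<and> z \<notin> F"
proof -
  have "\<exists>a b. a < b \<and> (\<forall>d\<in>D. d \<le> a) \<and> (\<forall>u\<in>U. b \<le> u)"
  proof (cases "D = {}")
    case True
    show ?thesis
    proof (cases "U = {}")
      case False
      then show ?thesis using True fin by - (rule exI[of _ "Min U - 1"], rule exI[of _ "Min U"], intro conjI, linarith, simp, simp)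
    qed (rule exI[of _ 0], rule exI[of _ 1], use True in simp)
  next
    case False
    show ?thesis
    proof (cases "U = {}")
      case True
      then show ?thesis using False fin by - (rule exI[of _ "Max D"], rule exI[of _ "Max D + 1"], intro conjI, linarith, simp, simp)
    next
      case U: False
      have "Max D < Min U" using lt False U fin by (simp add: Max_in Min_in)
      then show ?thesis using False U fin by - (rule exI[of _ "Max D"], rule exI[of _ "Min U"], intro conjI, assumption, simp, simp)
    qed
  qed
  then obtain a b where ab: "a < b" "\<forall>d\<in>D. d \<le> a" "\<forall>u\<in>U. b \<le> u" by blast
  have "infinite {a<..<b}" using ab by (simp add: infinite_Ioo)
  then have "{a<..<b} - F \<noteq> {}" using fin(3) by (metis finite.emptyI finite_Diff2)
  then obtain z where "z \<in> {a<..<b} - F" by blast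
  then have z: "a < z" "z < b" "z \<notin> F" by simp_all
  show ?thesis using z ab by (intro exI[of _ z]) force
qed

lemma amalgamate:
  fixes k0 w :: "nat \<Rightarrow> real"
  assumes "finite I" "finite J" "inj_on k0 I" "inj_on w J"
    and "\<And>p q. p \<in> I \<inter> J \<Longrightarrow> q \<in> I \<inter> J \<Longrightarrow> k0 p < k0 q \<longleftrightarrow> w p < w q"
  shows "\<exists>k :: nat \<Rightarrow> real. inj_on k (I \<union> J) \<and> (\<forall>p\<in>I. \<forall>q\<in>I. k p < k q \<longleftrightarrow> k0 p < k0 q) \<and>
    (\<forall>p\<in>J. \<forall>q\<in>J. k p < k q \<longleftrightarrow> w p < w q)"
  using assms
proof (induction "card (J - I)" arbitrary: I k0)
  case 0
  then have "J \<subseteq> I" by simp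
  then show ?case using 0 by (intro exI[of _ k0]) (auto simp: Un_absorb2)
next
  case (Suc n)
  have "J - I \<noteq> {}"
  proof
    assume "J - I = {}"
    then have "card (J - I) = 0" by (simp only: card.empty)
    then show False using Suc.hyps(2) by simp
  qed
  then obtain q where q: "q \<in> J" "q \<notin> I" by blast
  define D where "D = k0 ` {p \<in> I \<inter> J. w p < w q}"
  define U where "U = k0 ` {p \<in> I \<inter> J. w q < w p}"
  have lt: "d < u" if du: "d \<in> D" "u \<in> U" for d u
  proof -
    obtain p p' where "p \<in> I \<inter> J" "w p < w q" "d = k0 p" "p' \<in> I \<inter> J" "w q < w p'" "u = k0 p'"
      using du by (auto simp: D_def U_def)
    then show ?thesis using Suc.prems(5)[of p p'] by simp
  qed
  have "\<exists>z. (\<forall>d\<in>D. d < z) \<and> (\<forall>u\<in>U. z < u) \<and> z \<notin> k0 ` I"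
    by (rule gap) (simp_all add: lt, simp_all add: D_def U_def Suc.prems(1))
  then obtain z where z: "\<forall>d\<in>D. d < z" "\<forall>u\<in>U. z < u" "z \<notin> k0 ` I" by (elim exE conjE)
  define k1 where "k1 = k0(q := z)"
  have k1I: "k1 p = k0 p" if "p \<in> I" for p using that q by (auto simp: k1_def)
  have inj1: "inj_on k1 (insert q I)"
    using Suc.prems(3) z(3) q by (auto simp: k1_def inj_on_def)
  have agree: "k1 p < k1 p' \<longleftrightarrow> w p < w p'" if pp: "p \<in> insert q I \<inter> J" "p' \<in> insert q I \<inter> J" for p p'
  proof -
    have wne: "w p \<noteq> w q" if "p \<in> I \<inter> J" for p using Suc.prems(4) that q by (auto dest: inj_onD)
    have less: "(k0 p < z \<longleftrightarrow> w p < w q) \<and> (z < k0 p \<longleftrightarrow> w q < w p)" if p: "p \<in> I \<inter> J" for p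
    proof (cases "w p < w q")
      case True
      then have "k0 p < z" using z(1) p by (simp add: D_def)
      then show ?thesis using True by simp
    next
      case False
      then have "w q < w p" using wne[OF p] by simp
      then have "z < k0 p" using z(2) p by (simp add: U_def)
      then show ?thesis using \<open>w q < w p\<close> by simp
    qed
    show ?thesis
      using pp Suc.prems(5)[of p p'] less[of p] less[of p'] q by (auto simp: k1_def)
  qed
  have "J - insert q I = (J - I) - {q}" by blast
  then have "n = card (J - insert q I)" using Suc.hyps(2) q Suc.prems(2) by simp
  then have "\<exists>k :: nat \<Rightarrow> real. inj_on k (insert q I \<union> J) \<and>
    (\<forall>p\<in>insert q I. \<forall>p'\<in>insert q I. k p < k p' \<longleftrightarrow> k1 p < k1 p') \<and>
    (\<forall>p\<in>J. \<forall>p'\<in>J. k p < k p' \<longleftrightarrow> w p < w p')"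
    by (rule Suc.hyps(1)) (use Suc.prems inj1 agree in auto)
  then obtain k :: "nat \<Rightarrow> real" where k: "inj_on k (insert q I \<union> J)"
    "\<forall>p\<in>insert q I. \<forall>p'\<in>insert q I. k p < k p' \<longleftrightarrow> k1 p < k1 p'"
    "\<forall>p\<in>J. \<forall>p'\<in>J. k p < k p' \<longleftrightarrow> w p < w p'" by (elim exE conjE)
  have "insert q I \<union> J = I \<union> J" using q by blast
  then show ?case using k k1I by (intro exI[of _ k]) simp
qed

section \<open>Aligning the lines of monotone cells\<close>

text \<open>\<open>L\<close> selects the lines to be aligned; cells with a line outside \<open>L\<close> need not be monotone.\<close>

definition fits :: "(nat \<times> nat) set \<Rightarrow> (bool \<Rightarrow> nat \<Rightarrow> bool) \<Rightarrow> (nat \<times> nat \<Rightarrow> real) \<Rightarrow>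
    nat set \<Rightarrow> (nat \<Rightarrow> nat \<times> nat) \<Rightarrow> (bool \<Rightarrow> nat \<Rightarrow> real) \<Rightarrow> bool" where
  "fits X L \<sigma> I lab ky \<longleftrightarrow> finite I \<and> lab ` I \<subseteq> X \<and> (\<forall>d. inj_on (ky d) I) \<and>
     (\<forall>p\<in>I. \<forall>q\<in>I. lab p = lab q \<longrightarrow> (\<forall>d. L d (coord d (lab p))) \<longrightarrow>
       (\<forall>d. ky d p < ky d q \<longleftrightarrow> \<sigma> (lab p) * ky (\<not> d) p < \<sigma> (lab p) * ky (\<not> d) q))"

definition ordered :: "(bool \<Rightarrow> nat \<Rightarrow> bool) \<Rightarrow> (bool \<Rightarrow> nat \<Rightarrow> real) \<Rightarrow>
    nat set \<Rightarrow> (nat \<Rightarrow> nat \<times> nat) \<Rightarrow> (bool \<Rightarrow> nat \<Rightarrow> real) \<Rightarrow> (nat \<Rightarrow> real) \<Rightarrow> bool" where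
  "ordered L s I lab ky k \<longleftrightarrow> (\<forall>d. \<forall>p\<in>I. \<forall>q\<in>I. coord d (lab p) = coord d (lab q) \<longrightarrow> L d (coord d (lab p)) \<longrightarrow>
     (k p < k q \<longleftrightarrow> s d (coord d (lab p)) * ky d p < s d (coord d (lab p)) * ky d q))"

lemma sign_mult_less:
  fixes a b c :: real
  assumes "a = 1 \<or> a = - 1" "c = 1 \<or> c = - 1" "x < y \<longleftrightarrow> c * u < c * v" "y < x \<longleftrightarrow> c * v < c * u"
  shows "a * x < a * y \<longleftrightarrow> (a * c) * u < (a * c) * v"
  using assms by auto

text \<open>The order of quantifiers matters: the signs \<open>s\<close> are chosen before the
  structure, so one choice serves all structures that are later compared. The induction adds a leaf
  cell back and merges its points with the rest along its other line.\<close>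

lemma linear_keys:
  assumes "finite X" "acyc X" and \<sigma>: "\<And>x. \<sigma> x = 1 \<or> \<sigma> x = - 1"
  shows "\<exists>s. (\<forall>d i. s d i = 1 \<or> s d i = - 1) \<and>
    (\<forall>I lab ky. fits X L \<sigma> I lab ky \<longrightarrow> (\<exists>k. inj_on k I \<and> ordered L s I lab ky k))"
  using assms(1,2)
proof (induction "card X" arbitrary: X)
  case 0
  then have "X = {}" by simp
  then show ?case by (intro exI[of _ "\<lambda>_ _. 1"]) (auto simp: fits_def ordered_def)
next
  case (Suc n)
  have "X \<noteq> {}" using Suc.hyps(2) by auto
  then obtain x d where x: "x \<in> X" "lone X d x" using Suc.prems(2) unfolding acyc_def by blast
  define X0 where "X0 = X - {x}"
  have "\<exists>s. (\<forall>d i. s d i = 1 \<or> s d i = - 1) \<and>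
    (\<forall>I lab ky. fits X0 L \<sigma> I lab ky \<longrightarrow> (\<exists>k. inj_on k I \<and> ordered L s I lab ky k))"
    unfolding X0_def
    by (rule Suc.hyps(1)) (use Suc.hyps(2) Suc.prems x acyc_sub[of X] in auto)
  then obtain s0 where s0: "\<forall>d i. s0 d i = 1 \<or> s0 d i = - 1"
    and IH: "\<forall>I lab ky. fits X0 L \<sigma> I lab ky \<longrightarrow> (\<exists>k. inj_on k I \<and> ordered L s0 I lab ky k)"
    by (elim exE conjE)
  define e where "e = (\<not> d)"
  define sE where "sE = s0 e (coord e x)"
  \<comment> \<open>The line of \<open>x\<close> in direction \<open>d\<close> carries only
    \<open>x\<close>. If the other line is to be aligned and \<open>x\<close> is monotone, composing
    the sign of that line with the sign of the cell aligns this one too.\<close>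
  define \<theta> where "\<theta> = (if L e (coord e x) then sE * \<sigma> x else 1)"
  define s where "s f i = (if f = d \<and> i = coord d x then \<theta> else s0 f i)" for f i
  have sE: "sE = 1 \<or> sE = - 1" using s0 by (simp add: sE_def)
  have \<theta>: "\<theta> = 1 \<or> \<theta> = - 1" using sE \<sigma>[of x] by (auto simp: \<theta>_def)
  have s1: "s f i = 1 \<or> s f i = - 1" for f i using s0 \<theta> by (simp add: s_def)
  have se: "s e i = s0 e i" for i by (simp add: s_def e_def)
  have "\<exists>k. inj_on k I \<and> ordered L s I lab ky k" if fit: "fits X L \<sigma> I lab ky" for I lab ky
  proof -
    have finI: "finite I" and labI: "\<And>p. p \<in> I \<Longrightarrow> lab p \<in> X" and inj: "\<And>f. inj_on (ky f) I"
      using fit by (auto simp: fits_def)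
    have mono: "ky f p < ky f q \<longleftrightarrow> \<sigma> x * ky (\<not> f) p < \<sigma> x * ky (\<not> f) q"
      if "p \<in> I" "q \<in> I" "lab p = x" "lab q = x" "L d (coord d x)" "L e (coord e x)" for f p q
    proof -
      have "L f (coord f x)" for f using that(5,6) by (cases "f = d") (auto simp: e_def)
      then have "\<forall>f. L f (coord f x)" by blast
      then show ?thesis using fit that(1-4) unfolding fits_def by metis
    qed
    define I0 where "I0 = {p\<in>I. lab p \<noteq> x}"
    have "fits X0 L \<sigma> I0 lab ky"
      using fit unfolding fits_def I0_def X0_def by (auto intro: inj_on_subset)
    then obtain k0 where k0: "inj_on k0 I0" "ordered L s0 I0 lab ky k0" using IH by blast
    have k0o: "k0 p < k0 q \<longleftrightarrow> s0 f (coord f (lab p)) * ky f p < s0 f (coord f (lab p)) * ky f q"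
      if "p \<in> I0" "q \<in> I0" "coord f (lab p) = coord f (lab q)" "L f (coord f (lab p))" for f p q
      using k0(2) that unfolding ordered_def by blast
    \<comment> \<open>\<open>J\<close> carries the order to be merged with \<open>k0\<close>: the
      whole line of \<open>x\<close> in direction \<open>e\<close>, or, if that line is not to be
      aligned, the points of \<open>x\<close> alone, which share nothing with
      \<open>I0\<close>.\<close>
    define J where "J = (if L e (coord e x) then {p\<in>I. coord e (lab p) = coord e x} else {p\<in>I. lab p = x})"
    define w where "w p = (if L e (coord e x) then sE * ky e p else ky d p)" for p
    have JI: "J \<subseteq> I" by (auto simp: J_def)
    have wJ: "inj_on w J"
    proof (rule inj_onI)
      fix p q assume "p \<in> J" "q \<in> J" "w p = w q"
      then show "p = q" using JI inj_onD[OF inj[of e], of p q] inj_onD[OF inj[of d], of p q] sE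
        by (auto simp: w_def split: if_splits)
    qed
    have agree: "k0 p < k0 q \<longleftrightarrow> w p < w q" if "p \<in> I0 \<inter> J" "q \<in> I0 \<inter> J" for p q
    proof (cases "L e (coord e x)")
      case True
      then show ?thesis using k0o[of p q e] that by (simp add: J_def w_def sE_def)
    next
      case False
      then show ?thesis using that by (auto simp: J_def I0_def)
    qed
    have "\<exists>k :: nat \<Rightarrow> real. inj_on k (I0 \<union> J) \<and> (\<forall>p\<in>I0. \<forall>q\<in>I0. k p < k q \<longleftrightarrow> k0 p < k0 q) \<and>
      (\<forall>p\<in>J. \<forall>q\<in>J. k p < k q \<longleftrightarrow> w p < w q)"
      by (rule amalgamate[OF _ _ k0(1) wJ agree])
        (use finI JI in \<open>auto simp: I0_def intro: finite_subset\<close>)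
    then obtain k :: "nat \<Rightarrow> real" where k: "inj_on k (I0 \<union> J)"
      "\<forall>p\<in>I0. \<forall>q\<in>I0. k p < k q \<longleftrightarrow> k0 p < k0 q" "\<forall>p\<in>J. \<forall>q\<in>J. k p < k q \<longleftrightarrow> w p < w q" by (elim exE conjE)
    have xJ: "p \<in> J" if "p \<in> I" "lab p = x" for p using that by (simp add: J_def)
    have "I0 \<union> J = I" using xJ JI by (auto simp: I0_def)
    moreover have "ordered L s I lab ky k"
      unfolding ordered_def
    proof (intro allI ballI impI)
      fix f p q assume pq: "p \<in> I" "q \<in> I" "coord f (lab p) = coord f (lab q)" "L f (coord f (lab p))"
      show "k p < k q \<longleftrightarrow> s f (coord f (lab p)) * ky f p < s f (coord f (lab p)) * ky f q"
      proof (cases "lab p = x \<or> lab q = x")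
        case False
        then have I0: "p \<in> I0" "q \<in> I0" using pq by (auto simp: I0_def)
        have "\<not> (f = d \<and> coord f (lab p) = coord d x)"
        proof
          assume a: "f = d \<and> coord f (lab p) = coord d x"
          have fd: "f = d" using a by blast
          have "coord d (lab p) = coord d x" using a unfolding fd by blast
          then have "lab p = x" using x(2) labI[OF pq(1)] unfolding lone_def by blast
          then show False using False by blast
        qed
        then have "s f (coord f (lab p)) = s0 f (coord f (lab p))" by (auto simp: s_def)
        then show ?thesis using k(2) I0 k0o[OF I0 pq(3,4)] by simp
      next
        case True
        then have cx: "coord f (lab p) = coord f x" "coord f (lab q) = coord f x" using pq by auto
        show ?thesis
        proof (cases "f = d")
          case fd: True
          have lx: "lab p = x" "lab q = x"
            using x(2) labI[OF pq(1)] labI[OF pq(2)] cx fd by (auto simp: lone_def)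
          then have J: "p \<in> J" "q \<in> J" using xJ pq by auto
          have sd: "s f (coord f (lab p)) = \<theta>" using fd lx by (simp add: s_def)
          show ?thesis
          proof (cases "L e (coord e x)")
            case True
            have Ld: "L d (coord d x)" using pq(4) lx fd by simp
            have m: "ky e p < ky e q \<longleftrightarrow> \<sigma> x * ky d p < \<sigma> x * ky d q"
              "ky e q < ky e p \<longleftrightarrow> \<sigma> x * ky d q < \<sigma> x * ky d p"
              using mono[OF pq(1,2) lx Ld True, of e] mono[OF pq(2,1) lx(2,1) Ld True, of e] by (simp_all add: e_def)
            have "w p < w q \<longleftrightarrow> \<theta> * ky d p < \<theta> * ky d q"
              using sign_mult_less[OF sE \<sigma>[of x] m] True by (simp add: w_def \<theta>_def)
            then show ?thesis using k(3) J sd fd by simp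
          next
            case False
            then show ?thesis using k(3) J sd fd by (simp add: w_def \<theta>_def)
          qed
        next
          case False
          then have fe: "f = e" by (simp add: e_def)
          then have Le: "L e (coord e x)" using pq(4) cx by simp
          then have J: "p \<in> J" "q \<in> J" using pq cx fe by (auto simp: J_def)
          have "s f (coord f (lab p)) = sE" using fe cx by (simp add: se sE_def)
          then show ?thesis using k(3) J Le fe by (simp add: w_def)
        qed
      qed
    qed
    ultimately show ?thesis using k(1) by auto
  qed
  then show ?case using s1 by blast
qed

section \<open>Well-quasi-ordered structures with a root cell\<close>

definition wqo_on :: "('a \<Rightarrow> 'a \<Rightarrow> bool) \<Rightarrow> 'a set \<Rightarrow> bool" where
  "wqo_on le A \<longleftrightarrow> (\<forall>f. (\<forall>i::nat. f i \<in> A) \<longrightarrow> (\<exists>i j. i < j \<and> le (f i) (f j)))"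

lemma wqo_onD: "wqo_on le A \<Longrightarrow> (\<And>i::nat. f i \<in> A) \<Longrightarrow> \<exists>i j. i < j \<and> le (f i) (f j)"
  unfolding wqo_on_def by blast

text \<open>Ramsey: pairs of indices are coloured by whether \<open>le\<close> holds, and the colour
  of an infinite homogeneous set cannot be the failing one.\<close>

lemma wqo_subseq:
  fixes f :: "nat \<Rightarrow> 'a"
  assumes wqo: "wqo_on le A" and f: "\<And>i. f i \<in> A"
  obtains \<phi> :: "nat \<Rightarrow> nat" where "strict_mono \<phi>" "\<And>i j. i < j \<Longrightarrow> le (f (\<phi> i)) (f (\<phi> j))"
proof -
  define col where "col S = (if le (f (Min S)) (f (Max S)) then 0 else 1 :: nat)" for S
  have "\<exists>Y t. Y \<subseteq> (UNIV :: nat set) \<and> infinite Y \<and> t < 2 \<and> (\<forall>x\<in>Y. \<forall>y\<in>Y. x \<noteq> y \<longrightarrow> col {x, y} = t)"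
    by (rule Ramsey2) (auto simp: col_def)
  then obtain Y t where Y: "infinite Y" and t': "\<forall>x\<in>Y. \<forall>y\<in>Y. x \<noteq> y \<longrightarrow> col {x, y} = t"
    by (elim exE conjE)
  have t: "col {x, y} = t" if "x \<in> Y" "y \<in> Y" "x \<noteq> y" for x y using t' that by blast
  define \<phi> where "\<phi> = enumerate Y"
  have sm: "strict_mono \<phi>" unfolding \<phi>_def by (rule strict_mono_enumerate[OF Y])
  have in_Y: "\<phi> i \<in> Y" for i unfolding \<phi>_def by (rule enumerate_in_set[OF Y])
  have mm: "Min {x, y} = x" "Max {x, y} = y" if "x < y" for x y :: nat using that by auto
  obtain i j where "i < j" "le (f (\<phi> i)) (f (\<phi> j))"
    using wqo_onD[OF wqo, of "\<lambda>i. f (\<phi> i)"] f by blast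
  then have "t = 0"
    using t[OF in_Y in_Y, of i j] strict_monoD[OF sm, of i j] by (auto simp: col_def mm)
  have "le (f (\<phi> i)) (f (\<phi> j))" if "i < j" for i j
    using t[OF in_Y in_Y, of i j] strict_monoD[OF sm that] \<open>t = 0\<close>
    by (auto simp: col_def mm split: if_splits)
  then show ?thesis using sm that by blast
qed

lemma wqo_subseq_family:
  fixes f :: "'k \<Rightarrow> nat \<Rightarrow> 'a"
  assumes "finite K" "\<And>k. k \<in> K \<Longrightarrow> wqo_on (le k) (A k)" "\<And>k i. k \<in> K \<Longrightarrow> f k i \<in> A k"
  shows "\<exists>\<phi> :: nat \<Rightarrow> nat. strict_mono \<phi> \<and>
    (\<forall>k\<in>K. \<forall>i j. i < j \<longrightarrow> le k (f k (\<phi> i)) (f k (\<phi> j)))"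
  using assms
proof (induction K rule: finite_induct)
  case empty
  show ?case by (rule exI[of _ id]) (simp add: strict_mono_def)
next
  case (insert x K)
  have "\<exists>\<phi> :: nat \<Rightarrow> nat. strict_mono \<phi> \<and> (\<forall>k\<in>K. \<forall>i j. i < j \<longrightarrow> le k (f k (\<phi> i)) (f k (\<phi> j)))"
    by (rule insert.IH) (use insert.prems in auto)
  then obtain \<phi> :: "nat \<Rightarrow> nat" where \<phi>: "strict_mono \<phi>"
    "\<forall>k\<in>K. \<forall>i j. i < j \<longrightarrow> le k (f k (\<phi> i)) (f k (\<phi> j))"
    by (elim exE conjE)
  have fx: "f x (\<phi> i) \<in> A x" for i using insert.prems by simp
  have wx: "wqo_on (le x) (A x)" using insert.prems by simp
  obtain \<psi> :: "nat \<Rightarrow> nat" where \<psi>: "strict_mono \<psi>"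
    "\<And>i j. i < j \<Longrightarrow> le x (f x (\<phi> (\<psi> i))) (f x (\<phi> (\<psi> j)))"
    by (rule wqo_subseq[OF wx, of "\<lambda>i. f x (\<phi> i)", OF fx], rule that)
  have "le k (f k ((\<phi> \<circ> \<psi>) i)) (f k ((\<phi> \<circ> \<psi>) j))" if "k \<in> insert x K" "i < j" for k i j
    using \<phi>(2) \<psi>(2)[OF that(2)] strict_monoD[OF \<psi>(1) that(2)] that(1) by auto
  moreover have "strict_mono (\<phi> \<circ> \<psi>)" using \<phi>(1) \<psi>(1) by (simp add: strict_mono_o)
  ultimately show ?case by blast
qed

text \<open>Badness is kept abstract; \<open>local\<close> says that finite prefixes decide it, so
  the diagonal of the successive minimal choices is bad again.\<close>

lemma minimal_bad_sequence:
  fixes size :: "'a \<Rightarrow> nat" and bad :: "(nat \<Rightarrow> 'a) \<Rightarrow> bool"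
  assumes f0: "bad f0"
    and local: "\<And>g. (\<And>n. \<exists>h. bad h \<and> (\<forall>i\<le>n. h i = g i)) \<Longrightarrow> bad g"
  shows "\<exists>g. bad g \<and> (\<forall>h n. bad h \<longrightarrow> (\<forall>i<n. h i = g i) \<longrightarrow> size (g n) \<le> size (h n))"
proof -
  define ok where "ok n f h \<longleftrightarrow> bad h \<and> (\<forall>i<n. h i = f i) \<and>
    (\<forall>h'. bad h' \<and> (\<forall>i<n. h' i = f i) \<longrightarrow> size (h n) \<le> size (h' n))" for n and f h :: "nat \<Rightarrow> 'a"
  have ex: "\<exists>h. ok n f h" if "bad f" for n f
  proof -
    have "\<exists>h. (bad h \<and> (\<forall>i<n. h i = f i)) \<and> (\<forall>h'. bad h' \<and> (\<forall>i<n. h' i = f i) \<longrightarrow> size (h n) \<le> size (h' n))"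
      using that by (intro ex_has_least_nat[where k = f]) auto
    then show ?thesis unfolding ok_def by blast
  qed
  define F where "F = rec_nat f0 (\<lambda>n f. SOME h. ok n f h)"
  have F0: "F 0 = f0" and FS: "F (Suc n) = (SOME h. ok n (F n) h)" for n by (simp_all add: F_def)
  have badF: "bad (F n)" for n
  proof (induction n)
    case (Suc n)
    have "ok n (F n) (F (Suc n))" unfolding FS by (rule someI_ex[OF ex[OF Suc]])
    then show ?case unfolding ok_def by blast
  qed (simp add: F0 f0)
  have okF: "ok n (F n) (F (Suc n))" for n
    unfolding FS by (rule someI_ex[OF ex[OF badF]])
  \<comment> \<open>A later stage never changes the entries fixed by earlier ones, so the diagonal
    sequence is well determined.\<close>
  have agree: "F m i = F (Suc i) i" if "Suc i \<le> m" for m i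
    using that
  proof (induction m rule: dec_induct)
    case (step m)
    then show ?case using okF[of m] by (simp add: ok_def)
  qed simp
  define g where "g n = F (Suc n) n" for n
  show ?thesis
  proof (intro exI[of _ g] conjI allI impI)
    show "bad g"
    proof (rule local)
      fix n show "\<exists>h. bad h \<and> (\<forall>i\<le>n. h i = g i)"
        using badF[of "Suc n"] agree[of _ "Suc n"] by (intro exI[of _ "F (Suc n)"]) (auto simp: g_def)
    qed
    fix h n assume h: "bad h" "\<forall>i<n. h i = g i"
    then have "\<forall>i<n. h i = F n i" using agree[of _ n] by (simp add: g_def)
    then show "size (g n) \<le> size (h n)" using okF[of n] h(1) by (simp add: ok_def g_def)
  qed
qed

text \<open>As for terms, a code is a top symbol and \<open>ch\<close> lists the immediate subterms.
  The children along a minimal bad sequence are well-quasi-ordered; infinitely many members share a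
  code, two of these have comparable children, and \<open>comb\<close> contradicts badness.\<close>

lemma wqo_by_decomposition:
  fixes le :: "'a \<Rightarrow> 'a \<Rightarrow> bool" and size :: "'a \<Rightarrow> nat" and rel :: "'c \<Rightarrow> 'a \<Rightarrow> (nat \<Rightarrow> 'a) \<Rightarrow> bool"
  assumes trans: "\<And>a b c. le a b \<Longrightarrow> le b c \<Longrightarrow> le a c"
    and fin: "finite Codes"
    and dec: "\<And>a. a \<in> A \<Longrightarrow> \<exists>c\<in>Codes. \<exists>ch. rel c a ch \<and>
      (\<forall>k<ar c. ch k \<in> A \<and> size (ch k) < size a \<and> le (ch k) a)"
    and comb: "\<And>c a ch b ch'. c \<in> Codes \<Longrightarrow> a \<in> A \<Longrightarrow> b \<in> A \<Longrightarrow> rel c a ch \<Longrightarrow> rel c b ch' \<Longrightarrow>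
      (\<forall>k<ar c. le (ch k) (ch' k)) \<Longrightarrow> le a b"
  shows "wqo_on le A"
proof (rule ccontr)
  assume not_wqo: "\<not> wqo_on le A"
  define bad where "bad f \<longleftrightarrow> (\<forall>i. f i \<in> A) \<and> (\<forall>i j. i < j \<longrightarrow> \<not> le (f i) (f j))" for f :: "nat \<Rightarrow> 'a"
  obtain f0 where f0: "bad f0" using not_wqo unfolding wqo_on_def bad_def by blast
  have local: "bad g" if H: "\<And>n. \<exists>h. bad h \<and> (\<forall>i\<le>n. h i = g i)" for g
    unfolding bad_def
  proof (intro conjI allI impI)
    fix i obtain h where "bad h" "\<forall>k\<le>i. h k = g k" using H by blast
    then show "g i \<in> A" by (metis bad_def order_refl)
  next
    fix i j :: nat assume ij: "i < j"
    obtain h where "bad h" "\<forall>k\<le>j. h k = g k" using H by blast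
    then show "\<not> le (g i) (g j)" using ij unfolding bad_def by (metis less_imp_le order_refl)
  qed
  have "\<exists>g. bad g \<and> (\<forall>h n. bad h \<longrightarrow> (\<forall>i<n. h i = g i) \<longrightarrow> size (g n) \<le> size (h n))"
    by (rule minimal_bad_sequence[of bad f0], rule f0, rule local)
  then obtain g where g: "bad g"
    and gmin: "\<forall>h n. bad h \<longrightarrow> (\<forall>i<n. h i = g i) \<longrightarrow> size (g n) \<le> size (h n)"
    by (elim exE conjE)
  have gA: "g i \<in> A" and gbad: "i < j \<Longrightarrow> \<not> le (g i) (g j)" for i j using g by (auto simp: bad_def)
  have "\<forall>i. \<exists>c ch. c \<in> Codes \<and> rel c (g i) ch \<and>
      (\<forall>k<ar c. ch k \<in> A \<and> size (ch k) < size (g i) \<and> le (ch k) (g i))"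
    using dec[OF gA] by blast
  then obtain c ch where c: "\<And>i. c i \<in> Codes" "\<And>i. rel (c i) (g i) (ch i)"
    and ch: "\<And>i k. k < ar (c i) \<Longrightarrow> ch i k \<in> A \<and> size (ch i k) < size (g i) \<and> le (ch i k) (g i)"
    by metis
  define D where "D = {ch i k | i k. k < ar (c i)}"
  have D: "wqo_on le D"
    unfolding wqo_on_def
  proof (intro allI impI, rule ccontr)
    fix d :: "nat \<Rightarrow> 'a" assume d: "\<forall>i. d i \<in> D" and nb: "\<nexists>i j. i < j \<and> le (d i) (d j)"
    have "\<forall>j. \<exists>i k. d j = ch i k \<and> k < ar (c i)" using d unfolding D_def by blast
    then obtain ix kx where ix: "\<And>j. d j = ch (ix j) (kx j)" "\<And>j. kx j < ar (c (ix j))" by metis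
    \<comment> \<open>Starting from the child whose parent has the least index \<open>n\<close> lets
      \<open>g\<close> below \<open>n\<close> be continued by children: each of them lies below a
      parent of index at least \<open>n\<close>, so the splice is bad, but its entry at
      \<open>n\<close> is smaller than \<open>g n\<close>.\<close>
    obtain j0 where j0: "\<And>j. ix j0 \<le> ix j"
      using ex_has_least_nat[of "\<lambda>_. True" 0 ix] by auto
    define n where "n = ix j0"
    define h where "h i = (if i < n then g i else d (j0 + (i - n)))" for i
    have "bad h"
      unfolding bad_def
    proof (intro conjI allI impI)
      fix i show "h i \<in> A" using gA ch ix by (simp add: h_def)
      fix j :: nat assume ij: "i < j"
      consider "j < n" | "n \<le> i" | "i < n" "n \<le> j" by linarith
      then show "\<not> le (h i) (h j)"
      proof cases
        case 1 then show ?thesis using gbad ij by (simp add: h_def)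
      next
        case 2
        then have "j0 + (i - n) < j0 + (j - n)" using ij by simp
        then show ?thesis using nb 2 ij by (auto simp: h_def)
      next
        case 3
        let ?j = "j0 + (j - n)"
        show ?thesis
        proof
          assume "le (h i) (h j)"
          then have "le (g i) (d ?j)" using 3 by (simp add: h_def)
          moreover have "le (d ?j) (g (ix ?j))" using ch ix by simp
          ultimately have "le (g i) (g (ix ?j))" by (rule trans)
          moreover have "i < ix ?j" using 3 j0[of ?j] by (simp add: n_def)
          ultimately show False using gbad by blast
        qed
      qed
    qed
    moreover have "\<forall>i<n. h i = g i" by (simp add: h_def)
    ultimately have "size (g n) \<le> size (h n)" using gmin by blast
    moreover have "size (d j0) < size (g n)" using ch ix by (simp add: n_def)
    ultimately show False by (simp add: h_def)
  qed
  have "finite (c ` UNIV)" using c fin by (meson finite_subset image_subsetI)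
  then obtain i0 where inf: "infinite {i. c i = c i0}"
    using pigeonhole_infinite[of "UNIV :: nat set" c] by auto
  define \<psi> where "\<psi> = enumerate {i. c i = c i0}"
  have \<psi>: "strict_mono \<psi>" "\<And>i. c (\<psi> i) = c i0"
    using strict_mono_enumerate[OF inf] enumerate_in_set[OF inf] by (auto simp: \<psi>_def)
  have "\<exists>\<phi> :: nat \<Rightarrow> nat. strict_mono \<phi> \<and>
    (\<forall>k\<in>{..<ar (c i0)}. \<forall>i j. i < j \<longrightarrow> le (ch (\<psi> (\<phi> i)) k) (ch (\<psi> (\<phi> j)) k))"
  proof (rule wqo_subseq_family[of "{..<ar (c i0)}" "\<lambda>_. le" "\<lambda>_. D" "\<lambda>k i. ch (\<psi> i) k"])
    show "ch (\<psi> i) k \<in> D" if "k \<in> {..<ar (c i0)}" for k i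
      using that \<psi>(2)[of i] unfolding D_def by (intro CollectI exI[of _ "\<psi> i"] exI[of _ k]) simp
  qed (use D in auto)
  then obtain \<phi> :: "nat \<Rightarrow> nat" where \<phi>: "strict_mono \<phi>"
    "\<forall>k\<in>{..<ar (c i0)}. \<forall>i j. i < j \<longrightarrow> le (ch (\<psi> (\<phi> i)) k) (ch (\<psi> (\<phi> j)) k)"
    by (elim exE conjE)
  have "le (g (\<psi> (\<phi> 0))) (g (\<psi> (\<phi> 1)))"
  proof (rule comb[OF c(1)[of i0] gA gA])
    show "rel (c i0) (g (\<psi> (\<phi> 0))) (ch (\<psi> (\<phi> 0)))" "rel (c i0) (g (\<psi> (\<phi> 1))) (ch (\<psi> (\<phi> 1)))"
      using c(2) \<psi>(2) by metis+
    show "\<forall>k<ar (c i0). le (ch (\<psi> (\<phi> 0)) k) (ch (\<psi> (\<phi> 1)) k)" using \<phi>(2) by simp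
  qed
  moreover have "\<psi> (\<phi> 0) < \<psi> (\<phi> 1)" using \<phi>(1) \<psi>(1) by (simp add: strict_mono_less)
  ultimately show False using gbad by blast
qed

section \<open>Structures over two linear orders\<close>

text \<open>
  A structure consists of a finite set of points labelled by cells, with one linear order for each
  of two sides; the points labelled by the root cell \<open>r\<close> are the ones lying on both sides.
\<close>

datatype 'c code = Strip bool bool 'c | Infl nat "bool \<Rightarrow> nat \<Rightarrow> int" | Leaf bool

fun arity :: "'c code \<Rightarrow> nat" where
  "arity (Strip s e x) = 1"
| "arity (Infl n \<sigma>) = n"
| "arity (Leaf e) = 0"

type_synonym 'c struc = "nat set \<times> (nat \<Rightarrow> 'c) \<times> (bool \<Rightarrow> nat \<Rightarrow> real)"

text \<open>A substitution decomposition on both sides at once: \<open>\<beta>\<close> names the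
  block of a point and \<open>\<sigma> s\<close> ranks the blocks on side \<open>s\<close>. Ranks
  are integers so that a reversed side is expressed by negation.\<close>

definition inflates :: "nat \<Rightarrow> (bool \<Rightarrow> nat \<Rightarrow> int) \<Rightarrow> nat set \<Rightarrow> (bool \<Rightarrow> nat \<Rightarrow> real) \<Rightarrow> (nat \<Rightarrow> nat) \<Rightarrow> bool" where
  "inflates n \<sigma> R k \<beta> \<longleftrightarrow> 2 \<le> n \<and> \<beta> ` R = {..<n} \<and>
     (\<forall>s. \<forall>p\<in>R. \<forall>q\<in>R. \<beta> p \<noteq> \<beta> q \<longrightarrow> (k s p < k s q \<longleftrightarrow> \<sigma> s (\<beta> p) < \<sigma> s (\<beta> q)))"

locale rooted =
  fixes XX :: "bool \<Rightarrow> 'c set" and r :: 'c and \<Gamma> :: "(nat \<times> (bool \<Rightarrow> nat \<Rightarrow> int)) set"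
  assumes finX: "finite (XX s)" and root: "XX True \<inter> XX False = {r}" and fin\<Gamma>: "finite \<Gamma>"
begin

definition sle :: "'c struc \<Rightarrow> 'c struc \<Rightarrow> bool" where
  "sle a b \<longleftrightarrow> (case a of (I, lab, k) \<Rightarrow> case b of (J, lab', k') \<Rightarrow>
     \<exists>f. (\<forall>p\<in>I. f p \<in> J \<and> lab' (f p) = lab p) \<and>
       (\<forall>s. \<forall>p\<in>I. \<forall>q\<in>I. lab p \<in> XX s \<longrightarrow> lab q \<in> XX s \<longrightarrow> (k s p < k s q \<longleftrightarrow> k' s (f p) < k' s (f q))))"

text \<open>The last condition speaks of all sets of root points, not only of the full one, so that
  it passes to substructures and in particular to the children of a decomposition.\<close>

definition strucs :: "'c struc set" where
  "strucs = {(I, lab, k). finite I \<and> lab ` I \<subseteq> XX True \<union> XX False \<and>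
     (\<forall>s. inj_on (k s) {p\<in>I. lab p \<in> XX s}) \<and>
     (\<forall>R\<subseteq>{p\<in>I. lab p = r}. 2 \<le> card R \<longrightarrow> (\<exists>(n, \<sigma>)\<in>\<Gamma>. \<exists>\<beta>. inflates n \<sigma> R k \<beta>))}"

lemma sle_trans: "sle a b \<Longrightarrow> sle b c \<Longrightarrow> sle a c"
proof -
  assume ab: "sle a b" and bc: "sle b c"
  obtain I lab k J lab' k' K lab'' k'' where abc: "a = (I, lab, k)" "b = (J, lab', k')" "c = (K, lab'', k'')"
    by (cases a, cases b, cases c) blast
  obtain f where f: "\<forall>p\<in>I. f p \<in> J \<and> lab' (f p) = lab p"
    "\<forall>s. \<forall>p\<in>I. \<forall>q\<in>I. lab p \<in> XX s \<longrightarrow> lab q \<in> XX s \<longrightarrow> (k s p < k s q \<longleftrightarrow> k' s (f p) < k' s (f q))"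
    using ab by (auto simp: sle_def abc)
  obtain g where g: "\<forall>p\<in>J. g p \<in> K \<and> lab'' (g p) = lab' p"
    "\<forall>s. \<forall>p\<in>J. \<forall>q\<in>J. lab' p \<in> XX s \<longrightarrow> lab' q \<in> XX s \<longrightarrow> (k' s p < k' s q \<longleftrightarrow> k'' s (g p) < k'' s (g q))"
    using bc by (auto simp: sle_def abc)
  show "sle a c" unfolding sle_def abc prod.case
    using f g by (intro exI[of _ "g \<circ> f"]) simp
qed

lemma r_in: "r \<in> XX s"
  using root by (cases s) auto

lemma only_root: "x \<in> XX s \<Longrightarrow> x \<in> XX (\<not> s) \<Longrightarrow> x = r"
  using root by (cases s) auto

text \<open>The code holds what is required to compare structures through their children: side, end
  and label of a removed extreme point, or the ranks of the blocks. A removed point lies outside the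
  root cell, so its place in a single order is all that counts.\<close>

definition rel :: "'c code \<Rightarrow> 'c struc \<Rightarrow> (nat \<Rightarrow> 'c struc) \<Rightarrow> bool" where
  "rel c a ch \<longleftrightarrow> (case a of (I, lab, k) \<Rightarrow> (case c of
      Strip s e x \<Rightarrow> x \<in> XX s \<and> x \<noteq> r \<and> (\<exists>p\<in>I. lab p = x \<and>
        (\<forall>q\<in>I. lab q \<in> XX s \<longrightarrow> q \<noteq> p \<longrightarrow> (if e then k s q < k s p else k s p < k s q)) \<and>
        ch 0 = (I - {p}, lab, k))
    | Infl n \<sigma> \<Rightarrow> \<exists>\<beta>. (\<forall>p\<in>I. \<beta> p < n) \<and> (\<forall>t<n. ch t = ({p\<in>I. \<beta> p = t}, lab, k)) \<and>
        (\<forall>s. \<forall>p\<in>I. \<forall>q\<in>I. lab p \<in> XX s \<longrightarrow> lab q \<in> XX s \<longrightarrow> \<beta> p \<noteq> \<beta> q \<longrightarrow>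
          (k s p < k s q \<longleftrightarrow> \<sigma> s (\<beta> p) < \<sigma> s (\<beta> q)))
    | Leaf e \<Rightarrow> (if e then I = {} else (\<exists>p. I = {p} \<and> lab p = r))))"

text \<open>For \<open>Strip\<close> the removed points are matched with each other, being extreme
  in the same order and absent from the other one. For \<open>Infl\<close> the maps of the blocks
  are glued, since points of different blocks compare as their blocks do.\<close>

lemma rel_comb:
  assumes ra: "rel c a ch" and rb: "rel c b ch'" and le: "\<forall>t<arity c. sle (ch t) (ch' t)"
  shows "sle a b"
proof -
  obtain I lab k J lab' k' where ab: "a = (I, lab, k)" "b = (J, lab', k')"
    by (cases a, cases b) blast
  show ?thesis
  proof (cases c)
    case (Strip s e x)
    obtain p where p: "x \<in> XX s" "x \<noteq> r" "p \<in> I" "lab p = x"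
      "\<And>q. q\<in>I \<Longrightarrow> lab q \<in> XX s \<Longrightarrow> q \<noteq> p \<Longrightarrow> (if e then k s q < k s p else k s p < k s q)"
      "ch 0 = (I - {p}, lab, k)"
      using ra unfolding rel_def ab Strip by auto
    obtain p' where p': "p' \<in> J" "lab' p' = x"
      "\<And>q. q\<in>J \<Longrightarrow> lab' q \<in> XX s \<Longrightarrow> q \<noteq> p' \<Longrightarrow> (if e then k' s q < k' s p' else k' s p' < k' s q)"
      "ch' 0 = (J - {p'}, lab', k')"
      using rb unfolding rel_def ab Strip by auto
    have "sle (I - {p}, lab, k) (J - {p'}, lab', k')" using le p p' Strip by simp
    then obtain f where f0: "\<forall>q\<in>I - {p}. f q \<in> J - {p'} \<and> lab' (f q) = lab q"
      "\<forall>s. \<forall>q\<in>I - {p}. \<forall>q'\<in>I - {p}. lab q \<in> XX s \<longrightarrow> lab q' \<in> XX s \<longrightarrow>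
        (k s q < k s q' \<longleftrightarrow> k' s (f q) < k' s (f q'))"
      unfolding sle_def prod.case by (elim exE conjE)
    have f: "f q \<in> J \<and> f q \<noteq> p' \<and> lab' (f q) = lab q" if "q \<in> I" "q \<noteq> p" for q
      using f0(1) that by blast
    have f': "k s q < k s q' \<longleftrightarrow> k' s (f q) < k' s (f q')"
      if "q \<in> I" "q \<noteq> p" "q' \<in> I" "q' \<noteq> p" "lab q \<in> XX s" "lab q' \<in> XX s" for s q q'
      using f0(2) that by blast
    define h where "h = f(p := p')"
    have "\<forall>q\<in>I. h q \<in> J \<and> lab' (h q) = lab q" using f p p' by (auto simp: h_def)
    moreover have "k s' q < k s' q' \<longleftrightarrow> k' s' (h q) < k' s' (h q')"
      if q: "q \<in> I" "q' \<in> I" "lab q \<in> XX s'" "lab q' \<in> XX s'" for s' q q'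
    proof -
      consider "q \<noteq> p" "q' \<noteq> p" | "q = p" "q' = p" | "q = p" "q' \<noteq> p" | "q \<noteq> p" "q' = p" by blast
      then show ?thesis
      proof cases
        case 1 then show ?thesis using f' q by (simp add: h_def)
      next
        case 3
        then have "s' = s" using only_root[of x s] p q by (cases s; cases s') auto
        then show ?thesis using 3 p(5)[of q'] p'(3)[of "f q'"] f[of q'] q
          by (cases e) (auto simp: h_def)
      next
        case 4
        then have "s' = s" using only_root[of x s] p q by (cases s; cases s') auto
        then show ?thesis using 4 p(5)[of q] p'(3)[of "f q"] f[of q] q
          by (cases e) (auto simp: h_def)
      qed simp
    qed
    ultimately show ?thesis unfolding sle_def ab prod.case by blast
  next
    case (Infl n \<sigma>)
    obtain \<beta> where b0: "\<forall>p\<in>I. \<beta> p < n" "\<forall>t<n. ch t = ({p\<in>I. \<beta> p = t}, lab, k)"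
      "\<forall>s. \<forall>p\<in>I. \<forall>q\<in>I. lab p \<in> XX s \<longrightarrow> lab q \<in> XX s \<longrightarrow> \<beta> p \<noteq> \<beta> q \<longrightarrow>
          (k s p < k s q \<longleftrightarrow> \<sigma> s (\<beta> p) < \<sigma> s (\<beta> q))"
      using ra unfolding rel_def ab Infl prod.case code.case by (elim exE conjE)
    obtain \<beta>' where b1: "\<forall>t<n. ch' t = ({p\<in>J. \<beta>' p = t}, lab', k')"
      "\<forall>s. \<forall>p\<in>J. \<forall>q\<in>J. lab' p \<in> XX s \<longrightarrow> lab' q \<in> XX s \<longrightarrow> \<beta>' p \<noteq> \<beta>' q \<longrightarrow>
          (k' s p < k' s q \<longleftrightarrow> \<sigma> s (\<beta>' p) < \<sigma> s (\<beta>' q))"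
      using rb unfolding rel_def ab Infl prod.case code.case by (elim exE conjE)
    have \<beta>1: "\<beta> p < n" if "p \<in> I" for p using b0(1) that by blast
    have \<beta>2: "ch t = ({p\<in>I. \<beta> p = t}, lab, k)" if "t < n" for t using b0(2) that by blast
    have \<beta>3: "k s p < k s q \<longleftrightarrow> \<sigma> s (\<beta> p) < \<sigma> s (\<beta> q)"
      if "p\<in>I" "q\<in>I" "lab p \<in> XX s" "lab q \<in> XX s" "\<beta> p \<noteq> \<beta> q" for s p q
      using b0(3) that by blast
    have \<beta>'1: "ch' t = ({p\<in>J. \<beta>' p = t}, lab', k')" if "t < n" for t using b1(1) that by blast
    have \<beta>'2: "k' s p < k' s q \<longleftrightarrow> \<sigma> s (\<beta>' p) < \<sigma> s (\<beta>' q)"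
      if "p\<in>J" "q\<in>J" "lab' p \<in> XX s" "lab' q \<in> XX s" "\<beta>' p \<noteq> \<beta>' q" for s p q
      using b1(2) that by blast
    have "\<forall>t. \<exists>f. t < n \<longrightarrow> (\<forall>p. p\<in>I \<and> \<beta> p = t \<longrightarrow> f p \<in> J \<and> \<beta>' (f p) = t \<and> lab' (f p) = lab p) \<and>
       (\<forall>s p q. p\<in>I \<and> \<beta> p = t \<and> q\<in>I \<and> \<beta> q = t \<and> lab p \<in> XX s \<and> lab q \<in> XX s \<longrightarrow>
         (k s p < k s q \<longleftrightarrow> k' s (f p) < k' s (f q)))"
    proof
      fix t
      show "\<exists>f. t < n \<longrightarrow> (\<forall>p. p\<in>I \<and> \<beta> p = t \<longrightarrow> f p \<in> J \<and> \<beta>' (f p) = t \<and> lab' (f p) = lab p) \<and>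
       (\<forall>s p q. p\<in>I \<and> \<beta> p = t \<and> q\<in>I \<and> \<beta> q = t \<and> lab p \<in> XX s \<and> lab q \<in> XX s \<longrightarrow>
         (k s p < k s q \<longleftrightarrow> k' s (f p) < k' s (f q)))"
      proof (cases "t < n")
        case True
        then have "sle ({p\<in>I. \<beta> p = t}, lab, k) ({p\<in>J. \<beta>' p = t}, lab', k')"
          using le \<beta>2 \<beta>'1 Infl by simp
        then obtain f where "\<forall>p\<in>{p\<in>I. \<beta> p = t}. f p \<in> {p\<in>J. \<beta>' p = t} \<and> lab' (f p) = lab p"
          "\<forall>s. \<forall>p\<in>{p\<in>I. \<beta> p = t}. \<forall>q\<in>{p\<in>I. \<beta> p = t}. lab p \<in> XX s \<longrightarrow> lab q \<in> XX s \<longrightarrow>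
            (k s p < k s q \<longleftrightarrow> k' s (f p) < k' s (f q))"
          unfolding sle_def prod.case by (elim exE conjE)
        then show ?thesis by (intro exI[of _ f]) simp
      qed simp
    qed
    then obtain F where F: "\<forall>t. t < n \<longrightarrow> (\<forall>p. p\<in>I \<and> \<beta> p = t \<longrightarrow> F t p \<in> J \<and> \<beta>' (F t p) = t \<and> lab' (F t p) = lab p) \<and>
       (\<forall>s p q. p\<in>I \<and> \<beta> p = t \<and> q\<in>I \<and> \<beta> q = t \<and> lab p \<in> XX s \<and> lab q \<in> XX s \<longrightarrow>
         (k s p < k s q \<longleftrightarrow> k' s (F t p) < k' s (F t q)))"
      by (rule choice[THEN exE])
    define h where "h p = F (\<beta> p) p" for p
    have h: "h p \<in> J" "\<beta>' (h p) = \<beta> p" "lab' (h p) = lab p" if "p \<in> I" for p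
      using F \<beta>1[OF that] that by (auto simp: h_def)
    have "k s p < k s q \<longleftrightarrow> k' s (h p) < k' s (h q)"
      if q: "p \<in> I" "q \<in> I" "lab p \<in> XX s" "lab q \<in> XX s" for s p q
    proof (cases "\<beta> p = \<beta> q")
      case True
      then show ?thesis using F \<beta>1[OF q(1)] q by (simp add: h_def)
    next
      case False
      then show ?thesis using \<beta>3[of p q s] \<beta>'2[of "h p" "h q" s] h q by simp
    qed
    then show ?thesis unfolding sle_def ab prod.case using h by blast
  next
    case (Leaf e)
    show ?thesis
    proof (cases e)
      case True
      then show ?thesis using ra unfolding rel_def ab Leaf sle_def by simp
    next
      case False
      then obtain p q where "I = {p}" "lab p = r" "J = {q}" "lab' q = r"
        using ra rb unfolding rel_def ab Leaf by auto
      then show ?thesis unfolding ab sle_def by auto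
    qed
  qed
qed

lemma struc_sub:
  assumes "(I, lab, k) \<in> strucs" "J \<subseteq> I"
  shows "(J, lab, k) \<in> strucs" "sle (J, lab, k) (I, lab, k)"
proof -
  have sub: "{p \<in> J. P p} \<subseteq> {p \<in> I. P p}" for P using assms(2) by blast
  have I: "finite I" "lab ` I \<subseteq> XX True \<union> XX False" "\<And>s. inj_on (k s) {p\<in>I. lab p \<in> XX s}"
    "\<forall>R\<subseteq>{p\<in>I. lab p = r}. 2 \<le> card R \<longrightarrow> (\<exists>(n, \<sigma>)\<in>\<Gamma>. \<exists>\<beta>. inflates n \<sigma> R k \<beta>)"
    using assms(1) by (simp_all add: strucs_def)
  have "finite J" using I(1) assms(2) by (rule finite_subset[rotated])
  moreover have "lab ` J \<subseteq> XX True \<union> XX False" using I(2) assms(2) by blast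
  moreover have "inj_on (k s) {p\<in>J. lab p \<in> XX s}" for s by (rule inj_on_subset[OF I(3) sub])
  moreover have "\<forall>R\<subseteq>{p\<in>J. lab p = r}. 2 \<le> card R \<longrightarrow> (\<exists>(n, \<sigma>)\<in>\<Gamma>. \<exists>\<beta>. inflates n \<sigma> R k \<beta>)"
    using I(4) sub[of "\<lambda>p. lab p = r"] by (meson order_trans)
  ultimately show "(J, lab, k) \<in> strucs" by (simp add: strucs_def)
  show "sle (J, lab, k) (I, lab, k)"
    unfolding sle_def prod.case using assms(2) by (intro exI[of _ id]) auto
qed

lemma ex_extreme:
  fixes key :: "nat \<Rightarrow> real"
  assumes "finite S" "S \<noteq> {}"
  shows "\<exists>p\<in>S. \<forall>q\<in>S. key q \<le> key p" "\<exists>p\<in>S. \<forall>q\<in>S. key p \<le> key q"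
proof -
  have f: "finite (key ` S)" "key ` S \<noteq> {}" using assms by auto
  obtain p where "p \<in> S" "key p = Max (key ` S)" using Max_in[OF f] by force
  then show "\<exists>p\<in>S. \<forall>q\<in>S. key q \<le> key p" using Max_ge[OF f(1)] by (intro bexI[of _ p]) simp_all
  obtain p where "p \<in> S" "key p = Min (key ` S)" using Min_in[OF f] by force
  then show "\<exists>p\<in>S. \<forall>q\<in>S. key p \<le> key q" using Min_le[OF f(1)] by (intro bexI[of _ p]) simp_all
qed

text \<open>If nothing can be stripped, both extremes of every non-empty side are root points. Then
  each point is bounded by root points of its side, and the blocks of the root points spread to all
  points; with fewer than two root points the structure has at most one point.\<close>

lemma struc_dec:
  assumes a: "(I, lab, k) \<in> strucs"
  defines "Codes \<equiv> (\<lambda>(s, e, x). Strip s e x) ` (UNIV \<times> UNIV \<times> (XX True \<union> XX False)) \<union>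
    (\<lambda>(n, \<sigma>). Infl n \<sigma>) ` \<Gamma> \<union> range Leaf"
  shows "\<exists>c\<in>Codes. \<exists>ch. rel c (I, lab, k) ch \<and>
    (\<forall>t<arity c. ch t \<in> strucs \<and> card (fst (ch t)) < card I \<and> sle (ch t) (I, lab, k))"
proof -
  have fI: "finite I" and labI: "\<And>p. p \<in> I \<Longrightarrow> lab p \<in> XX True \<or> lab p \<in> XX False"
    and inj: "\<And>s. inj_on (k s) {p\<in>I. lab p \<in> XX s}"
    and decR: "\<And>R. R\<subseteq>{p\<in>I. lab p = r} \<Longrightarrow> 2 \<le> card R \<Longrightarrow> \<exists>(n, \<sigma>)\<in>\<Gamma>. \<exists>\<beta>. inflates n \<sigma> R k \<beta>"
    using a by (auto simp: strucs_def)
  have child: "(J, lab, k) \<in> strucs \<and> card J < card I \<and> sle (J, lab, k) (I, lab, k)" if "J \<subset> I" for J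
    using struc_sub[OF a, of J] that psubset_card_mono[OF fI] by blast
  define ext where "ext s e p \<longleftrightarrow> p \<in> I \<and> lab p \<in> XX s \<and>
    (\<forall>q\<in>I. lab q \<in> XX s \<longrightarrow> q \<noteq> p \<longrightarrow> (if e then k s q < k s p else k s p < k s q))" for s e p
  have ext_ex: "\<exists>p. ext s e p" if "\<exists>p\<in>I. lab p \<in> XX s" for s e
  proof -
    let ?S = "{p\<in>I. lab p \<in> XX s}"
    have S: "finite ?S" "?S \<noteq> {}" using fI that by auto
    have ne: "k s p \<noteq> k s q" if "p \<in> ?S" "q \<in> ?S" "p \<noteq> q" for p q
      using inj_onD[OF inj[of s]] that by blast
    show ?thesis
    proof (cases e)
      case True
      obtain p where p: "p \<in> ?S" "\<forall>q\<in>?S. k s q \<le> k s p" using ex_extreme(1)[OF S] by blast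
      then have "k s q < k s p" if "q \<in> ?S" "q \<noteq> p" for q using ne[OF that(1) p(1)] that by force
      then show ?thesis using p True unfolding ext_def by auto
    next
      case False
      obtain p where p: "p \<in> ?S" "\<forall>q\<in>?S. k s p \<le> k s q" using ex_extreme(2)[OF S] by blast
      then have "k s p < k s q" if "q \<in> ?S" "q \<noteq> p" for q using ne[OF that(1) p(1)] that by force
      then show ?thesis using p False unfolding ext_def by auto
    qed
  qed
  define R where "R = {p\<in>I. lab p = r}"
  show ?thesis
  proof (cases "\<exists>s e p. ext s e p \<and> lab p \<noteq> r")
    case True
    then obtain s e p where p: "ext s e p" "lab p \<noteq> r" by blast
    define ch where "ch = (\<lambda>t::nat. (I - {p}, lab, k))"
    have "rel (Strip s e (lab p)) (I, lab, k) ch"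
      using p unfolding rel_def ext_def ch_def by auto
    moreover have "Strip s e (lab p) \<in> Codes"
    proof -
      have "lab p \<in> XX True \<union> XX False" using p(1) labI by (auto simp: ext_def)
      then show ?thesis unfolding Codes_def by (intro UnI1 image_eqI[of _ _ "(s, e, lab p)"]) auto
    qed
    moreover have "I - {p} \<subset> I" using p by (auto simp: ext_def)
    ultimately show ?thesis using child by (intro bexI[of _ "Strip s e (lab p)"] exI[of _ ch]) (auto simp: ch_def)
  next
    case False
    then have ext_root: "ext s e p \<Longrightarrow> lab p = r" for s e p by blast
    show ?thesis
    proof (cases "2 \<le> card R")
      case True
      obtain n \<sigma> \<beta>0 where \<Gamma>: "(n, \<sigma>) \<in> \<Gamma>" and inf: "inflates n \<sigma> R k \<beta>0"
        using decR[of R] True by (auto simp: R_def)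
      have fR: "finite R" using fI by (simp add: R_def)
      \<comment> \<open>Each point joins the block of the next root point at or above it on its
        side. It exists because the maximum of the side is a root point.\<close>
      have nxt: "\<exists>q. q \<in> R \<and> k s p \<le> k s q \<and> (\<forall>q'\<in>R. k s p \<le> k s q' \<longrightarrow> k s q \<le> k s q')"
        if p: "p \<in> I" "lab p \<in> XX s" for s p
      proof -
        obtain m where m: "ext s True m" using ext_ex p by blast
        then have "m \<in> R" using ext_root[OF m] by (auto simp: ext_def R_def)
        moreover have "k s p \<le> k s m" using m p by (cases "p = m") (auto simp: ext_def less_imp_le)
        ultimately have "{q\<in>R. k s p \<le> k s q} \<noteq> {}" by blast
        from ex_extreme(2)[OF _ this, of "k s"] fR show ?thesis by auto
      qed
      define nx where "nx s p = (SOME q. q \<in> R \<and> k s p \<le> k s q \<and> (\<forall>q'\<in>R. k s p \<le> k s q' \<longrightarrow> k s q \<le> k s q'))" for s p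
      have nx: "nx s p \<in> R \<and> k s p \<le> k s (nx s p)"
        "\<And>q. q \<in> R \<Longrightarrow> k s p \<le> k s q \<Longrightarrow> k s (nx s p) \<le> k s q" if "p \<in> I" "lab p \<in> XX s" for s p
        using someI_ex[OF nxt[OF that]] unfolding nx_def by blast+
      have Rin: "p \<in> I \<and> lab p = r \<and> lab p \<in> XX s" if "p \<in> R" for p s
        using that r_in by (auto simp: R_def)
      have nxR: "nx s p = p" if "p \<in> R" for s p
      proof -
        have "k s (nx s p) = k s p" using nx(1)[of p s] nx(2)[of p s p] Rin[OF that] that by fastforce
        moreover have "nx s p \<in> R" using nx(1)[of p s] Rin[OF that] by blast
        ultimately show ?thesis using inj_onD[OF inj[of s]] Rin that by blast
      qed
      define \<beta> where "\<beta> p = \<beta>0 (nx (lab p \<in> XX True) p)" for p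
      have \<beta>s: "\<beta> p = \<beta>0 (nx s p)" if "p \<in> I" "lab p \<in> XX s" for p s
      proof (cases "lab p = r")
        case True
        then have "p \<in> R" using that by (simp add: R_def)
        then show ?thesis using nxR by (simp add: \<beta>_def)
      next
        case False
        then have "(lab p \<in> XX True) = s" using only_root[of "lab p" True] that by (cases s) auto
        then show ?thesis by (simp add: \<beta>_def)
      qed
      have \<beta>R: "\<beta> p = \<beta>0 p" if "p \<in> R" for p using nxR[OF that] by (simp add: \<beta>_def)
      have \<beta>n: "\<beta> p < n" if pI: "p \<in> I" for p
      proof -
        obtain s where s: "lab p \<in> XX s" using labI[OF pI] by blast
        then have "nx s p \<in> R" using nx(1)[OF pI] by blast
        then have "\<beta>0 (nx s p) \<in> {..<n}" using inf unfolding inflates_def by blast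
        then show ?thesis using \<beta>s[OF pI s] by simp
      qed
      define ch where "ch t = ({p\<in>I. \<beta> p = t}, lab, k)" for t
      have ord: "k s p < k s q \<longleftrightarrow> \<sigma> s (\<beta> p) < \<sigma> s (\<beta> q)"
        if pq: "p \<in> I" "q \<in> I" "lab p \<in> XX s" "lab q \<in> XX s" "\<beta> p \<noteq> \<beta> q" for s p q
      proof -
        let ?P = "nx s p" and ?Q = "nx s q"
        have R: "?P \<in> R" "?Q \<in> R" using nx(1) pq by auto
        have ne: "\<beta>0 ?P \<noteq> \<beta>0 ?Q" using \<beta>s pq by simp
        then have "?P \<noteq> ?Q" by auto
        then have kne: "k s ?P \<noteq> k s ?Q" using inj_onD[OF inj[of s]] R Rin by blast
        have "k s p < k s q \<longleftrightarrow> k s ?P < k s ?Q"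
        proof
          assume "k s p < k s q"
          then have "k s ?P \<le> k s ?Q" using nx(1)[of q s] nx(2)[of p s ?Q] pq R by fastforce
          then show "k s ?P < k s ?Q" using kne by simp
        next
          assume *: "k s ?P < k s ?Q"
          show "k s p < k s q"
          proof (rule ccontr)
            assume "\<not> k s p < k s q"
            then have "k s ?Q \<le> k s ?P" using nx(1)[of p s] nx(2)[of q s ?P] pq R by fastforce
            then show False using * by simp
          qed
        qed
        also have "\<dots> \<longleftrightarrow> \<sigma> s (\<beta>0 ?P) < \<sigma> s (\<beta>0 ?Q)" using inf R ne unfolding inflates_def by blast
        finally show ?thesis using \<beta>s pq by simp
      qed
      have "rel (Infl n \<sigma>) (I, lab, k) ch"
        unfolding rel_def prod.case code.case
      proof (intro exI[of _ \<beta>] conjI)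
        show "\<forall>p\<in>I. \<beta> p < n" using \<beta>n by blast
        show "\<forall>t<n. ch t = ({p\<in>I. \<beta> p = t}, lab, k)" by (simp add: ch_def)
        show "\<forall>s. \<forall>p\<in>I. \<forall>q\<in>I. lab p \<in> XX s \<longrightarrow> lab q \<in> XX s \<longrightarrow> \<beta> p \<noteq> \<beta> q \<longrightarrow>
          (k s p < k s q \<longleftrightarrow> \<sigma> s (\<beta> p) < \<sigma> s (\<beta> q))" using ord by blast
      qed
      moreover have "Infl n \<sigma> \<in> Codes" unfolding Codes_def
        by (intro UnI1 UnI2 image_eqI[of _ _ "(n, \<sigma>)"]) (use \<Gamma> in simp_all)
      \<comment> \<open>There are at least two blocks and each contains a root point, so every child
        is a proper part.\<close>
      moreover have "{p\<in>I. \<beta> p = t} \<subset> I" if "t < n" for t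
      proof -
        define t' where "t' = (if t = 0 then 1 else 0 :: nat)"
        have t': "t' < n" "t' \<noteq> t" using inf by (auto simp: t'_def inflates_def)
        then obtain q where "q \<in> R" "\<beta>0 q = t'" using inf unfolding inflates_def by (metis imageE lessThan_iff)
        then have "q \<in> I" "\<beta> q \<noteq> t" using Rin \<beta>R t' by auto
        then show ?thesis by blast
      qed
      ultimately show ?thesis using child by (intro bexI[of _ "Infl n \<sigma>"] exI[of _ ch]) (auto simp: ch_def)
    next
      case False
      have fR: "finite R" using fI by (simp add: R_def)
      have R1: "p = q" if "p \<in> R" "q \<in> R" for p q
      proof (rule ccontr)
        assume "p \<noteq> q"
        then have "card {p, q} \<le> card R" using that fR by (intro card_mono) auto
        then show False using False \<open>p \<noteq> q\<close> by simp
      qed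
      \<comment> \<open>Maximum and minimum of the side are both root points, hence the same
        point.\<close>
      have single: "p \<in> R \<and> (\<forall>q\<in>I. lab q \<in> XX s \<longrightarrow> q = p)" if p: "p \<in> I" "lab p \<in> XX s" for p s
      proof -
        obtain a where a: "ext s True a" using ext_ex p by blast
        obtain b where b: "ext s False b" using ext_ex p by blast
        have "a \<in> R" "b \<in> R" using ext_root[OF a] ext_root[OF b] a b by (auto simp: ext_def R_def)
        then have "a = b" using R1 by blast
        then have "q = a" if "q \<in> I" "lab q \<in> XX s" for q
          using a b that unfolding ext_def by (metis less_asym)
        then show ?thesis using p \<open>a \<in> R\<close> by metis
      qed
      show ?thesis
      proof (cases "I = {}")
        case True
        then have "rel (Leaf True) (I, lab, k) (\<lambda>_. undefined)" by (simp add: rel_def)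
        moreover have "Leaf True \<in> Codes" unfolding Codes_def by (rule UnI2, rule rangeI)
        ultimately show ?thesis by (intro bexI[of _ "Leaf True"]) auto
      next
        case False
        then obtain p0 where "p0 \<in> I" by blast
        then obtain p where p: "p \<in> R" using single labI by blast
        then have "lab p \<in> XX s" "p \<in> I" for s using r_in by (auto simp: R_def)
        then have "I = {p}" using single labI by blast
        then have "rel (Leaf False) (I, lab, k) (\<lambda>_. undefined)" using p by (auto simp: rel_def R_def)
        moreover have "Leaf False \<in> Codes" unfolding Codes_def by (rule UnI2, rule rangeI)
        ultimately show ?thesis by (intro bexI[of _ "Leaf False"]) auto
      qed
    qed
  qed
qed

theorem wqo_strucs: "wqo_on sle strucs"
proof (rule wqo_by_decomposition[where rel = rel and ar = arity and size = "\<lambda>a. card (fst a)"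
      and Codes = "(\<lambda>(s, e, x). Strip s e x) ` (UNIV \<times> UNIV \<times> (XX True \<union> XX False)) \<union>
    (\<lambda>(n, \<sigma>). Infl n \<sigma>) ` \<Gamma> \<union> range Leaf"])
  fix a assume "a \<in> strucs"
  then show "\<exists>c\<in>(\<lambda>(s, e, x). Strip s e x) ` (UNIV \<times> UNIV \<times> (XX True \<union> XX False)) \<union>
    (\<lambda>(n, \<sigma>). Infl n \<sigma>) ` \<Gamma> \<union> range Leaf. \<exists>ch. rel c a ch \<and>
      (\<forall>t<arity c. ch t \<in> strucs \<and> card (fst (ch t)) < card (fst a) \<and> sle (ch t) a)"
    using struc_dec[of "fst a" "fst (snd a)" "snd (snd a)"] by simp
next
  show "finite ((\<lambda>(s, e, x). Strip s e x) ` (UNIV \<times> UNIV \<times> (XX True \<union> XX False)) \<union>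
    (\<lambda>(n, \<sigma>). Infl n \<sigma>) ` \<Gamma> \<union> range Leaf)" using finX fin\<Gamma> by simp
qed (use sle_trans rel_comb in blast)+

end

section \<open>Substitution decomposition\<close>

text \<open>Among the partitions into at least two blocks that are intervals in \<open>kA\<close>
  and compare consistently in \<open>kB\<close>, take one with fewest blocks. A nontrivial interval
  of its quotient could be merged into one block, so minimality makes the quotient simple. The
  embedding \<open>e\<close> shows that the quotient is a pattern of the points.\<close>

lemma substitution:
  fixes kA :: "'a \<Rightarrow> 'k::linorder" and kB :: "'a \<Rightarrow> 'l::linorder"
  assumes R: "finite R" "2 \<le> card R" and inj: "inj_on kA R" "inj_on kB R"
  shows "\<exists>\<tau> \<beta> e. simple_perm \<tau> \<and> 2 \<le> length \<tau> \<and> \<beta> ` R = {..<length \<tau>} \<and>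
    (\<forall>p\<in>R. \<forall>q\<in>R. \<beta> p \<noteq> \<beta> q \<longrightarrow> (kA p < kA q \<longleftrightarrow> \<beta> p < \<beta> q) \<and> (kB p < kB q \<longleftrightarrow> \<tau> ! \<beta> p < \<tau> ! \<beta> q)) \<and>
    emb {..<length \<tau>} (\<lambda>i. i) ((!) \<tau>) R kA kB e"
proof -
  define blk where "blk n \<beta> \<longleftrightarrow> 2 \<le> n \<and> \<beta> ` R = {..<n} \<and> (\<forall>p\<in>R. \<forall>q\<in>R. \<beta> p < \<beta> q \<longrightarrow> kA p < kA q) \<and>
    (\<forall>p\<in>R. \<forall>q\<in>R. \<forall>p'\<in>R. \<forall>q'\<in>R. \<beta> p = \<beta> p' \<longrightarrow> \<beta> q = \<beta> q' \<longrightarrow> \<beta> p \<noteq> \<beta> q \<longrightarrow> (kB p < kB q \<longleftrightarrow> kB p' < kB q'))"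
    for n :: nat and \<beta> :: "'a \<Rightarrow> nat"
  have "\<exists>n \<beta>. blk n \<beta>"
  proof -
    define r where "r p = card {q \<in> R. kA q < kA p}" for p
    note r = rank_bij[OF R(1) inj(1), folded r_def]
    have ri: "inj_on r R" "r ` R = {..<card R}" using r(1) by (simp_all add: bij_betw_def)
    have "blk (card R) r" unfolding blk_def
    proof (intro conjI ballI impI)
      show "2 \<le> card R" "r ` R = {..<card R}" by fact+
      show "kA p < kA q" if "p \<in> R" "q \<in> R" "r p < r q" for p q using r(2) that by simp
      fix p q p' q' assume "p \<in> R" "q \<in> R" "p' \<in> R" "q' \<in> R" "r p = r p'" "r q = r q'"
      then have "p = p'" "q = q'" using inj_onD[OF ri(1)] by simp_all
      then show "kB p < kB q \<longleftrightarrow> kB p' < kB q'" by simp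
    qed
    then show ?thesis by blast
  qed
  then have exn: "\<exists>n. \<exists>\<beta>. blk n \<beta>" .
  define n where "n = (LEAST n. \<exists>\<beta>. blk n \<beta>)"
  have "\<exists>\<beta>. blk n \<beta>" unfolding n_def by (rule LeastI_ex[OF exn])
  then obtain \<beta> where b: "blk n \<beta>" by blast
  have least: "\<not> blk n' \<beta>'" if "n' < n" for n' \<beta>'
    using not_less_Least[of n' "\<lambda>n. \<exists>\<beta>. blk n \<beta>"] that unfolding n_def by blast
  have n2: "2 \<le> n" and bR: "\<beta> ` R = {..<n}" using b by (simp_all add: blk_def)
  have bA: "kA p < kA q" if "p \<in> R" "q \<in> R" "\<beta> p < \<beta> q" for p q using b that unfolding blk_def by blast
  have bB: "kB p < kB q \<longleftrightarrow> kB p' < kB q'"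
    if "p \<in> R" "q \<in> R" "p' \<in> R" "q' \<in> R" "\<beta> p = \<beta> p'" "\<beta> q = \<beta> q'" "\<beta> p \<noteq> \<beta> q" for p q p' q'
    using b that unfolding blk_def by blast
  have "\<forall>t\<in>{..<n}. \<exists>p. p \<in> R \<and> \<beta> p = t" unfolding bR[symmetric] by blast
  from bchoice[OF this] obtain g where "\<forall>t\<in>{..<n}. g t \<in> R \<and> \<beta> (g t) = t" by (elim exE)
  then have g: "g t \<in> R \<and> \<beta> (g t) = t" if "t < n" for t using that by blast
  have ginj: "inj_on (kB \<circ> g) {..<n}"
  proof (rule inj_onI)
    fix s t assume "s \<in> {..<n}" "t \<in> {..<n}" "(kB \<circ> g) s = (kB \<circ> g) t"
    then have "g s = g t" using inj_onD[OF inj(2)] g by simp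
    then show "s = t" using g \<open>s \<in> {..<n}\<close> \<open>t \<in> {..<n}\<close> by (metis lessThan_iff)
  qed
  define \<rho> where "\<rho> i = card {j \<in> {..<n}. (kB \<circ> g) j < (kB \<circ> g) i}" for i
  note \<rho> = rank_bij[OF finite_lessThan ginj, folded \<rho>_def, unfolded card_lessThan]
  define \<tau> where "\<tau> = map \<rho> [0..<n]"
  have lt: "length \<tau> = n" and nt: "\<And>i. i < n \<Longrightarrow> \<tau> ! i = \<rho> i" by (simp_all add: \<tau>_def)
  have \<tau>p: "\<tau> \<in> perms"
    using \<rho>(1) by (auto simp: perms_iff \<tau>_def distinct_map bij_betw_def lessThan_atLeast0)
  have \<beta>n: "\<beta> p < n" if "p \<in> R" for p using bR that by blast
  have ordA: "kA p < kA q \<longleftrightarrow> \<beta> p < \<beta> q" if "p \<in> R" "q \<in> R" "\<beta> p \<noteq> \<beta> q" for p q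
    using bA[OF that(1,2)] bA[OF that(2,1)] that(3) by fastforce
  have ordB: "kB p < kB q \<longleftrightarrow> \<tau> ! \<beta> p < \<tau> ! \<beta> q" if "p \<in> R" "q \<in> R" "\<beta> p \<noteq> \<beta> q" for p q
  proof -
    note gp = g[OF \<beta>n[OF that(1)]] and gq = g[OF \<beta>n[OF that(2)]]
    have "kB p < kB q \<longleftrightarrow> kB (g (\<beta> p)) < kB (g (\<beta> q))"
      by (rule bB[OF that(1,2) conjunct1[OF gp] conjunct1[OF gq] conjunct2[OF gp, symmetric]
            conjunct2[OF gq, symmetric] that(3)])
    also have "\<dots> \<longleftrightarrow> \<rho> (\<beta> p) < \<rho> (\<beta> q)" using \<rho>(2)[of "\<beta> p" "\<beta> q"] \<beta>n that by simp
    finally show ?thesis unfolding nt[OF \<beta>n[OF that(1)]] nt[OF \<beta>n[OF that(2)]] .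
  qed
  have "simple_perm \<tau>"
    unfolding simple_perm_def
  proof (intro conjI allI impI)
    fix J assume J: "perm_interval \<tau> J"
    show "J = {} \<or> (\<exists>i. J = {i}) \<or> J = {..<length \<tau>}"
    proof (rule ccontr)
      assume neg: "\<not> ?thesis"
      obtain a b' where Jab: "J = {a..<b'}" using J by (auto simp: perm_interval_def contiguous_def)
      obtain c d where Jcd: "(!) \<tau> ` J = {c..<d}" using J unfolding perm_interval_def contiguous_def by blast
      have Jn: "J \<subseteq> {..<n}" using J lt by (simp add: perm_interval_def)
      have ab: "a + 2 \<le> b'"
      proof (rule ccontr)
        assume "\<not> a + 2 \<le> b'"
        then have "J = {} \<or> J = {a}" unfolding Jab by (cases "b' \<le> a") auto
        then show False using neg by blast
      qed
      have bn: "b' \<le> n"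
      proof -
        have "b' - 1 \<in> J" using ab unfolding Jab by auto
        then have "b' - 1 < n" using Jn by blast
        then show ?thesis by simp
      qed
      have w: "b' - a < n"
      proof (rule ccontr)
        assume "\<not> b' - a < n"
        then have "a = 0" "b' = n" using bn ab by auto
        then show False using neg lt unfolding Jab by (simp add: lessThan_atLeast0)
      qed
      define m where "m = b' - a - 1"
      have m: "1 \<le> m" "b' = a + m + 1" using ab by (auto simp: m_def)
      \<comment> \<open>Collapses the interval \<open>J\<close> to the index \<open>a\<close> and
        closes the gap behind it; by \<open>w\<close> at least two blocks remain.\<close>
      define \<phi> where "\<phi> t = (if t < a then t else if t < b' then a else t - m)" for t
      have \<phi>lt: "s < t" if "\<phi> s < \<phi> t" for s t
        using that m by (auto simp: \<phi>_def split: if_splits)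
      have \<phi>eq: "s = t \<or> s \<in> J \<and> t \<in> J" if "\<phi> s = \<phi> t" for s t
        using that m unfolding Jab by (auto simp: \<phi>_def split: if_splits)
      have \<phi>J: "\<phi> s = a" if "s \<in> J" for s using that unfolding Jab by (auto simp: \<phi>_def)
      have \<phi>im: "\<phi> ` {..<n} = {..<n - m}"
      proof (intro equalityI subsetI)
        fix t assume "t \<in> \<phi> ` {..<n}" then show "t \<in> {..<n - m}" using m bn w by (auto simp: \<phi>_def)
      next
        fix t assume t: "t \<in> {..<n - m}"
        show "t \<in> \<phi> ` {..<n}"
        proof (cases "t \<le> a")
          case True
          then show ?thesis using t m by (intro image_eqI[of _ _ t]) (auto simp: \<phi>_def)
        next
          case False
          then show ?thesis using t m by (intro image_eqI[of _ _ "t + m"]) (auto simp: \<phi>_def)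
        qed
      qed
      have out: "(\<tau> ! s < \<tau> ! t \<longleftrightarrow> \<tau> ! s' < \<tau> ! t) \<and> (\<tau> ! t < \<tau> ! s \<longleftrightarrow> \<tau> ! t < \<tau> ! s')"
        if s: "s \<in> J" "s' \<in> J" "t \<notin> J" "t < n" for s s' t
      proof -
        have "\<tau> ! t \<notin> {c..<d}"
        proof
          assume "\<tau> ! t \<in> {c..<d}"
          then obtain u where u: "u \<in> J" "\<tau> ! u = \<tau> ! t" unfolding Jcd[symmetric] by force
          then have "u = t" using inj_onD[OF perms_inj[OF \<tau>p], of u t] Jn s lt by auto
          then show False using u s by simp
        qed
        moreover have "\<tau> ! s \<in> {c..<d}" "\<tau> ! s' \<in> {c..<d}" using s unfolding Jcd[symmetric] by blast+
        ultimately show ?thesis by auto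
      qed
      have "blk (n - m) (\<phi> \<circ> \<beta>)"
        unfolding blk_def
      proof (intro conjI ballI impI)
        show "2 \<le> n - m" using w m by linarith
        show "(\<phi> \<circ> \<beta>) ` R = {..<n - m}" unfolding image_comp[symmetric] bR by (rule \<phi>im)
        show "kA p < kA q" if "p \<in> R" "q \<in> R" "(\<phi> \<circ> \<beta>) p < (\<phi> \<circ> \<beta>) q" for p q
          using that \<phi>lt bA by simp
        fix p q p' q' assume mem: "p \<in> R" "q \<in> R" "p' \<in> R" "q' \<in> R"
          and e: "(\<phi> \<circ> \<beta>) p = (\<phi> \<circ> \<beta>) p'" "(\<phi> \<circ> \<beta>) q = (\<phi> \<circ> \<beta>) q'" "(\<phi> \<circ> \<beta>) p \<noteq> (\<phi> \<circ> \<beta>) q"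
        have ne: "\<beta> p \<noteq> \<beta> q" "\<beta> p' \<noteq> \<beta> q'" using e by auto
        have notJ: "\<not> (\<beta> p \<in> J \<and> \<beta> q \<in> J)" using e(3) \<phi>J by auto
        have c1: "\<beta> p = \<beta> p' \<or> \<beta> p \<in> J \<and> \<beta> p' \<in> J" using \<phi>eq e(1) by simp
        have c2: "\<beta> q = \<beta> q' \<or> \<beta> q \<in> J \<and> \<beta> q' \<in> J" using \<phi>eq e(2) by simp
        have "\<tau> ! \<beta> p < \<tau> ! \<beta> q \<longleftrightarrow> \<tau> ! \<beta> p' < \<tau> ! \<beta> q'"
        proof (cases "\<beta> p = \<beta> p'")
          case True
          then show ?thesis
            using c2 notJ out[of "\<beta> q" "\<beta> q'" "\<beta> p"] \<beta>n[OF mem(1)] by auto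
        next
          case False
          then have "\<beta> q = \<beta> q'" "\<beta> q \<notin> J" using c1 c2 notJ by auto
          then show ?thesis using c1 False out[of "\<beta> p" "\<beta> p'" "\<beta> q"] \<beta>n[OF mem(2)] by auto
        qed
        then show "kB p < kB q \<longleftrightarrow> kB p' < kB q'"
          using ordB[OF mem(1,2) ne(1)] ordB[OF mem(3,4) ne(2)] by simp
      qed
      moreover have "n - m < n" using m n2 by simp
      ultimately show False using least by blast
    qed
  qed (rule \<tau>p)
  moreover have "emb {..<length \<tau>} (\<lambda>i. i) ((!) \<tau>) R kA kB g"
    unfolding emb_def lt
  proof (intro conjI ballI)
    fix s t assume s: "s \<in> {..<n}" and t: "t \<in> {..<n}"
    show "g s \<in> R" using g s by simp
    show "s < t \<longleftrightarrow> kA (g s) < kA (g t)" using ordA[of "g s" "g t"] g s t by (cases "s = t") auto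
    show "\<tau> ! s < \<tau> ! t \<longleftrightarrow> kB (g s) < kB (g t)" using ordB[of "g s" "g t"] g s t by (cases "s = t") auto
  qed
  moreover have "\<forall>p\<in>R. \<forall>q\<in>R. \<beta> p \<noteq> \<beta> q \<longrightarrow>
      (kA p < kA q \<longleftrightarrow> \<beta> p < \<beta> q) \<and> (kB p < kB q \<longleftrightarrow> \<tau> ! \<beta> p < \<tau> ! \<beta> q)"
  proof (intro ballI impI conjI)
    fix p q assume pq: "p \<in> R" "q \<in> R" "\<beta> p \<noteq> \<beta> q"
    show "kA p < kA q \<longleftrightarrow> \<beta> p < \<beta> q" by (rule ordA[OF pq])
    show "kB p < kB q \<longleftrightarrow> \<tau> ! \<beta> p < \<tau> ! \<beta> q" by (rule ordB[OF pq])
  qed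
  moreover have "2 \<le> length \<tau>" "\<beta> ` R = {..<length \<tau>}" using n2 bR lt by simp_all
  ultimately show ?thesis by - (rule exI[of _ \<tau>], rule exI[of _ \<beta>], rule exI[of _ g], intro conjI)
qed

section \<open>Boxes in the plane\<close>

locale boxes =
  fixes x1 x2 y1 y2 :: "'r \<Rightarrow> nat"
begin

definition yd :: "'r \<Rightarrow> 'r \<Rightarrow> bool" where
  "yd a b \<longleftrightarrow> y2 a < y1 b \<or> y2 b < y1 a"

definition ydisj :: "nat \<Rightarrow> 'r set \<Rightarrow> bool" where
  "ydisj K S \<longleftrightarrow> finite S \<and> card S = K \<and> (\<forall>a\<in>S. \<forall>b\<in>S. a \<noteq> b \<longrightarrow> yd a b)"

lemma yd_sym: "yd a b = yd b a"
  by (auto simp: yd_def)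

text \<open>Greedy duality for intervals: the interval with the least upper end is disjoint from all
  those that start above this end, so these contain no \<open>K\<close> disjoint members, and the
  remaining ones all reach that end.\<close>

lemma pierce:
  assumes "\<And>r. r \<in> R \<Longrightarrow> y1 r < y2 r" "\<And>S. S \<subseteq> R \<Longrightarrow> \<not> ydisj K S"
  shows "\<exists>H. finite H \<and> card H \<le> 2 * K \<and> (\<forall>r\<in>R. \<exists>h\<in>H. y1 r \<le> h \<and> h < y2 r)"
  using assms
proof (induction K arbitrary: R)
  case 0
  have "ydisj 0 {}" by (simp add: ydisj_def)
  then show ?case using 0(2)[of "{}"] by simp
next
  case (Suc K)
  show ?case
  proof (cases "R = {}")
    case True then show ?thesis by (intro exI[of _ "{}"]) simp
  next
    case False
    then obtain r00 where "r00 \<in> R" by blast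
    then obtain r0 where r0: "r0 \<in> R" "\<And>r. r \<in> R \<Longrightarrow> y2 r0 \<le> y2 r"
      using ex_has_least_nat[of "\<lambda>r. r \<in> R" r00 y2] by blast
    define R' where "R' = {r\<in>R. y2 r0 < y1 r}"
    have "\<exists>H. finite H \<and> card H \<le> 2 * K \<and> (\<forall>r\<in>R'. \<exists>h\<in>H. y1 r \<le> h \<and> h < y2 r)"
    proof (rule Suc.IH)
      show "y1 r < y2 r" if "r \<in> R'" for r using that Suc.prems(1) by (simp add: R'_def)
      fix S assume S: "S \<subseteq> R'"
      show "\<not> ydisj K S"
      proof
        assume d: "ydisj K S"
        have far: "y2 r0 < y1 r" if "r \<in> S" for r using that S by (auto simp: R'_def)
        have "r0 \<notin> S" using far[of r0] Suc.prems(1)[OF r0(1)] by auto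
        then have "ydisj (Suc K) (insert r0 S)" using d far by (auto simp: ydisj_def yd_def)
        moreover have "insert r0 S \<subseteq> R" using S r0 by (auto simp: R'_def)
        ultimately show False using Suc.prems(2) by blast
      qed
    qed
    then obtain H where H: "finite H" "card H \<le> 2 * K" "\<And>r. r\<in>R' \<Longrightarrow> \<exists>h\<in>H. y1 r \<le> h \<and> h < y2 r" by blast
    \<comment> \<open>A cut \<open>h\<close> stands for a line at \<open>h + 1/2\<close>. Each round
      contributes two cuts because disjointness is strict: a box starting exactly at
      \<open>y2 r0\<close> is missed by the cut at \<open>y2 r0 - 1\<close>.\<close>
    define H' where "H' = insert (y2 r0 - 1) (insert (y2 r0) H)"
    have "card H' \<le> 2 * Suc K"
      using H card_insert_le_m1[of "2 * Suc K" "insert (y2 r0) H" "y2 r0 - 1"]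
        card_insert_le_m1[of "2 * K + 1" H "y2 r0"] by (simp add: H'_def)
    moreover have "\<exists>h\<in>H'. y1 r \<le> h \<and> h < y2 r" if r: "r \<in> R" for r
    proof -
      have b: "y2 r0 \<le> y2 r" "y1 r < y2 r" "0 < y2 r0"
        using r0 Suc.prems(1)[OF r] Suc.prems(1)[OF r0(1)] r by auto
      consider "y1 r \<le> y2 r0 - 1" | "y1 r = y2 r0" | "y2 r0 < y1 r" by linarith
      then show ?thesis
      proof cases
        case 1 then show ?thesis using b by (intro bexI[of _ "y2 r0 - 1"]) (auto simp: H'_def)
      next
        case 2 then show ?thesis using b by (intro bexI[of _ "y2 r0"]) (auto simp: H'_def)
      next
        case 3 then show ?thesis using H(3)[of r] r by (auto simp: H'_def R'_def)
      qed
    qed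
    ultimately show ?thesis using H(1) by (intro exI[of _ H']) (auto simp: H'_def)
  qed
qed

definition stacks :: "nat \<Rightarrow> nat \<Rightarrow> 'r set \<Rightarrow> (nat \<Rightarrow> 'r set) \<Rightarrow> bool" where
  "stacks k K R F \<longleftrightarrow> (\<forall>i<k. F i \<subseteq> R \<and> ydisj K (F i)) \<and>
     (\<forall>i j. i < j \<longrightarrow> j < k \<longrightarrow> (\<forall>r\<in>F i. \<forall>r'\<in>F j. x2 r < x1 r'))"

definition sliced :: "nat \<Rightarrow> nat \<Rightarrow> 'r set \<Rightarrow> bool" where
  "sliced a b R \<longleftrightarrow> (\<exists>V H. finite V \<and> finite H \<and> card V \<le> a \<and> card H \<le> b \<and>
     (\<forall>r\<in>R. (\<exists>v\<in>V. x1 r \<le> v \<and> v < x2 r) \<or> (\<exists>h\<in>H. y1 r \<le> h \<and> h < y2 r)))"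

text \<open>Sweep from the left to the least \<open>v\<close> at which \<open>K\<close> boxes with
  disjoint heights have ended. The boxes that end before \<open>v\<close> are pierced by
  \<open>2 * K\<close> horizontal cuts, those that meet \<open>v\<close> by two vertical cuts, and
  the boxes beyond \<open>v\<close> are left to the induction.\<close>

lemma stacks_or_sliced:
  assumes "\<And>r. r \<in> R \<Longrightarrow> x1 r < x2 r \<and> y1 r < y2 r" and K: "0 < K"
  shows "(\<exists>F. stacks k K R F) \<or> sliced (2 * k) (2 * K * Suc k) R"
  using assms(1)
proof (induction k arbitrary: R)
  case 0
  then show ?case by (simp add: stacks_def)
next
  case (Suc k)
  show ?case
  proof (cases "\<exists>S\<subseteq>R. ydisj K S")
    case False
    then obtain H where "finite H" "card H \<le> 2 * K" "\<forall>r\<in>R. \<exists>h\<in>H. y1 r \<le> h \<and> h < y2 r"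
      using pierce[of R K] Suc.prems by blast
    moreover have "2 * K \<le> 2 * K * Suc (Suc k)" by simp
    ultimately have "sliced (2 * Suc k) (2 * K * Suc (Suc k)) R"
      unfolding sliced_def by (intro exI[of _ "{}"] exI[of _ H]) auto
    then show ?thesis by blast
  next
    case True
    define P where "P v \<longleftrightarrow> (\<exists>S\<subseteq>{r\<in>R. x2 r \<le> v}. ydisj K S)" for v
    obtain S1 where S1: "S1 \<subseteq> R" "ydisj K S1" using True by blast
    then have "P (Max (x2 ` S1))" unfolding P_def by (intro exI[of _ S1]) (auto simp: ydisj_def)
    then have exP: "\<exists>v. P v" by blast
    define v where "v = (LEAST v. P v)"
    have Pv: "P v" unfolding v_def by (rule LeastI_ex[OF exP])
    then obtain S0 where S0: "S0 \<subseteq> {r\<in>R. x2 r \<le> v}" "ydisj K S0" unfolding P_def by blast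
    have "S0 \<noteq> {}" using S0(2) K by (auto simp: ydisj_def)
    then have v0: "0 < v" using S0(1) Suc.prems by fastforce
    have "\<exists>H. finite H \<and> card H \<le> 2 * K \<and> (\<forall>r\<in>{r\<in>R. x2 r < v}. \<exists>h\<in>H. y1 r \<le> h \<and> h < y2 r)"
    proof (rule pierce)
      show "y1 r < y2 r" if "r \<in> {r\<in>R. x2 r < v}" for r using that Suc.prems by simp
      fix S assume S: "S \<subseteq> {r\<in>R. x2 r < v}"
      show "\<not> ydisj K S"
      proof
        assume "ydisj K S"
        moreover have "S \<subseteq> {r\<in>R. x2 r \<le> v - 1}" using S by auto
        ultimately have "P (v - 1)" unfolding P_def by blast
        then have "v \<le> v - 1" unfolding v_def by (rule Least_le)
        then show False using v0 by simp
      qed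
    qed
    then obtain H0 where H0: "finite H0" "card H0 \<le> 2 * K"
      "\<And>r. r \<in> R \<Longrightarrow> x2 r < v \<Longrightarrow> \<exists>h\<in>H0. y1 r \<le> h \<and> h < y2 r" by auto
    define R1 where "R1 = {r\<in>R. v < x1 r}"
    have "(\<exists>F. stacks k K R1 F) \<or> sliced (2 * k) (2 * K * Suc k) R1"
      by (rule Suc.IH) (simp add: R1_def Suc.prems)
    then show ?thesis
    proof
      assume "\<exists>F. stacks k K R1 F"
      then obtain F where F: "stacks k K R1 F" by blast
      define G where "G i = (case i of 0 \<Rightarrow> S0 | Suc j \<Rightarrow> F j)" for i
      have "stacks (Suc k) K R G"
        unfolding stacks_def
      proof (intro conjI allI impI ballI)
        fix i assume i: "i < Suc k"
        show "G i \<subseteq> R" "ydisj K (G i)"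
          using i S0 F by (auto simp: G_def stacks_def R1_def split: nat.splits)
      next
        fix i j r r' assume ij: "i < j" "j < Suc k" "r \<in> G i" "r' \<in> G j"
        then obtain j' where j': "j = Suc j'" "j' < k" by (cases j) auto
        then have r': "r' \<in> F j'" using ij by (simp add: G_def)
        show "x2 r < x1 r'"
        proof (cases i)
          case 0
          then have "x2 r \<le> v" using ij S0 by (auto simp: G_def)
          moreover have "v < x1 r'" using r' F j' by (auto simp: stacks_def R1_def)
          ultimately show ?thesis by simp
        next
          case (Suc i')
          then show ?thesis using ij j' r' F by (simp add: G_def stacks_def)
        qed
      qed
      then show ?thesis by blast
    next
      assume "sliced (2 * k) (2 * K * Suc k) R1"
      then obtain V H where VH: "finite V" "finite H" "card V \<le> 2 * k" "card H \<le> 2 * K * Suc k"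
        "\<forall>r\<in>R1. (\<exists>v\<in>V. x1 r \<le> v \<and> v < x2 r) \<or> (\<exists>h\<in>H. y1 r \<le> h \<and> h < y2 r)"
        unfolding sliced_def by (elim exE conjE)
      define V' where "V' = insert (v - 1) (insert v V)"
      have "card V' \<le> 2 * Suc k"
        using VH card_insert_le_m1[of "2 * Suc k" "insert v V" "v - 1"]
          card_insert_le_m1[of "2 * k + 1" V v] by (simp add: V'_def)
      moreover have "card (H \<union> H0) \<le> 2 * K * Suc (Suc k)"
        using card_Un_le[of H H0] VH(4) H0(2) by (simp add: algebra_simps)
      moreover have "(\<exists>u\<in>V'. x1 r \<le> u \<and> u < x2 r) \<or> (\<exists>h\<in>H \<union> H0. y1 r \<le> h \<and> h < y2 r)" if r: "r \<in> R" for r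
      proof -
        have rr: "x1 r < x2 r" using Suc.prems r by blast
        consider "x2 r < v" | "v \<le> x2 r" "x1 r < v" | "v \<le> x2 r" "x1 r = v" | "v < x1 r" by linarith
        then show ?thesis
        proof cases
          case 1 then show ?thesis using H0(3)[OF r] by blast
        next
          case 2
          then have "x1 r \<le> v - 1 \<and> v - 1 < x2 r" by linarith
          then show ?thesis unfolding V'_def by blast
        next
          case 3 then show ?thesis using rr unfolding V'_def by auto
        next
          case 4
          then have "r \<in> R1" using r by (simp add: R1_def)
          then show ?thesis using VH(5) unfolding V'_def by blast
        qed
      qed
      ultimately have "sliced (2 * Suc k) (2 * K * Suc (Suc k)) R"
        unfolding sliced_def using VH H0 by (intro exI[of _ V'] exI[of _ "H \<union> H0"]) (simp add: V'_def)
      then show ?thesis by blast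
    qed
  qed
qed

text \<open>Choosing the box \<open>r0\<close> with the lowest top costs every other family at most
  one box: two boxes that start no higher than this top and end no lower are not disjoint in
  height.\<close>

lemma select_disjoint:
  assumes "finite I" "\<And>i. i \<in> I \<Longrightarrow> finite (F i) \<and> card I \<le> card (F i) \<and>
      (\<forall>a\<in>F i. \<forall>b\<in>F i. a \<noteq> b \<longrightarrow> yd a b)"
    and lt: "\<And>i a. i \<in> I \<Longrightarrow> a \<in> F i \<Longrightarrow> y1 a < y2 a"
  shows "\<exists>c. (\<forall>i\<in>I. c i \<in> F i) \<and> (\<forall>i\<in>I. \<forall>j\<in>I. i \<noteq> j \<longrightarrow> yd (c i) (c j))"
  using assms
proof (induction "card I" arbitrary: I F)
  case 0 then show ?case by simp
next
  case (Suc n)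
  have Ine: "I \<noteq> {}" using Suc.hyps(2) by auto
  then obtain i1 where i1: "i1 \<in> I" by blast
  then have "F i1 \<noteq> {}" using Suc.prems(2)[OF i1] Suc.hyps(2) by auto
  then obtain r1 where "r1 \<in> F i1" by blast
  then have "r1 \<in> (\<Union>i\<in>I. F i)" using i1 by blast
  then obtain r0 where r0: "r0 \<in> (\<Union>i\<in>I. F i)" "\<And>r. r \<in> (\<Union>i\<in>I. F i) \<Longrightarrow> y2 r0 \<le> y2 r"
    using ex_has_least_nat[of "\<lambda>r. r \<in> (\<Union>i\<in>I. F i)" r1 y2] by blast
  obtain i0 where i0: "i0 \<in> I" "r0 \<in> F i0" using r0(1) by blast
  define F' where "F' i = {r \<in> F i. y2 r0 < y1 r}" for i
  have cI: "n = card (I - {i0})" using Suc.hyps(2) i0 Suc.prems(1) by simp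
  have "\<exists>c. (\<forall>i\<in>I - {i0}. c i \<in> F' i) \<and> (\<forall>i\<in>I - {i0}. \<forall>j\<in>I - {i0}. i \<noteq> j \<longrightarrow> yd (c i) (c j))"
  proof (rule Suc.hyps(1)[OF cI])
    show "finite (I - {i0})" using Suc.prems by simp
    show "y1 a < y2 a" if "i \<in> I - {i0}" "a \<in> F' i" for i a
      using Suc.prems(3)[of i a] that by (simp add: F'_def)
    fix i assume i: "i \<in> I - {i0}"
    then have Fi: "finite (F i)" "Suc n \<le> card (F i)" "\<And>a b. a \<in> F i \<Longrightarrow> b \<in> F i \<Longrightarrow> a \<noteq> b \<Longrightarrow> yd a b"
      using Suc.prems(2)[of i] Suc.hyps(2) by auto
    have one: "a = b" if "a \<in> F i - F' i" "b \<in> F i - F' i" for a b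
    proof (rule ccontr)
      assume "a \<noteq> b"
      then have "yd a b" using Fi(3) that by blast
      moreover have "y1 a \<le> y2 r0" "y1 b \<le> y2 r0" using that by (auto simp: F'_def)
      moreover have "y2 r0 \<le> y2 a" "y2 r0 \<le> y2 b" using r0(2) that i by blast+
      ultimately show False by (auto simp: yd_def)
    qed
    have "card (F i - F' i) \<le> 1"
      using card_le_Suc0_iff_eq[of "F i - F' i"] Fi(1) one by auto
    moreover have "card (F i) = card (F' i) + card (F i - F' i)"
      using Fi(1) card_Diff_subset[of "F' i" "F i"] card_mono[of "F i" "F' i"] by (simp add: F'_def)
    ultimately have "n \<le> card (F' i)" using Fi(2) by linarith
    then show "finite (F' i) \<and> card (I - {i0}) \<le> card (F' i) \<and> (\<forall>a\<in>F' i. \<forall>b\<in>F' i. a \<noteq> b \<longrightarrow> yd a b)"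
      using Fi cI by (simp add: F'_def)
  qed
  then obtain c where c: "\<forall>i\<in>I - {i0}. c i \<in> F' i"
    "\<forall>i\<in>I - {i0}. \<forall>j\<in>I - {i0}. i \<noteq> j \<longrightarrow> yd (c i) (c j)" by (elim exE conjE)
  define c' where "c' = c(i0 := r0)"
  have n0: "yd (c i) r0" if "i \<in> I" "i \<noteq> i0" for i
    using c(1) that by (auto simp: F'_def yd_def)
  have "c' i \<in> F i" if "i \<in> I" for i
  proof (cases "i = i0")
    case True then show ?thesis using i0 by (simp add: c'_def)
  next
    case False
    then have "c i \<in> F' i" using c(1) that by blast
    then show ?thesis using False by (simp add: c'_def F'_def)
  qed
  moreover have "yd (c' i) (c' j)" if ij: "i \<in> I" "j \<in> I" "i \<noteq> j" for i j
  proof -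
    consider "i = i0" "j \<noteq> i0" | "j = i0" "i \<noteq> i0" | "i \<noteq> i0" "j \<noteq> i0" using ij by blast
    then show ?thesis
    proof cases
      case 1 then show ?thesis using n0[of j] ij yd_sym[of r0 "c j"] by (simp add: c'_def)
    next
      case 2 then show ?thesis using n0[of i] ij by (simp add: c'_def)
    next
      case 3
      then have "yd (c i) (c j)" using c(2) ij by blast
      then show ?thesis using 3 by (simp add: c'_def)
    qed
  qed
  ultimately show ?case by blast
qed

text \<open>One box from each stack gives \<open>K\<close> boxes that are disjoint in both
  projections, and Ramsey extracts a rising or a falling chain.\<close>

lemma chain_or_sliced:
  fixes a b :: nat
  shows "\<exists>B. \<forall>R. (\<forall>r\<in>R. x1 r < x2 r \<and> y1 r < y2 r) \<longrightarrow>
    (\<exists>r. \<forall>i<a. r i \<in> R \<and> (\<forall>j<i. x2 (r j) < x1 (r i) \<and> y2 (r j) < y1 (r i))) \<or>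
    (\<exists>r. \<forall>i<b. r i \<in> R \<and> (\<forall>j<i. x2 (r j) < x1 (r i) \<and> y2 (r i) < y1 (r j))) \<or> sliced B B R"
proof -
  obtain K where K: "1 \<le> K" and ram: "\<And>(V :: nat set) E. finite V \<Longrightarrow> K \<le> card V \<Longrightarrow>
      \<exists>S\<subseteq>V. card S = a \<and> clique S E \<or> card S = b \<and> indep S E"
    using ramsey2[of a b] by blast
  define B where "B = 2 * K * Suc K"
  have "(\<exists>r. \<forall>i<a. r i \<in> R \<and> (\<forall>j<i. x2 (r j) < x1 (r i) \<and> y2 (r j) < y1 (r i))) \<or>
    (\<exists>r. \<forall>i<b. r i \<in> R \<and> (\<forall>j<i. x2 (r j) < x1 (r i) \<and> y2 (r i) < y1 (r j))) \<or> sliced B B R"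
    if R: "\<forall>r\<in>R. x1 r < x2 r \<and> y1 r < y2 r" for R
  proof (cases "sliced (2 * K) (2 * K * Suc K) R")
    case True
    moreover have "2 * K \<le> B" by (simp add: B_def)
    moreover obtain V H where "finite V" "finite H" "card V \<le> 2 * K" "card H \<le> 2 * K * Suc K"
      "\<forall>r\<in>R. (\<exists>v\<in>V. x1 r \<le> v \<and> v < x2 r) \<or> (\<exists>h\<in>H. y1 r \<le> h \<and> h < y2 r)"
      using True unfolding sliced_def by (elim exE conjE)
    ultimately have "sliced B B R" unfolding sliced_def
      by (intro exI[of _ V] exI[of _ H]) (simp add: B_def)
    then show ?thesis by blast
  next
    case False
    then have "\<exists>F. stacks K K R F" using stacks_or_sliced[of R K K] R K by auto
    then obtain F where F: "stacks K K R F" by blast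
    have "\<exists>c. (\<forall>i\<in>{..<K}. c i \<in> F i) \<and> (\<forall>i\<in>{..<K}. \<forall>j\<in>{..<K}. i \<noteq> j \<longrightarrow> yd (c i) (c j))"
    proof (rule select_disjoint)
      show "y1 q < y2 q" if "i \<in> {..<K}" "q \<in> F i" for i q
        using F R that unfolding stacks_def by blast
    qed (use F in \<open>simp_all add: stacks_def ydisj_def\<close>)
    then obtain c where c: "\<forall>i\<in>{..<K}. c i \<in> F i" "\<forall>i\<in>{..<K}. \<forall>j\<in>{..<K}. i \<noteq> j \<longrightarrow> yd (c i) (c j)"
      by (elim exE conjE)
    have cx: "x2 (c i) < x1 (c j)" if "i < j" "j < K" for i j
      using F c(1) that by (simp add: stacks_def)
    have cR: "c i \<in> R" if "i < K" for i using F c(1) that by (auto simp: stacks_def)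
    have cy: "y2 (c i) < y1 (c j) \<or> y2 (c j) < y1 (c i)" if "i < j" "j < K" for i j
      using c(2) that by (auto simp: yd_def)
    define E where "E = {{i, j} | i j. i < j \<and> y2 (c i) < y1 (c j)}"
    have E: "{i, j} \<in> E \<longleftrightarrow> y2 (c i) < y1 (c j)" if "i < j" for i j
      using that by (auto simp: E_def doubleton_eq_iff)
    obtain S where S: "S \<subseteq> {..<K}" "card S = a \<and> clique S E \<or> card S = b \<and> indep S E"
      using ram[of "{..<K}" E] by auto
    have fS: "finite S" using S(1) finite_subset by blast
    define h where "h i = sorted_list_of_set S ! i" for i
    have h: "h i \<in> S" "h i < K" if "i < card S" for i
    proof -
      have "i < length (sorted_list_of_set S)" using that by simp
      from nth_mem[OF this] show "h i \<in> S" using fS by (simp add: h_def)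
      then show "h i < K" using S by blast
    qed
    have hlt: "h i < h j" if "i < j" "j < card S" for i j
      using sorted_wrt_nth_less[of "(<)" "sorted_list_of_set S" i j] that by (simp add: h_def)
    show ?thesis
    proof (cases "card S = a \<and> clique S E")
      case True
      have "y2 (c (h j)) < y1 (c (h i))" if "j < i" "i < a" for i j
      proof -
        have "{h j, h i} \<in> E" using True h[of i] h[of j] hlt[of j i] that unfolding clique_def by auto
        then show ?thesis using E[OF hlt[of j i]] that True by simp
      qed
      then have "\<forall>i<a. c (h i) \<in> R \<and> (\<forall>j<i. x2 (c (h j)) < x1 (c (h i)) \<and> y2 (c (h j)) < y1 (c (h i)))"
        using True h cR cx hlt by simp
      then show ?thesis by (intro disjI1 exI[of _ "\<lambda>i. c (h i)"])
    next
      case False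
      then have T: "card S = b" "indep S E" using S by auto
      have "y2 (c (h i)) < y1 (c (h j))" if "j < i" "i < b" for i j
      proof -
        have "{h j, h i} \<notin> E" using T h[of i] h[of j] hlt[of j i] that unfolding indep_def by auto
        then show ?thesis using E[OF hlt[of j i]] cy[OF hlt[of j i]] h[of i] that T by simp
      qed
      then have "\<forall>i<b. c (h i) \<in> R \<and> (\<forall>j<i. x2 (c (h j)) < x1 (c (h i)) \<and> y2 (c (h i)) < y1 (c (h j)))"
        using T h cR cx hlt by simp
      then show ?thesis by (intro disjI2 disjI1 exI[of _ "\<lambda>i. c (h i)"])
    qed
  qed
  then show ?thesis by blast
qed

end

section \<open>Sums of 21 and skew sums of 12\<close>

definition sum21 :: "nat \<Rightarrow> nat list" where
  "sum21 a = map (\<lambda>i. if even i then i + 1 else i - 1) [0..<2 * a]"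

definition skew12 :: "nat \<Rightarrow> nat list" where
  "skew12 a = map (\<lambda>i. 2 * a - 1 - (if even i then i + 1 else i - 1)) [0..<2 * a]"

lemma length_sum21 [simp]: "length (sum21 a) = 2 * a" "length (skew12 a) = 2 * a"
  by (simp_all add: sum21_def skew12_def)

lemma nth_sum21:
  "i < 2 * a \<Longrightarrow> sum21 a ! i = (if even i then i + 1 else i - 1)"
  "i < 2 * a \<Longrightarrow> skew12 a ! i = 2 * a - 1 - (if even i then i + 1 else i - 1)"
  by (simp_all add: sum21_def skew12_def)

lemma swap_bound: "i < 2 * a \<Longrightarrow> (if even i then i + 1 else i - 1) < 2 * (a::nat)"
  by (auto elim!: evenE)

lemma sum21_perms: "sum21 a \<in> perms"
proof -
  have b: "bij_betw (\<lambda>i. if even i then i + 1 else i - 1) {..<2 * a} {..<2 * a}"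
    by (rule bij_betwI[where g = "\<lambda>i. if even i then i + 1 else i - 1"])
       (use swap_bound in \<open>auto simp: odd_pos\<close>)
  then show ?thesis
    by (simp add: perms_iff sum21_def distinct_map bij_betw_def lessThan_atLeast0)
qed

lemma skew12_perms: "skew12 a \<in> perms"
proof -
  have b: "bij_betw (\<lambda>i. if even i then i + 1 else i - 1) {..<2 * a} {..<2 * a}"
    by (rule bij_betwI[where g = "\<lambda>i. if even i then i + 1 else i - 1"])
       (use swap_bound in \<open>auto simp: odd_pos\<close>)
  have c: "bij_betw (\<lambda>i. 2 * a - 1 - i) {..<2 * a} {..<2 * a}"
    by (rule bij_betwI[where g = "\<lambda>i. 2 * a - 1 - i"]) auto
  have "bij_betw (\<lambda>i. 2 * a - 1 - (if even i then i + 1 else i - 1)) {..<2 * a} {..<2 * a}"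
    using bij_betw_trans[OF b c] unfolding comp_def .
  then show ?thesis
    by (simp add: perms_iff skew12_def distinct_map bij_betw_def lessThan_atLeast0)
qed

lemma class_sub: "perm_class C \<Longrightarrow> \<alpha> \<in> C \<Longrightarrow> \<beta> \<in> perms \<Longrightarrow> lemb \<beta> \<alpha> f \<Longrightarrow> \<beta> \<in> C"
  using contained_lemb unfolding perm_class_def by blast

lemma half_less: "k < 2 * a \<Longrightarrow> k div 2 < (a::nat)"
  by (simp add: less_mult_imp_div_less mult.commute)

lemma same_half: "k < l \<Longrightarrow> k div 2 = l div 2 \<Longrightarrow> even k \<and> odd (l::nat)"
  by presburger

lemma half_mono: "k < l \<Longrightarrow> k div 2 \<noteq> l div 2 \<Longrightarrow> k div 2 < l div (2::nat)"
  by presburger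

text \<open>Different pairs lie in boxes that increase strictly in both coordinates, so the order
  between them depends only on the pair number \<open>k div 2\<close>.\<close>

lemma chain_sum21:
  assumes C: "perm_class C" "\<pi> \<in> C"
    and u: "\<And>i. i < a \<Longrightarrow> p i < q i \<and> q i < length \<pi> \<and> \<pi> ! q i < \<pi> ! p i"
    and ch: "\<And>i j. j < i \<Longrightarrow> i < a \<Longrightarrow> q j < p i \<and> \<pi> ! p j < \<pi> ! q i"
  shows "sum21 a \<in> C"
proof (rule class_sub[OF C sum21_perms])
  define f where "f k = (if even k then p (k div 2) else q (k div 2))" for k
  have lo: "p (k div 2) \<le> f k \<and> f k \<le> q (k div 2) \<and> \<pi> ! q (k div 2) \<le> \<pi> ! f k \<and> \<pi> ! f k \<le> \<pi> ! p (k div 2)"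
    if "k < 2 * a" for k
  proof -
    have "k div 2 < a" by (rule half_less[OF that])
    then show ?thesis using u[of "k div 2"] by (auto simp: f_def)
  qed
  have lt: "f k < f l \<and> (\<pi> ! f k < \<pi> ! f l \<longleftrightarrow> k div 2 < l div 2) \<and> \<pi> ! f k \<noteq> \<pi> ! f l" if "k < l" "l < 2 * a" for k l
  proof (cases "k div 2 = l div 2")
    case True
    then have p: "even k" "odd l" using same_half[OF that(1)] by auto
    have fk: "f k = p (l div 2)" "f l = q (l div 2)" using p True by (simp_all add: f_def)
    show ?thesis unfolding fk using True u[OF half_less[OF that(2)]] by auto
  next
    case False
    then have "k div 2 < l div 2" by (rule half_mono[OF that(1)])
    then show ?thesis using lo[of k] lo[of l] ch[OF _ half_less[OF that(2)]] that by fastforce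
  qed
  have val: "sum21 a ! k < sum21 a ! l \<longleftrightarrow> k div 2 < l div 2" if "k < l" "l < 2 * a" for k l
    using that by (auto simp: nth_sum21 elim!: evenE oddE)
  have val': "sum21 a ! k \<noteq> sum21 a ! l" if "k < l" "l < 2 * a" for k l
    using inj_onD[OF perms_inj[OF sum21_perms], of a k l] that by auto
  show "lemb (sum21 a) \<pi> f"
    unfolding emb_def
  proof (intro conjI ballI)
    fix k l assume kl: "k \<in> {..<length (sum21 a)}" "l \<in> {..<length (sum21 a)}"
    then show "f k \<in> {..<length \<pi>}" using lo[of k] u[OF half_less[of k a]] by simp
    show "k < l \<longleftrightarrow> f k < f l" using lt[of k l] lt[of l k] kl by (cases k l rule: linorder_cases) auto
    show "sum21 a ! k < sum21 a ! l \<longleftrightarrow> \<pi> ! f k < \<pi> ! f l"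
      using lt[of k l] lt[of l k] val[of k l] val[of l k] val'[of k l] val'[of l k] kl
      by (cases k l rule: linorder_cases) auto
  qed
qed

lemma chain_skew12:
  assumes C: "perm_class C" "\<pi> \<in> C"
    and u: "\<And>i. i < a \<Longrightarrow> p i < q i \<and> q i < length \<pi> \<and> \<pi> ! p i < \<pi> ! q i"
    and ch: "\<And>i j. j < i \<Longrightarrow> i < a \<Longrightarrow> q j < p i \<and> \<pi> ! q i < \<pi> ! p j"
  shows "skew12 a \<in> C"
proof (rule class_sub[OF C skew12_perms])
  define f where "f k = (if even k then p (k div 2) else q (k div 2))" for k
  have lo: "p (k div 2) \<le> f k \<and> f k \<le> q (k div 2) \<and> \<pi> ! p (k div 2) \<le> \<pi> ! f k \<and> \<pi> ! f k \<le> \<pi> ! q (k div 2)"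
    if "k < 2 * a" for k
  proof -
    have "k div 2 < a" by (rule half_less[OF that])
    then show ?thesis using u[of "k div 2"] by (auto simp: f_def)
  qed
  have lt: "f k < f l \<and> (\<pi> ! f k < \<pi> ! f l \<longleftrightarrow> k div 2 = l div 2) \<and> \<pi> ! f k \<noteq> \<pi> ! f l" if "k < l" "l < 2 * a" for k l
  proof (cases "k div 2 = l div 2")
    case True
    then have p: "even k" "odd l" using same_half[OF that(1)] by auto
    have fk: "f k = p (l div 2)" "f l = q (l div 2)" using p True by (simp_all add: f_def)
    show ?thesis unfolding fk using True u[OF half_less[OF that(2)]] by auto
  next
    case False
    then have "k div 2 < l div 2" by (rule half_mono[OF that(1)])
    then show ?thesis using lo[of k] lo[of l] ch[OF _ half_less[OF that(2)]] that by fastforce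
  qed
  have val: "skew12 a ! k < skew12 a ! l \<longleftrightarrow> k div 2 = l div 2" if "k < l" "l < 2 * a" for k l
  proof -
    have "(if even l then l + 1 else l - 1) < (if even k then k + 1 else k - 1) \<longleftrightarrow> k div 2 = l div 2"
      using that by (auto elim!: evenE oddE)
    then show ?thesis using that swap_bound[of l a] swap_bound[of k a] by (auto simp: nth_sum21)
  qed
  have val': "skew12 a ! k \<noteq> skew12 a ! l" if "k < l" "l < 2 * a" for k l
    using inj_onD[OF perms_inj[OF skew12_perms], of a k l] that by auto
  show "lemb (skew12 a) \<pi> f"
    unfolding emb_def
  proof (intro conjI ballI)
    fix k l assume kl: "k \<in> {..<length (skew12 a)}" "l \<in> {..<length (skew12 a)}"
    then show "f k \<in> {..<length \<pi>}" using lo[of k] u[OF half_less[of k a]] by simp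
    show "k < l \<longleftrightarrow> f k < f l" using lt[of k l] lt[of l k] kl by (cases k l rule: linorder_cases) auto
    show "skew12 a ! k < skew12 a ! l \<longleftrightarrow> \<pi> ! f k < \<pi> ! f l"
      using lt[of k l] lt[of l k] val[of k l] val[of l k] val'[of k l] val'[of l k] kl
      by (cases k l rule: linorder_cases) auto
  qed
qed

lemma perm_class_Av: "perm_class (Av B)"
  unfolding perm_class_def
proof (intro conjI ballI impI)
  show "Av B \<subseteq> perms" by (auto simp: Av_def)
  fix \<pi> \<alpha> assume \<pi>: "\<pi> \<in> Av B" and \<alpha>: "\<alpha> \<in> perms" "contained \<alpha> \<pi>"
  obtain f where f: "lemb \<alpha> \<pi> f" using \<alpha> \<pi> contained_lemb by (auto simp: Av_def)
  have "\<not> contained \<beta> \<alpha>" if "\<beta> \<in> B" for \<beta>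
  proof
    assume "contained \<beta> \<alpha>"
    then obtain g where "lemb \<beta> \<alpha> g" using \<alpha> contained_lemb by blast
    then have "lemb \<beta> \<pi> (f \<circ> g)" using emb_comp f by blast
    then have "contained \<beta> \<pi>" using \<pi> contained_lemb by (auto simp: Av_def)
    then show False using \<pi> that by (simp add: Av_def)
  qed
  then show "\<alpha> \<in> Av B" using \<alpha> by (simp add: Av_def)
qed

lemma contained_pair:
  assumes "\<pi> \<in> perms"
  shows "contained [1, 0] \<pi> \<longleftrightarrow> (\<exists>i j. i < j \<and> j < length \<pi> \<and> \<pi> ! j < \<pi> ! i)"
    "contained [0, 1] \<pi> \<longleftrightarrow> (\<exists>i j. i < j \<and> j < length \<pi> \<and> \<pi> ! i < \<pi> ! j)"
proof -
  have two: "{..<length [x, y]} = {0, 1}" for x y :: nat by auto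
  show "contained [1, 0] \<pi> \<longleftrightarrow> (\<exists>i j. i < j \<and> j < length \<pi> \<and> \<pi> ! j < \<pi> ! i)"
    unfolding contained_lemb[OF assms] emb_def two
  proof
    assume "\<exists>i j. i < j \<and> j < length \<pi> \<and> \<pi> ! j < \<pi> ! i"
    then obtain i j where "i < j" "j < length \<pi>" "\<pi> ! j < \<pi> ! i" by blast
    then show "\<exists>f. (\<forall>p\<in>{0, 1}. f p \<in> {..<length \<pi>}) \<and> (\<forall>p\<in>{0, 1}. \<forall>q\<in>{0, 1}. (p < q) = (f p < f q) \<and>
          (([1, 0] ! p :: nat) < [1, 0] ! q) = (\<pi> ! f p < \<pi> ! f q))"
      by (intro exI[of _ "\<lambda>k. if k = 0 then i else j"]) auto
  qed (force dest: bspec[of _ _ 0] bspec[of _ _ 1])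
  show "contained [0, 1] \<pi> \<longleftrightarrow> (\<exists>i j. i < j \<and> j < length \<pi> \<and> \<pi> ! i < \<pi> ! j)"
    unfolding contained_lemb[OF assms] emb_def two
  proof
    assume "\<exists>i j. i < j \<and> j < length \<pi> \<and> \<pi> ! i < \<pi> ! j"
    then obtain i j where "i < j" "j < length \<pi>" "\<pi> ! i < \<pi> ! j" by blast
    then show "\<exists>f. (\<forall>p\<in>{0, 1}. f p \<in> {..<length \<pi>}) \<and> (\<forall>p\<in>{0, 1}. \<forall>q\<in>{0, 1}. (p < q) = (f p < f q) \<and>
          (([0, 1] ! p :: nat) < [0, 1] ! q) = (\<pi> ! f p < \<pi> ! f q))"
      by (intro exI[of _ "\<lambda>k. if k = 0 then i else j"]) auto
  qed (force dest: bspec[of _ _ 0] bspec[of _ _ 1])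
qed

lemma in_class_Av:
  assumes "finite I" "inj_on X I" "inj_on Y I"
  shows "in_class (Av {[1, 0]}) I X Y \<longleftrightarrow> (\<forall>p\<in>I. \<forall>q\<in>I. X p < X q \<longrightarrow> Y p < Y q)"
    "in_class (Av {[0, 1]}) I X Y \<longleftrightarrow> (\<forall>p\<in>I. \<forall>q\<in>I. X p < X q \<longrightarrow> Y q < Y p)"
proof -
  obtain \<alpha> where \<alpha>: "\<alpha> \<in> perms" "is_pattern I X Y \<alpha>" by (rule pattern_exists[OF assms])
  obtain f where f: "bij_betw f I {..<length \<alpha>}" "emb I X Y {..<length \<alpha>} (\<lambda>i. i) ((!) \<alpha>) f"
    using \<alpha> by (auto simp: is_pattern_def)
  have iff: "in_class (Av B) I X Y \<longleftrightarrow> \<alpha> \<in> Av B" for B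
    using in_class_pattern[OF perm_class_Av _ \<alpha>(2,1)] \<alpha>(2) by (auto simp: in_class_def)
  have fI: "f ` I = {..<length \<alpha>}" using f(1) by (simp add: bij_betw_def)
  have fe: "X p < X q \<longleftrightarrow> f p < f q" "Y p < Y q \<longleftrightarrow> \<alpha> ! f p < \<alpha> ! f q" if "p \<in> I" "q \<in> I" for p q
    using f(2) that by (simp_all add: emb_def)
  have ne: "\<alpha> ! i \<noteq> \<alpha> ! j" if "i < j" "j < length \<alpha>" for i j
    using inj_onD[OF perms_inj[OF \<alpha>(1)], of i j] that by auto
  have all: "(\<forall>p\<in>I. \<forall>q\<in>I. X p < X q \<longrightarrow> Q (Y p < Y q) (Y q < Y p)) \<longleftrightarrow>
    (\<forall>i\<in>{..<length \<alpha>}. \<forall>j\<in>{..<length \<alpha>}. i < j \<longrightarrow> Q (\<alpha> ! i < \<alpha> ! j) (\<alpha> ! j < \<alpha> ! i))" for Q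
    unfolding fI[symmetric] using fe by simp
  show "in_class (Av {[1, 0]}) I X Y \<longleftrightarrow> (\<forall>p\<in>I. \<forall>q\<in>I. X p < X q \<longrightarrow> Y p < Y q)"
    unfolding iff all[of "\<lambda>a b. a"] using \<alpha>(1) contained_pair(1)[OF \<alpha>(1)] ne
    by (fastforce simp: Av_def)
  show "in_class (Av {[0, 1]}) I X Y \<longleftrightarrow> (\<forall>p\<in>I. \<forall>q\<in>I. X p < X q \<longrightarrow> Y q < Y p)"
    unfolding iff all[of "\<lambda>a b. b"] using \<alpha>(1) contained_pair(2)[OF \<alpha>(1)] ne
    by (fastforce simp: Av_def)
qed

lemma id_perms: "[0..<k] \<in> perms" "rev [0..<k] \<in> perms"
  by (auto simp: perms_iff)

lemma id_Av: "[0..<k] \<in> Av {[1, 0]}" "rev [0..<k] \<in> Av {[0, 1]}"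
proof -
  show "[0..<k] \<in> Av {[1, 0]}" using contained_pair(1)[OF id_perms(1)] id_perms(1) by (simp add: Av_def)
  show "rev [0..<k] \<in> Av {[0, 1]}" using contained_pair(2)[OF id_perms(2)] id_perms(2)
    by (auto simp: Av_def rev_nth)
qed

lemma infinite_Av: "infinite (Av {[1, 0]})" "infinite (Av {[0, 1]})"
proof -
  have "inj (\<lambda>k::nat. [0..<k])" by (rule injI) (metis diff_zero length_upt)
  then have "infinite (range (\<lambda>k::nat. [0..<k]))" using finite_imageD by blast
  then show "infinite (Av {[1, 0]})" using id_Av(1) infinite_super by (metis image_subsetI)
  have "inj (\<lambda>k::nat. rev [0..<k])" by (rule injI) (metis diff_zero length_upt length_rev)
  then have "infinite (range (\<lambda>k::nat. rev [0..<k]))" using finite_imageD by blast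
  then show "infinite (Av {[0, 1]})" using id_Av(2) infinite_super by (metis image_subsetI)
qed

section \<open>Classes that are not monotone griddable\<close>

lemma enum_set:
  fixes S :: "nat set"
  assumes "finite S"
  shows "\<exists>h. (\<forall>i<card S. h i \<in> S) \<and> (\<forall>i j. i < j \<longrightarrow> j < card S \<longrightarrow> h i < h j)"
proof (intro exI[of _ "\<lambda>i. sorted_list_of_set S ! i"] conjI allI impI)
  fix i assume "i < card S"
  then have "i < length (sorted_list_of_set S)" by simp
  from nth_mem[OF this] show "sorted_list_of_set S ! i \<in> S" using assms by simp
next
  fix i j assume "i < j" "j < card S"
  then show "sorted_list_of_set S ! i < sorted_list_of_set S ! j"
    using sorted_wrt_nth_less[of "(<)" "sorted_list_of_set S" i j] by simp
qed

text \<open>Erdos-Szekeres by way of Ramsey: an infinite class has arbitrarily long members, and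
  these contain long monotone subsequences.\<close>

lemma infinite_class_monotone:
  assumes C: "perm_class C" "infinite C"
  shows "(\<forall>k. [0..<k] \<in> C) \<or> (\<forall>k. rev [0..<k] \<in> C)"
proof (rule ccontr)
  assume "\<not> ?thesis"
  then obtain k l where kl: "[0..<k] \<notin> C" "rev [0..<l] \<notin> C" by blast
  obtain K where K: "\<And>(V :: nat set) E. finite V \<Longrightarrow> K \<le> card V \<Longrightarrow>
      \<exists>S\<subseteq>V. card S = k \<and> clique S E \<or> card S = l \<and> indep S E"
    using ramsey2[of k l] by blast
  have "\<exists>\<pi>\<in>C. K \<le> length \<pi>"
  proof (rule ccontr)
    assume "\<not> ?thesis"
    then have "C \<subseteq> {\<pi> \<in> perms. length \<pi> < K}" using C(1) by (auto simp: perm_class_def not_le)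
    then show False using C(2) finite_perms_le finite_subset by blast
  qed
  then obtain \<pi> where \<pi>: "\<pi> \<in> C" "K \<le> length \<pi>" by blast
  have \<pi>p: "\<pi> \<in> perms" using \<pi> C by (auto simp: perm_class_def)
  define E where "E = {{i, j} | i j. i < j \<and> \<pi> ! i < \<pi> ! j}"
  have E: "{i, j} \<in> E \<longleftrightarrow> \<pi> ! i < \<pi> ! j" if "i < j" for i j
    using that by (auto simp: E_def doubleton_eq_iff)
  obtain S where S: "S \<subseteq> {..<length \<pi>}" "card S = k \<and> clique S E \<or> card S = l \<and> indep S E"
    using K[of "{..<length \<pi>}" E] \<pi>(2) by auto
  obtain h where h: "\<And>i. i < card S \<Longrightarrow> h i \<in> S" "\<And>i j. i < j \<Longrightarrow> j < card S \<Longrightarrow> h i < h j"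
    using enum_set[OF finite_subset[OF S(1)]] by auto
  have hE: "{h i, h j} \<in> E \<longleftrightarrow> \<pi> ! h i < \<pi> ! h j" if "i < j" "j < card S" for i j
    using E h(2) that by blast
  have hlen: "h i < length \<pi>" if "i < card S" for i using h(1)[OF that] S(1) by blast
  have hne: "\<pi> ! h i \<noteq> \<pi> ! h j" if "i < j" "j < card S" for i j
    using inj_onD[OF perms_inj[OF \<pi>p], of "h i" "h j"] hlen[of i] hlen[of j] h(2)[OF that] that by auto
  from S(2) show False
  proof
    assume c: "card S = k \<and> clique S E"
    have lt: "\<pi> ! h i < \<pi> ! h j" if "i < j" "j < k" for i j
    proof -
      have "h i \<in> S" "h j \<in> S" "h i \<noteq> h j" using h(1)[of i] h(1)[of j] h(2)[of i j] that c by auto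
      then have "{h i, h j} \<in> E" using c unfolding clique_def by blast
      then show ?thesis using hE that c by blast
    qed
    have "lemb [0..<k] \<pi> h"
      unfolding emb_def
    proof (intro conjI ballI)
      fix i j assume ij: "i \<in> {..<length [0..<k]}" "j \<in> {..<length [0..<k]}"
      show "h i \<in> {..<length \<pi>}" using hlen ij c by simp
      show "i < j \<longleftrightarrow> h i < h j" using h(2)[of i j] h(2)[of j i] ij c by (cases i j rule: linorder_cases) auto
      show "[0..<k] ! i < [0..<k] ! j \<longleftrightarrow> \<pi> ! h i < \<pi> ! h j"
        using lt[of i j] lt[of j i] ij by (cases i j rule: linorder_cases) auto
    qed
    then show False using kl class_sub[OF C(1) \<pi>(1) id_perms(1)] by blast
  next
    assume c: "card S = l \<and> indep S E"
    have lt: "\<pi> ! h j < \<pi> ! h i" if "i < j" "j < l" for i j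
    proof -
      have "h i \<in> S" "h j \<in> S" "h i \<noteq> h j" using h(1)[of i] h(1)[of j] h(2)[of i j] that c by auto
      then have "{h i, h j} \<notin> E" using c unfolding indep_def by blast
      then show ?thesis using hE[of i j] hne[of i j] that c by auto
    qed
    have "lemb (rev [0..<l]) \<pi> h"
      unfolding emb_def
    proof (intro conjI ballI)
      fix i j assume ij: "i \<in> {..<length (rev [0..<l])}" "j \<in> {..<length (rev [0..<l])}"
      show "h i \<in> {..<length \<pi>}" using hlen ij c by simp
      show "i < j \<longleftrightarrow> h i < h j" using h(2)[of i j] h(2)[of j i] ij c by (cases i j rule: linorder_cases) auto
      show "rev [0..<l] ! i < rev [0..<l] ! j \<longleftrightarrow> \<pi> ! h i < \<pi> ! h j"
        using lt[of i j] lt[of j i] ij by (cases i j rule: linorder_cases) (auto simp: rev_nth)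
    qed
    then show False using kl class_sub[OF C(1) \<pi>(1) id_perms(2)] by blast
  qed
qed

lemma card_cut:
  fixes v :: nat
  assumes "finite V" "v \<in> V" "s \<le> v" "v < t"
  shows "card {u\<in>V. u < s} < card {u\<in>V. u < t}"
proof (rule psubset_card_mono)
  show "finite {u\<in>V. u < t}" using assms(1) by simp
  have "v \<in> {u\<in>V. u < t}" "v \<notin> {u\<in>V. u < s}" using assms by simp_all
  moreover have "{u\<in>V. u < s} \<subseteq> {u\<in>V. u < t}" using assms(3,4) by (intro Collect_mono) auto
  ultimately show "{u\<in>V. u < s} \<subset> {u\<in>V. u < t}" by blast
qed

text \<open>
  A box is bad if it contains both an increasing and a decreasing pair.  If few lines cut all bad
  boxes, then the cells between the lines are monotone; otherwise there is a long chain of disjoint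
  bad boxes, and each contributes a 21 or a 12 to a sum or a skew sum.
\<close>

definition straddles :: "nat list \<Rightarrow> nat \<times> nat \<times> nat \<times> nat \<Rightarrow> nat \<Rightarrow> nat \<Rightarrow> nat \<Rightarrow> nat \<Rightarrow> bool" where
  "straddles \<pi> b p q p' q' \<longleftrightarrow> fst b \<le> p \<and> p < q \<and> q \<le> fst (snd b) \<and> q < length \<pi> \<and>
     fst b \<le> p' \<and> p' < q' \<and> q' \<le> fst (snd b) \<and> q' < length \<pi> \<and>
     fst (snd (snd b)) \<le> \<pi> ! q \<and> \<pi> ! q < \<pi> ! p \<and> \<pi> ! p \<le> snd (snd (snd b)) \<and>
     fst (snd (snd b)) \<le> \<pi> ! p' \<and> \<pi> ! p' < \<pi> ! q' \<and> \<pi> ! q' \<le> snd (snd (snd b))"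

definition badbox :: "nat list \<Rightarrow> nat \<times> nat \<times> nat \<times> nat \<Rightarrow> bool" where
  "badbox \<pi> b \<longleftrightarrow> (\<exists>p q p' q'. straddles \<pi> b p q p' q')"

interpretation BX: boxes "fst :: nat \<times> nat \<times> nat \<times> nat \<Rightarrow> nat" "\<lambda>b. fst (snd b)" "\<lambda>b. fst (snd (snd b))" "\<lambda>b. snd (snd (snd b))" .

lemma sliced_monotone_cells:
  assumes \<pi>: "\<pi> \<in> perms" and V: "finite V" "finite H"
    and cut: "\<And>b. badbox \<pi> b \<Longrightarrow> (\<exists>v\<in>V. fst b \<le> v \<and> v < fst (snd b)) \<or>
      (\<exists>h\<in>H. fst (snd (snd b)) \<le> h \<and> h < snd (snd (snd b)))"
  defines "S \<equiv> \<lambda>i j. {x. x < length \<pi> \<and> card {v\<in>V. v < x} = i \<and> card {h\<in>H. h < \<pi> ! x} = j}"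
  shows "(\<forall>p\<in>S i j. \<forall>q\<in>S i j. p < q \<longrightarrow> \<pi> ! p < \<pi> ! q) \<or> (\<forall>p\<in>S i j. \<forall>q\<in>S i j. p < q \<longrightarrow> \<pi> ! q < \<pi> ! p)"
proof (rule ccontr)
  assume "\<not> ?thesis"
  then obtain p q p' q' where pq: "p \<in> S i j" "q \<in> S i j" "p < q" "\<not> \<pi> ! p < \<pi> ! q"
    "p' \<in> S i j" "q' \<in> S i j" "p' < q'" "\<not> \<pi> ! q' < \<pi> ! p'" by blast
  have len: "x < length \<pi>" "card {v\<in>V. v < x} = i" "card {h\<in>H. h < \<pi> ! x} = j" if "x \<in> S i j" for x
    using that by (simp_all add: S_def)
  have ne: "\<pi> ! p \<noteq> \<pi> ! q" "\<pi> ! p' \<noteq> \<pi> ! q'"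
    using inj_onD[OF perms_inj[OF \<pi>], of p q] inj_onD[OF perms_inj[OF \<pi>], of p' q'] len pq by auto
  \<comment> \<open>The smallest box around a decreasing and an increasing pair of one cell. A cut
    through it would give different counts to two of these points.\<close>
  define b where "b = (min p p', max q q', min (\<pi> ! q) (\<pi> ! p'), max (\<pi> ! p) (\<pi> ! q'))"
  have "straddles \<pi> b p q p' q'"
    unfolding straddles_def b_def fst_conv snd_conv using pq ne len(1)[OF pq(2)] len(1)[OF pq(6)] by auto
  then have "badbox \<pi> b" unfolding badbox_def by blast
  from cut[OF this] show False
  proof
    assume "\<exists>v\<in>V. fst b \<le> v \<and> v < fst (snd b)"
    then obtain v where "v \<in> V" "min p p' \<le> v" "v < max q q'" by (auto simp: b_def)
    from card_cut[OF V(1) this] show False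
      using len(2)[OF pq(1)] len(2)[OF pq(2)] len(2)[OF pq(5)] len(2)[OF pq(6)]
      by (auto simp: min_def max_def split: if_splits)
  next
    assume "\<exists>h\<in>H. fst (snd (snd b)) \<le> h \<and> h < snd (snd (snd b))"
    then obtain h where "h \<in> H" "min (\<pi> ! q) (\<pi> ! p') \<le> h" "h < max (\<pi> ! p) (\<pi> ! q')" by (auto simp: b_def)
    from card_cut[OF V(2) this] show False
      using len(3)[OF pq(1)] len(3)[OF pq(2)] len(3)[OF pq(5)] len(3)[OF pq(6)]
      by (auto simp: min_def max_def split: if_splits)
  qed
qed

text \<open>The direction of each cell varies with the permutation, but the matrix must not. Every
  vertical strip is therefore offered one column for each possible set of increasing rows, and a
  permutation leaves the columns it does not use empty.\<close>

lemma universal_gridding: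
  assumes C: "C \<subseteq> perms"
    and cells: "\<And>\<pi>. \<pi> \<in> C \<Longrightarrow> \<exists>V H. finite V \<and> finite H \<and> card V \<le> B \<and> card H \<le> B \<and>
      (\<forall>b. badbox \<pi> b \<longrightarrow> (\<exists>v\<in>V. fst b \<le> v \<and> v < fst (snd b)) \<or>
        (\<exists>h\<in>H. fst (snd (snd b)) \<le> h \<and> h < snd (snd (snd b))))"
  shows "monotone_griddable C"
proof -
  define n where "n = B + 1"
  define Q where "Q = card (Pow {1..n})"
  have Q0: "0 < Q" by (simp add: Q_def card_Pow)
  obtain e where e: "bij_betw e {0..<Q} (Pow {1..n})"
    using ex_bij_betw_nat_finite[of "Pow {1..n}"] by (auto simp: Q_def)
  define m where "m = (B + 1) * Q"
  define N where "N c j = (if j \<in> e ((c - 1) mod Q) then Av {[1, 0]} else Av {[0, 1]})" for c j :: nat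
  have "gridding_matrix m n N"
    using Q0 perm_class_Av infinite_Av by (auto simp: gridding_matrix_def m_def n_def N_def)
  moreover have "\<forall>i\<in>{1..m}. \<forall>j\<in>{1..n}. monotone_class (N i j) \<or> N i j = {}"
    by (simp add: N_def monotone_class_def)
  moreover have "has_gridding m n N \<pi>" if \<pi>C: "\<pi> \<in> C" for \<pi>
  proof -
    have \<pi>: "\<pi> \<in> perms" using \<pi>C C by blast
    obtain V H where VH: "finite V" "finite H" "card V \<le> B" "card H \<le> B"
      and cut: "\<forall>b. badbox \<pi> b \<longrightarrow> (\<exists>v\<in>V. fst b \<le> v \<and> v < fst (snd b)) \<or>
        (\<exists>h\<in>H. fst (snd (snd b)) \<le> h \<and> h < snd (snd (snd b)))"
      using cells[OF \<pi>C] by (elim exE conjE)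
    define c0 where "c0 x = card {v\<in>V. v < x}" for x
    define r0 where "r0 x = card {h\<in>H. h < \<pi> ! x}" for x
    define S where "S i j = {x. x < length \<pi> \<and> c0 x = i \<and> r0 x = j}" for i j
    have mono: "(\<forall>p\<in>S i j. \<forall>q\<in>S i j. p < q \<longrightarrow> \<pi> ! p < \<pi> ! q) \<or> (\<forall>p\<in>S i j. \<forall>q\<in>S i j. p < q \<longrightarrow> \<pi> ! q < \<pi> ! p)" for i j
      unfolding S_def c0_def r0_def by (rule sliced_monotone_cells[OF \<pi> VH(1,2)]) (use cut in blast)
    have c0B: "c0 x \<le> B" and r0B: "r0 x \<le> B" for x
      using card_mono[OF VH(1), of "{v\<in>V. v < x}"] card_mono[OF VH(2), of "{h\<in>H. h < \<pi> ! x}"] VH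
      by (auto simp: c0_def r0_def)
    have c0m: "c0 x \<le> c0 y" if "x \<le> y" for x y
      unfolding c0_def using that VH by (intro card_mono) auto
    have r0m: "r0 x \<le> r0 y" if "\<pi> ! x \<le> \<pi> ! y" for x y
      unfolding r0_def using that VH by (intro card_mono) auto
    define inc where "inc i = {j\<in>{1..n}. \<forall>p\<in>S i (j - 1). \<forall>q\<in>S i (j - 1). p < q \<longrightarrow> \<pi> ! p < \<pi> ! q}" for i
    have "\<forall>i. \<exists>k. k < Q \<and> e k = inc i"
    proof
      fix i
      have "inc i \<in> Pow {1..n}" by (auto simp: inc_def)
      then have "inc i \<in> e ` {0..<Q}" using e by (simp add: bij_betw_def)
      then show "\<exists>k. k < Q \<and> e k = inc i" by auto
    qed
    then obtain code where code: "\<forall>i. code i < Q \<and> e (code i) = inc i" by (rule choice[THEN exE])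
    \<comment> \<open>Strip \<open>c0 x\<close> owns \<open>Q\<close> consecutive columns, and the
      one whose increasing rows are exactly \<open>inc (c0 x)\<close> is used.\<close>
    define c where "c x = c0 x * Q + code (c0 x) + 1" for x
    define r where "r x = r0 x + 1" for x
    have cQ: "code i < Q" "e (code i) = inc i" for i using code by blast+
    have cdiv: "(c x - 1) div Q = c0 x" "(c x - 1) mod Q = code (c0 x)" for x
      using cQ(1)[of "c0 x"] by (simp_all add: c_def)
    have "coloured m n N \<pi> c r"
      unfolding coloured_def
    proof (intro conjI allI impI ballI)
      fix x
      have "c0 x * Q + code (c0 x) + 1 \<le> B * Q + Q"
        using mult_le_mono1[OF c0B[of x], of Q] cQ(1)[of "c0 x"] by linarith
      then show "c x \<in> {1..m}" by (simp add: c_def m_def)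
      show "r x \<in> {1..n}" using r0B[of x] by (simp add: r_def n_def)
      fix y
      show "r x \<le> r y" if "\<pi> ! x \<le> \<pi> ! y" using r0m[OF that] by (simp add: r_def)
      show "c x \<le> c y" if "x \<le> y"
      proof (cases "c0 x = c0 y")
        case False
        then have "c0 x + 1 \<le> c0 y" using c0m[OF that] by simp
        then have "(c0 x + 1) * Q \<le> c0 y * Q" by (rule mult_le_mono1)
        moreover have "code (c0 x) < Q" by (rule cQ)
        ultimately show ?thesis by (simp add: c_def)
      qed (simp add: c_def)
    next
      fix i j assume ij: "i \<in> {1..m}" "j \<in> {1..n}"
      let ?T = "{x. x < length \<pi> \<and> c x = i \<and> r x = j}"
      show "?T = {} \<or> in_class (N i j) ?T (\<lambda>x. x) ((!) \<pi>)"
      proof (cases "?T = {}")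
        case False
        then obtain x0 where x0: "x0 < length \<pi>" "c x0 = i" "r x0 = j" by blast
        have T: "?T = S (c0 x0) (j - 1)"
        proof -
          have "c x = i \<longleftrightarrow> c0 x = c0 x0" for x
          proof
            assume "c x = i"
            then have "c x - 1 = c x0 - 1" using x0(2) by simp
            then show "c0 x = c0 x0" using cdiv(1)[of x] cdiv(1)[of x0] by simp
          next
            assume "c0 x = c0 x0"
            then show "c x = i" using x0(2) by (simp add: c_def)
          qed
          moreover have "r x = j \<longleftrightarrow> r0 x = j - 1" for x using ij by (auto simp: r_def)
          ultimately show ?thesis unfolding S_def by simp
        qed
        have fin: "finite (S a b)" "inj_on (\<lambda>x. x) (S a b)" "inj_on ((!) \<pi>) (S a b)" for a b
          using inj_on_subset[OF perms_inj[OF \<pi>], of "S a b"] by (auto simp: S_def)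
        have "e ((i - 1) mod Q) = inc (c0 x0)" using cdiv(2)[of x0] x0(2) cQ(2) by simp
        then have Nij: "N i j = (if j \<in> inc (c0 x0) then Av {[1, 0]} else Av {[0, 1]})" by (simp add: N_def)
        show ?thesis
        proof (cases "j \<in> inc (c0 x0)")
          case True
          then have "in_class (Av {[1, 0]}) (S (c0 x0) (j - 1)) (\<lambda>x. x) ((!) \<pi>)"
            unfolding in_class_Av(1)[OF fin] by (simp add: inc_def)
          then show ?thesis using True T Nij by simp
        next
          case False
          then have "\<not> (\<forall>p\<in>S (c0 x0) (j - 1). \<forall>q\<in>S (c0 x0) (j - 1). p < q \<longrightarrow> \<pi> ! p < \<pi> ! q)"
            using ij by (simp add: inc_def)
          then have "\<forall>p\<in>S (c0 x0) (j - 1). \<forall>q\<in>S (c0 x0) (j - 1). p < q \<longrightarrow> \<pi> ! q < \<pi> ! p" using mono by blast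
          then have "in_class (Av {[0, 1]}) (S (c0 x0) (j - 1)) (\<lambda>x. x) ((!) \<pi>)"
            unfolding in_class_Av(2)[OF fin] .
          then show ?thesis using False T Nij by simp
        qed
      qed simp
    qed
    then show ?thesis using gridding_iff_coloured[OF \<pi>, of m n N] Q0 by (auto simp: m_def n_def)
  qed
  ultimately show ?thesis unfolding monotone_griddable_def by blast
qed

theorem not_monotone_griddable:
  assumes C: "perm_class C" and ng: "\<not> monotone_griddable C"
  shows "(\<forall>a. sum21 a \<in> C) \<or> (\<forall>a. skew12 a \<in> C)"
proof (rule ccontr)
  assume "\<not> ?thesis"
  then obtain a b where ab: "sum21 a \<notin> C" "skew12 b \<notin> C" by blast
  obtain B where B: "\<forall>R. (\<forall>r\<in>R. fst r < fst (snd r) \<and> fst (snd (snd r)) < snd (snd (snd r))) \<longrightarrow>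
    (\<exists>r. \<forall>i<a. r i \<in> R \<and> (\<forall>j<i. fst (snd (r j)) < fst (r i) \<and> snd (snd (snd (r j))) < fst (snd (snd (r i))))) \<or>
    (\<exists>r. \<forall>i<b. r i \<in> R \<and> (\<forall>j<i. fst (snd (r j)) < fst (r i) \<and> snd (snd (snd (r i))) < fst (snd (snd (r j))))) \<or>
    BX.sliced B B R"
    using BX.chain_or_sliced[of a b] by (elim exE)
  have "\<exists>V H. finite V \<and> finite H \<and> card V \<le> B \<and> card H \<le> B \<and>
      (\<forall>b. badbox \<pi> b \<longrightarrow> (\<exists>v\<in>V. fst b \<le> v \<and> v < fst (snd b)) \<or>
        (\<exists>h\<in>H. fst (snd (snd b)) \<le> h \<and> h < snd (snd (snd b))))" if \<pi>: "\<pi> \<in> C" for \<pi>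
  proof -
    have ok: "\<forall>r\<in>{r. badbox \<pi> r}. fst r < fst (snd r) \<and> fst (snd (snd r)) < snd (snd (snd r))"
    proof
      fix r assume "r \<in> {r. badbox \<pi> r}"
      then have "\<exists>p q p' q'. straddles \<pi> r p q p' q'" by (simp add: badbox_def)
      then obtain p q p' q' where "straddles \<pi> r p q p' q'" by (elim exE)
      then show "fst r < fst (snd r) \<and> fst (snd (snd r)) < snd (snd (snd r))"
        unfolding straddles_def by linarith
    qed
    consider (up) r where "\<forall>i<a. r i \<in> {r. badbox \<pi> r} \<and> (\<forall>j<i. fst (snd (r j)) < fst (r i) \<and> snd (snd (snd (r j))) < fst (snd (snd (r i))))"
      | (down) r where "\<forall>i<b. r i \<in> {r. badbox \<pi> r} \<and> (\<forall>j<i. fst (snd (r j)) < fst (r i) \<and> snd (snd (snd (r i))) < fst (snd (snd (r j))))"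
      | (cut) "BX.sliced B B {r. badbox \<pi> r}"
      using B[rule_format, OF ok[rule_format]] by blast
    then show ?thesis
    proof cases
      case up
      have "\<forall>i. \<exists>pq. i < a \<longrightarrow> fst (r i) \<le> fst pq \<and> fst pq < snd pq \<and> snd pq \<le> fst (snd (r i)) \<and> snd pq < length \<pi> \<and>
        fst (snd (snd (r i))) \<le> \<pi> ! snd pq \<and> \<pi> ! snd pq < \<pi> ! fst pq \<and> \<pi> ! fst pq \<le> snd (snd (snd (r i)))"
      proof
        fix i
        show "\<exists>pq. i < a \<longrightarrow> fst (r i) \<le> fst pq \<and> fst pq < snd pq \<and> snd pq \<le> fst (snd (r i)) \<and> snd pq < length \<pi> \<and>
        fst (snd (snd (r i))) \<le> \<pi> ! snd pq \<and> \<pi> ! snd pq < \<pi> ! fst pq \<and> \<pi> ! fst pq \<le> snd (snd (snd (r i)))"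
        proof (cases "i < a")
          case True
          then have "badbox \<pi> (r i)" using up by blast
          then obtain p q p' q' where "straddles \<pi> (r i) p q p' q'" unfolding badbox_def by (elim exE)
          then show ?thesis unfolding straddles_def by (intro exI[of _ "(p, q)"]) simp
        qed simp
      qed
      then obtain pq where pq: "\<forall>i. i < a \<longrightarrow> fst (r i) \<le> fst (pq i) \<and> fst (pq i) < snd (pq i) \<and>
        snd (pq i) \<le> fst (snd (r i)) \<and> snd (pq i) < length \<pi> \<and>
        fst (snd (snd (r i))) \<le> \<pi> ! snd (pq i) \<and> \<pi> ! snd (pq i) < \<pi> ! fst (pq i) \<and> \<pi> ! fst (pq i) \<le> snd (snd (snd (r i)))"
        by (rule choice[THEN exE])
      have "sum21 a \<in> C"
      proof (rule chain_sum21[OF C \<pi>, of a "\<lambda>i. fst (pq i)" "\<lambda>i. snd (pq i)"])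
        fix i assume "i < a"
        then show "fst (pq i) < snd (pq i) \<and> snd (pq i) < length \<pi> \<and> \<pi> ! snd (pq i) < \<pi> ! fst (pq i)" using pq by blast
      next
        fix i j assume ij: "j < i" "i < a"
        then have "fst (snd (r j)) < fst (r i)" "snd (snd (snd (r j))) < fst (snd (snd (r i)))" using up by blast+
        then show "snd (pq j) < fst (pq i) \<and> \<pi> ! fst (pq j) < \<pi> ! snd (pq i)"
          using pq[rule_format, of i] pq[rule_format, of j] ij by linarith
      qed
      then show ?thesis using ab by blast
    next
      case down
      have "\<forall>i. \<exists>pq. i < b \<longrightarrow> fst (r i) \<le> fst pq \<and> fst pq < snd pq \<and> snd pq \<le> fst (snd (r i)) \<and> snd pq < length \<pi> \<and>
        fst (snd (snd (r i))) \<le> \<pi> ! fst pq \<and> \<pi> ! fst pq < \<pi> ! snd pq \<and> \<pi> ! snd pq \<le> snd (snd (snd (r i)))"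
      proof
        fix i
        show "\<exists>pq. i < b \<longrightarrow> fst (r i) \<le> fst pq \<and> fst pq < snd pq \<and> snd pq \<le> fst (snd (r i)) \<and> snd pq < length \<pi> \<and>
        fst (snd (snd (r i))) \<le> \<pi> ! fst pq \<and> \<pi> ! fst pq < \<pi> ! snd pq \<and> \<pi> ! snd pq \<le> snd (snd (snd (r i)))"
        proof (cases "i < b")
          case True
          then have "badbox \<pi> (r i)" using down by blast
          then obtain p q p' q' where "straddles \<pi> (r i) p q p' q'" unfolding badbox_def by (elim exE)
          then show ?thesis unfolding straddles_def by (intro exI[of _ "(p', q')"]) simp
        qed simp
      qed
      then obtain pq where pq: "\<forall>i. i < b \<longrightarrow> fst (r i) \<le> fst (pq i) \<and> fst (pq i) < snd (pq i) \<and>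
        snd (pq i) \<le> fst (snd (r i)) \<and> snd (pq i) < length \<pi> \<and>
        fst (snd (snd (r i))) \<le> \<pi> ! fst (pq i) \<and> \<pi> ! fst (pq i) < \<pi> ! snd (pq i) \<and> \<pi> ! snd (pq i) \<le> snd (snd (snd (r i)))"
        by (rule choice[THEN exE])
      have "skew12 b \<in> C"
      proof (rule chain_skew12[OF C \<pi>, of b "\<lambda>i. fst (pq i)" "\<lambda>i. snd (pq i)"])
        fix i assume "i < b"
        then show "fst (pq i) < snd (pq i) \<and> snd (pq i) < length \<pi> \<and> \<pi> ! fst (pq i) < \<pi> ! snd (pq i)" using pq by blast
      next
        fix i j assume ij: "j < i" "i < b"
        then have "fst (snd (r j)) < fst (r i)" "snd (snd (snd (r i))) < fst (snd (snd (r j)))" using down by blast+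
        then show "snd (pq j) < fst (pq i) \<and> \<pi> ! snd (pq i) < \<pi> ! fst (pq j)"
          using pq[rule_format, of i] pq[rule_format, of j] ij by linarith
      qed
      then show ?thesis using ab by blast
    next
      case cut
      then show ?thesis unfolding BX.sliced_def by simp
    qed
  qed
  then have "monotone_griddable C" using universal_gridding[of C B] C by (auto simp: perm_class_def)
  then show False using ng by blast
qed

section \<open>Point sets whose inversions form a matching\<close>

lemma sum21_less:
  "k < l \<Longrightarrow> l < 2 * a \<Longrightarrow> sum21 a ! k < sum21 a ! l \<longleftrightarrow> k div 2 < l div 2"
  by (auto simp: nth_sum21 elim!: evenE oddE)

text \<open>When each point has at most one inversion, the points form a direct sum of single points
  and copies of 21. Inverted partners have the same points below them, so \<open>\<kappa>\<close>
  agrees on partners and grows from summand to summand; the last bit of \<open>f\<close> puts the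
  right-hand partner second.\<close>

lemma matching_emb:
  fixes X Y :: "'a \<Rightarrow> int"
  assumes fin: "finite S" and inj: "inj_on X S" "inj_on Y S"
    and match: "\<And>p q q'. p \<in> S \<Longrightarrow> q \<in> S \<Longrightarrow> q' \<in> S \<Longrightarrow>
      (X p < X q \<and> Y q < Y p \<or> X q < X p \<and> Y p < Y q) \<Longrightarrow>
      (X p < X q' \<and> Y q' < Y p \<or> X q' < X p \<and> Y p < Y q') \<Longrightarrow> q = q'"
  shows "\<exists>f. emb S X Y {..<2 * card S} (\<lambda>i. i) ((!) (sum21 (card S))) f"
proof -
  define a where "a = card S"
  define below where "below p = {q\<in>S. X q < X p \<and> Y q < Y p}" for p
  define \<kappa> where "\<kappa> p = card (below p)" for p
  define f where "f p = 2 * \<kappa> p + (if \<exists>q\<in>S. X q < X p \<and> Y p < Y q then 1 else 0)" for p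
  have fb: "finite (below p)" for p using fin by (simp add: below_def)
  have \<kappa>a: "\<kappa> p < a" if "p \<in> S" for p
    unfolding \<kappa>_def a_def using that fin by (intro psubset_card_mono) (auto simp: below_def)
  have fd: "f p div 2 = \<kappa> p" for p by (simp add: f_def)
  have f2a: "f p < 2 * a" if "p \<in> S" for p using \<kappa>a[OF that] by (simp add: f_def)
  have ne: "X p \<noteq> X q" "Y p \<noteq> Y q" if "p \<in> S" "q \<in> S" "p \<noteq> q" for p q
    using inj_onD[OF inj(1)] inj_onD[OF inj(2)] that by blast+
  have A: "f p < f q \<and> sum21 a ! f p < sum21 a ! f q" if "p \<in> S" "q \<in> S" "X p < X q" "Y p < Y q" for p q
  proof -
    have "below p \<subset> below q" using that by (auto simp: below_def)
    then have "\<kappa> p < \<kappa> q" unfolding \<kappa>_def by (rule psubset_card_mono[OF fb])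
    then show ?thesis using sum21_less[of "f p" "f q" a] fd f2a[OF that(2)] by (simp add: f_def)
  qed
  have B: "f p < f q \<and> sum21 a ! f q < sum21 a ! f p" if pq: "p \<in> S" "q \<in> S" "X p < X q" "Y q < Y p" for p q
  proof -
    have "below p = below q"
    proof (intro equalityI subsetI)
      fix r assume r: "r \<in> below p"
      then have "r \<noteq> q" "r \<in> S" "X r < X q" "X r < X p" "Y r < Y p" using pq by (auto simp: below_def)
      moreover have "Y r < Y q"
      proof (rule ccontr)
        assume "\<not> Y r < Y q"
        then have "Y q < Y r" using ne[of r q] calculation pq by auto
        then have "r = p" using match[of q r p] calculation pq by auto
        then show False using calculation by simp
      qed
      ultimately show "r \<in> below q" by (simp add: below_def)
    next
      fix r assume r: "r \<in> below q"
      then have "r \<noteq> p" "r \<in> S" "X r < X q" "Y r < Y q" "Y r < Y p" using pq by (auto simp: below_def)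
      moreover have "X r < X p"
      proof (rule ccontr)
        assume "\<not> X r < X p"
        then have "X p < X r" using ne[of r p] calculation pq by auto
        then have "r = q" using match[of p r q] calculation pq by auto
        then show False using calculation by simp
      qed
      ultimately show "r \<in> below p" by (simp add: below_def)
    qed
    then have \<kappa>: "\<kappa> p = \<kappa> q" by (simp add: \<kappa>_def)
    have "\<not> (\<exists>r\<in>S. X r < X p \<and> Y p < Y r)"
    proof
      assume "\<exists>r\<in>S. X r < X p \<and> Y p < Y r"
      then obtain r where r: "r \<in> S" "X r < X p" "Y p < Y r" by blast
      then have "r = q" using match[of p r q] pq by auto
      then show False using r pq by simp
    qed
    then have "f p = 2 * \<kappa> q" "f q = 2 * \<kappa> q + 1" using pq \<kappa> by (auto simp: f_def)
    then show ?thesis using f2a[OF pq(1)] f2a[OF pq(2)] by (simp add: nth_sum21)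
  qed
  have "emb S X Y {..<2 * a} (\<lambda>i. i) ((!) (sum21 a)) f"
    unfolding emb_def
  proof (intro conjI ballI)
    fix p q assume pq: "p \<in> S" "q \<in> S"
    show "f p \<in> {..<2 * a}" using f2a pq by simp
    consider "p = q" | "X p < X q" "Y p < Y q" | "X p < X q" "Y q < Y p" | "X q < X p" "Y p < Y q" | "X q < X p" "Y q < Y p"
      using ne[OF pq] by fastforce
    then show "X p < X q \<longleftrightarrow> f p < f q" "Y p < Y q \<longleftrightarrow> sum21 a ! f p < sum21 a ! f q"
      using A[OF pq] A[OF pq(2,1)] B[OF pq] B[OF pq(2,1)] by (cases; force)+
  qed
  then show ?thesis unfolding a_def by blast
qed

lemma matching_in_class:
  fixes X Y :: "'a \<Rightarrow> int"
  assumes C: "perm_class C" and fin: "finite S" and inj: "inj_on X S" "inj_on Y S"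
  shows "\<lbrakk>\<And>a. sum21 a \<in> C; \<And>p q q'. p \<in> S \<Longrightarrow> q \<in> S \<Longrightarrow> q' \<in> S \<Longrightarrow>
      (X p < X q \<and> Y q < Y p \<or> X q < X p \<and> Y p < Y q) \<Longrightarrow>
      (X p < X q' \<and> Y q' < Y p \<or> X q' < X p \<and> Y p < Y q') \<Longrightarrow> q = q'\<rbrakk> \<Longrightarrow> in_class C S X Y"
    and "\<lbrakk>\<And>a. skew12 a \<in> C; \<And>p q q'. p \<in> S \<Longrightarrow> q \<in> S \<Longrightarrow> q' \<in> S \<Longrightarrow>
      (X p < X q \<and> Y p < Y q \<or> X q < X p \<and> Y q < Y p) \<Longrightarrow>
      (X p < X q' \<and> Y p < Y q' \<or> X q' < X p \<and> Y q' < Y p) \<Longrightarrow> q = q'\<rbrakk> \<Longrightarrow> in_class C S X Y"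
proof -
  assume s: "\<And>a. sum21 a \<in> C" and m: "\<And>p q q'. p \<in> S \<Longrightarrow> q \<in> S \<Longrightarrow> q' \<in> S \<Longrightarrow>
      (X p < X q \<and> Y q < Y p \<or> X q < X p \<and> Y p < Y q) \<Longrightarrow>
      (X p < X q' \<and> Y q' < Y p \<or> X q' < X p \<and> Y p < Y q') \<Longrightarrow> q = q'"
  have "\<exists>f. emb S X Y {..<2 * card S} (\<lambda>i. i) ((!) (sum21 (card S))) f"
    by (rule matching_emb[OF fin inj]) (rule m)
  then obtain f where f: "emb S X Y {..<2 * card S} (\<lambda>i. i) ((!) (sum21 (card S))) f" ..
  have "in_class C {..<2 * card S} (\<lambda>i. i) ((!) (sum21 (card S)))"
    using in_class_self[OF s[of "card S"]] by simp
  then show "in_class C S X Y" by (rule in_class_mono[OF C _ f fin inj])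
next
  assume s: "\<And>a. skew12 a \<in> C" and m: "\<And>p q q'. p \<in> S \<Longrightarrow> q \<in> S \<Longrightarrow> q' \<in> S \<Longrightarrow>
      (X p < X q \<and> Y p < Y q \<or> X q < X p \<and> Y q < Y p) \<Longrightarrow>
      (X p < X q' \<and> Y p < Y q' \<or> X q' < X p \<and> Y q' < Y p) \<Longrightarrow> q = q'"
  \<comment> \<open>Negating \<open>Y\<close> exchanges inversions and non-inversions, and
    \<open>sum21\<close> with \<open>skew12\<close>.\<close>
  have inj': "inj_on (\<lambda>p. - Y p) S" using inj(2) by (auto simp: inj_on_def)
  have "\<exists>f. emb S X (\<lambda>p. - Y p) {..<2 * card S} (\<lambda>i. i) ((!) (sum21 (card S))) f"
    by (rule matching_emb[OF fin inj(1) inj']) (rule m, auto)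
  then obtain f where f: "emb S X (\<lambda>p. - Y p) {..<2 * card S} (\<lambda>i. i) ((!) (sum21 (card S))) f" ..
  have rev: "skew12 (card S) ! i < skew12 (card S) ! j \<longleftrightarrow> sum21 (card S) ! j < sum21 (card S) ! i"
    if "i < 2 * card S" "j < 2 * card S" for i j
  proof -
    have "skew12 (card S) ! i = 2 * card S - 1 - sum21 (card S) ! i" "sum21 (card S) ! i < 2 * card S"
      if "i < 2 * card S" for i using that swap_bound[OF that] by (simp_all only: nth_sum21[OF that])
    from this[OF that(1)] this[OF that(2)] show ?thesis by linarith
  qed
  have "emb S X Y {..<2 * card S} (\<lambda>i. i) ((!) (skew12 (card S))) f"
    unfolding emb_def
  proof (intro conjI ballI)
    fix p q assume pq: "p \<in> S" "q \<in> S"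
    have fp: "f p < 2 * card S" "f q < 2 * card S" using f pq by (auto simp: emb_def)
    then show "f p \<in> {..<2 * card S}" by simp
    show "X p < X q \<longleftrightarrow> f p < f q" using f pq by (simp add: emb_def)
    have "- Y q < - Y p \<longleftrightarrow> sum21 (card S) ! f q < sum21 (card S) ! f p" using f pq unfolding emb_def by blast
    then show "Y p < Y q \<longleftrightarrow> skew12 (card S) ! f p < skew12 (card S) ! f q" using rev[OF fp] by simp
  qed
  moreover have "in_class C {..<2 * card S} (\<lambda>i. i) ((!) (skew12 (card S)))"
    using in_class_self[OF s[of "card S"]] by simp
  ultimately show "in_class C S X Y" using in_class_mono[OF C _ _ fin inj] by blast
qed

lemma monotone_in_class:
  fixes X Y :: "'a \<Rightarrow> int"
  assumes C: "perm_class C" and fin: "finite S" and inj: "inj_on X S" "inj_on Y S"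
  shows "\<lbrakk>\<And>k. [0..<k] \<in> C; \<And>p q. p \<in> S \<Longrightarrow> q \<in> S \<Longrightarrow> X p < X q \<longleftrightarrow> Y p < Y q\<rbrakk> \<Longrightarrow> in_class C S X Y"
    and "\<lbrakk>\<And>k. rev [0..<k] \<in> C; \<And>p q. p \<in> S \<Longrightarrow> q \<in> S \<Longrightarrow> X p < X q \<longleftrightarrow> Y q < Y p\<rbrakk> \<Longrightarrow> in_class C S X Y"
proof -
  define r where "r p = card {q \<in> S. X q < X p}" for p
  note r = rank_bij[OF fin inj(1), folded r_def]
  have rS: "r p < card S" if "p \<in> S" for p using r(1) that by (auto simp: bij_betw_def)
  {
    assume k: "\<And>k. [0..<k] \<in> C" and m: "\<And>p q. p \<in> S \<Longrightarrow> q \<in> S \<Longrightarrow> X p < X q \<longleftrightarrow> Y p < Y q"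
    have "emb S X Y {..<length [0..<card S]} (\<lambda>i. i) ((!) [0..<card S]) r"
      unfolding emb_def using r(2) m rS by auto
    then show "in_class C S X Y" by (rule in_class_mono[OF C in_class_self[OF k] _ fin inj])
  next
    assume k: "\<And>k. rev [0..<k] \<in> C" and m: "\<And>p q. p \<in> S \<Longrightarrow> q \<in> S \<Longrightarrow> X p < X q \<longleftrightarrow> Y q < Y p"
    have "emb S X Y {..<length (rev [0..<card S])} (\<lambda>i. i) ((!) (rev [0..<card S])) r"
      unfolding emb_def
    proof (intro conjI ballI)
      fix p q assume pq: "p \<in> S" "q \<in> S"
      show "r p \<in> {..<length (rev [0..<card S])}" using rS pq by simp
      show "X p < X q \<longleftrightarrow> r p < r q" using r(2) pq by simp
      have "rev [0..<card S] ! r p < rev [0..<card S] ! r q \<longleftrightarrow> r q < r p"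
        using rS[OF pq(1)] rS[OF pq(2)] by (auto simp: rev_nth)
      then show "Y p < Y q \<longleftrightarrow> rev [0..<card S] ! r p < rev [0..<card S] ! r q"
        using m[OF pq(2,1)] r(2)[OF pq(2,1)] by simp
    qed
    then show "in_class C S X Y" by (rule in_class_mono[OF C in_class_self[OF k] _ fin inj])
  }
qed

section \<open>Antichains from closed walks\<close>

text \<open>The cells assigned to abstract points are pulled back along the pattern map to a
  colouring of the positions.\<close>

lemma grid_of_points:
  fixes X Y :: "'a \<Rightarrow> int"
  assumes gm: "gridding_matrix m n M" and fin: "finite I" and inj: "inj_on X I" "inj_on Y I"
    and pat: "is_pattern I X Y \<pi>" and \<pi>: "\<pi> \<in> perms"
    and cl: "\<And>p. p \<in> I \<Longrightarrow> fst (cl p) \<in> {1..m} \<and> snd (cl p) \<in> {1..n}"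
    and mX: "\<And>p q. p \<in> I \<Longrightarrow> q \<in> I \<Longrightarrow> X p < X q \<Longrightarrow> fst (cl p) \<le> fst (cl q)"
    and mY: "\<And>p q. p \<in> I \<Longrightarrow> q \<in> I \<Longrightarrow> Y p < Y q \<Longrightarrow> snd (cl p) \<le> snd (cl q)"
    and inC: "\<And>p. p \<in> I \<Longrightarrow> in_class (M (fst (cl p)) (snd (cl p))) {q\<in>I. cl q = cl p} X Y"
  shows "\<pi> \<in> Grid m n M"
proof -
  let ?L = "length \<pi>"
  obtain f where f: "bij_betw f I {..<?L}" "emb I X Y {..<?L} (\<lambda>i. i) ((!) \<pi>) f"
    using pat unfolding is_pattern_def by (elim exE conjE)
  define g where "g = inv_into I f"
  have g: "emb {..<?L} (\<lambda>i. i) ((!) \<pi>) I X Y g" unfolding g_def by (rule emb_inv[OF f])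
  have gI: "g x \<in> I" if "x < ?L" for x using g that by (simp add: emb_def)
  have gX: "x < y \<longleftrightarrow> X (g x) < X (g y)" "\<pi> ! x < \<pi> ! y \<longleftrightarrow> Y (g x) < Y (g y)" if "x < ?L" "y < ?L" for x y
    using g that by (simp_all add: emb_def)
  have "coloured m n M \<pi> (\<lambda>x. fst (cl (g x))) (\<lambda>x. snd (cl (g x)))"
    unfolding coloured_def
  proof (intro conjI allI impI ballI)
    fix x assume x: "x < ?L"
    show "fst (cl (g x)) \<in> {1..m}" "snd (cl (g x)) \<in> {1..n}" using cl[OF gI[OF x]] by blast+
    fix y assume y: "y < ?L"
    show "fst (cl (g x)) \<le> fst (cl (g y))" if "x \<le> y"
      using mX[OF gI[OF x] gI[OF y]] gX(1)[OF x y] that by (cases "x = y") auto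
    show "snd (cl (g x)) \<le> snd (cl (g y))" if "\<pi> ! x \<le> \<pi> ! y"
    proof (cases "x = y")
      case False
      then have "\<pi> ! x \<noteq> \<pi> ! y" using inj_onD[OF perms_inj[OF \<pi>], of x y] x y by auto
      then show ?thesis using mY[OF gI[OF x] gI[OF y]] gX(2)[OF x y] that by simp
    qed simp
  next
    fix i j assume ij: "i \<in> {1..m}" "j \<in> {1..n}"
    let ?T = "{x. x < ?L \<and> fst (cl (g x)) = i \<and> snd (cl (g x)) = j}"
    show "?T = {} \<or> in_class (M i j) ?T (\<lambda>x. x) ((!) \<pi>)"
    proof (cases "?T = {}")
      case False
      then obtain x0 where x0: "x0 < ?L" "cl (g x0) = (i, j)" by (auto simp: prod_eq_iff)
      have C: "perm_class (M i j)" using gm ij by (auto simp: gridding_matrix_def)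
      have "in_class (M i j) {q\<in>I. cl q = cl (g x0)} X Y" using inC[OF gI[OF x0(1)]] x0(2) by simp
      moreover have "emb ?T (\<lambda>x. x) ((!) \<pi>) {q\<in>I. cl q = cl (g x0)} X Y g"
        unfolding emb_def using gI gX x0(2) by (simp add: prod_eq_iff)
      moreover have "inj_on ((!) \<pi>) ?T" by (rule inj_on_subset[OF perms_inj[OF \<pi>]]) auto
      ultimately show ?thesis using in_class_mono[OF C, of _ X Y ?T "\<lambda>x. x" "(!) \<pi>" g] by simp
    qed simp
  qed
  then have "has_gridding m n M \<pi>"
    using gridding_iff_coloured[OF \<pi>, of m n M] gm by (auto simp: gridding_matrix_def)
  then show ?thesis using \<pi> by (simp add: Grid_def)
qed

text \<open>
  At a step with \<open>y t = y (Suc t)\<close> the walk pauses in a cell, which then holds two consecutive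
  points of the zigzag and has to contain an inversion for each such pair.
\<close>

locale walk =
  fixes m n :: nat and M :: "nat \<Rightarrow> nat \<Rightarrow> nat list set" and d0 :: bool
    and y :: "nat \<Rightarrow> nat \<times> nat" and P0 :: nat and \<sigma> :: "nat \<times> nat \<Rightarrow> int"
  assumes gm: "gridding_matrix m n M" and P0: "even P0" "2 \<le> P0" and per: "y (t + P0) = y t"
    and cell: "y t \<in> cell_vertices m n M"
    and link: "coord (even (Suc t) = d0) (y t) = coord (even (Suc t) = d0) (y (Suc t))"
    and \<sigma>1: "\<sigma> x = 1 \<or> \<sigma> x = - 1"
    and mono1: "\<sigma> (y t) = 1 \<Longrightarrow> [0..<k] \<in> M (fst (y t)) (snd (y t))"
    and mono2: "\<sigma> (y t) = - 1 \<Longrightarrow> rev [0..<k] \<in> M (fst (y t)) (snd (y t))"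
    and osc1: "y t = y (Suc t) \<Longrightarrow> \<sigma> (y t) = 1 \<Longrightarrow> sum21 k \<in> M (fst (y t)) (snd (y t))"
    and osc2: "y t = y (Suc t) \<Longrightarrow> \<sigma> (y t) = - 1 \<Longrightarrow> skew12 k \<in> M (fst (y t)) (snd (y t))"
    and no3: "y t = y (Suc t) \<Longrightarrow> y (Suc t) \<noteq> y (Suc (Suc t))"
    and ends: "y 0 \<noteq> y 1" "y (P0 - 2) \<noteq> y (P0 - 1)"
begin

lemma y_mult: "y (t + k * P0) = y t"
proof (induction k)
  case (Suc k)
  have "t + Suc k * P0 = (t + k * P0) + P0" by simp
  then show ?case using Suc per by metis
qed simp

lemma y_mod: "y (t mod P0) = y t"
  using y_mult[of "t mod P0" "t div P0"] by (simp add: mult.commute)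

text \<open>The walk extended periodically to all integers, as the times of a zigzag are
  integers.\<close>

definition yy :: "int \<Rightarrow> nat \<times> nat" where "yy s = y (nat (s mod int P0))"

lemma yy_nat: "yy (int t) = y t"
proof -
  have "nat (int t mod int P0) = t mod P0" by (simp flip: zmod_int)
  then show ?thesis by (simp add: yy_def y_mod)
qed

lemma yy_P0: "yy (s + int P0 * k) = yy s"
  by (simp add: yy_def)

lemma ex_nat_rep: "\<exists>t k. s = int t + int (2 * P0) * k"
proof -
  have "0 \<le> s mod int (2 * P0)" using P0 by simp
  then have "s = int (nat (s mod int (2 * P0))) + int (2 * P0) * (s div int (2 * P0))" by simp
  then show ?thesis by blast
qed

lemma yy_rep: "yy (int t + int (2 * P0) * k) = y t"
proof -
  have "int t + int (2 * P0) * k = int t + int P0 * (2 * k)" by simp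
  then show ?thesis using yy_P0[of "int t" "2 * k"] yy_nat by metis
qed

text \<open>Orientation of link \<open>t\<close>: it flips whenever the walk passes a cell of sign
  \<open>- 1\<close>.\<close>

primrec sgN :: "nat \<Rightarrow> int" where
  "sgN 0 = 1"
| "sgN (Suc t) = \<sigma> (y t) * sgN t"

lemma sgN1: "sgN t = 1 \<or> sgN t = - 1"
proof (induction t)
  case (Suc t) then show ?case using \<sigma>1[of "y t"] by auto
qed simp

lemma sgN_P0: "sgN (t + P0) = sgN P0 * sgN t"
proof (induction t)
  case (Suc t) then show ?case using per[of t] by simp
qed simp

text \<open>One round of the walk may reverse the orientation, a second one restores it; hence the
  zigzags have period \<open>2 * P0\<close>.\<close>

lemma sgN_2P0: "sgN (t + 2 * P0) = sgN t"
proof -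
  have "sgN (t + 2 * P0) = sgN P0 * (sgN P0 * sgN t)"
    using sgN_P0[of "t + P0"] sgN_P0[of t] by (simp add: mult_2 add.assoc)
  then show ?thesis using sgN1[of P0] by auto
qed

lemma sgN_mult: "sgN (t + k * (2 * P0)) = sgN t"
proof (induction k)
  case (Suc k)
  have "t + Suc k * (2 * P0) = (t + k * (2 * P0)) + 2 * P0" by simp
  then show ?case using Suc sgN_2P0 by metis
qed simp

definition sg :: "int \<Rightarrow> int" where "sg s = sgN (nat (s mod int (2 * P0)))"

lemma sg_rep: "sg (int t + int (2 * P0) * k) = sgN t"
proof -
  have "(int t + int (2 * P0) * k) mod int (2 * P0) = int (t mod (2 * P0))"
    by (simp only: mod_mult_self2 zmod_int)
  then have "sg (int t + int (2 * P0) * k) = sgN (t mod (2 * P0))" by (simp only: sg_def nat_int)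
  also have "\<dots> = sgN t" using sgN_mult[of "t mod (2 * P0)" "t div (2 * P0)"]
    by (simp only: mod_mult_div_eq mult.commute[of "t div (2 * P0)"])
  finally show ?thesis .
qed

lemma step: "\<exists>t. yy s = y t \<and> yy (s + 1) = y (Suc t) \<and> yy (s + 2) = y (Suc (Suc t)) \<and>
    sg s = sgN t \<and> sg (s + 1) = sgN (Suc t) \<and> even s = even t"
proof -
  obtain t k where s: "s = int t + int (2 * P0) * k" using ex_nat_rep by blast
  have s1: "s + 1 = int (Suc t) + int (2 * P0) * k" and s2: "s + 2 = int (Suc (Suc t)) + int (2 * P0) * k"
    using s by simp_all
  have "yy s = y t" "sg s = sgN t" unfolding s by (rule yy_rep, rule sg_rep)
  moreover have "yy (s + 1) = y (Suc t)" "sg (s + 1) = sgN (Suc t)" unfolding s1 by (rule yy_rep, rule sg_rep)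
  moreover have "yy (s + 2) = y (Suc (Suc t))" unfolding s2 by (rule yy_rep)
  moreover have "even s = even t" by (simp add: s)
  ultimately show ?thesis by (intro exI[of _ t] conjI)
qed

lemma sg1: "sg s = 1 \<or> sg s = - 1"
  unfolding sg_def by (rule sgN1)

lemma sg_step: "sg (s + 1) = \<sigma> (yy s) * sg s"
  using step[of s] by auto

lemma yy_link: "coord (even (s + 1) = d0) (yy s) = coord (even (s + 1) = d0) (yy (s + 1))"
proof -
  obtain t where t: "yy s = y t" "yy (s + 1) = y (Suc t)" "even s = even t" using step by blast
  then have "even (s + 1) = even (Suc t)" by simp
  then show ?thesis using link[of t] t by simp
qed

text \<open>Links in the same row or column but of opposite orientation are put on different lines,
  with the decreasing strand first. The parity is the orientation, as \<open>sgv\<close>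
  expects.\<close>

definition cid :: "int \<Rightarrow> int" where
  "cid s = 2 * int (coord (even s = d0) (yy s)) + (if sg s = 1 then 1 else 0)"

sublocale osc "int (2 * P0)" cid
proof
  show "even (int (2 * P0))" "2 \<le> int (2 * P0)" using P0 by auto
  fix s
  obtain t k where s: "s = int t + int (2 * P0) * k" using ex_nat_rep by blast
  then have s': "s + int (2 * P0) = int t + int (2 * P0) * (k + 1)" by (simp add: algebra_simps)
  have "yy (s + int (2 * P0)) = yy s" unfolding s' yy_rep unfolding s yy_rep ..
  moreover have "sg (s + int (2 * P0)) = sg s" unfolding s' sg_rep unfolding s sg_rep ..
  ultimately show "cid (s + int (2 * P0)) = cid s" by (simp add: cid_def)
qed

lemma line_eq:
  "line a p = 2 * int (coord (a = d0) (yy (fst p))) + (if sg (link a (fst p)) = 1 then 1 else 0)"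
proof (cases "even (fst p) = a")
  case True
  then show ?thesis by (auto simp: line_def link_def cid_def)
next
  case False
  then have "even (fst p + 1) = a" by auto
  then show ?thesis using False yy_link[of "fst p"] by (auto simp: line_def link_def cid_def)
qed

text \<open>Larger than twice any key occurring in \<open>opts N\<close>, so keys never carry a
  point past a neighbouring line.\<close>

definition K :: "int \<Rightarrow> int" where "K N = 8 * N + 40"

text \<open>An integer coordinate realising the order \<open>lt a\<close>, which compares lines first and keys second.\<close>

definition Z :: "int \<Rightarrow> bool \<Rightarrow> int \<times> int \<Rightarrow> int" where
  "Z N a p = K N * line a p + sgv (line a p) * pkey a p"

lemma Z_lt:
  assumes N: "1 \<le> N" and p: "p \<in> opts N" "q \<in> opts N"
  shows "Z N a p < Z N a q \<longleftrightarrow> lt a p q"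
proof -
  have bd: "2 * \<bar>sgv v * pkey a p\<bar> < K N" if "p \<in> opts N" for p v
  proof -
    have "0 \<le> pkey a p" "pkey a p \<le> 2 * N + 5"
      using opts_fst[OF that N] opts_snd[OF that] by (auto simp: pkey_def tkey_def)
    then show ?thesis using N sgv_cases[of v] by (auto simp: K_def abs_mult)
  qed
  have K0: "0 \<le> K N" using N by (simp add: K_def)
  have far: "Z N a p < Z N a q" if "line a p < line a q" "p \<in> opts N" "q \<in> opts N" for p q
  proof -
    have "K N * (line a p + 1) \<le> K N * line a q" using that(1) K0 by (intro mult_left_mono) auto
    then show ?thesis using bd[OF that(2), of "line a p"] bd[OF that(3), of "line a q"]
      by (simp add: Z_def algebra_simps)
  qed
  consider "line a p < line a q" | "line a q < line a p" | "line a p = line a q" by linarith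
  then show ?thesis
  proof cases
    case 1 then show ?thesis using far[OF 1 p] by (simp add: lt_def)
  next
    case 2 then show ?thesis using far[OF 2 p(2,1)] by (simp add: lt_def)
  next
    case 3 then show ?thesis by (simp add: lt_def Z_def)
  qed
qed

lemma Z_inj:
  assumes "1 \<le> N"
  shows "inj_on (Z N a) (opts N)"
proof (rule inj_onI, rule ccontr)
  fix p q assume pq: "p \<in> opts N" "q \<in> opts N" "Z N a p = Z N a q" "p \<noteq> q"
  then have "lt a p q \<or> lt a q p" by (intro lt_total)
  then show False using Z_lt[OF assms pq(1,2), of a] Z_lt[OF assms pq(2,1), of a] pq by auto
qed

lemma sg_links: "sg (link True s) * sg (link False s) = \<sigma> (yy s)"
proof -
  have "sg s * sg (s + 1) = \<sigma> (yy s)" using sg_step[of s] sg1[of s] by auto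
  then show ?thesis by (cases "even s") (auto simp: link_def mult.commute)
qed

text \<open>In a cell the later point decides: with orientation \<open>1\<close> it comes after the
  earlier one, with \<open>- 1\<close> before it, whether or not they are on the same strand. Within
  a strand this is the order of keys; between strands it is the reason for placing the decreasing
  strand first.\<close>

lemma before:
  assumes p: "yy (fst p) = yy (fst q)" "snd p = 0 \<or> snd p = 1" "snd q = 0 \<or> snd q = 1"
    and bf: "fst p + 2 \<le> fst q \<or> fst p = fst q \<and> snd p < snd q"
  shows "lt a p q \<longleftrightarrow> sg (link a (fst q)) = 1" "lt a q p \<longleftrightarrow> sg (link a (fst q)) = - 1"
proof -
  have t: "tkey a (fst p) < tkey a (fst q) \<or> fst p = fst q \<and> snd p < snd q"
  proof -
    have "even (fst q) = even (fst p)" if "fst q = fst p + 2" using that by simp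
    then show ?thesis using bf by (cases "fst q = fst p + 2") (auto simp: tkey_def)
  qed
  have k: "pkey a p < pkey a q" using t p(2,3) by (auto simp: pkey_def)
  let ?u = "sg (link a (fst p))" and ?v = "sg (link a (fst q))"
  have lp: "line a p = 2 * int (coord (a = d0) (yy (fst q))) + (if ?u = 1 then 1 else 0)"
    and lq: "line a q = 2 * int (coord (a = d0) (yy (fst q))) + (if ?v = 1 then 1 else 0)"
    using line_eq[of a p] line_eq[of a q] p(1) by simp_all
  have "?u = 1 \<or> ?u = - 1" "?v = 1 \<or> ?v = - 1" using sg1 by blast+
  then show "lt a p q \<longleftrightarrow> ?v = 1" "lt a q p \<longleftrightarrow> ?v = - 1"
    using k unfolding lt_def lp lq by (auto simp: sgv_def)
qed

text \<open>By \<open>before\<close> the later point decides in both directions, and its two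
  orientations multiply to the sign of the cell. So a cell is monotone except for points at
  consecutive times.\<close>

lemma orient:
  assumes p: "yy (fst p) = z" "yy (fst q) = z" "snd p = 0 \<or> snd p = 1" "snd q = 0 \<or> snd q = 1"
    and na: "\<bar>fst p - fst q\<bar> \<noteq> 1"
  shows "lt d p q \<longleftrightarrow> (if \<sigma> z = 1 then lt (\<not> d) p q else lt (\<not> d) q p)"
proof -
  have main: "(lt d p q \<longleftrightarrow> (if \<sigma> z = 1 then lt (\<not> d) p q else lt (\<not> d) q p)) \<and>
      (lt d q p \<longleftrightarrow> (if \<sigma> z = 1 then lt (\<not> d) q p else lt (\<not> d) p q))"
    if p: "yy (fst p) = z" "yy (fst q) = z" "snd p = 0 \<or> snd p = 1" "snd q = 0 \<or> snd q = 1"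
      and bf: "fst p + 2 \<le> fst q \<or> fst p = fst q \<and> snd p < snd q" for p q
  proof -
    have e: "yy (fst p) = yy (fst q)" using p by simp
    have "sg (link d (fst q)) * sg (link (\<not> d) (fst q)) = \<sigma> z"
      using sg_links[of "fst q"] p(2) by (cases d) (simp_all add: mult.commute)
    then show ?thesis
      using before[OF e p(3,4) bf] sg1[of "link d (fst q)"] sg1[of "link (\<not> d) (fst q)"] by auto
  qed
  consider "p = q" | "fst p + 2 \<le> fst q \<or> fst p = fst q \<and> snd p < snd q"
    | "fst q + 2 \<le> fst p \<or> fst q = fst p \<and> snd q < snd p"
  proof -
    have "fst p + 2 \<le> fst q \<or> fst q + 2 \<le> fst p \<or> fst p = fst q" using na by linarith
    moreover have "snd p < snd q \<or> snd q < snd p \<or> snd p = snd q" by linarith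
    ultimately show ?thesis using that prod_eqI[of p q] by metis
  qed
  then show ?thesis
  proof cases
    case 1 then show ?thesis using lt_irrefl by simp
  next
    case 2 then show ?thesis using main[OF p 2] by blast
  next
    case 3 then show ?thesis using main[OF p(2,1,4,3) 3] by blast
  qed
qed

text \<open>The walk does not pause at its ends, and as \<open>N\<close> is a multiple of the
  period, the last two times have the phases \<open>P0 - 2\<close> and
  \<open>P0 - 1\<close>.\<close>

lemma twin_alone:
  assumes N: "N = int (2 * P0) * j" "1 \<le> j" and q: "q \<in> opts N" "q' \<in> opts N" "fst q = fst q'" "q \<noteq> q'"
    and p: "0 \<le> fst p" "fst p < N" "\<bar>fst p - fst q\<bar> = 1"
  shows "yy (fst p) \<noteq> yy (fst q)"
proof -
  have "fst q = 0 \<or> fst q = N - 1" using q by (auto simp: opts_def)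
  then show ?thesis
  proof
    assume 0: "fst q = 0"
    then have "fst p = 1" using p by auto
    then show ?thesis using 0 ends(1) yy_nat[of 0] yy_nat[of 1] by simp
  next
    assume 1: "fst q = N - 1"
    then have f: "fst p = N - 2" using p by auto
    have "N - 1 = int (P0 - 1) + int P0 * (2 * j - 1)" "N - 2 = int (P0 - 2) + int P0 * (2 * j - 1)"
      using P0 N by (simp_all add: algebra_simps of_nat_diff)
    then have "yy (N - 1) = y (P0 - 1)" "yy (N - 2) = y (P0 - 2)" using yy_P0 yy_nat by metis+
    then show ?thesis using ends(2) f 1 by simp
  qed
qed

text \<open>Only consecutive times can violate the sign of the cell. If there are none, the cell is
  monotone. Otherwise \<open>no3\<close> and \<open>twin_alone\<close> allow each point at most one
  such partner, so the violations form a matching, which sums of 21 or skew sums of 12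
  absorb.\<close>

lemma cell_in_class:
  assumes N: "N = int (2 * P0) * j" "1 \<le> j" and p0: "p0 \<in> opts N"
  defines "z \<equiv> yy (fst p0)"
  shows "in_class (M (fst z) (snd z)) {q\<in>opts N. yy (fst q) = z} (Z N d) (Z N (\<not> d))"
proof -
  define S where "S = {q\<in>opts N. yy (fst q) = z}"
  have "int (2 * P0) * 1 \<le> N" unfolding N(1) using N(2) by (intro mult_left_mono) auto
  then have N1: "1 \<le> N" using P0 by simp
  have SN: "q \<in> opts N" "yy (fst q) = z" "snd q = 0 \<or> snd q = 1" "0 \<le> fst q" "fst q < N" if "q \<in> S" for q
  proof -
    show q: "q \<in> opts N" and "yy (fst q) = z" using that by (simp_all add: S_def)
    show "snd q = 0 \<or> snd q = 1" by (rule opts_snd[OF q])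
    show "0 \<le> fst q" "fst q < N" using opts_fst[OF q N1] by simp_all
  qed
  have fS: "finite S" by (simp add: S_def finite_opts)
  have inj: "inj_on (Z N a) S" for a by (rule inj_on_subset[OF Z_inj[OF N1]]) (auto simp: S_def)
  have zlt: "Z N a p < Z N a q \<longleftrightarrow> lt a p q" if "p \<in> S" "q \<in> S" for a p q
    by (rule Z_lt[OF N1 SN(1)[OF that(1)] SN(1)[OF that(2)]])
  obtain t0 where t0: "z = y t0" using step unfolding z_def by blast
  have C: "perm_class (M (fst z) (snd z))"
    using gm cell[of t0] t0 by (auto simp: gridding_matrix_def cell_vertices_def)
  have or: "Z N d p < Z N d q \<longleftrightarrow> (if \<sigma> z = 1 then Z N (\<not> d) p < Z N (\<not> d) q else Z N (\<not> d) q < Z N (\<not> d) p)"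
    if "p \<in> S" "q \<in> S" "\<bar>fst p - fst q\<bar> \<noteq> 1" for p q
    using orient[OF SN(2)[OF that(1)] SN(2)[OF that(2)] SN(3)[OF that(1)] SN(3)[OF that(2)] that(3), of d]
      zlt[OF that(1,2)] zlt[OF that(2,1)] by simp
  have "in_class (M (fst z) (snd z)) S (Z N d) (Z N (\<not> d))"
  proof (cases "\<exists>p\<in>S. \<exists>q\<in>S. fst q = fst p + 1")
    case False
    then have na: "\<bar>fst p - fst q\<bar> \<noteq> 1" if "p \<in> S" "q \<in> S" for p q
    proof -
      have "fst q \<noteq> fst p + 1" "fst p \<noteq> fst q + 1" using False that by blast+
      then show ?thesis by linarith
    qed
    show ?thesis
    proof (cases "\<sigma> z = 1")
      case True
      show ?thesis
      proof (rule monotone_in_class(1)[OF C fS inj inj])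
        show "[0..<k] \<in> M (fst z) (snd z)" for k using mono1[of t0 k] True t0 by simp
        show "Z N d p < Z N d q \<longleftrightarrow> Z N (\<not> d) p < Z N (\<not> d) q" if "p \<in> S" "q \<in> S" for p q
          using or[OF that na[OF that]] True by simp
      qed
    next
      case False
      show ?thesis
      proof (rule monotone_in_class(2)[OF C fS inj inj])
        show "rev [0..<k] \<in> M (fst z) (snd z)" for k using mono2[of t0 k] \<sigma>1[of z] False t0 by simp
        show "Z N d p < Z N d q \<longleftrightarrow> Z N (\<not> d) q < Z N (\<not> d) p" if "p \<in> S" "q \<in> S" for p q
          using or[OF that na[OF that]] False by simp
      qed
    qed
  next
    case True
    then obtain p1 q1 where "p1 \<in> S" "q1 \<in> S" "fst q1 = fst p1 + 1" by blast
    then have "yy (fst p1) = z" "yy (fst p1 + 1) = z" using SN(2)[of p1] SN(2)[of q1] by auto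
    then obtain t where t: "y t = z" "y (Suc t) = z" using step[of "fst p1"] by metis
    have uniq: "q = q'" if pq: "p \<in> S" "q \<in> S" "q' \<in> S" "\<bar>fst p - fst q\<bar> = 1" "\<bar>fst p - fst q'\<bar> = 1" for p q q'
    proof (rule ccontr)
      assume ne: "q \<noteq> q'"
      show False
      proof (cases "fst q = fst q'")
        case True
        then show False using twin_alone[OF N SN(1)[OF pq(2)] SN(1)[OF pq(3)] True ne SN(4)[OF pq(1)] SN(5)[OF pq(1)] pq(4)]
          SN(2)[OF pq(1)] SN(2)[OF pq(2)] by simp
      next
        case False
        then have "fst q = fst p - 1 \<and> fst q' = fst p + 1 \<or> fst q' = fst p - 1 \<and> fst q = fst p + 1"
          using pq(4,5) by linarith
        then have "yy (fst p - 1) = z" "yy (fst p) = z" "yy (fst p + 1) = z"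
          using SN(2)[OF pq(1)] SN(2)[OF pq(2)] SN(2)[OF pq(3)] by auto
        moreover obtain t' where "yy (fst p - 1) = y t'" "yy (fst p - 1 + 1) = y (Suc t')"
          "yy (fst p - 1 + 2) = y (Suc (Suc t'))" using step[of "fst p - 1"] by blast
        ultimately show False using no3[of t'] by (simp add: add.commute)
      qed
    qed
    show ?thesis
    proof (cases "\<sigma> z = 1")
      case s1: True
      show ?thesis
      proof (rule matching_in_class(1)[OF C fS inj inj])
        show "sum21 a \<in> M (fst z) (snd z)" for a using osc1[of t a] t s1 by simp
        fix p q q' assume pq: "p \<in> S" "q \<in> S" "q' \<in> S"
          and i: "Z N d p < Z N d q \<and> Z N (\<not> d) q < Z N (\<not> d) p \<or> Z N d q < Z N d p \<and> Z N (\<not> d) p < Z N (\<not> d) q"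
            "Z N d p < Z N d q' \<and> Z N (\<not> d) q' < Z N (\<not> d) p \<or> Z N d q' < Z N d p \<and> Z N (\<not> d) p < Z N (\<not> d) q'"
        have "\<bar>fst p - fst q\<bar> = 1" "\<bar>fst p - fst q'\<bar> = 1"
          using or[OF pq(1,2)] or[OF pq(2,1)] or[OF pq(1,3)] or[OF pq(3,1)] i s1 by (smt (verit))+
        then show "q = q'" using uniq pq by blast
      qed
    next
      case s1: False
      show ?thesis
      proof (rule matching_in_class(2)[OF C fS inj inj])
        show "skew12 a \<in> M (fst z) (snd z)" for a using osc2[of t a] t s1 \<sigma>1[of z] by simp
        fix p q q' assume pq: "p \<in> S" "q \<in> S" "q' \<in> S"
          and i: "Z N d p < Z N d q \<and> Z N (\<not> d) p < Z N (\<not> d) q \<or> Z N d q < Z N d p \<and> Z N (\<not> d) q < Z N (\<not> d) p"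
            "Z N d p < Z N d q' \<and> Z N (\<not> d) p < Z N (\<not> d) q' \<or> Z N d q' < Z N d p \<and> Z N (\<not> d) q' < Z N (\<not> d) p"
        have "\<bar>fst p - fst q\<bar> = 1" "\<bar>fst p - fst q'\<bar> = 1"
          using or[OF pq(1,2)] or[OF pq(2,1)] or[OF pq(1,3)] or[OF pq(3,1)] i s1 by (smt (verit))+
        then show "q = q'" using uniq pq by blast
      qed
    qed
  qed
  then show ?thesis by (simp add: S_def)
qed

lemma pattern_in_Grid:
  assumes N: "N = int (2 * P0) * j" "1 \<le> j" and \<pi>: "\<pi> \<in> perms"
    and pat: "is_pattern (opts N) (Z N d0) (Z N (\<not> d0)) \<pi>"
  shows "\<pi> \<in> Grid m n M"
proof -
  have "int (2 * P0) * 1 \<le> N" unfolding N(1) using N(2) by (intro mult_left_mono) auto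
  then have N1: "1 \<le> N" using P0 by simp
  have le: "coord (a = d0) (yy (fst p)) \<le> coord (a = d0) (yy (fst q))"
    if "p \<in> opts N" "q \<in> opts N" "Z N a p < Z N a q" for a p q
  proof -
    have "line a p \<le> line a q" using that Z_lt[OF N1 that(1,2)] lt_line by blast
    then show ?thesis unfolding line_eq by (auto split: if_splits)
  qed
  show ?thesis
  proof (rule grid_of_points[OF gm finite_opts Z_inj[OF N1] Z_inj[OF N1] pat \<pi>, where cl = "\<lambda>p. yy (fst p)"])
    fix p assume p: "p \<in> opts N"
    obtain t where "yy (fst p) = y t" using step by blast
    then show "fst (yy (fst p)) \<in> {1..m} \<and> snd (yy (fst p)) \<in> {1..n}"
      using cell[of t] by (auto simp: cell_vertices_def)
    show "in_class (M (fst (yy (fst p))) (snd (yy (fst p)))) {q\<in>opts N. yy (fst q) = yy (fst p)} (Z N d0) (Z N (\<not> d0))"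
      by (rule cell_in_class[OF N p])
    fix q assume q: "q \<in> opts N"
    show "fst (yy (fst p)) \<le> fst (yy (fst q))" if "Z N d0 p < Z N d0 q"
      using le[OF p q that] by (simp add: coord_def)
    show "snd (yy (fst p)) \<le> snd (yy (fst q))" if "Z N (\<not> d0) p < Z N (\<not> d0) q"
      using le[OF p q that] by (simp add: coord_def)
  qed
qed

theorem not_pwo: "\<not> partially_well_ordered (Grid m n M)"
proof -
  define P where "P = int (2 * P0)"
  have P4: "4 \<le> P" using P0 by (simp add: P_def)
  obtain B :: nat where B: "\<And>t. \<bar>cid t\<bar> \<le> int B" using cid_bound by blast
  \<comment> \<open>\<open>P * b\<close> is the threshold in \<open>rigid\<close>; the lengths are
    the multiples of \<open>P\<close> from there on.\<close>
  define b where "b = (6 * P + 20) * (4 * int B * P + 1) + 3"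
  define NN where "NN j = P * (b + int j)" for j :: nat
  have b3: "3 \<le> b" using P4 by (simp add: b_def)
  have big: "P * b \<le> NN j" "1 \<le> b + int j" for j using P4 b3 by (simp_all add: NN_def)
  have N2: "2 \<le> NN j" for j
  proof -
    have "P * 1 \<le> NN j" unfolding NN_def using P4 b3 by (intro mult_left_mono) auto
    then show ?thesis using P4 by simp
  qed
  have "\<exists>\<pi>. \<pi> \<in> perms \<and> is_pattern (opts (NN j)) (Z (NN j) d0) (Z (NN j) (\<not> d0)) \<pi>" for j
  proof -
    have N1: "1 \<le> NN j" using N2[of j] by simp
    show ?thesis using pattern_exists[OF finite_opts Z_inj[OF N1] Z_inj[OF N1]] by metis
  qed
  then have "\<exists>\<pi>. \<forall>j. \<pi> j \<in> perms \<and> is_pattern (opts (NN j)) (Z (NN j) d0) (Z (NN j) (\<not> d0)) (\<pi> j)"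
    by (intro choice) blast
  then obtain \<pi> where \<pi>': "\<forall>j. \<pi> j \<in> perms \<and> is_pattern (opts (NN j)) (Z (NN j) d0) (Z (NN j) (\<not> d0)) (\<pi> j)" ..
  have \<pi>: "\<pi> j \<in> perms" "is_pattern (opts (NN j)) (Z (NN j) d0) (Z (NN j) (\<not> d0)) (\<pi> j)" for j
    using \<pi>' by blast+
  have inG: "\<pi> j \<in> Grid m n M" for j
    by (rule pattern_in_Grid[OF _ big(2) \<pi>(1) \<pi>(2)]) (simp only: NN_def P_def)
  have anti: "i = j" if c: "contained (\<pi> i) (\<pi> j)" for i j
  proof -
    have "\<exists>f. lemb (\<pi> i) (\<pi> j) f" using c contained_lemb[OF \<pi>(1)] by blast
    then have "\<exists>f. emb (opts (NN i)) (Z (NN i) d0) (Z (NN i) (\<not> d0)) (opts (NN j)) (Z (NN j) d0) (Z (NN j) (\<not> d0)) f"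
      using pattern_lemb[OF \<pi>(2) \<pi>(2)] by blast
    then obtain f where f: "emb (opts (NN i)) (Z (NN i) d0) (Z (NN i) (\<not> d0)) (opts (NN j)) (Z (NN j) d0) (Z (NN j) (\<not> d0)) f" ..
    have N1: "1 \<le> NN i" "1 \<le> NN j" using N2[of i] N2[of j] by auto
    have fm: "f p \<in> opts (NN j)" if "p \<in> opts (NN i)" for p using f that by (simp add: emb_def)
    have "Z (NN j) a (f p) < Z (NN j) a (f q) \<longleftrightarrow> Z (NN i) a p < Z (NN i) a q"
      if "p \<in> opts (NN i)" "q \<in> opts (NN i)" for a p q
      using f that unfolding emb_def by (cases "a = d0") auto
    then have fl: "lt a (f p) (f q) \<longleftrightarrow> lt a p q" if "p \<in> opts (NN i)" "q \<in> opts (NN i)" for a p q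
      using Z_lt[OF N1(1) that] Z_lt[OF N1(2) fm[OF that(1)] fm[OF that(2)]] that by blast
    interpret E: osc_emb "int (2 * P0)" cid "NN i" "NN j" f
      by unfold_locales (use N2 fm fl in auto)
    have "NN i = NN j" by (rule E.rigid[OF B]) (use big(1)[of i] in \<open>simp add: b_def P_def\<close>)
    then show ?thesis using P4 by (simp add: NN_def)
  qed
  have inj: "inj \<pi>"
  proof (rule injI)
    fix i j assume "\<pi> i = \<pi> j"
    then show "i = j" using anti contained_lemb[OF \<pi>(1)] lemb_refl by metis
  qed
  have "infinite (range \<pi>)" using inj finite_imageD by blast
  then show ?thesis
    unfolding partially_well_ordered_def using inG anti by (intro notI) (metis (no_types, lifting) image_subset_iff rangeE)
qed

end

section \<open>Closed walks in the graph of a gridding matrix\<close>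

text \<open>All cells of a line are joined here, not only consecutive ones. The components stay the
  same, while a walk may now jump over cells, which the zigzags permit.\<close>

definition share :: "(nat \<times> nat) set \<Rightarrow> ((nat \<times> nat) \<times> (nat \<times> nat)) set" where
  "share V = {(x, z). x \<in> V \<and> z \<in> V \<and> (\<exists>d. coord d x = coord d z)}"

lemma sym_share: "sym ((share V)\<^sup>*)"
  by (rule sym_rtrancl) (auto simp: sym_def share_def eq_commute)

lemma line_connected:
  assumes "finite V"
  shows "x \<in> V \<Longrightarrow> z \<in> V \<Longrightarrow> coord d x = coord d z \<Longrightarrow> coord (\<not> d) x \<le> coord (\<not> d) z \<Longrightarrow>
    (x, z) \<in> {(b, c). {b, c} \<in> edges V}\<^sup>*"
proof (induction "coord (\<not> d) z - coord (\<not> d) x" arbitrary: x rule: less_induct)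
  case less
  show ?case
  proof (cases "x = z")
    case False
    then have lt: "coord (\<not> d) x < coord (\<not> d) z" using less.prems coord_eqI[of d x z] by linarith
    then obtain u where u: "adj V d x u" using next_on_line[OF assms less.prems(1,2)] less.prems(3) by metis
    then have u': "u \<in> V" "coord d u = coord d z" "coord (\<not> d) x < coord (\<not> d) u"
      "coord (\<not> d) u \<le> coord (\<not> d) z"
      using less.prems(2,3) lt unfolding adj_def by (simp_all add: leD) (metis leD)
    have "(u, z) \<in> {(b, c). {b, c} \<in> edges V}\<^sup>*"
      by (rule less.hyps[OF _ u'(1) less.prems(2) u'(2,4)]) (use u' lt in simp)
    moreover have "(x, u) \<in> {(b, c). {b, c} \<in> edges V}" using u unfolding edges_def by blast
    ultimately show ?thesis by (rule converse_rtrancl_into_rtrancl[rotated])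
  qed simp
qed

lemma rtrancl_edges:
  assumes "finite V"
  shows "{(b, c). {b, c} \<in> edges V}\<^sup>* = (share V)\<^sup>*"
proof (rule rtrancl_subset[symmetric])
  let ?E = "{(b, c). {b, c} \<in> edges V}"
  have "(x, z) \<in> share V \<and> (z, x) \<in> share V" if "adj V d x z" for x z d
  proof -
    have "x \<in> V" "z \<in> V" "coord d x = coord d z" using that by (simp_all add: adj_def)
    then show ?thesis unfolding share_def by (metis (mono_tags, lifting) case_prodI mem_Collect_eq)
  qed
  then show "?E \<subseteq> share V" unfolding edges_def by (force simp: doubleton_eq_iff)
  have sym: "sym (?E\<^sup>*)" by (rule sym_rtrancl) (auto simp: sym_def insert_commute)
  show "share V \<subseteq> ?E\<^sup>*"
  proof (rule subrelI)
    fix x z assume "(x, z) \<in> share V"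
    then obtain d where d: "x \<in> V" "z \<in> V" "coord d x = coord d z" by (auto simp: share_def)
    show "(x, z) \<in> ?E\<^sup>*"
    proof (cases "coord (\<not> d) x \<le> coord (\<not> d) z")
      case True then show ?thesis using line_connected[OF assms d] by blast
    next
      case False
      then have "(z, x) \<in> ?E\<^sup>*" using line_connected[OF assms d(2,1) d(3)[symmetric]] by simp
      then show ?thesis using symD[OF sym] by blast
    qed
  qed
qed

lemma components_unique_iff:
  assumes "finite V"
  shows "(\<forall>K\<in>components V (edges V). \<exists>\<^sub>\<le>\<^sub>1(i, j). (i, j) \<in> K \<and> Q i j) \<longleftrightarrow>
    (\<forall>a\<in>V. \<forall>b\<in>V. (a, b) \<in> (share V)\<^sup>* \<longrightarrow> Q (fst a) (snd a) \<longrightarrow> Q (fst b) (snd b) \<longrightarrow> a = b)" (is "?l \<longleftrightarrow> ?r")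
proof
  assume l: ?l
  show ?r
  proof (intro ballI impI)
    fix a b assume ab: "a \<in> V" "b \<in> V" "(a, b) \<in> (share V)\<^sup>*" "Q (fst a) (snd a)" "Q (fst b) (snd b)"
    then have "(share V)\<^sup>* `` {a} \<in> components V (edges V)" by (auto simp: components_def rtrancl_edges[OF assms])
    then have "\<exists>\<^sub>\<le>\<^sub>1(i, j). (i, j) \<in> (share V)\<^sup>* `` {a} \<and> Q i j" using l by blast
    moreover have "case a of (i, j) \<Rightarrow> (i, j) \<in> (share V)\<^sup>* `` {a} \<and> Q i j"
      "case b of (i, j) \<Rightarrow> (i, j) \<in> (share V)\<^sup>* `` {a} \<and> Q i j"
      using ab by (simp_all add: case_prod_beta)
    ultimately show "a = b" unfolding Uniq_def by blast
  qed
next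
  assume r: ?r
  have V: "z \<in> V" if "(v, z) \<in> (share V)\<^sup>*" "v \<in> V" for v z
    using that by (induction rule: rtrancl_induct) (auto simp: share_def)
  show ?l
  proof
    fix K assume "K \<in> components V (edges V)"
    then obtain v where v: "v \<in> V" "K = (share V)\<^sup>* `` {v}" by (auto simp: components_def rtrancl_edges[OF assms])
    have "a = b" if "a \<in> K" "b \<in> K" "Q (fst a) (snd a)" "Q (fst b) (snd b)" for a b
    proof -
      have "(v, a) \<in> (share V)\<^sup>*" "(v, b) \<in> (share V)\<^sup>*" using that v by auto
      then show ?thesis using r V[OF _ v(1)] that symD[OF sym_share, of v a V] rtrancl_trans[of a v "share V" b] by blast
    qed
    then show "\<exists>\<^sub>\<le>\<^sub>1(i, j). (i, j) \<in> K \<and> Q i j" unfolding Uniq_def by (simp add: case_prod_beta)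
  qed
qed

text \<open>In a shortest path two consecutive steps in one direction could be replaced by a single
  step, so the directions alternate.\<close>

lemma alternating_path:
  assumes "(a, b) \<in> (share V)\<^sup>*" "a \<noteq> b" "a \<in> V"
  shows "\<exists>f q d. 1 \<le> q \<and> f 0 = a \<and> f q = b \<and> (\<forall>i\<le>q. f i \<in> V) \<and>
    (\<forall>i<q. f i \<noteq> f (Suc i) \<and> coord (even i = d) (f i) = coord (even i = d) (f (Suc i)))"
proof -
  define P where "P n f \<longleftrightarrow> f 0 = a \<and> f n = b \<and> (\<forall>i<n. (f i, f (Suc i)) \<in> share V)" for n :: nat and f
  have "\<exists>n f. P n f" using rtrancl_imp_relpow[OF assms(1)] unfolding P_def relpow_fun_conv by blast
  then obtain q where q: "\<exists>f. P q f" "\<And>m. m < q \<Longrightarrow> \<not> (\<exists>f. P m f)" using exists_least_iff[of "\<lambda>n. \<exists>f. P n f"] by blast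
  obtain f where f: "P q f" using q(1) by blast
  have q1: "1 \<le> q" using f assms(2) by (cases q) (auto simp: P_def)
  have st: "(f i, f (Suc i)) \<in> share V" if "i < q" for i using f that by (simp add: P_def)
  have no: "(f i, f (Suc (Suc i))) \<notin> share V" if "Suc i < q" for i
  proof
    assume s: "(f i, f (Suc (Suc i))) \<in> share V"
    define g where "g j = (if j \<le> i then f j else f (Suc j))" for j
    have "P (q - 1) g"
      unfolding P_def
    proof (intro conjI allI impI)
      show "g 0 = a" using f by (simp add: g_def P_def)
      show "g (q - 1) = b" using f that by (auto simp: g_def P_def)
      fix j assume j: "j < q - 1"
      consider "j < i" | "j = i" | "i < j" by linarith
      then show "(g j, g (Suc j)) \<in> share V"
      proof cases
        case 1 then show ?thesis using st[of j] j by (simp add: g_def)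
      next
        case 2 then show ?thesis using s by (simp add: g_def)
      next
        case 3 then show ?thesis using st[of "Suc j"] j by (simp add: g_def)
      qed
    qed
    then show False using q(2)[of "q - 1"] q1 by auto
  qed
  have V: "f i \<in> V" if "i \<le> q" for i
  proof (cases i)
    case 0 then show ?thesis using f assms(3) by (simp add: P_def)
  next
    case (Suc j) then show ?thesis using st[of j] that by (simp add: share_def)
  qed
  have ne: "f i \<noteq> f (Suc i)" if iq: "i < q" for i
  proof
    assume e: "f i = f (Suc i)"
    consider "Suc i < q" | "Suc i = q" "i = 0" | j where "Suc i = q" "i = Suc j"
      using iq Suc_lessI[OF iq] by (cases i) blast+
    then show False
    proof cases
      case 1 then show False using no[OF 1] st[of "Suc i"] e by simp
    next
      case 2
      have "f 0 = a" "f q = b" using f by (simp_all add: P_def)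
      then show False using 2 e assms(2) by metis
    next
      case 3 then show False using no[of j] st[of j] e by simp
    qed
  qed
  have "\<exists>\<delta>. \<forall>i<q. coord (\<delta> i) (f i) = coord (\<delta> i) (f (Suc i))"
    using st by (intro choice) (auto simp: share_def)
  then obtain \<delta> where \<delta>: "\<And>i. i < q \<Longrightarrow> coord (\<delta> i) (f i) = coord (\<delta> i) (f (Suc i))" by blast
  have \<delta>S: "\<delta> (Suc i) \<noteq> \<delta> i" if "Suc i < q" for i
  proof
    assume "\<delta> (Suc i) = \<delta> i"
    then have "coord (\<delta> i) (f i) = coord (\<delta> i) (f (Suc (Suc i)))" using \<delta>[of i] \<delta>[of "Suc i"] that by simp
    then show False using no[OF that] V[of i] V[of "Suc (Suc i)"] that by (auto simp: share_def)
  qed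
  have \<delta>0: "\<delta> i = (even i = \<delta> 0)" if "i < q" for i
    using that
  proof (induction i)
    case (Suc i) then show ?case using \<delta>S[of i] by auto
  qed simp
  have "coord (even i = \<delta> 0) (f i) = coord (even i = \<delta> 0) (f (Suc i))" if "i < q" for i
    by (rule subst[where P = "\<lambda>e. coord e (f i) = coord e (f (Suc i))", OF \<delta>0[OF that] \<delta>[OF that]])
  then show ?thesis using q1 f V ne unfolding P_def by blast
qed

text \<open>One sign must serve a walk both for passing through the cell and for pausing in it. This
  is consistent because sums of 21 contain the increasing permutations and skew sums of 12 the
  decreasing ones.\<close>

lemma ex_cell_sign:
  assumes C: "perm_class C" "infinite C"
  shows "\<exists>s::int. (s = 1 \<or> s = - 1) \<and> (\<forall>k. (s = 1 \<longrightarrow> [0..<k] \<in> C) \<and> (s = - 1 \<longrightarrow> rev [0..<k] \<in> C)) \<and>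
    (\<not> monotone_griddable C \<longrightarrow> (\<forall>k. (s = 1 \<longrightarrow> sum21 k \<in> C) \<and> (s = - 1 \<longrightarrow> skew12 k \<in> C)))"
proof (cases "monotone_griddable C")
  case True
  then show ?thesis using infinite_class_monotone[OF C]
    by (elim disjE) (auto intro: exI[of _ 1] exI[of _ "- 1"])
next
  case False
  have 1: "[0..<k] \<in> C" if "sum21 k \<in> C" for k
    by (rule class_sub[OF C(1) that id_perms(1), of _ "\<lambda>i. 2 * i"]) (auto simp: emb_def nth_sum21)
  have 2: "rev [0..<k] \<in> C" if "skew12 k \<in> C" for k
    by (rule class_sub[OF C(1) that id_perms(2), of _ "\<lambda>i. 2 * i"]) (auto simp: emb_def skew12_def rev_nth)
  from not_monotone_griddable[OF C(1) False] show ?thesis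
  proof
    assume "\<forall>a. sum21 a \<in> C" then show ?thesis using 1 by (intro exI[of _ 1]) auto
  next
    assume "\<forall>a. skew12 a \<in> C" then show ?thesis using 2 by (intro exI[of _ "- 1"]) auto
  qed
qed

lemma ex_signs:
  assumes gm: "gridding_matrix m n M"
  shows "\<exists>\<sigma> :: nat \<times> nat \<Rightarrow> int. \<forall>x. (\<sigma> x = 1 \<or> \<sigma> x = - 1) \<and> (x \<in> cell_vertices m n M \<longrightarrow>
    (\<forall>k. (\<sigma> x = 1 \<longrightarrow> [0..<k] \<in> M (fst x) (snd x)) \<and> (\<sigma> x = - 1 \<longrightarrow> rev [0..<k] \<in> M (fst x) (snd x))) \<and>
    (\<not> monotone_griddable (M (fst x) (snd x)) \<longrightarrow>
      (\<forall>k. (\<sigma> x = 1 \<longrightarrow> sum21 k \<in> M (fst x) (snd x)) \<and> (\<sigma> x = - 1 \<longrightarrow> skew12 k \<in> M (fst x) (snd x)))))"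
proof (rule choice, rule allI)
  fix x
  show "\<exists>s::int. (s = 1 \<or> s = - 1) \<and> (x \<in> cell_vertices m n M \<longrightarrow>
    (\<forall>k. (s = 1 \<longrightarrow> [0..<k] \<in> M (fst x) (snd x)) \<and> (s = - 1 \<longrightarrow> rev [0..<k] \<in> M (fst x) (snd x))) \<and>
    (\<not> monotone_griddable (M (fst x) (snd x)) \<longrightarrow>
      (\<forall>k. (s = 1 \<longrightarrow> sum21 k \<in> M (fst x) (snd x)) \<and> (s = - 1 \<longrightarrow> skew12 k \<in> M (fst x) (snd x)))))"
  proof (cases "x \<in> cell_vertices m n M")
    case True
    then have "fst x \<in> {1..m}" "snd x \<in> {1..n}" "M (fst x) (snd x) \<noteq> {}"
      by (simp_all add: cell_vertices_def case_prod_beta)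
    then have "perm_class (M (fst x) (snd x))" "infinite (M (fst x) (snd x))"
      using gm unfolding gridding_matrix_def by blast+
    from ex_cell_sign[OF this] show ?thesis by blast
  qed (intro exI[of _ 1], simp)
qed

text \<open>In a set without lone cells a walk can always turn into the other direction, and
  finiteness makes it return.\<close>

theorem not_acyc_not_pwo:
  assumes gm: "gridding_matrix m n M" and na: "\<not> acyc (cell_vertices m n M)"
  shows "\<not> partially_well_ordered (Grid m n M)"
proof -
  obtain Y where Y: "Y \<subseteq> cell_vertices m n M" "Y \<noteq> {}" "\<forall>y\<in>Y. \<forall>d. \<not> lone Y d y" using na unfolding acyc_def by blast
  have fY: "finite Y" by (rule finite_subset[OF Y(1) finite_cell_vertices])
  obtain \<sigma> :: "nat \<times> nat \<Rightarrow> int" where \<sigma>: "\<forall>x. (\<sigma> x = 1 \<or> \<sigma> x = - 1) \<and> (x \<in> cell_vertices m n M \<longrightarrow>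
    (\<forall>k. (\<sigma> x = 1 \<longrightarrow> [0..<k] \<in> M (fst x) (snd x)) \<and> (\<sigma> x = - 1 \<longrightarrow> rev [0..<k] \<in> M (fst x) (snd x))) \<and>
    (\<not> monotone_griddable (M (fst x) (snd x)) \<longrightarrow>
      (\<forall>k. (\<sigma> x = 1 \<longrightarrow> sum21 k \<in> M (fst x) (snd x)) \<and> (\<sigma> x = - 1 \<longrightarrow> skew12 k \<in> M (fst x) (snd x)))))"
    by (rule ex_signs[OF gm, THEN exE])
  define nx where "nx d y = (SOME z. z \<in> Y \<and> coord d z = coord d y \<and> z \<noteq> y)" for d y
  have nx: "nx d y \<in> Y \<and> coord d (nx d y) = coord d y \<and> nx d y \<noteq> y" if "y \<in> Y" for d y
  proof -
    have "\<exists>z. z \<in> Y \<and> coord d z = coord d y \<and> z \<noteq> y" using Y(3) that unfolding lone_def by blast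
    from someI_ex[OF this] show ?thesis unfolding nx_def .
  qed
  obtain y0 where y0: "y0 \<in> Y" using Y(2) by blast
  define w where "w = rec_nat y0 (\<lambda>t y. nx (even (Suc t)) y)"
  have w0: "w 0 = y0" and wS: "w (Suc t) = nx (even (Suc t)) (w t)" for t by (simp_all add: w_def)
  have wY: "w t \<in> Y" for t by (induction t) (simp_all add: w0 wS y0 nx)
  have wl: "coord (even (Suc t)) (w (Suc t)) = coord (even (Suc t)) (w t)" "w (Suc t) \<noteq> w t" for t
    unfolding wS using nx[OF wY] by blast+
  \<comment> \<open>Only even times are compared, so that the repeated cell is left in the same
    direction and the period is even.\<close>
  have "\<not> inj (\<lambda>i. w (2 * i))"
  proof
    assume "inj (\<lambda>i. w (2 * i))"
    then have "infinite (range (\<lambda>i. w (2 * i)))" using finite_imageD by blast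
    moreover have "range (\<lambda>i. w (2 * i)) \<subseteq> Y" using wY by blast
    ultimately show False using fY finite_subset by blast
  qed
  then obtain i j where ij: "i < j" "w (2 * i) = w (2 * j)" unfolding inj_def by (metis linorder_neqE_nat)
  define P0 where "P0 = 2 * (j - i)"
  have P0: "even P0" "2 \<le> P0" "2 * j = 2 * i + P0" using ij by (simp_all add: P0_def)
  define y where "y t = w (2 * i + t mod P0)" for t
  have yS: "y (Suc t) = w (Suc (2 * i + t mod P0))" for t
  proof (cases "Suc (t mod P0) = P0")
    case True
    then have "Suc t mod P0 = 0" by (simp add: mod_Suc)
    then have "y (Suc t) = w (2 * i + P0)" using ij P0(3) by (simp add: y_def)
    then show ?thesis using True by (metis add_Suc_right)
  next
    case False
    then show ?thesis by (simp add: y_def mod_Suc)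
  qed
  have ev: "even (Suc (2 * i + t mod P0)) = even (Suc t)" for t using P0(1) by (simp add: dvd_mod_iff)
  have ne: "y t \<noteq> y (Suc t)" for t unfolding yS using wl(2) by (simp add: y_def) metis
  have yV: "y t \<in> cell_vertices m n M" for t unfolding y_def using wY Y(1) by blast
  have "walk m n M True y P0 \<sigma>"
  proof
    show "gridding_matrix m n M" "even P0" "2 \<le> P0" by fact+
    show "y (t + P0) = y t" for t by (simp add: y_def)
    show "y t \<in> cell_vertices m n M" for t by (rule yV)
    show "coord (even (Suc t) = True) (y t) = coord (even (Suc t) = True) (y (Suc t))" for t
      using wl(1)[of "2 * i + t mod P0"] unfolding ev yS unfolding y_def by simp
    show "\<sigma> x = 1 \<or> \<sigma> x = - 1" for x using \<sigma> by blast
    show "[0..<k] \<in> M (fst (y t)) (snd (y t))" if "\<sigma> (y t) = 1" for t k using \<sigma> that yV by blast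
    show "rev [0..<k] \<in> M (fst (y t)) (snd (y t))" if "\<sigma> (y t) = - 1" for t k using \<sigma> that yV by blast
    show "y 0 \<noteq> y 1" using ne[of 0] by simp
    have "Suc (P0 - 2) = P0 - 1" using P0 by simp
    then show "y (P0 - 2) \<noteq> y (P0 - 1)" using ne[of "P0 - 2"] by simp
  qed (use ne in blast)+
  then show ?thesis by (rule walk.not_pwo)
qed

text \<open>The walk follows an alternating path from \<open>a\<close> to \<open>b\<close> and back.
  Returning along the line just used would break the alternation; a pause at either end takes up the
  step in the other direction, and \<open>ng\<close> provides the classes that permit it.\<close>

theorem two_cells_not_pwo:
  assumes gm: "gridding_matrix m n M" and ab: "(a, b) \<in> (share (cell_vertices m n M))\<^sup>*" "a \<noteq> b" "a \<in> cell_vertices m n M"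
    and ng: "\<not> monotone_griddable (M (fst a) (snd a))" "\<not> monotone_griddable (M (fst b) (snd b))"
  shows "\<not> partially_well_ordered (Grid m n M)"
proof -
  obtain \<sigma> :: "nat \<times> nat \<Rightarrow> int" where \<sigma>: "\<forall>x. (\<sigma> x = 1 \<or> \<sigma> x = - 1) \<and> (x \<in> cell_vertices m n M \<longrightarrow>
    (\<forall>k. (\<sigma> x = 1 \<longrightarrow> [0..<k] \<in> M (fst x) (snd x)) \<and> (\<sigma> x = - 1 \<longrightarrow> rev [0..<k] \<in> M (fst x) (snd x))) \<and>
    (\<not> monotone_griddable (M (fst x) (snd x)) \<longrightarrow>
      (\<forall>k. (\<sigma> x = 1 \<longrightarrow> sum21 k \<in> M (fst x) (snd x)) \<and> (\<sigma> x = - 1 \<longrightarrow> skew12 k \<in> M (fst x) (snd x)))))"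
    by (rule ex_signs[OF gm, THEN exE])
  obtain f q d where q: "1 \<le> q" and f: "f 0 = a" "f q = b" "\<forall>i\<le>q. f i \<in> cell_vertices m n M"
    and fs: "\<forall>i<q. f i \<noteq> f (Suc i) \<and> coord (even i = d) (f i) = coord (even i = d) (f (Suc i))"
    using alternating_path[OF ab] by (elim exE conjE)
  define P0 where "P0 = 2 * (q + 1)"
  \<comment> \<open>Times \<open>q\<close> and \<open>q + 1\<close> are spent at \<open>b\<close>,
    and time \<open>2 * q + 1\<close> and the start of the next round at \<open>a\<close>; this
    explains the period \<open>2 * (q + 1)\<close>.\<close>
  define h where "h i = (if i \<le> q then f i else f (2 * q + 1 - i))" for i
  define y where "y t = h (t mod P0)" for t
  have tl: "t mod P0 < 2 * q + 2" for t
  proof -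
    have "t mod P0 < P0" by (rule mod_less_divisor) (simp add: P0_def)
    then show ?thesis by (simp add: P0_def)
  qed
  have yS: "y (Suc t) = h (Suc (t mod P0))" for t
  proof (cases "Suc (t mod P0) = P0")
    case True
    then have "y (Suc t) = h 0" "h (Suc (t mod P0)) = h (2 * q + 2)" by (simp_all add: y_def mod_Suc P0_def)
    \<comment> \<open>Truncated subtraction turns \<open>h (2 * q + 2)\<close> into
      \<open>f 0\<close>, which equals \<open>h 0\<close>.\<close>
    then show ?thesis using q by (simp add: h_def)
  next
    case False
    then show ?thesis by (simp add: y_def mod_Suc)
  qed
  have hstep: "h i \<in> cell_vertices m n M \<and> coord (even i = d) (h i) = coord (even i = d) (h (Suc i)) \<and>
      (h i = h (Suc i) \<longrightarrow> i = q \<and> h i = b \<or> i = 2 * q + 1 \<and> h i = a)" if i: "i < 2 * q + 2" for i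
  proof -
    consider "i < q" | "i = q" | "q < i" "i < 2 * q + 1" | "i = 2 * q + 1" using i by linarith
    then show ?thesis
    proof cases
      case 1 then show ?thesis using f fs by (auto simp: h_def)
    next
      case 2 then show ?thesis using f q by (auto simp: h_def)
    next
      case 3
      define k where "k = 2 * q - i"
      have k: "i = 2 * q - k" "k < q" using 3 by (simp_all add: k_def)
      have "even i = even k" using k by simp
      moreover have "h i = f (Suc k)" "h (Suc i) = f k" using k 3 by (simp_all add: h_def Suc_diff_le)
      ultimately show ?thesis using fs[rule_format, of k] f k(2) 3 by auto
    next
      case 4 then show ?thesis using f q by (auto simp: h_def)
    qed
  qed
  have yV: "y t \<in> cell_vertices m n M" for t unfolding y_def using hstep[OF tl] by blast
  have ev: "even (t mod P0) = even t" for t by (simp add: dvd_mod_iff P0_def)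
  have eqD: "t mod P0 = q \<and> y t = b \<or> t mod P0 = 2 * q + 1 \<and> y t = a" if "y t = y (Suc t)" for t
    using hstep[OF tl[of t]] that unfolding yS unfolding y_def by blast
  have ngt: "\<not> monotone_griddable (M (fst (y t)) (snd (y t)))" if "y t = y (Suc t)" for t
    using eqD[OF that] ng by auto
  have "walk m n M (\<not> d) y P0 \<sigma>"
  proof
    show "gridding_matrix m n M" by fact
    show "even P0" "2 \<le> P0" by (simp_all add: P0_def)
    show "y (t + P0) = y t" for t by (simp add: y_def)
    show "y t \<in> cell_vertices m n M" for t by (rule yV)
    show "coord (even (Suc t) = (\<not> d)) (y t) = coord (even (Suc t) = (\<not> d)) (y (Suc t))" for t
    proof -
      have "(even (Suc t) = (\<not> d)) = (even (t mod P0) = d)" unfolding ev by auto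
      then show ?thesis using hstep[OF tl[of t]] unfolding yS unfolding y_def by simp
    qed
    show "\<sigma> x = 1 \<or> \<sigma> x = - 1" for x using \<sigma> by blast
    show "[0..<k] \<in> M (fst (y t)) (snd (y t))" if "\<sigma> (y t) = 1" for t k using \<sigma> that yV by blast
    show "rev [0..<k] \<in> M (fst (y t)) (snd (y t))" if "\<sigma> (y t) = - 1" for t k using \<sigma> that yV by blast
    show "sum21 k \<in> M (fst (y t)) (snd (y t))" if "y t = y (Suc t)" "\<sigma> (y t) = 1" for t k
      using \<sigma> that(2) yV ngt[OF that(1)] by blast
    show "skew12 k \<in> M (fst (y t)) (snd (y t))" if "y t = y (Suc t)" "\<sigma> (y t) = - 1" for t k
      using \<sigma> that(2) yV ngt[OF that(1)] by blast
    show "y (Suc t) \<noteq> y (Suc (Suc t))" if "y t = y (Suc t)" for t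
    proof
      assume "y (Suc t) = y (Suc (Suc t))"
      then have "Suc t mod P0 = q \<or> Suc t mod P0 = 2 * q + 1" using eqD by blast
      moreover have "t mod P0 = q \<or> t mod P0 = 2 * q + 1" using eqD[OF that] by blast
      ultimately show False using q by (auto simp: mod_Suc P0_def split: if_splits)
    qed
    \<comment> \<open>A round begins and ends in the middle of the pause at \<open>a\<close>, so its
      first and its last step are genuine moves.\<close>
    have m: "0 mod P0 = 0" "2 * q mod P0 = 2 * q" by (simp_all add: P0_def)
    have "y 0 \<noteq> y (Suc 0)" using eqD[of 0] m q by auto
    then show "y 0 \<noteq> y 1" by simp
    have "y (2 * q) \<noteq> y (Suc (2 * q))" using eqD[of "2 * q"] m q by auto
    then show "y (P0 - 2) \<noteq> y (P0 - 1)" by (simp add: P0_def)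
  qed
  then show ?thesis by (rule walk.not_pwo)
qed

section \<open>Grid classes over forests\<close>

text \<open>The first two entries of a monotone permutation form an interval. Thus monotone entries
  also have finitely many simple permutations, and a monotone cell may serve as the root of its
  component.\<close>

lemma monotone_simple_length:
  assumes "monotone_class C" "\<pi> \<in> C" "simple_perm \<pi>"
  shows "length \<pi> < 3"
proof (rule ccontr)
  assume "\<not> ?thesis"
  then have l: "3 \<le> length \<pi>" by simp
  have \<pi>: "\<pi> \<in> perms" using assms(3) by (simp add: simple_perm_def)
  have ne: "\<pi> ! i \<noteq> \<pi> ! j" if "i < j" "j < length \<pi>" for i j
    using inj_onD[OF perms_inj[OF \<pi>], of i j] that by auto
  have "\<exists>lo hi. {\<pi> ! 0, \<pi> ! 1} = {lo, hi} \<and> lo < hi \<and> (\<forall>j. 2 \<le> j \<longrightarrow> j < length \<pi> \<longrightarrow> \<pi> ! j < lo \<or> hi < \<pi> ! j)"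
  proof (cases "C = Av {[1, 0]}")
    case True
    then have "\<not> contained [1, 0] \<pi>" using assms(2) by (simp add: Av_def)
    then have "\<pi> ! i < \<pi> ! j" if "i < j" "j < length \<pi>" for i j
      using contained_pair(1)[OF \<pi>] that ne[OF that] by (meson linorder_neqE_nat)
    from this[of 0 1] this[of 1] show ?thesis using l by (intro exI[of _ "\<pi> ! 0"] exI[of _ "\<pi> ! 1"]) simp
  next
    case False
    then have "C = Av {[0, 1]}" using assms(1) by (simp add: monotone_class_def)
    then have "\<not> contained [0, 1] \<pi>" using assms(2) by (simp add: Av_def)
    then have "\<pi> ! j < \<pi> ! i" if "i < j" "j < length \<pi>" for i j
      using contained_pair(2)[OF \<pi>] that ne[OF that] by (meson linorder_neqE_nat)
    from this[of 0 1] this[of 1] show ?thesis using l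
      by (intro exI[of _ "\<pi> ! 1"] exI[of _ "\<pi> ! 0"]) (simp add: insert_commute)
  qed
  then obtain lo hi where lh: "{\<pi> ! 0, \<pi> ! 1} = {lo, hi}" "lo < hi"
    "\<And>j. 2 \<le> j \<Longrightarrow> j < length \<pi> \<Longrightarrow> \<pi> ! j < lo \<or> hi < \<pi> ! j" by (elim exE conjE) blast
  have pi: "perm_interval \<pi> {0, 1}"
    unfolding perm_interval_def
  proof (intro conjI)
    show "{0, 1} \<subseteq> {..<length \<pi>}" using l by auto
    show "contiguous {0, 1}" unfolding contiguous_def by (intro exI[of _ 0] exI[of _ 2]) auto
    have "(!) \<pi> ` {0, 1} = {lo..<Suc hi}"
    proof
      show "(!) \<pi> ` {0, 1} \<subseteq> {lo..<Suc hi}" using lh(1,2) by auto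
      show "{lo..<Suc hi} \<subseteq> (!) \<pi> ` {0, 1}"
      proof
        fix v assume v: "v \<in> {lo..<Suc hi}"
        have S: "(!) \<pi> ` {..<length \<pi>} = {..<length \<pi>}" using perms_bij[OF \<pi>] by (simp add: bij_betw_def)
        have "hi \<in> {\<pi> ! 0, \<pi> ! 1}" using lh(1) by blast
        then have "hi \<in> (!) \<pi> ` {..<length \<pi>}" using l by auto
        then have "v \<in> (!) \<pi> ` {..<length \<pi>}" using v S by auto
        then obtain j where j: "j < length \<pi>" "v = \<pi> ! j" by auto
        then have "\<not> 2 \<le> j" using lh(3)[of j] v by auto
        then have "j = 0 \<or> j = 1" by linarith
        then show "v \<in> (!) \<pi> ` {0, 1}" using j by auto
      qed
    qed
    then show "contiguous ((!) \<pi> ` {0, 1})" unfolding contiguous_def by blast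
  qed
  have "{0, 1::nat} = {} \<or> (\<exists>i. {0, 1::nat} = {i}) \<or> {0, 1} = {..<length \<pi>}"
    by (rule mp[OF spec[OF conjunct2[OF iffD1[OF simple_perm_def assms(3)]]] pi])
  then show False
  proof (elim disjE exE)
    assume "{0, 1::nat} = {..<length \<pi>}"
    moreover have "2 \<in> {..<length \<pi>}" using l by simp
    ultimately have "2 \<in> {0, 1::nat}" by (rule ssubst)
    then show False by simp
  next
    fix i assume i: "{0, 1::nat} = {i}"
    have "0 \<in> {i}" "1 \<in> {i}" unfolding i[symmetric] by simp_all
    then show False by simp
  qed simp
qed

lemma finite_monotone_simples:
  assumes "monotone_class C"
  shows "finite {\<pi> \<in> C. simple_perm \<pi>}"
proof (rule finite_subset[OF _ finite_perms_le[of 3]])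
  show "{\<pi> \<in> C. simple_perm \<pi>} \<subseteq> {\<pi> \<in> perms. length \<pi> < 3}"
    using monotone_simple_length[OF assms] by (auto simp: simple_perm_def)
qed

section \<open>Components of gridded permutations as structures\<close>

text \<open>Gridded permutations restricted to the cells \<open>K\<close>: \<open>lab\<close> gives
  the cell of a point, and \<open>ky\<close> its horizontal and vertical coordinates.\<close>

definition insts :: "(nat \<times> nat) set \<Rightarrow> (nat \<Rightarrow> nat \<Rightarrow> nat list set) \<Rightarrow> (nat \<times> nat) struc set" where
  "insts K M = {(I, lab, ky). finite I \<and> lab ` I \<subseteq> K \<and> (\<forall>d. inj_on (ky d) I) \<and>
     (\<forall>x\<in>K. {p\<in>I. lab p = x} = {} \<or> in_class (M (fst x) (snd x)) {p\<in>I. lab p = x} (ky True) (ky False))}"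

text \<open>The order is compared only along common lines. Points on different lines are ordered by
  their cells, and these are preserved.\<close>

definition cle :: "(nat \<times> nat) struc \<Rightarrow> (nat \<times> nat) struc \<Rightarrow> bool" where
  "cle a b \<longleftrightarrow> (case a of (I, lab, ky) \<Rightarrow> case b of (J, lab', ky') \<Rightarrow>
     \<exists>f. (\<forall>p\<in>I. f p \<in> J \<and> lab' (f p) = lab p) \<and>
       (\<forall>d. \<forall>p\<in>I. \<forall>q\<in>I. coord d (lab p) = coord d (lab q) \<longrightarrow> (ky d p < ky d q \<longleftrightarrow> ky' d (f p) < ky' d (f q))))"

lemma sign_less:
  fixes e x y x' y' :: real
  assumes "e = 1 \<or> e = - 1"
    and "a \<longleftrightarrow> e * x < e * y" "b \<longleftrightarrow> e * y < e * x" "a \<longleftrightarrow> e * x' < e * y'" "b \<longleftrightarrow> e * y' < e * x'"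
  shows "x < y \<longleftrightarrow> x' < y'"
  using assms by auto

text \<open>The simple quotient of the root points is itself contained in the entry of the root
  cell, which leaves finitely many possibilities. Side \<open>s\<close> belongs to the direction
  \<open>s = s0\<close>, and \<open>e\<close> records which directions were reversed in the
  alignment.\<close>

lemma root_inflates:
  assumes C: "perm_class C" and R0: "finite R0" "in_class C R0 (ky True) (ky False)" "\<And>d. inj_on (ky d) R0"
    and R: "R \<subseteq> R0" "2 \<le> card R" and e: "\<And>d. e d = 1 \<or> e d = (- 1 :: real)"
    and k: "\<And>d p q. p \<in> R \<Longrightarrow> q \<in> R \<Longrightarrow> k (d = s0) p < k (d = s0) q \<longleftrightarrow> e d * ky d p < e d * ky d q"
  shows "\<exists>\<tau>\<in>{\<pi>\<in>C. simple_perm \<pi>}. \<exists>\<beta>. inflates (length \<tau>)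
    (\<lambda>s t. (if e (s = s0) = 1 then 1 else - 1) * int (if s = s0 then t else \<tau> ! t)) R k \<beta>"
proof -
  have fR: "finite R" and injR: "inj_on (ky d) R" for d
    using R0 R(1) finite_subset inj_on_subset by blast+
  obtain \<tau> \<beta> f where \<tau>: "simple_perm \<tau>" "2 \<le> length \<tau>" "\<beta> ` R = {..<length \<tau>}"
    and \<beta>: "\<forall>p\<in>R. \<forall>q\<in>R. \<beta> p \<noteq> \<beta> q \<longrightarrow> (ky True p < ky True q \<longleftrightarrow> \<beta> p < \<beta> q) \<and> (ky False p < ky False q \<longleftrightarrow> \<tau> ! \<beta> p < \<tau> ! \<beta> q)"
    and f: "emb {..<length \<tau>} (\<lambda>i. i) ((!) \<tau>) R (ky True) (ky False) f"
    using substitution[OF fR R(2) injR injR, of True False] by (elim exE conjE)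
  have \<tau>p: "\<tau> \<in> perms" using \<tau>(1) by (simp add: simple_perm_def)
  have "emb {..<length \<tau>} (\<lambda>i. i) ((!) \<tau>) R0 (ky True) (ky False) f" using f R(1) unfolding emb_def by blast
  then have "in_class C {..<length \<tau>} (\<lambda>i. i) ((!) \<tau>)"
    by (rule in_class_mono[OF C R0(2)]) (simp_all add: perms_inj[OF \<tau>p])
  then have "\<tau> \<in> C" by (rule in_class_pattern[OF C _ is_pattern_self \<tau>p])
  have "inflates (length \<tau>)
    (\<lambda>s t. (if e (s = s0) = 1 then 1 else - 1) * int (if s = s0 then t else \<tau> ! t)) R k \<beta>"
    unfolding inflates_def
  proof (intro conjI allI ballI impI)
    fix s p q assume pq: "p \<in> R" "q \<in> R" "\<beta> p \<noteq> \<beta> q"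
    define d where "d = (s = s0)"
    have s: "s = (d = s0)" by (auto simp: d_def)
    define v where "v t = int (if d then t else \<tau> ! t)" for t
    have "ky d p < ky d q \<longleftrightarrow> v (\<beta> p) < v (\<beta> q)" "ky d q < ky d p \<longleftrightarrow> v (\<beta> q) < v (\<beta> p)"
      using \<beta> pq by (cases d; force simp: v_def)+
    then have "k s p < k s q \<longleftrightarrow> (if e d = 1 then 1 else - 1) * v (\<beta> p) < (if e d = 1 then 1 else - 1) * v (\<beta> q)"
      unfolding s k[OF pq(1,2)] using e[of d] by auto
    then show "k s p < k s q \<longleftrightarrow> (if e (s = s0) = 1 then 1 else - 1) * int (if s = s0 then \<beta> p else \<tau> ! \<beta> p) <
        (if e (s = s0) = 1 then 1 else - 1) * int (if s = s0 then \<beta> q else \<tau> ! \<beta> q)"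
      unfolding d_def v_def .
  qed (use \<tau> in blast)+
  then show ?thesis using \<open>\<tau> \<in> C\<close> \<tau>(1) by blast
qed

text \<open>Aligning the lines of each colour turns an instance into a structure with two linear
  orders. Conversely \<open>sle\<close> yields \<open>cle\<close>, because all instances are aligned
  with the same signs.\<close>

theorem component_wqo:
  assumes K: "finite K" "acyc K" "r \<in> K" and pc: "\<And>x. x \<in> K \<Longrightarrow> perm_class (M (fst x) (snd x))"
    and mono: "\<And>x. x \<in> K \<Longrightarrow> x \<noteq> r \<Longrightarrow> monotone_class (M (fst x) (snd x))"
    and fs: "finite {\<pi> \<in> M (fst r) (snd r). simple_perm \<pi>}"
  shows "wqo_on cle (insts K M)"
proof -
  obtain g :: "bool \<Rightarrow> nat \<Rightarrow> bool" where g: "g True (fst r) \<noteq> g False (snd r)"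
    and gx: "\<forall>x\<in>K - {r}. g True (fst x) = g False (snd x)" using acyc_colouring[OF K] by blast
  define XX where "XX s = {x\<in>K. \<exists>d. g d (coord d x) = s}" for s
  define \<sigma> where "\<sigma> x = (if M (fst x) (snd x) = Av {[1, 0]} then 1 else - 1 :: real)" for x
  have XK: "XX s \<subseteq> K" for s by (auto simp: XX_def)
  have gd: "g d (coord d x) = g True (fst x)" if "x \<in> K" "x \<noteq> r" for d x
    using gx that by (cases d) (auto simp: coord_def)
  have grd: "g d (coord d r) = (d = g True (fst r))" for d using g by (cases d) (auto simp: coord_def)
  \<comment> \<open>The side of the column of the root cell; its row lies on the other side. With
    truth values for both, side \<open>s\<close> meets the root cell in direction
    \<open>s = s0\<close>, and direction \<open>d\<close> belongs to side
    \<open>d = s0\<close>.\<close>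
  define s0 where "s0 = g True (fst r)"
  have "\<exists>sg. \<forall>s. (\<forall>d i. sg s d i = 1 \<or> sg s d i = - 1) \<and>
    (\<forall>I lab ky. fits (XX s) (\<lambda>d i. g d i = s) \<sigma> I lab ky \<longrightarrow>
      (\<exists>k. inj_on k I \<and> ordered (\<lambda>d i. g d i = s) (sg s) I lab ky k))"
    by (intro choice allI linear_keys finite_subset[OF XK K(1)] acyc_sub[OF K(2) XK]) (simp add: \<sigma>_def)
  then obtain sg where sg: "\<forall>s. (\<forall>d i. sg s d i = 1 \<or> sg s d i = - 1) \<and>
    (\<forall>I lab ky. fits (XX s) (\<lambda>d i. g d i = s) \<sigma> I lab ky \<longrightarrow>
      (\<exists>k. inj_on k I \<and> ordered (\<lambda>d i. g d i = s) (sg s) I lab ky k))" by (elim exE)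
  define e where "e d = sg (d = s0) d (coord d r)" for d
  define \<Gamma> where "\<Gamma> = (\<lambda>\<tau>. (length \<tau>, \<lambda>s t. (if e (s = s0) = 1 then 1 else - 1) * int (if s = s0 then t else \<tau> ! t))) `
    {\<pi> \<in> M (fst r) (snd r). simple_perm \<pi>}"
  interpret rooted XX r \<Gamma>
  proof
    show "finite (XX s)" for s by (rule finite_subset[OF XK K(1)])
    show "finite \<Gamma>" unfolding \<Gamma>_def by (rule finite_imageI[OF fs])
    have "r \<in> XX s" for s
    proof -
      have "g (s = g True (fst r)) (coord (s = g True (fst r)) r) = s" unfolding grd by blast
      then show ?thesis unfolding XX_def using K(3) by blast
    qed
    moreover have "x = r" if x: "x \<in> XX True" "x \<in> XX False" for x
    proof (rule ccontr)
      assume "x \<noteq> r"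
      moreover obtain d1 d2 where "x \<in> K" "g d1 (coord d1 x) = True" "g d2 (coord d2 x) = False"
        using x unfolding XX_def by blast
      ultimately show False using gd[of x d1] gd[of x d2] by metis
    qed
    ultimately show "XX True \<inter> XX False = {r}" by blast
  qed
  have ex_k: "\<exists>k. (I, lab, k) \<in> strucs \<and> (\<forall>s. ordered (\<lambda>d i. g d i = s) (sg s) {p\<in>I. lab p \<in> XX s} lab ky (k s))"
    if "(I, lab, ky) \<in> insts K M" for I lab ky
  proof -
    have I: "finite I" "lab ` I \<subseteq> K" "\<And>d. inj_on (ky d) I"
      and Icl: "\<And>x. x \<in> K \<Longrightarrow> {p\<in>I. lab p = x} = {} \<or> in_class (M (fst x) (snd x)) {p\<in>I. lab p = x} (ky True) (ky False)"
      using that unfolding insts_def by simp_all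
    have ord: "ky d p < ky d q \<longleftrightarrow> \<sigma> (lab p) * ky (\<not> d) p < \<sigma> (lab p) * ky (\<not> d) q"
      if pq: "p \<in> I" "q \<in> I" "lab p = lab q" "lab p \<noteq> r" for d p q
    proof -
      define x where "x = lab p"
      define S where "S = {p\<in>I. lab p = x}"
      have x: "x \<in> K" "x \<noteq> r" "p \<in> S" "q \<in> S" using I(2) pq by (auto simp: x_def S_def)
      have inc: "in_class (M (fst x) (snd x)) S (ky True) (ky False)" using Icl[OF x(1)] x(3) by (auto simp: S_def)
      have SI: "S \<subseteq> I" by (auto simp: S_def)
      have fS: "finite S" "inj_on (ky True) S" "inj_on (ky False) S"
        using finite_subset[OF SI I(1)] inj_on_subset[OF I(3) SI] by blast+
      have eq: "ky True p = ky True q \<longleftrightarrow> ky False p = ky False q" using fS(2,3) x(3,4) by (metis inj_onD)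
      show ?thesis
      proof (cases "M (fst x) (snd x) = Av {[1, 0]}")
        case True
        then have "\<forall>p\<in>S. \<forall>q\<in>S. ky True p < ky True q \<longrightarrow> ky False p < ky False q"
          using inc in_class_Av(1)[OF fS] by simp
        then have "ky True p < ky True q \<longrightarrow> ky False p < ky False q" "ky True q < ky True p \<longrightarrow> ky False q < ky False p"
          using x by blast+
        then have "ky True p < ky True q \<longleftrightarrow> ky False p < ky False q" using eq by linarith
        moreover have "\<sigma> (lab p) = 1" using True by (simp add: \<sigma>_def x_def)
        ultimately show ?thesis by (cases d) simp_all
      next
        case False
        then have "M (fst x) (snd x) = Av {[0, 1]}" using mono[OF x(1,2)] by (simp add: monotone_class_def)
        then have "\<forall>p\<in>S. \<forall>q\<in>S. ky True p < ky True q \<longrightarrow> ky False q < ky False p"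
          using inc in_class_Av(2)[OF fS] by simp
        then have "ky True p < ky True q \<longrightarrow> ky False q < ky False p" "ky True q < ky True p \<longrightarrow> ky False p < ky False q"
          using x by blast+
        then have "ky True p < ky True q \<longleftrightarrow> ky False q < ky False p" "ky False p < ky False q \<longleftrightarrow> ky True q < ky True p"
          using eq by linarith+
        moreover have "\<sigma> (lab p) = - 1" using False by (simp add: \<sigma>_def x_def)
        ultimately show ?thesis by (cases d) simp_all
      qed
    qed
    have "fits (XX s) (\<lambda>d i. g d i = s) \<sigma> {p\<in>I. lab p \<in> XX s} lab ky" for s
      unfolding fits_def
    proof (intro conjI ballI allI impI)
      show "finite {p\<in>I. lab p \<in> XX s}" using I(1) by simp
      show "lab ` {p\<in>I. lab p \<in> XX s} \<subseteq> XX s" by blast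
      show "inj_on (ky d) {p\<in>I. lab p \<in> XX s}" for d by (rule inj_on_subset[OF I(3)]) blast
      fix p q d assume pq: "p \<in> {p\<in>I. lab p \<in> XX s}" "q \<in> {p\<in>I. lab p \<in> XX s}" "lab p = lab q"
        and l: "\<forall>d. g d (coord d (lab p)) = s"
      \<comment> \<open>The two lines of the root cell have different colours, so monotonicity is
        never asked of it.\<close>
      have "lab p \<noteq> r"
      proof
        assume "lab p = r"
        then have "g True (fst r) = s" "g False (snd r) = s" using l[rule_format, of True] l[rule_format, of False]
          by (simp_all add: coord_def)
        then show False using g by simp
      qed
      then show "ky d p < ky d q \<longleftrightarrow> \<sigma> (lab p) * ky (\<not> d) p < \<sigma> (lab p) * ky (\<not> d) q" using ord pq by blast
    qed
    then have "\<forall>s. \<exists>k. inj_on k {p\<in>I. lab p \<in> XX s} \<and> ordered (\<lambda>d i. g d i = s) (sg s) {p\<in>I. lab p \<in> XX s} lab ky k"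
      using sg by blast
    then obtain k where k: "\<forall>s. inj_on (k s) {p\<in>I. lab p \<in> XX s} \<and>
        ordered (\<lambda>d i. g d i = s) (sg s) {p\<in>I. lab p \<in> XX s} lab ky (k s)"
      by (rule choice[THEN exE])
    have "\<exists>(n, \<sigma>)\<in>\<Gamma>. \<exists>\<beta>. inflates n \<sigma> R k \<beta>" if R: "R \<subseteq> {p\<in>I. lab p = r}" "2 \<le> card R" for R
    proof -
      have "R \<noteq> {}" using R(2) by auto
      then have ne: "{p\<in>I. lab p = r} \<noteq> {}" using R(1) by blast
      have "\<exists>\<tau>\<in>{\<pi>\<in>M (fst r) (snd r). simple_perm \<pi>}. \<exists>\<beta>. inflates (length \<tau>)
        (\<lambda>s t. (if e (s = s0) = 1 then 1 else - 1) * int (if s = s0 then t else \<tau> ! t)) R k \<beta>"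
      proof (rule root_inflates[OF pc[OF K(3)] _ _ _ R])
        show "finite {p\<in>I. lab p = r}" using I(1) by simp
        show "in_class (M (fst r) (snd r)) {p\<in>I. lab p = r} (ky True) (ky False)" using Icl[OF K(3)] ne by blast
        show "inj_on (ky d) {p\<in>I. lab p = r}" for d by (rule inj_on_subset[OF I(3)]) blast
        show "e d = 1 \<or> e d = - 1" for d unfolding e_def using sg by blast
        fix d p q assume pq: "p \<in> R" "q \<in> R"
        have r: "p \<in> I" "lab p = r" "q \<in> I" "lab q = r" using R(1) pq by auto
        have gr: "g d (coord d r) = (d = s0)" using grd unfolding s0_def .
        have o: "ordered (\<lambda>d' i. g d' i = (d = s0)) (sg (d = s0)) {p\<in>I. lab p \<in> XX (d = s0)} lab ky (k (d = s0))"
          using k by blast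
        show "k (d = s0) p < k (d = s0) q \<longleftrightarrow> e d * ky d p < e d * ky d q"
          unfolding e_def using o[unfolded ordered_def, rule_format, of p q d] r r_in gr by simp
      qed
      then show ?thesis unfolding \<Gamma>_def by blast
    qed
    moreover have "lab ` I \<subseteq> XX True \<union> XX False" using I(2) unfolding XX_def by blast
    ultimately have "(I, lab, k) \<in> strucs" unfolding strucs_def using I(1) k by simp
    then show ?thesis using k by blast
  qed
  have "\<exists>kk. \<forall>a. a \<in> insts K M \<longrightarrow> (fst a, fst (snd a), kk a) \<in> strucs \<and>
    (\<forall>s. ordered (\<lambda>d i. g d i = s) (sg s) {p\<in>fst a. fst (snd a) p \<in> XX s} (fst (snd a)) (snd (snd a)) (kk a s))"
  proof (rule choice, rule allI)
    fix a
    show "\<exists>k. a \<in> insts K M \<longrightarrow> (fst a, fst (snd a), k) \<in> strucs \<and>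
      (\<forall>s. ordered (\<lambda>d i. g d i = s) (sg s) {p\<in>fst a. fst (snd a) p \<in> XX s} (fst (snd a)) (snd (snd a)) (k s))"
    proof (cases "a \<in> insts K M")
      case True
      then have "(fst a, fst (snd a), snd (snd a)) \<in> insts K M" by simp
      from ex_k[OF this] show ?thesis by (elim exE) (intro exI impI)
    qed simp
  qed
  then obtain kk where kk: "\<forall>a. a \<in> insts K M \<longrightarrow> (fst a, fst (snd a), kk a) \<in> strucs \<and>
    (\<forall>s. ordered (\<lambda>d i. g d i = s) (sg s) {p\<in>fst a. fst (snd a) p \<in> XX s} (fst (snd a)) (snd (snd a)) (kk a s))" ..
  have le: "cle a b" if a: "a \<in> insts K M" and b: "b \<in> insts K M"
    and s: "sle (fst a, fst (snd a), kk a) (fst b, fst (snd b), kk b)" for a b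
  proof -
    obtain I lab ky J lab' ky' where ab: "a = (I, lab, ky)" "b = (J, lab', ky')" by (cases a, cases b) blast
    obtain f where f: "\<forall>p\<in>I. f p \<in> J \<and> lab' (f p) = lab p"
      "\<forall>s. \<forall>p\<in>I. \<forall>q\<in>I. lab p \<in> XX s \<longrightarrow> lab q \<in> XX s \<longrightarrow> (kk a s p < kk a s q \<longleftrightarrow> kk b s (f p) < kk b s (f q))"
      using s unfolding sle_def ab by auto
    have oa: "ordered (\<lambda>d i. g d i = s) (sg s) {p\<in>I. lab p \<in> XX s} lab ky (kk a s)" for s
      using kk[rule_format, OF a] unfolding ab by simp
    have ob: "ordered (\<lambda>d i. g d i = s) (sg s) {p\<in>J. lab' p \<in> XX s} lab' ky' (kk b s)" for s
      using kk[rule_format, OF b] unfolding ab by simp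
    have labI: "lab ` I \<subseteq> K" using a unfolding ab insts_def by simp
    have "ky d p < ky d q \<longleftrightarrow> ky' d (f p) < ky' d (f q)"
      if pq: "p \<in> I" "q \<in> I" "coord d (lab p) = coord d (lab q)" for d p q
    proof -
      define s where "s = g d (coord d (lab p))"
      have g': "g d (coord d (lab p)) = s" "g d (coord d (lab q)) = s" using pq(3) by (simp_all add: s_def)
      have "lab p \<in> K" "lab q \<in> K" using labI pq by auto
      then have X: "lab p \<in> XX s" "lab q \<in> XX s" using g' unfolding XX_def by blast+
      have f': "f p \<in> J" "f q \<in> J" "lab' (f p) = lab p" "lab' (f q) = lab q" using f(1) pq by auto
      \<comment> \<open>The sign of this line is the same in both instances and cancels.\<close>
      show ?thesis
      proof (rule sign_less[of "sg s d (coord d (lab p))"])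
        show "sg s d (coord d (lab p)) = 1 \<or> sg s d (coord d (lab p)) = - 1" using sg by blast
        show "kk a s p < kk a s q \<longleftrightarrow> sg s d (coord d (lab p)) * ky d p < sg s d (coord d (lab p)) * ky d q"
          using oa[of s, unfolded ordered_def, rule_format, of p q d] X pq g' by simp
        show "kk a s q < kk a s p \<longleftrightarrow> sg s d (coord d (lab p)) * ky d q < sg s d (coord d (lab p)) * ky d p"
          using oa[of s, unfolded ordered_def, rule_format, of q p d] X pq g' by simp
        show "kk a s p < kk a s q \<longleftrightarrow> sg s d (coord d (lab p)) * ky' d (f p) < sg s d (coord d (lab p)) * ky' d (f q)"
          using ob[of s, unfolded ordered_def, rule_format, of "f p" "f q" d] f(2) f' X pq g' by simp
        show "kk a s q < kk a s p \<longleftrightarrow> sg s d (coord d (lab p)) * ky' d (f q) < sg s d (coord d (lab p)) * ky' d (f p)"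
          using ob[of s, unfolded ordered_def, rule_format, of "f q" "f p" d] f(2) f' X pq g' by simp
      qed
    qed
    then show ?thesis unfolding cle_def ab prod.case using f(1) by (intro exI[of _ f]) blast
  qed
  show ?thesis unfolding wqo_on_def
  proof (intro allI impI)
    fix F :: "nat \<Rightarrow> (nat \<times> nat) struc" assume F: "\<forall>i. F i \<in> insts K M"
    have "\<exists>i j. i < j \<and> sle (fst (F i), fst (snd (F i)), kk (F i)) (fst (F j), fst (snd (F j)), kk (F j))"
      by (rule wqo_onD[OF wqo_strucs]) (use kk F in blast)
    then show "\<exists>i j. i < j \<and> cle (F i) (F j)" using le F by blast
  qed
qed

text \<open>An antichain gives a sequence of gridded permutations; some subsequence increases in all
  components at once, and the embeddings of the components are glued. Points on a common line always
  belong to the same component.\<close>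

theorem forest_pwo:
  assumes gm: "gridding_matrix m n M" and ac: "acyc (cell_vertices m n M)"
    and fs: "\<And>x. x \<in> cell_vertices m n M \<Longrightarrow> finite {\<pi> \<in> M (fst x) (snd x). simple_perm \<pi>}"
    and un: "\<And>a b. a \<in> cell_vertices m n M \<Longrightarrow> b \<in> cell_vertices m n M \<Longrightarrow> (a, b) \<in> (share (cell_vertices m n M))\<^sup>* \<Longrightarrow>
      \<not> monotone_class (M (fst a) (snd a)) \<Longrightarrow> \<not> monotone_class (M (fst b) (snd b)) \<Longrightarrow> a = b"
  shows "partially_well_ordered (Grid m n M)"
  unfolding partially_well_ordered_def
proof (rule notI, elim exE conjE)
  fix S assume S: "S \<subseteq> Grid m n M" "infinite S" "\<forall>\<alpha>\<in>S. \<forall>\<beta>\<in>S. \<alpha> \<noteq> \<beta> \<longrightarrow> \<not> contained \<alpha> \<beta>"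
  let ?V = "cell_vertices m n M"
  define cp where "cp v = (share ?V)\<^sup>* `` {v}" for v
  have cpV: "cp v \<subseteq> ?V" if "v \<in> ?V" for v
  proof
    fix z assume "z \<in> cp v"
    then have "(v, z) \<in> (share ?V)\<^sup>*" by (simp add: cp_def)
    then show "z \<in> ?V" using that by (induction rule: rtrancl_induct) (auto simp: share_def)
  qed
  have cps: "(a, b) \<in> (share ?V)\<^sup>*" if "a \<in> cp v" "b \<in> cp v" for a b v
    using that symD[OF sym_share, of v a ?V] rtrancl_trans[of a v "share ?V" b] unfolding cp_def by blast
  have wq: "wqo_on cle (insts K M)" if KC: "K \<in> cp ` ?V" for K
  proof -
    obtain v where v: "v \<in> ?V" "K = cp v" using KC by blast
    have KV: "K \<subseteq> ?V" using cpV v by blast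
    have vK: "v \<in> K" by (simp add: v cp_def)
    have "\<exists>r. r \<in> K \<and> (\<forall>x\<in>K. x \<noteq> r \<longrightarrow> monotone_class (M (fst x) (snd x)))"
    proof (cases "\<exists>r\<in>K. \<not> monotone_class (M (fst r) (snd r))")
      case True
      then obtain r where r: "r \<in> K" "\<not> monotone_class (M (fst r) (snd r))" by blast
      have "x = r" if "x \<in> K" "\<not> monotone_class (M (fst x) (snd x))" for x
        by (rule un) (use that r KV cps v in blast)+
      then show ?thesis using r by blast
    next
      case False then show ?thesis using vK by blast
    qed
    then obtain r where r: "r \<in> K" "\<And>x. x \<in> K \<Longrightarrow> x \<noteq> r \<Longrightarrow> monotone_class (M (fst x) (snd x))" by blast
    show ?thesis
    proof (rule component_wqo[where r = r])
      show "finite K" by (rule finite_subset[OF KV finite_cell_vertices])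
      show "acyc K" by (rule acyc_sub[OF ac KV])
      show "r \<in> K" by (rule r(1))
      show "perm_class (M (fst x) (snd x))" if "x \<in> K" for x
      proof -
        have "fst x \<in> {1..m}" "snd x \<in> {1..n}" using KV that by (auto simp: cell_vertices_def)
        then show ?thesis using gm unfolding gridding_matrix_def by blast
      qed
      show "monotone_class (M (fst x) (snd x))" if "x \<in> K" "x \<noteq> r" for x by (rule r(2)[OF that])
      show "finite {\<pi> \<in> M (fst r) (snd r). simple_perm \<pi>}" using fs KV r(1) by blast
    qed
  qed
  obtain \<pi> :: "nat \<Rightarrow> nat list" where \<pi>: "inj \<pi>" "range \<pi> \<subseteq> S" using infinite_countable_subset[OF S(2)] by blast
  have \<pi>p: "\<pi> i \<in> perms" "has_gridding m n M (\<pi> i)" for i using \<pi>(2) S(1) unfolding Grid_def by blast+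
  have mn: "1 \<le> m" "1 \<le> n" using gm by (auto simp: gridding_matrix_def)
  have "\<exists>cr. \<forall>i. coloured m n M (\<pi> i) (fst (cr i)) (snd (cr i))"
    using \<pi>p gridding_iff_coloured[OF \<pi>p(1) mn] by (intro choice) (metis fst_conv snd_conv)
  then obtain cr where cr: "\<And>i. coloured m n M (\<pi> i) (fst (cr i)) (snd (cr i))" by blast
  define lab where "lab i x = (fst (cr i) x, snd (cr i) x)" for i x
  define ky where "ky i d x = (if d then real x else real (\<pi> i ! x))" for i d x
  have range: "fst (lab i x) \<in> {1..m}" "snd (lab i x) \<in> {1..n}" if "x < length (\<pi> i)" for i x
    using cr[of i] that unfolding coloured_def lab_def by auto
  have mono: "coord d (lab i x) \<le> coord d (lab i y)"
    if "x < length (\<pi> i)" "y < length (\<pi> i)" "ky i d x \<le> ky i d y" for i d x y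
    using cr[of i] that unfolding coloured_def lab_def by (cases d) (auto simp: coord_def ky_def)
  have cls: "in_class (M (fst z) (snd z)) {x. x < length (\<pi> i) \<and> lab i x = z} (ky i True) (ky i False)"
    if "x < length (\<pi> i)" "lab i x = z" for i x z
  proof -
    have e: "{x. x < length (\<pi> i) \<and> fst (cr i) x = fst z \<and> snd (cr i) x = snd z} = {x. x < length (\<pi> i) \<and> lab i x = z}"
      by (auto simp: lab_def prod_eq_iff)
    have z: "fst z \<in> {1..m}" "snd z \<in> {1..n}" using range[OF that(1)] that(2) by simp_all
    have "\<forall>a\<in>{1..m}. \<forall>b\<in>{1..n}. {x. x < length (\<pi> i) \<and> fst (cr i) x = a \<and> snd (cr i) x = b} = {} \<or>
        in_class (M a b) {x. x < length (\<pi> i) \<and> fst (cr i) x = a \<and> snd (cr i) x = b} (\<lambda>x. x) ((!) (\<pi> i))"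
      using cr[of i] unfolding coloured_def by blast
    from bspec[OF bspec[OF this z(1)] z(2)]
    have "in_class (M (fst z) (snd z)) {x. x < length (\<pi> i) \<and> lab i x = z} (\<lambda>x. x) ((!) (\<pi> i))"
      unfolding e using that by blast
    then show ?thesis by (simp add: in_class_def is_pattern_def emb_def ky_def)
  qed
  \<comment> \<open>A cell that holds a point has a non-empty entry and is therefore a
    vertex.\<close>
  have labV: "lab i x \<in> ?V" if "x < length (\<pi> i)" for i x
  proof -
    have "M (fst (lab i x)) (snd (lab i x)) \<noteq> {}" using cls[OF that refl] by (auto simp: in_class_def)
    then show ?thesis using range[OF that] by (simp add: cell_vertices_def case_prod_beta)
  qed
  have kinj: "inj_on (ky i d) {..<length (\<pi> i)}" for i d
    using perms_inj[OF \<pi>p(1)[of i]] by (cases d) (auto simp: ky_def inj_on_def)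
  define str where "str K i = ({x. x < length (\<pi> i) \<and> lab i x \<in> K}, lab i, ky i)" for K i
  have "str K i \<in> insts K M" for K i
    unfolding insts_def str_def
  proof (simp only: mem_Collect_eq prod.case, intro conjI allI ballI)
    show "finite {x. x < length (\<pi> i) \<and> lab i x \<in> K}" by simp
    show "lab i ` {x. x < length (\<pi> i) \<and> lab i x \<in> K} \<subseteq> K" by blast
    show "inj_on (ky i d) {x. x < length (\<pi> i) \<and> lab i x \<in> K}" for d by (rule inj_on_subset[OF kinj]) blast
    fix z assume z: "z \<in> K"
    then have "{p. (p < length (\<pi> i) \<and> lab i p \<in> K) \<and> lab i p = z} = {x. x < length (\<pi> i) \<and> lab i x = z}" by blast
    then show "{p. (p < length (\<pi> i) \<and> lab i p \<in> K) \<and> lab i p = z} = {} \<or>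
      in_class (M (fst z) (snd z)) {p. (p < length (\<pi> i) \<and> lab i p \<in> K) \<and> lab i p = z} (ky i True) (ky i False)"
      using cls[of _ i z] by auto
  qed
  then obtain \<phi> :: "nat \<Rightarrow> nat" where \<phi>: "strict_mono \<phi>"
    and le: "\<forall>K\<in>cp ` ?V. \<forall>i j. i < j \<longrightarrow> cle (str K (\<phi> i)) (str K (\<phi> j))"
    using wqo_subseq_family[of "cp ` ?V" "\<lambda>_. cle" "\<lambda>K. insts K M" str] finite_cell_vertices[of m n M] wq by blast
  define i j where "i = \<phi> 0" and "j = \<phi> 1"
  have ij: "i < j" using \<phi> by (simp add: i_def j_def strict_mono_def)
  have "\<forall>v\<in>?V. \<exists>f. (\<forall>x. x < length (\<pi> i) \<and> lab i x \<in> cp v \<longrightarrow> f x < length (\<pi> j) \<and> lab j (f x) = lab i x) \<and>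
    (\<forall>d x y. x < length (\<pi> i) \<and> lab i x \<in> cp v \<longrightarrow> y < length (\<pi> i) \<and> lab i y \<in> cp v \<longrightarrow>
      coord d (lab i x) = coord d (lab i y) \<longrightarrow> (ky i d x < ky i d y \<longleftrightarrow> ky j d (f x) < ky j d (f y)))"
  proof
    fix v assume "v \<in> ?V"
    then have "cle (str (cp v) i) (str (cp v) j)" using le by (simp add: i_def j_def)
    then obtain f where "(\<forall>p\<in>{x. x < length (\<pi> i) \<and> lab i x \<in> cp v}. f p \<in> {x. x < length (\<pi> j) \<and> lab j x \<in> cp v} \<and> lab j (f p) = lab i p) \<and>
       (\<forall>d. \<forall>p\<in>{x. x < length (\<pi> i) \<and> lab i x \<in> cp v}. \<forall>q\<in>{x. x < length (\<pi> i) \<and> lab i x \<in> cp v}.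
         coord d (lab i p) = coord d (lab i q) \<longrightarrow> (ky i d p < ky i d q \<longleftrightarrow> ky j d (f p) < ky j d (f q)))"
      unfolding cle_def str_def prod.case by (elim exE)
    then show "\<exists>f. (\<forall>x. x < length (\<pi> i) \<and> lab i x \<in> cp v \<longrightarrow> f x < length (\<pi> j) \<and> lab j (f x) = lab i x) \<and>
    (\<forall>d x y. x < length (\<pi> i) \<and> lab i x \<in> cp v \<longrightarrow> y < length (\<pi> i) \<and> lab i y \<in> cp v \<longrightarrow>
      coord d (lab i x) = coord d (lab i y) \<longrightarrow> (ky i d x < ky i d y \<longleftrightarrow> ky j d (f x) < ky j d (f y)))"
      by (intro exI[of _ f]) blast
  qed
  then obtain f where fV: "\<forall>v\<in>?V. (\<forall>x. x < length (\<pi> i) \<and> lab i x \<in> cp v \<longrightarrow> f v x < length (\<pi> j) \<and> lab j (f v x) = lab i x) \<and>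
    (\<forall>d x y. x < length (\<pi> i) \<and> lab i x \<in> cp v \<longrightarrow> y < length (\<pi> i) \<and> lab i y \<in> cp v \<longrightarrow>
      coord d (lab i x) = coord d (lab i y) \<longrightarrow> (ky i d x < ky i d y \<longleftrightarrow> ky j d (f v x) < ky j d (f v y)))"
    by (rule bchoice[THEN exE])
  have f: "f v x < length (\<pi> j) \<and> lab j (f v x) = lab i x"
    if "v \<in> ?V" "x < length (\<pi> i)" "lab i x \<in> cp v" for v x
    using bspec[OF fV that(1)] that(2,3) by simp
  have fo: "ky i d x < ky i d y \<longleftrightarrow> ky j d (f v x) < ky j d (f v y)"
    if "v \<in> ?V" "x < length (\<pi> i)" "lab i x \<in> cp v" "y < length (\<pi> i)" "lab i y \<in> cp v"
      "coord d (lab i x) = coord d (lab i y)" for v d x y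
    using conjunct2[OF bspec[OF fV that(1)], rule_format, of x y d] that(2-6) by simp
  \<comment> \<open>The maps \<open>f v\<close> were chosen for each cell separately; a fixed
    representative makes the glued map use a single one on each component.\<close>
  define rep where "rep z = (SOME v. v \<in> ?V \<and> cp v = cp z)" for z
  have rep: "rep z \<in> ?V \<and> cp (rep z) = cp z" if "z \<in> ?V" for z
    unfolding rep_def by (rule someI[of _ z]) (use that in blast)
  define F where "F x = f (rep (lab i x)) x" for x
  have own: "z \<in> cp z" for z by (simp add: cp_def)
  have F: "F x < length (\<pi> j)" "lab j (F x) = lab i x" if "x < length (\<pi> i)" for x
    using f[of "rep (lab i x)" x] rep[OF labV[OF that]] own[of "lab i x"] that unfolding F_def by auto
  have Fo: "ky i d x < ky i d y \<longleftrightarrow> ky j d (F x) < ky j d (F y)" if xy: "x < length (\<pi> i)" "y < length (\<pi> i)" for d x y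
  proof (cases "coord d (lab i x) = coord d (lab i y)")
    case True
    then have sh: "(lab i x, lab i y) \<in> share ?V" using labV xy by (auto simp: share_def)
    have s1: "(lab i x, lab i y) \<in> (share ?V)\<^sup>*" using sh by (rule r_into_rtrancl)
    have s2: "(lab i y, lab i x) \<in> (share ?V)\<^sup>*" by (rule symD[OF sym_share s1])
    have "cp (lab i x) = cp (lab i y)"
      unfolding cp_def using rtrancl_trans[OF s1] rtrancl_trans[OF s2] by blast
    then have "rep (lab i x) = rep (lab i y)" by (simp add: rep_def)
    then show ?thesis
      using fo[of "rep (lab i x)" x y d] rep[OF labV[OF xy(1)]] own[of "lab i x"] own[of "lab i y"] xy True
        \<open>cp (lab i x) = cp (lab i y)\<close> unfolding F_def by auto
  next
    case False
    \<comment> \<open>On different lines both orders are read off from the cells, as the colourings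
      are monotone.\<close>
    have "ky i d x < ky i d y \<longleftrightarrow> coord d (lab i x) < coord d (lab i y)"
      using mono[OF xy, of d] mono[OF xy(2,1), of d] False by linarith
    moreover have "ky j d (F x) < ky j d (F y) \<longleftrightarrow> coord d (lab j (F x)) < coord d (lab j (F y))"
      using mono[OF F(1) F(1), OF xy, of d] mono[OF F(1) F(1), OF xy(2,1), of d] False
      unfolding F(2)[OF xy(1)] F(2)[OF xy(2)] by linarith
    ultimately show ?thesis unfolding F(2)[OF xy(1)] F(2)[OF xy(2)] by simp
  qed
  have "lemb (\<pi> i) (\<pi> j) F"
    unfolding emb_def using F Fo[of _ _ True] Fo[of _ _ False] by (simp add: ky_def)
  then have "contained (\<pi> i) (\<pi> j)" using contained_lemb[OF \<pi>p(1)] by blast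
  moreover have "\<pi> i \<noteq> \<pi> j" using injD[OF \<pi>(1), of i j] ij by auto
  ultimately show False using S(3) \<pi>(2) by blast
qed

theorem theorem1:
  fixes m n :: nat and M :: "nat \<Rightarrow> nat \<Rightarrow> nat list set"
  assumes "gridding_matrix m n M"
    and "\<forall>i\<in>{1..m}. \<forall>j\<in>{1..n}.
           monotone_class (M i j) \<or>
           (\<not> monotone_griddable (M i j) \<and> finite {\<pi> \<in> M i j. simple_perm \<pi>}) \<or>
           M i j = {}"
  shows "partially_well_ordered (Grid m n M) \<longleftrightarrow>
           forest (cell_edges m n M) \<and>
           (\<forall>K\<in>components (cell_vertices m n M) (cell_edges m n M).
              \<exists>\<^sub>\<le>\<^sub>1(i, j). (i, j) \<in> K \<and> \<not> monotone_class (M i j))"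
proof -
  let ?V = "cell_vertices m n M"
  have fV: "finite ?V" by (rule finite_cell_vertices)
  have V: "monotone_class (M (fst x) (snd x)) \<or>
      \<not> monotone_griddable (M (fst x) (snd x)) \<and> finite {\<pi> \<in> M (fst x) (snd x). simple_perm \<pi>}" if "x \<in> ?V" for x
  proof -
    have "fst x \<in> {1..m}" "snd x \<in> {1..n}" "M (fst x) (snd x) \<noteq> {}"
      using that by (simp_all add: cell_vertices_def case_prod_beta)
    then show ?thesis using assms(2) by blast
  qed
  have "forest (edges ?V) \<longleftrightarrow> acyc ?V" using forest_imp_acyc[OF fV] acyc_imp_forest[OF fV] by blast
  moreover note components_unique_iff[OF fV, of "\<lambda>i j. \<not> monotone_class (M i j)"]
  moreover have "acyc ?V" if "partially_well_ordered (Grid m n M)"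
    using not_acyc_not_pwo[OF assms(1)] that by blast
  \<comment> \<open>By \<open>V\<close> a vertex whose entry is not monotone has an entry that is
    not monotone griddable, so two of them in a component contradict
    \<open>two_cells_not_pwo\<close>.\<close>
  moreover have "a = b"
    if "partially_well_ordered (Grid m n M)" "a \<in> ?V" "b \<in> ?V" "(a, b) \<in> (share ?V)\<^sup>*"
      "\<not> monotone_class (M (fst a) (snd a))" "\<not> monotone_class (M (fst b) (snd b))" for a b
    using two_cells_not_pwo[OF assms(1) that(4) _ that(2)] that V by blast
  moreover have "partially_well_ordered (Grid m n M)"
    if "acyc ?V" "\<forall>a\<in>?V. \<forall>b\<in>?V. (a, b) \<in> (share ?V)\<^sup>* \<longrightarrow>
      \<not> monotone_class (M (fst a) (snd a)) \<longrightarrow> \<not> monotone_class (M (fst b) (snd b)) \<longrightarrow> a = b"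
  proof (rule forest_pwo[OF assms(1) that(1)])
    show "finite {\<pi> \<in> M (fst x) (snd x). simple_perm \<pi>}" if "x \<in> ?V" for x
      using V[OF that] finite_monotone_simples by blast
  qed (use that(2) in blast)
  ultimately show ?thesis unfolding cell_edges_eq by blast
qed

end
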